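(* Let $R$ be a commutative noetherian ring. For every $R$-complex $M$, one has an inclusion $\mathrm{cosupp}_R M\subseteq\mathrm{coSupp}_R M$. Equality holds if $R$ is a semi-local complete ring and $M\in\mathrm{D}^{\mathrm{a}}_{-}(R)$.
   Context: $R$ is a commutative noetherian ring. $R$-complexes are arbitrary (unbounded) chain complexes; $\simeq$ denotes isomorphism in the derived category $\mathrm{D}(R)$. $E(-)$ denotes injective envelopes, and $k(\mathfrak p)=R_\mathfrak p/\mathfrak pR_\mathfrak p$. Put $D_R(-)=\mathrm{Hom}_R(-,\bigoplus_{\mathfrak{m}\in\mathrm{Max}R}E(R/\mathfrak{m}))$ and, for $\mathfrak{p}\in\mathrm{Spec}R$, ${}^{\mathfrak{p}}M=\mathrm{Hom}_{R_\mathfrak{p}}(D_R(M)_\mathfrak{p},E_{R_\mathfrak{p}}(k(\mathfrak{p})))$. The big cosupport is $\mathrm{coSupp}_R M=\{\mathfrak{p}\in\mathrm{Spec}R \mid {}^{\mathfrak{p}}M\not\simeq 0\}$ and the small cosupport is $\mathrm{cosupp}_R M=\{\mathfrak{p}\in\mathrm{Spec}R\mid \mathrm{RHom}_R(R/\mathfrak{p},{}^{\mathfrak{p}}M)\not\simeq 0\}$. $\mathrm{D}^{\mathrm{a}}_{-}(R)$ is the full subcategory of $\mathrm{D}(R)$ of complexes $M$ with all $\mathrm{H}_i(M)$ artinian $R$-modules and $\mathrm{H}_n(M)=0$ for all $n\gg 0$. Semi-local complete means that $R$ has finitely many maximal ideals and is complete in the adic topology of its Jacobson radical. *)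

theory Defs
  imports "HOL-Algebra.Module" "HOL-Algebra.Ideal_Product" "HOL-Algebra.Ring_Divisibility"
begin

section \<open>Modules\<close>

text \<open>The fields \<open>mult\<close> and \<open>one\<close> of a module record carry no meaning and are filled arbitrarily.\<close>

definition mod_hom ::
    "('a, 'r) ring_scheme \<Rightarrow> ('a, 'b) module \<Rightarrow> ('a, 'c) module \<Rightarrow> ('b \<Rightarrow> 'c) set" where
  "mod_hom R M N = {f \<in> carrier M \<rightarrow> carrier N.
     (\<forall>x\<in>carrier M. \<forall>y\<in>carrier M. f (x \<oplus>\<^bsub>M\<^esub> y) = f x \<oplus>\<^bsub>N\<^esub> f y) \<and>
     (\<forall>r\<in>carrier R. \<forall>x\<in>carrier M. f (r \<odot>\<^bsub>M\<^esub> x) = r \<odot>\<^bsub>N\<^esub> f x)}"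

definition self_mod :: "('a, 'r) ring_scheme \<Rightarrow> ('a, 'a) module" where
  "self_mod R = \<lparr>carrier = carrier R, monoid.mult = monoid.mult R, one = \<one>\<^bsub>R\<^esub>,
     zero = \<zero>\<^bsub>R\<^esub>, add = add R, smult = monoid.mult R\<rparr>"

definition zero_mod :: "('a, 'b) module" where
  "zero_mod = \<lparr>carrier = {undefined}, monoid.mult = (\<lambda>_ _. undefined), one = undefined,
     zero = undefined, add = (\<lambda>_ _. undefined), smult = (\<lambda>_ _. undefined)\<rparr>"

definition quot_mod :: "('a, 'b) module \<Rightarrow> 'b set \<Rightarrow> ('a, 'b set) module" where
  "quot_mod M N = \<lparr>carrier = a_rcosets\<^bsub>M\<^esub> N, monoid.mult = undefined, one = undefined,
     zero = N, add = (\<lambda>A B. A <+>\<^bsub>M\<^esub> B),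
     smult = (\<lambda>r A. \<Union>x\<in>A. N +>\<^bsub>M\<^esub> (r \<odot>\<^bsub>M\<^esub> x))\<rparr>"

definition direct_sum :: "'i set \<Rightarrow> ('i \<Rightarrow> ('a, 'b) module) \<Rightarrow> ('a, 'i \<Rightarrow> 'b) module" where
  "direct_sum I N = \<lparr>
     carrier = {f \<in> (\<Pi>\<^sub>E i\<in>I. carrier (N i)). finite {i \<in> I. f i \<noteq> \<zero>\<^bsub>N i\<^esub>}},
     monoid.mult = undefined, one = undefined,
     zero = (\<lambda>i\<in>I. \<zero>\<^bsub>N i\<^esub>),
     add = (\<lambda>f g. \<lambda>i\<in>I. f i \<oplus>\<^bsub>N i\<^esub> g i),
     smult = (\<lambda>r f. \<lambda>i\<in>I. r \<odot>\<^bsub>N i\<^esub> f i)\<rparr>"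

text \<open>The module \<open>R\<^sup>k\<close>, as sequences that vanish from position \<open>k\<close> on.\<close>

definition free_mod :: "('a, 'r) ring_scheme \<Rightarrow> nat \<Rightarrow> ('a, nat \<Rightarrow> 'a) module" where
  "free_mod R k = \<lparr>
     carrier = {v. (\<forall>i<k. v i \<in> carrier R) \<and> (\<forall>i\<ge>k. v i = \<zero>\<^bsub>R\<^esub>)},
     monoid.mult = undefined, one = undefined,
     zero = (\<lambda>_. \<zero>\<^bsub>R\<^esub>),
     add = (\<lambda>v w i. v i \<oplus>\<^bsub>R\<^esub> w i),
     smult = (\<lambda>r v i. r \<otimes>\<^bsub>R\<^esub> v i)\<rparr>"

definition artinian_module :: "('a, 'r) ring_scheme \<Rightarrow> ('a, 'b) module \<Rightarrow> bool" where
  "artinian_module R M \<longleftrightarrow> module R M \<and>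
     (\<forall>U :: nat \<Rightarrow> 'b set. (\<forall>n. submodule (U n) R M) \<and> (\<forall>n. U (Suc n) \<subseteq> U n)
        \<longrightarrow> (\<exists>n. \<forall>m\<ge>n. U m = U n))"

text \<open>
  A definition cannot quantify over all types, so the test modules \<open>A\<close> and \<open>B\<close> live on the element
  type of the ring.  This is no restriction: every ideal and the ring itself occur among them,
  hence by Baer's criterion the extension property holds for modules on arbitrary types.
\<close>

definition injective_module :: "('a, 'r) ring_scheme \<Rightarrow> ('a, 'e) module \<Rightarrow> bool" where
  "injective_module R E \<longleftrightarrow> module R E \<and>
     (\<forall>(A :: ('a, 'a) module) (B :: ('a, 'a) module) f g.
        module R A \<and> module R B \<and>
        f \<in> mod_hom R A B \<and> inj_on f (carrier A) \<and> g \<in> mod_hom R A E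
        \<longrightarrow> (\<exists>h\<in>mod_hom R B E. \<forall>x\<in>carrier A. h (f x) = g x))"

definition injective_hull ::
    "('a, 'r) ring_scheme \<Rightarrow> ('a, 'b) module \<Rightarrow> ('a, 'e) module \<Rightarrow> bool" where
  "injective_hull R N E \<longleftrightarrow> injective_module R E \<and>
     (\<exists>j\<in>mod_hom R N E. inj_on j (carrier N) \<and>
        (\<forall>U. submodule U R E \<and> U \<inter> j ` carrier N = {\<zero>\<^bsub>E\<^esub>} \<longrightarrow> U = {\<zero>\<^bsub>E\<^esub>}))"


section \<open>Localization at a prime ideal\<close>

text \<open>The fraction \<open>m/s\<close>, as an equivalence class of pairs.\<close>

definition loc_frac ::
    "('a, 'r) ring_scheme \<Rightarrow> 'a set \<Rightarrow> ('a, 'b) module \<Rightarrow> 'b \<Rightarrow> 'a \<Rightarrow> ('b \<times> 'a) set" where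
  "loc_frac R p M m s = {(n, t). n \<in> carrier M \<and> t \<in> carrier R - p \<and>
     (\<exists>u\<in>carrier R - p. u \<odot>\<^bsub>M\<^esub> (t \<odot>\<^bsub>M\<^esub> m) = u \<odot>\<^bsub>M\<^esub> (s \<odot>\<^bsub>M\<^esub> n))}"

text \<open>The unions below range over all representatives; their members all coincide.\<close>

definition loc_mod :: "('a, 'r) ring_scheme \<Rightarrow> 'a set \<Rightarrow> ('a, 'b) module
    \<Rightarrow> (('a \<times> 'a) set, ('b \<times> 'a) set) module" where
  "loc_mod R p M = \<lparr>
     carrier = {loc_frac R p M m s | m s. m \<in> carrier M \<and> s \<in> carrier R - p},
     monoid.mult = undefined, one = undefined,
     zero = loc_frac R p M \<zero>\<^bsub>M\<^esub> \<one>\<^bsub>R\<^esub>,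
     add = (\<lambda>X Y. \<Union>(m, s)\<in>X. \<Union>(n, t)\<in>Y.
        loc_frac R p M (t \<odot>\<^bsub>M\<^esub> m \<oplus>\<^bsub>M\<^esub> s \<odot>\<^bsub>M\<^esub> n) (s \<otimes>\<^bsub>R\<^esub> t)),
     smult = (\<lambda>A X. \<Union>(a, s)\<in>A. \<Union>(m, t)\<in>X. loc_frac R p M (a \<odot>\<^bsub>M\<^esub> m) (s \<otimes>\<^bsub>R\<^esub> t))\<rparr>"

definition loc_ring :: "('a, 'r) ring_scheme \<Rightarrow> 'a set \<Rightarrow> ('a \<times> 'a) set ring" where
  "loc_ring R p = \<lparr>
     carrier = carrier (loc_mod R p (self_mod R)),
     monoid.mult = smult (loc_mod R p (self_mod R)),
     one = loc_frac R p (self_mod R) \<one>\<^bsub>R\<^esub> \<one>\<^bsub>R\<^esub>,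
     zero = \<zero>\<^bsub>loc_mod R p (self_mod R)\<^esub>,
     add = add (loc_mod R p (self_mod R))\<rparr>"

definition residue_field_mod :: "('a, 'r) ring_scheme \<Rightarrow> 'a set
    \<Rightarrow> (('a \<times> 'a) set, ('a \<times> 'a) set set) module" where
  "residue_field_mod R p = quot_mod (self_mod (loc_ring R p))
     {loc_frac R p (self_mod R) a s | a s. a \<in> p \<and> s \<in> carrier R - p}"


section \<open>Complexes\<close>

text \<open>Homological grading: \<open>cx_diff X i\<close> maps degree \<open>i\<close> to degree \<open>i - 1\<close>.\<close>

record ('a, 'b) cx =
  cx_mod :: "int \<Rightarrow> ('a, 'b) module"
  cx_diff :: "int \<Rightarrow> 'b \<Rightarrow> 'b"

definition chain_complex :: "('a, 'r) ring_scheme \<Rightarrow> ('a, 'b) cx \<Rightarrow> bool" where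
  "chain_complex R X \<longleftrightarrow>
     (\<forall>i. module R (cx_mod X i)) \<and>
     (\<forall>i. cx_diff X i \<in> mod_hom R (cx_mod X i) (cx_mod X (i - 1))) \<and>
     (\<forall>i. \<forall>x\<in>carrier (cx_mod X i).
        cx_diff X (i - 1) (cx_diff X i x) = \<zero>\<^bsub>cx_mod X (i - 1 - 1)\<^esub>)"

definition cycles :: "('a, 'b) cx \<Rightarrow> int \<Rightarrow> 'b set" where
  "cycles X i = {x \<in> carrier (cx_mod X i). cx_diff X i x = \<zero>\<^bsub>cx_mod X (i - 1)\<^esub>}"

definition boundaries :: "('a, 'b) cx \<Rightarrow> int \<Rightarrow> 'b set" where
  "boundaries X i = cx_diff X (i + 1) ` carrier (cx_mod X (i + 1))"

definition homology :: "('a, 'b) cx \<Rightarrow> int \<Rightarrow> ('a, 'b set) module" where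
  "homology X i = quot_mod (cx_mod X i \<lparr>carrier := cycles X i\<rparr>) (boundaries X i)"

definition homology_map ::
    "('a, 'c) cx \<Rightarrow> (int \<Rightarrow> 'b \<Rightarrow> 'c) \<Rightarrow> int \<Rightarrow> 'b set \<Rightarrow> 'c set" where
  "homology_map Y \<phi> i K = (\<Union>x\<in>K. boundaries Y i +>\<^bsub>cx_mod Y i\<^esub> \<phi> i x)"

definition chain_map ::
    "('a, 'r) ring_scheme \<Rightarrow> ('a, 'b) cx \<Rightarrow> ('a, 'c) cx \<Rightarrow> (int \<Rightarrow> 'b \<Rightarrow> 'c) \<Rightarrow> bool" where
  "chain_map R X Y \<phi> \<longleftrightarrow> chain_complex R X \<and> chain_complex R Y \<and>
     (\<forall>i. \<phi> i \<in> mod_hom R (cx_mod X i) (cx_mod Y i)) \<and>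
     (\<forall>i. \<forall>x\<in>carrier (cx_mod X i). \<phi> (i - 1) (cx_diff X i x) = cx_diff Y i (\<phi> i x))"

definition quasi_iso ::
    "('a, 'r) ring_scheme \<Rightarrow> ('a, 'b) cx \<Rightarrow> ('a, 'c) cx \<Rightarrow> (int \<Rightarrow> 'b \<Rightarrow> 'c) \<Rightarrow> bool" where
  "quasi_iso R X Y \<phi> \<longleftrightarrow> chain_map R X Y \<phi> \<and>
     (\<forall>i. bij_betw (homology_map Y \<phi> i) (carrier (homology X i)) (carrier (homology Y i)))"

text \<open>
  Isomorphism in the derived category: a zigzag of quasi-isomorphisms.  The complexes in the
  zigzag share one element type; this is harmless for comparison with the zero complex, the only
  use made of it here, since an acyclic complex maps quasi-isomorphically to zero in a single step.
\<close>

definition derived_iso :: "('a, 'r) ring_scheme \<Rightarrow> ('a, 'b) cx \<Rightarrow> ('a, 'b) cx \<Rightarrow> bool" where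
  "derived_iso R = equivclp (\<lambda>X Y. \<exists>\<phi>. quasi_iso R X Y \<phi>)"

definition zero_cx :: "('a, 'b) cx" where
  "zero_cx = \<lparr>cx_mod = (\<lambda>_. zero_mod), cx_diff = (\<lambda>_ _. undefined)\<rparr>"

text \<open>A module as a complex concentrated in degree \<open>0\<close>.\<close>

definition stalk :: "('a, 'b) module \<Rightarrow> ('a, 'b) cx" where
  "stalk N = (let C = (\<lambda>i :: int. if i = 0 then N else zero_mod)
     in \<lparr>cx_mod = C, cx_diff = (\<lambda>i _. \<zero>\<^bsub>C (i - 1)\<^esub>)\<rparr>)"

text \<open>
  \<open>Hom(X, Y)\<^sub>n = \<Prod>\<^sub>i Hom(X\<^sub>i, Y\<^sub>i\<^sub>+\<^sub>n)\<close> with differential \<open>f \<mapsto> d f - (-1)\<^sup>n f d\<close>.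
  Homomorphisms are made extensional, so that equality of functions is equality of homomorphisms.
\<close>

definition hom_cx :: "('a, 'r) ring_scheme \<Rightarrow> ('a, 'b) cx \<Rightarrow> ('a, 'c) cx
    \<Rightarrow> ('a, int \<Rightarrow> 'b \<Rightarrow> 'c) cx" where
  "hom_cx R X Y = \<lparr>
     cx_mod = (\<lambda>n. \<lparr>
       carrier = {f. \<forall>i. f i \<in> mod_hom R (cx_mod X i) (cx_mod Y (i + n)) \<inter>
                               extensional (carrier (cx_mod X i))},
       monoid.mult = undefined, one = undefined,
       zero = (\<lambda>i. \<lambda>x\<in>carrier (cx_mod X i). \<zero>\<^bsub>cx_mod Y (i + n)\<^esub>),
       add = (\<lambda>f g i. \<lambda>x\<in>carrier (cx_mod X i). f i x \<oplus>\<^bsub>cx_mod Y (i + n)\<^esub> g i x),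
       smult = (\<lambda>r f i. \<lambda>x\<in>carrier (cx_mod X i). r \<odot>\<^bsub>cx_mod Y (i + n)\<^esub> f i x)\<rparr>),
     cx_diff = (\<lambda>n f i. \<lambda>x\<in>carrier (cx_mod X i).
       if even n
       then cx_diff Y (i + n) (f i x) \<ominus>\<^bsub>cx_mod Y (i + n - 1)\<^esub> f (i - 1) (cx_diff X i x)
       else cx_diff Y (i + n) (f i x) \<oplus>\<^bsub>cx_mod Y (i + n - 1)\<^esub> f (i - 1) (cx_diff X i x))\<rparr>"

definition loc_cx :: "('a, 'r) ring_scheme \<Rightarrow> 'a set \<Rightarrow> ('a, 'b) cx
    \<Rightarrow> (('a \<times> 'a) set, ('b \<times> 'a) set) cx" where
  "loc_cx R p X = \<lparr>
     cx_mod = (\<lambda>i. loc_mod R p (cx_mod X i)),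
     cx_diff = (\<lambda>i F. \<Union>(x, s)\<in>F. loc_frac R p (cx_mod X (i - 1)) (cx_diff X i x) s)\<rparr>"

definition restrict_scalars :: "('a \<Rightarrow> 'c) \<Rightarrow> ('c, 'b) module \<Rightarrow> ('a, 'b) module" where
  "restrict_scalars \<phi> M = \<lparr>carrier = carrier M, monoid.mult = monoid.mult M,
     one = \<one>\<^bsub>M\<^esub>, zero = \<zero>\<^bsub>M\<^esub>, add = add M, smult = (\<lambda>r. smult M (\<phi> r))\<rparr>"

definition restrict_scalars_cx :: "('a \<Rightarrow> 'c) \<Rightarrow> ('c, 'b) cx \<Rightarrow> ('a, 'b) cx" where
  "restrict_scalars_cx \<phi> X = \<lparr>cx_mod = (\<lambda>i. restrict_scalars \<phi> (cx_mod X i)),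
     cx_diff = cx_diff X\<rparr>"

definition free_resolution ::
    "('a, 'r) ring_scheme \<Rightarrow> ('a, 'b) module \<Rightarrow> ('a, nat \<Rightarrow> 'a) cx \<Rightarrow> bool" where
  "free_resolution R N P \<longleftrightarrow>
     (\<exists>k :: int \<Rightarrow> nat. (\<forall>i<0. k i = 0) \<and> (\<forall>i. cx_mod P i = free_mod R (k i))) \<and>
     (\<exists>\<phi>. quasi_iso R P (stalk N) \<phi>)"

text \<open>
  Derived Hom out of a module, computed by a resolution by free modules of finite rank.  Such a
  resolution exists whenever \<open>R\<close> is noetherian and \<open>N\<close> is finitely generated, and up to
  quasi-isomorphism the result does not depend on its choice.
\<close>

definition RHom :: "('a, 'r) ring_scheme \<Rightarrow> ('a, 'b) module \<Rightarrow> ('a, 'c) cx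
    \<Rightarrow> ('a, int \<Rightarrow> (nat \<Rightarrow> 'a) \<Rightarrow> 'c) cx" where
  "RHom R N X = hom_cx R (SOME P. free_resolution R N P) X"

definition Da_minus :: "('a, 'r) ring_scheme \<Rightarrow> ('a, 'b) cx \<Rightarrow> bool" where
  "Da_minus R M \<longleftrightarrow> chain_complex R M \<and> (\<forall>i. artinian_module R (homology M i)) \<and>
     (\<exists>N. \<forall>n>N. carrier (homology M n) = {\<zero>\<^bsub>homology M n\<^esub>})"


section \<open>Semi-local complete rings\<close>

definition Max_ideals :: "('a, 'r) ring_scheme \<Rightarrow> 'a set set" where
  "Max_ideals R = {\<mm>. maximalideal \<mm> R}"

definition jacobson_radical :: "('a, 'r) ring_scheme \<Rightarrow> 'a set" where
  "jacobson_radical R = carrier R \<inter> \<Inter>(Max_ideals R)"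

primrec ideal_power :: "('a, 'r) ring_scheme \<Rightarrow> 'a set \<Rightarrow> nat \<Rightarrow> 'a set" where
  "ideal_power R J 0 = carrier R"
| "ideal_power R J (Suc n) = J \<cdot>\<^bsub>R\<^esub> ideal_power R J n"

text \<open>
  The canonical map from \<open>R\<close> to the inverse limit of the \<open>R/J\<^sup>n\<close> is bijective;
  \<open>x n\<close> represents the component in \<open>R/J\<^sup>n\<close>.
\<close>

definition adically_complete :: "('a, 'r) ring_scheme \<Rightarrow> 'a set \<Rightarrow> bool" where
  "adically_complete R J \<longleftrightarrow>
     (\<forall>x :: nat \<Rightarrow> 'a. (\<forall>n. x n \<in> carrier R) \<and>
        (\<forall>n. x (Suc n) \<ominus>\<^bsub>R\<^esub> x n \<in> ideal_power R J n)
        \<longrightarrow> (\<exists>!a. a \<in> carrier R \<and> (\<forall>n. a \<ominus>\<^bsub>R\<^esub> x n \<in> ideal_power R J n)))"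

definition semilocal_complete :: "('a, 'r) ring_scheme \<Rightarrow> bool" where
  "semilocal_complete R \<longleftrightarrow> finite (Max_ideals R) \<and> adically_complete R (jacobson_radical R)"


section \<open>Cosupport\<close>

text \<open>
  Injective envelopes are passed as arguments: \<open>E \<mm>\<close> is an injective envelope of \<open>R/\<mm>\<close> over \<open>R\<close>,
  and \<open>J p\<close> one of the residue field at \<open>p\<close> over the localization at \<open>p\<close>.
\<close>

definition matlis_dual :: "('a, 'r) ring_scheme \<Rightarrow> ('a set \<Rightarrow> ('a, 'e) module) \<Rightarrow> ('a, 'b) cx
    \<Rightarrow> ('a, int \<Rightarrow> 'b \<Rightarrow> 'a set \<Rightarrow> 'e) cx" where
  "matlis_dual R E M = hom_cx R M (stalk (direct_sum (Max_ideals R) E))"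

text \<open>The complex written \<open>M\<close> with left superscript \<open>p\<close>, regarded as an \<open>R\<close>-complex.\<close>

definition coloc :: "('a, 'r) ring_scheme \<Rightarrow> ('a set \<Rightarrow> ('a, 'e) module)
    \<Rightarrow> ('a set \<Rightarrow> (('a \<times> 'a) set, 'f) module) \<Rightarrow> 'a set \<Rightarrow> ('a, 'b) cx
    \<Rightarrow> ('a, int \<Rightarrow> ((int \<Rightarrow> 'b \<Rightarrow> 'a set \<Rightarrow> 'e) \<times> 'a) set \<Rightarrow> 'f) cx" where
  "coloc R E J p M =
     restrict_scalars_cx (\<lambda>r. loc_frac R p (self_mod R) r \<one>\<^bsub>R\<^esub>)
       (hom_cx (loc_ring R p) (loc_cx R p (matlis_dual R E M)) (stalk (J p)))"

definition big_cosupp :: "('a, 'r) ring_scheme \<Rightarrow> ('a set \<Rightarrow> ('a, 'e) module)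
    \<Rightarrow> ('a set \<Rightarrow> (('a \<times> 'a) set, 'f) module) \<Rightarrow> ('a, 'b) cx \<Rightarrow> 'a set set" where
  "big_cosupp R E J M = {p. primeideal p R \<and> \<not> derived_iso R (coloc R E J p M) zero_cx}"

definition small_cosupp :: "('a, 'r) ring_scheme \<Rightarrow> ('a set \<Rightarrow> ('a, 'e) module)
    \<Rightarrow> ('a set \<Rightarrow> (('a \<times> 'a) set, 'f) module) \<Rightarrow> ('a, 'b) cx \<Rightarrow> 'a set set" where
  "small_cosupp R E J M = {p. primeideal p R \<and>
     \<not> derived_iso R (RHom R (quot_mod (self_mod R) p) (coloc R E J p M)) zero_cx}"

end

theory Submission
  imports Defs
begin

text \<open>
  Isomorphism with zero in the derived category means exactness (\<open>derived_iso_zero_iff\<close>), so both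
  cosupports are about exactness of complexes.  Write \<open>X\<close> for \<open>coloc R E J p M\<close>.

  The inclusion holds for formal reasons: maps from a bounded below complex of free modules
  into an exact complex are null homotopic (\<open>hom_free_exact\<close>), so if \<open>X\<close> is exact, then so is
  \<open>RHom R (R/p) X\<close>.  A noetherian ring has the resolution of \<open>R/p\<close> that is used to compute \<open>RHom\<close>
  (\<open>free_resolution_exists\<close>).

  For equality, let \<open>X\<close> be not exact.  Injectivity of \<open>E\<close> and \<open>J p\<close> turns homology of a complex into
  homology of its dual (\<open>stalk_hom_cycles_iff\<close>, \<open>stalk_hom_boundaries_iff\<close>), so
  \<open>H\<^sub>i(X) = Hom(N\<^sub>p, J p)\<close> where \<open>N\<close> is the Matlis dual of \<open>H\<^sub>i(M)\<close>.  Since \<open>H\<^sub>i(M) = 0\<close> for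
  large \<open>i\<close>, there is a top degree \<open>s\<close> with \<open>H\<^sub>s(X) \<noteq> 0\<close>.  Here \<open>H\<^sub>s(M)\<close> is artinian, and its dual \<open>N\<close> is finitely
  generated over the complete ring \<open>R\<close> (\<open>artinian_dual_generators\<close>).  As \<open>N\<^sub>p\<close> is nonzero and finitely
  generated over a local ring, it has a nonzero map to the residue field in \<open>J p\<close>, and this is a nonzero class
  in \<open>H\<^sub>s(X)\<close> annihilated by \<open>p\<close> (\<open>local_annihilated_class\<close>).  The resulting map from \<open>R/p\<close> to the top homology
  of \<open>X\<close> lifts to a chain map from the resolution and gives a nonzero homology class of \<open>RHom\<close>
  (\<open>hom_resolution_top\<close>).

  Finite generation of the dual of an artinian module \<open>A\<close> is proved without computing the endomorphisms
  of \<open>E\<close>.  Let \<open>\<jj>\<close> be the Jacobson radical.  The part of \<open>E\<close> annihilated by \<open>\<jj>\<close> is cyclic, by the Chinese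
  remainder theorem (\<open>semilocal_socle_cyclic\<close>); with the descending chain condition it follows that finitely many
  maps \<open>x\<^sub>i: A \<rightarrow> E\<close> generate all maps, as far as their values on the part of \<open>A\<close> annihilated by \<open>\<jj>\<close> are
  concerned (\<open>dual_socle_generators\<close>).  A map \<open>A \<rightarrow> E\<close> is then approximated by combinations of the \<open>x\<^sub>i\<close> on
  the parts annihilated by higher and higher powers of \<open>\<jj>\<close>, which exhaust \<open>A\<close> (\<open>artinian_torsion\<close>), with
  corrections of the coefficients in \<open>\<jj>\<^sup>n\<close> (\<open>approximation_step\<close>).  By completeness the coefficients converge.
\<close>

section \<open>Homomorphisms, submodules and linear combinations\<close>

lemma mod_homI:
  assumes "\<And>x. x \<in> carrier M \<Longrightarrow> f x \<in> carrier N"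
    and "\<And>x y. x \<in> carrier M \<Longrightarrow> y \<in> carrier M \<Longrightarrow> f (x \<oplus>\<^bsub>M\<^esub> y) = f x \<oplus>\<^bsub>N\<^esub> f y"
    and "\<And>r x. r \<in> carrier R \<Longrightarrow> x \<in> carrier M \<Longrightarrow> f (r \<odot>\<^bsub>M\<^esub> x) = r \<odot>\<^bsub>N\<^esub> f x"
  shows "f \<in> mod_hom R M N"
  using assms by (auto simp: mod_hom_def)

lemma mod_hom_closed: "f \<in> mod_hom R M N \<Longrightarrow> x \<in> carrier M \<Longrightarrow> f x \<in> carrier N"
  by (auto simp: mod_hom_def)

lemma mod_hom_add: "f \<in> mod_hom R M N \<Longrightarrow> x \<in> carrier M \<Longrightarrow> y \<in> carrier M
    \<Longrightarrow> f (x \<oplus>\<^bsub>M\<^esub> y) = f x \<oplus>\<^bsub>N\<^esub> f y"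
  by (auto simp: mod_hom_def)

lemma mod_hom_smult: "f \<in> mod_hom R M N \<Longrightarrow> r \<in> carrier R \<Longrightarrow> x \<in> carrier M
    \<Longrightarrow> f (r \<odot>\<^bsub>M\<^esub> x) = r \<odot>\<^bsub>N\<^esub> f x"
  by (auto simp: mod_hom_def)

lemma module_cring: "module R M \<Longrightarrow> cring R"
  by (rule module.axioms(1))

lemma module_zero_closed: "module R M \<Longrightarrow> \<zero>\<^bsub>M\<^esub> \<in> carrier M"
  by (simp add: abelian_group.axioms(1) abelian_monoid.zero_closed module.axioms(2))

lemma mod_hom_zero:
  assumes "module R M" "module R N" "f \<in> mod_hom R M N"
  shows "f \<zero>\<^bsub>M\<^esub> = \<zero>\<^bsub>N\<^esub>"
proof -
  interpret M: module R M by fact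
  interpret N: module R N by fact
  have "f (\<zero>\<^bsub>R\<^esub> \<odot>\<^bsub>M\<^esub> \<zero>\<^bsub>M\<^esub>) = \<zero>\<^bsub>R\<^esub> \<odot>\<^bsub>N\<^esub> f \<zero>\<^bsub>M\<^esub>"
    by (rule mod_hom_smult[OF assms(3)]) auto
  thus ?thesis using mod_hom_closed[OF assms(3)] by simp
qed

text \<open>Subtraction is expressed by the scalar \<open>-1\<close>, so that it commutes with homomorphisms and
  stays inside submodules without separate lemmas about inverses.\<close>

lemma module_minus_eq:
  assumes "module R M" "x \<in> carrier M" "y \<in> carrier M"
  shows "x \<ominus>\<^bsub>M\<^esub> y = x \<oplus>\<^bsub>M\<^esub> (\<ominus>\<^bsub>R\<^esub> \<one>\<^bsub>R\<^esub>) \<odot>\<^bsub>M\<^esub> y"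
proof -
  interpret module R M by fact
  show ?thesis using assms by (simp add: M.minus_eq smult_l_minus)
qed

lemma module_diff_zero_iff:
  assumes "module R M" "x \<in> carrier M" "y \<in> carrier M"
  shows "x \<ominus>\<^bsub>M\<^esub> y = \<zero>\<^bsub>M\<^esub> \<longleftrightarrow> x = y"
proof -
  interpret module R M by fact
  show ?thesis
  proof
    assume "x \<ominus>\<^bsub>M\<^esub> y = \<zero>\<^bsub>M\<^esub>"
    hence "x \<oplus>\<^bsub>M\<^esub> (\<ominus>\<^bsub>M\<^esub> y) = \<zero>\<^bsub>M\<^esub>" by (simp add: M.minus_eq)
    from M.minus_equality[OF this] assms show "x = y" by simp
  qed (use assms in \<open>simp add: M.minus_eq M.r_neg\<close>)
qed

lemma mod_hom_minus:
  assumes "module R M" "module R N" "f \<in> mod_hom R M N" "x \<in> carrier M" "y \<in> carrier M"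
  shows "f (x \<ominus>\<^bsub>M\<^esub> y) = f x \<ominus>\<^bsub>N\<^esub> f y"
proof -
  interpret M: module R M by fact
  interpret N: module R N by fact
  show ?thesis using assms
    by (simp add: module_minus_eq[OF assms(1)] module_minus_eq[OF assms(2)]
        mod_hom_add[OF assms(3)] mod_hom_smult[OF assms(3)] mod_hom_closed[OF assms(3)])
qed

lemma mod_hom_comp:
  assumes "f \<in> mod_hom R L M" "g \<in> mod_hom R M N"
  shows "(\<lambda>x. g (f x)) \<in> mod_hom R L N"
  using assms by (auto simp: mod_hom_def Pi_def)

lemma mod_hom_add_scaled:
  assumes "module R M" "module R N" "f \<in> mod_hom R M N" "g \<in> mod_hom R M N" "c \<in> carrier R"
  shows "(\<lambda>x. f x \<oplus>\<^bsub>N\<^esub> c \<odot>\<^bsub>N\<^esub> g x) \<in> mod_hom R M N"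
proof -
  interpret M: module R M by fact
  interpret N: module R N by fact
  note cl = mod_hom_closed[OF assms(3)] mod_hom_closed[OF assms(4)]
  show ?thesis
  proof (rule mod_homI)
    fix x y assume xy: "x \<in> carrier M" "y \<in> carrier M"
    show "f (x \<oplus>\<^bsub>M\<^esub> y) \<oplus>\<^bsub>N\<^esub> c \<odot>\<^bsub>N\<^esub> g (x \<oplus>\<^bsub>M\<^esub> y) =
        f x \<oplus>\<^bsub>N\<^esub> c \<odot>\<^bsub>N\<^esub> g x \<oplus>\<^bsub>N\<^esub> (f y \<oplus>\<^bsub>N\<^esub> c \<odot>\<^bsub>N\<^esub> g y)"
      using xy assms(5) by (simp add: mod_hom_add[OF assms(3)] mod_hom_add[OF assms(4)] cl
          N.smult_r_distr N.M.a_ac)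
  next
    fix r x assume rx: "r \<in> carrier R" "x \<in> carrier M"
    show "f (r \<odot>\<^bsub>M\<^esub> x) \<oplus>\<^bsub>N\<^esub> c \<odot>\<^bsub>N\<^esub> g (r \<odot>\<^bsub>M\<^esub> x) = r \<odot>\<^bsub>N\<^esub> (f x \<oplus>\<^bsub>N\<^esub> c \<odot>\<^bsub>N\<^esub> g x)"
      using rx assms(5) by (simp add: mod_hom_smult[OF assms(3)] mod_hom_smult[OF assms(4)] cl
          N.smult_r_distr N.smult_assoc1[symmetric] M.R.m_comm)
  qed (use cl assms(5) in auto)
qed

lemma mod_hom_smult_fun:
  assumes "module R M" "module R N" "g \<in> mod_hom R M N" "c \<in> carrier R"
  shows "(\<lambda>x. c \<odot>\<^bsub>N\<^esub> g x) \<in> mod_hom R M N"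
proof -
  interpret M: module R M by fact
  interpret N: module R N by fact
  note cl = mod_hom_closed[OF assms(3)]
  show ?thesis
    by (rule mod_homI; use assms(4) in \<open>simp add: mod_hom_add[OF assms(3)] mod_hom_smult[OF assms(3)] cl
          N.smult_r_distr N.smult_assoc1[symmetric] M.R.m_comm\<close>)
qed

lemma submodule_iff:
  assumes "module R M"
  shows "submodule U R M \<longleftrightarrow> U \<subseteq> carrier M \<and> \<zero>\<^bsub>M\<^esub> \<in> U \<and>
    (\<forall>x\<in>U. \<forall>y\<in>U. x \<oplus>\<^bsub>M\<^esub> y \<in> U) \<and> (\<forall>r\<in>carrier R. \<forall>x\<in>U. r \<odot>\<^bsub>M\<^esub> x \<in> U)"
proof -
  interpret module R M by fact
  have neg: "\<ominus>\<^bsub>M\<^esub> x = (\<ominus>\<^bsub>R\<^esub> \<one>\<^bsub>R\<^esub>) \<odot>\<^bsub>M\<^esub> x" if "x \<in> carrier M" for x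
    using that by (simp add: smult_l_minus)
  show ?thesis
  proof
    assume U: "submodule U R M"
    from submoduleE[OF U] obtain x where x: "x \<in> U" by blast
    have "\<zero>\<^bsub>R\<^esub> \<odot>\<^bsub>M\<^esub> x \<in> U" using submoduleE(4)[OF U] x by auto
    hence "\<zero>\<^bsub>M\<^esub> \<in> U" using submoduleE(1)[OF U] x by auto
    thus "U \<subseteq> carrier M \<and> \<zero>\<^bsub>M\<^esub> \<in> U \<and>
      (\<forall>x\<in>U. \<forall>y\<in>U. x \<oplus>\<^bsub>M\<^esub> y \<in> U) \<and> (\<forall>r\<in>carrier R. \<forall>x\<in>U. r \<odot>\<^bsub>M\<^esub> x \<in> U)"
      using submoduleE[OF U] by blast
  next
    assume H: "U \<subseteq> carrier M \<and> \<zero>\<^bsub>M\<^esub> \<in> U \<and>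
      (\<forall>x\<in>U. \<forall>y\<in>U. x \<oplus>\<^bsub>M\<^esub> y \<in> U) \<and> (\<forall>r\<in>carrier R. \<forall>x\<in>U. r \<odot>\<^bsub>M\<^esub> x \<in> U)"
    show "submodule U R M"
      by (rule submoduleI) (use H neg in \<open>auto simp: subset_iff\<close>)
  qed
qed

lemma submodule_module: "module R M \<Longrightarrow> submodule U R M \<Longrightarrow> module R (M\<lparr>carrier := U\<rparr>)"
  by (rule submodule.submodule_is_module)

lemma mod_hom_image_submodule:
  assumes "module R M" "module R N" "f \<in> mod_hom R M N" "submodule U R M"
  shows "submodule (f ` U) R N"
proof -
  interpret M: module R M by fact
  interpret N: module R N by fact
  have U: "U \<subseteq> carrier M" "\<zero>\<^bsub>M\<^esub> \<in> U" "\<And>x y. x \<in> U \<Longrightarrow> y \<in> U \<Longrightarrow> x \<oplus>\<^bsub>M\<^esub> y \<in> U"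
     "\<And>r x. r \<in> carrier R \<Longrightarrow> x \<in> U \<Longrightarrow> r \<odot>\<^bsub>M\<^esub> x \<in> U"
    using assms(4) by (auto simp: submodule_iff[OF assms(1)])
  show ?thesis
    unfolding submodule_iff[OF assms(2)]
  proof (intro conjI ballI)
    show "f ` U \<subseteq> carrier N" using U(1) mod_hom_closed[OF assms(3)] by auto
    show "\<zero>\<^bsub>N\<^esub> \<in> f ` U" using U(2) mod_hom_zero[OF assms(1-3)] by force
    fix x y assume "x \<in> f ` U" "y \<in> f ` U"
    then obtain u v where "u \<in> U" "v \<in> U" "x = f u" "y = f v" by auto
    thus "x \<oplus>\<^bsub>N\<^esub> y \<in> f ` U" using U(1) U(3)[of u v] mod_hom_add[OF assms(3), of u v]
      by (metis image_eqI subsetD)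
  next
    fix r x assume "r \<in> carrier R" "x \<in> f ` U"
    then obtain u where "u \<in> U" "x = f u" by auto
    thus "r \<odot>\<^bsub>N\<^esub> x \<in> f ` U" using U(1) U(4)[of r u] mod_hom_smult[OF assms(3), of r u] \<open>r \<in> _\<close>
      by (metis image_eqI subsetD)
  qed
qed

lemma mod_hom_kernel_submodule:
  assumes "module R M" "module R N" "f \<in> mod_hom R M N"
  shows "submodule {x \<in> carrier M. f x = \<zero>\<^bsub>N\<^esub>} R M"
proof -
  interpret M: module R M by fact
  interpret N: module R N by fact
  show ?thesis
    unfolding submodule_iff[OF assms(1)]
    using mod_hom_zero[OF assms] mod_hom_add[OF assms(3)] mod_hom_smult[OF assms(3)] by auto
qed

lemma submodule_Int:
  "module R M \<Longrightarrow> submodule U R M \<Longrightarrow> submodule V R M \<Longrightarrow> submodule (U \<inter> V) R M"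
  by (auto simp: submodule_iff)

primrec lincomb :: "('a, 'b) module \<Rightarrow> (nat \<Rightarrow> 'b) \<Rightarrow> (nat \<Rightarrow> 'a) \<Rightarrow> nat \<Rightarrow> 'b" where
  "lincomb M x a 0 = \<zero>\<^bsub>M\<^esub>"
| "lincomb M x a (Suc k) = lincomb M x a k \<oplus>\<^bsub>M\<^esub> a k \<odot>\<^bsub>M\<^esub> x k"

lemma lincomb_in_submodule:
  assumes "module R M" "submodule U R M" "\<And>i. i < k \<Longrightarrow> x i \<in> U" "\<And>i. i < k \<Longrightarrow> a i \<in> carrier R"
  shows "lincomb M x a k \<in> U"
  using assms(3,4) by (induct k) (use assms(2) in \<open>auto simp: submodule_iff[OF assms(1)]\<close>)

lemma lincomb_closed:
  assumes "module R M" "\<And>i. i < k \<Longrightarrow> x i \<in> carrier M" "\<And>i. i < k \<Longrightarrow> a i \<in> carrier R"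
  shows "lincomb M x a k \<in> carrier M"
  using lincomb_in_submodule[OF assms(1) module.carrier_is_submodule[OF assms(1)]] assms by blast

lemma lincomb_cong:
  "(\<And>i. i < k \<Longrightarrow> x i = y i) \<Longrightarrow> (\<And>i. i < k \<Longrightarrow> a i = b i) \<Longrightarrow> lincomb M x a k = lincomb M y b k"
  by (induct k) auto

lemma lincomb_hom:
  assumes "module R M" "module R N" "f \<in> mod_hom R M N"
    and "\<And>i. i < k \<Longrightarrow> x i \<in> carrier M" "\<And>i. i < k \<Longrightarrow> a i \<in> carrier R"
  shows "f (lincomb M x a k) = lincomb N (\<lambda>i. f (x i)) a k"
  using assms(4,5)
proof (induct k)
  case 0 show ?case using mod_hom_zero[OF assms(1-3)] by simp
next
  case (Suc k)
  have "lincomb M x a k \<in> carrier M" "a k \<odot>\<^bsub>M\<^esub> x k \<in> carrier M"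
    using Suc.prems by (auto intro!: lincomb_closed[OF assms(1)] module.smult_closed[OF assms(1)])
  thus ?case using Suc by (simp add: mod_hom_add[OF assms(3)] mod_hom_smult[OF assms(3)])
qed

lemma lincomb_add:
  assumes "module R M"
    and "\<And>i. i < k \<Longrightarrow> x i \<in> carrier M" "\<And>i. i < k \<Longrightarrow> a i \<in> carrier R" "\<And>i. i < k \<Longrightarrow> b i \<in> carrier R"
  shows "lincomb M x (\<lambda>i. a i \<oplus>\<^bsub>R\<^esub> b i) k = lincomb M x a k \<oplus>\<^bsub>M\<^esub> lincomb M x b k"
proof -
  interpret module R M by fact
  show ?thesis using assms(2-)
  proof (induct k)
    case (Suc k)
    have "lincomb M x a k \<in> carrier M" "lincomb M x b k \<in> carrier M"
      using Suc.prems by (auto intro!: lincomb_closed[OF assms(1)])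
    thus ?case using Suc by (simp add: smult_l_distr M.a_ac)
  qed auto
qed

lemma lincomb_smult:
  assumes "module R M" "r \<in> carrier R"
    and "\<And>i. i < k \<Longrightarrow> x i \<in> carrier M" "\<And>i. i < k \<Longrightarrow> a i \<in> carrier R"
  shows "lincomb M x (\<lambda>i. r \<otimes>\<^bsub>R\<^esub> a i) k = r \<odot>\<^bsub>M\<^esub> lincomb M x a k"
proof -
  interpret module R M by fact
  show ?thesis using assms(3-)
  proof (induct k)
    case (Suc k)
    have "lincomb M x a k \<in> carrier M"
      using Suc.prems by (auto intro!: lincomb_closed[OF assms(1)])
    thus ?case using Suc assms(2) by (simp add: smult_r_distr smult_assoc1)
  qed (use assms(2) in auto)
qed

lemma lincomb_zero:
  assumes "module R M" "\<And>i. i < k \<Longrightarrow> x i \<in> carrier M"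
  shows "lincomb M x (\<lambda>i. \<zero>\<^bsub>R\<^esub>) k = \<zero>\<^bsub>M\<^esub>"
proof -
  interpret module R M by fact
  show ?thesis using assms(2) by (induct k) auto
qed

section \<open>Extending homomorphisms into an injective module\<close>

text \<open>Baer's condition: homomorphisms from ideals extend to the ring, so that they are given
  by multiplication by an element of the module.\<close>

definition baer :: "('a, 'r) ring_scheme \<Rightarrow> ('a, 'e) module \<Rightarrow> bool" where
  "baer R I \<longleftrightarrow> module R I \<and>
     (\<forall>\<aa> g. ideal \<aa> R \<and> g \<in> mod_hom R (self_mod R\<lparr>carrier := \<aa>\<rparr>) I
        \<longrightarrow> (\<exists>e\<in>carrier I. \<forall>r\<in>\<aa>. g r = r \<odot>\<^bsub>I\<^esub> e))"

lemma self_mod_simps [simp]: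
  "carrier (self_mod R) = carrier R" "zero (self_mod R) = \<zero>\<^bsub>R\<^esub>" "add (self_mod R) = add R"
  "smult (self_mod R) = monoid.mult R"
  by (auto simp: self_mod_def)

lemma self_mod_module: assumes "cring R" shows "module R (self_mod R)"
proof -
  interpret cring R by fact
  have "abelian_group (self_mod R)"
    by (rule abelian_groupI) (auto simp: a_ac intro: bexI[of _ "\<ominus>\<^bsub>R\<^esub> x" for x] l_neg)
  thus ?thesis
    by (intro moduleI) (use assms in \<open>auto simp: l_distr r_distr m_assoc\<close>)
qed

lemma ideal_iff_submodule:
  assumes "cring R" shows "ideal \<aa> R \<longleftrightarrow> submodule \<aa> R (self_mod R)"
proof -
  interpret cring R by fact
  show ?thesis
  proof
    assume "ideal \<aa> R"
    then interpret ideal \<aa> R .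
    show "submodule \<aa> R (self_mod R)"
      unfolding submodule_iff[OF self_mod_module[OF assms]]
      using a_subset zero_closed a_closed I_l_closed by auto
  next
    assume "submodule \<aa> R (self_mod R)"
    hence H: "\<aa> \<subseteq> carrier R" "\<zero>\<^bsub>R\<^esub> \<in> \<aa>" "\<And>x y. x \<in> \<aa> \<Longrightarrow> y \<in> \<aa> \<Longrightarrow> x \<oplus>\<^bsub>R\<^esub> y \<in> \<aa>"
      "\<And>r x. r \<in> carrier R \<Longrightarrow> x \<in> \<aa> \<Longrightarrow> r \<otimes>\<^bsub>R\<^esub> x \<in> \<aa>"
      unfolding submodule_iff[OF self_mod_module[OF assms]] by auto
    have neg: "\<ominus>\<^bsub>R\<^esub> x \<in> \<aa>" if "x \<in> \<aa>" for x
    proof -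
      have "\<ominus>\<^bsub>R\<^esub> x = (\<ominus>\<^bsub>R\<^esub> \<one>\<^bsub>R\<^esub>) \<otimes>\<^bsub>R\<^esub> x" using that H(1) by (simp add: l_minus subset_iff)
      thus ?thesis using H(4)[OF _ that, of "\<ominus>\<^bsub>R\<^esub> \<one>\<^bsub>R\<^esub>"] by simp
    qed
    have "subgroup \<aa> (add_monoid R)"
      by (rule subgroup.intro) (use H neg in \<open>auto simp: a_inv_def[symmetric]\<close>)
    moreover have "x \<otimes>\<^bsub>R\<^esub> a \<in> \<aa>" "a \<otimes>\<^bsub>R\<^esub> x \<in> \<aa>" if "a \<in> \<aa>" "x \<in> carrier R" for a x
      using H(4)[OF that(2,1)] m_comm[of a x] that H(1) by auto
    ultimately show "ideal \<aa> R"
      by (intro idealI ring_axioms) auto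
  qed
qed

lemma injective_module_module: "injective_module R I \<Longrightarrow> module R I"
  unfolding injective_module_def by (rule conjunct1)

lemma injective_moduleD:
  fixes A B :: "('a, 'a) module"
  assumes "injective_module R I" "module R A" "module R B" "f \<in> mod_hom R A B"
    "inj_on f (carrier A)" "g \<in> mod_hom R A I"
  shows "\<exists>h\<in>mod_hom R B I. \<forall>x\<in>carrier A. h (f x) = g x"
proof -
  note ext = conjunct2[OF assms(1)[unfolded injective_module_def]]
  show ?thesis
    by (rule ext[THEN spec, of A, THEN spec, of B, THEN spec, of f, THEN spec, of g, THEN mp])
      (intro conjI assms)
qed

text \<open>The ideals of \<open>R\<close> and \<open>R\<close> itself live on the element type of \<open>R\<close>, so they are among the
  test modules in the definition of injectivity.\<close>

lemma injective_module_baer: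
  assumes "cring R" "injective_module R I" shows "baer R I"
proof -
  interpret cring R by (rule assms(1))
  note S = self_mod_module[OF assms(1)]
  have "\<exists>e\<in>carrier I. \<forall>r\<in>\<aa>. g r = r \<odot>\<^bsub>I\<^esub> e"
    if a: "ideal \<aa> R" and g: "g \<in> mod_hom R (self_mod R\<lparr>carrier := \<aa>\<rparr>) I" for \<aa> g
  proof -
    have sub: "\<aa> \<subseteq> carrier R" by (rule additive_subgroup.a_subset[OF ideal.axioms(1)[OF a]])
    have A: "module R (self_mod R\<lparr>carrier := \<aa>\<rparr>)"
      by (rule submodule_module[OF S]) (use a in \<open>simp add: ideal_iff_submodule[OF assms(1)]\<close>)
    have f: "(\<lambda>x. x) \<in> mod_hom R (self_mod R\<lparr>carrier := \<aa>\<rparr>) (self_mod R)"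
      using sub by (auto simp: mod_hom_def)
    have "\<exists>h\<in>mod_hom R (self_mod R) I. \<forall>x\<in>carrier (self_mod R\<lparr>carrier := \<aa>\<rparr>). h x = g x"
      by (rule injective_moduleD[OF assms(2) A S f _ g]) simp
    then obtain h where h: "h \<in> mod_hom R (self_mod R) I" "\<And>x. x \<in> \<aa> \<Longrightarrow> h x = g x"
      by auto
    have "g r = r \<odot>\<^bsub>I\<^esub> h \<one>\<^bsub>R\<^esub>" if "r \<in> \<aa>" for r
      using mod_hom_smult[OF h(1), of r "\<one>\<^bsub>R\<^esub>"] h(2)[OF that] that sub by (auto simp: subset_iff)
    thus ?thesis
      using mod_hom_closed[OF h(1), of "\<one>\<^bsub>R\<^esub>"] by auto
  qed
  thus ?thesis unfolding baer_def using injective_module_module[OF assms(2)] by blast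
qed

text \<open>Although \<open>injective_module\<close> only tests modules on the element type of the ring, Baer's condition
  gives the extension property for modules on any type.  Zorn's lemma is applied to graphs of partial
  extensions, that is, to submodules of \<open>B \<times> I\<close> which meet \<open>0 \<times> I\<close> trivially.  If a maximal graph
  misses \<open>b\<close>, Baer's condition for the ideal that multiplies \<open>b\<close> into its domain provides a
  value at \<open>b\<close>.\<close>

lemma baer_extend:
  assumes "baer R I" "module R B" "submodule A R B" "g \<in> mod_hom R (B\<lparr>carrier := A\<rparr>) I"
  shows "\<exists>h\<in>mod_hom R B I. \<forall>x\<in>A. h x = g x"
proof -
  have mI: "module R I" using assms(1) by (simp add: baer_def)
  interpret B: module R B by fact
  interpret I: module R I by fact
  have A: "A \<subseteq> carrier B" "\<zero>\<^bsub>B\<^esub> \<in> A" "\<And>x y. x \<in> A \<Longrightarrow> y \<in> A \<Longrightarrow> x \<oplus>\<^bsub>B\<^esub> y \<in> A"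
     "\<And>r x. r \<in> carrier R \<Longrightarrow> x \<in> A \<Longrightarrow> r \<odot>\<^bsub>B\<^esub> x \<in> A"
    using assms(3) by (auto simp: submodule_iff[OF assms(2)])
  have g: "\<And>x. x \<in> A \<Longrightarrow> g x \<in> carrier I"
    "\<And>x y. x \<in> A \<Longrightarrow> y \<in> A \<Longrightarrow> g (x \<oplus>\<^bsub>B\<^esub> y) = g x \<oplus>\<^bsub>I\<^esub> g y"
    "\<And>r x. r \<in> carrier R \<Longrightarrow> x \<in> A \<Longrightarrow> g (r \<odot>\<^bsub>B\<^esub> x) = r \<odot>\<^bsub>I\<^esub> g x"
    using mod_hom_closed[OF assms(4)] mod_hom_add[OF assms(4)] mod_hom_smult[OF assms(4)] by auto
  have g0: "g \<zero>\<^bsub>B\<^esub> = \<zero>\<^bsub>I\<^esub>" using g(3)[of "\<zero>\<^bsub>R\<^esub>" "\<zero>\<^bsub>B\<^esub>"] g(1) A by auto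
  define P where "P = (\<lambda>G. G \<subseteq> carrier B \<times> carrier I \<and> (\<forall>x\<in>A. (x, g x) \<in> G) \<and>
    (\<forall>x y x' y'. (x, y) \<in> G \<longrightarrow> (x', y') \<in> G \<longrightarrow> (x \<oplus>\<^bsub>B\<^esub> x', y \<oplus>\<^bsub>I\<^esub> y') \<in> G) \<and>
    (\<forall>r\<in>carrier R. \<forall>x y. (x, y) \<in> G \<longrightarrow> (r \<odot>\<^bsub>B\<^esub> x, r \<odot>\<^bsub>I\<^esub> y) \<in> G) \<and>
    (\<forall>y. (\<zero>\<^bsub>B\<^esub>, y) \<in> G \<longrightarrow> y = \<zero>\<^bsub>I\<^esub>))"
  have "\<exists>G\<in>{G. P G}. \<forall>X\<in>{G. P G}. G \<subseteq> X \<longrightarrow> X = G"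
  proof (rule subset_Zorn_nonempty)
    have "P {(x, g x) | x. x \<in> A}"
      unfolding P_def using A g g0 by (auto simp: subset_iff)
    thus "{G. P G} \<noteq> {}" by blast
  next
    fix C assume C: "C \<noteq> {}" "subset.chain {G. P G} C"
    have CP: "\<And>G. G \<in> C \<Longrightarrow> P G" using C(2) by (auto simp: subset.chain_def)
    have lin: "\<And>G H. G \<in> C \<Longrightarrow> H \<in> C \<Longrightarrow> G \<subseteq> H \<or> H \<subseteq> G"
      using C(2) by (auto simp: subset.chain_def)
    show "\<Union>C \<in> {G. P G}" unfolding mem_Collect_eq P_def
    proof (intro conjI)
      show "\<Union>C \<subseteq> carrier B \<times> carrier I" using CP unfolding P_def by blast
      show "\<forall>x\<in>A. (x, g x) \<in> \<Union>C" using CP C(1) unfolding P_def by blast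
      show "\<forall>x y x' y'. (x, y) \<in> \<Union>C \<longrightarrow> (x', y') \<in> \<Union>C \<longrightarrow> (x \<oplus>\<^bsub>B\<^esub> x', y \<oplus>\<^bsub>I\<^esub> y') \<in> \<Union>C"
      proof (intro allI impI)
        fix x y x' y' assume "(x, y) \<in> \<Union>C" "(x', y') \<in> \<Union>C"
        then obtain G H where GH: "G \<in> C" "H \<in> C" "(x, y) \<in> G" "(x', y') \<in> H" by blast
        with lin obtain K where "K \<in> C" "(x, y) \<in> K" "(x', y') \<in> K" by blast
        thus "(x \<oplus>\<^bsub>B\<^esub> x', y \<oplus>\<^bsub>I\<^esub> y') \<in> \<Union>C" using CP[of K] unfolding P_def by blast
      qed
      show "\<forall>r\<in>carrier R. \<forall>x y. (x, y) \<in> \<Union>C \<longrightarrow> (r \<odot>\<^bsub>B\<^esub> x, r \<odot>\<^bsub>I\<^esub> y) \<in> \<Union>C"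
        using CP unfolding P_def by (meson UnionE UnionI)
      show "\<forall>y. (\<zero>\<^bsub>B\<^esub>, y) \<in> \<Union>C \<longrightarrow> y = \<zero>\<^bsub>I\<^esub>" using CP unfolding P_def by blast
    qed
  qed
  then obtain G where PG: "P G" and max: "\<And>X. P X \<Longrightarrow> G \<subseteq> X \<Longrightarrow> X = G" by blast
  have G: "G \<subseteq> carrier B \<times> carrier I" "\<And>x. x \<in> A \<Longrightarrow> (x, g x) \<in> G"
    "\<And>x y x' y'. (x, y) \<in> G \<Longrightarrow> (x', y') \<in> G \<Longrightarrow> (x \<oplus>\<^bsub>B\<^esub> x', y \<oplus>\<^bsub>I\<^esub> y') \<in> G"
    "\<And>r x y. r \<in> carrier R \<Longrightarrow> (x, y) \<in> G \<Longrightarrow> (r \<odot>\<^bsub>B\<^esub> x, r \<odot>\<^bsub>I\<^esub> y) \<in> G"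
    "\<And>y. (\<zero>\<^bsub>B\<^esub>, y) \<in> G \<Longrightarrow> y = \<zero>\<^bsub>I\<^esub>"
    using PG unfolding P_def by auto
  have Gc: "x \<in> carrier B" "y \<in> carrier I" if "(x, y) \<in> G" for x y using that G(1) by auto
  have fn: "y = y'" if "(x, y) \<in> G" "(x, y') \<in> G" for x y y'
  proof -
    note c = Gc[OF that(1)] Gc[OF that(2)]
    have "((\<ominus>\<^bsub>R\<^esub> \<one>\<^bsub>R\<^esub>) \<odot>\<^bsub>B\<^esub> x, (\<ominus>\<^bsub>R\<^esub> \<one>\<^bsub>R\<^esub>) \<odot>\<^bsub>I\<^esub> y') \<in> G" using G(4) that(2) by simp
    from G(3)[OF that(1) this] have "(\<zero>\<^bsub>B\<^esub>, y \<ominus>\<^bsub>I\<^esub> y') \<in> G"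
      using c by (simp add: B.smult_l_minus I.smult_l_minus B.M.r_neg I.M.minus_eq)
    from G(5)[OF this] show ?thesis using c by (simp add: module_diff_zero_iff[OF mI])
  qed
  have dom: "\<exists>y. (b, y) \<in> G" if b: "b \<in> carrier B" for b
  proof (rule ccontr)
    assume nb: "\<nexists>y. (b, y) \<in> G"
    define \<aa> where "\<aa> = {r \<in> carrier R. \<exists>y. (r \<odot>\<^bsub>B\<^esub> b, y) \<in> G}"
    define v where "v = (\<lambda>r. SOME y. (r \<odot>\<^bsub>B\<^esub> b, y) \<in> G)"
    have v: "(r \<odot>\<^bsub>B\<^esub> b, v r) \<in> G" if "r \<in> \<aa>" for r
      using that unfolding \<aa>_def v_def by (auto intro: someI)
    have vI: "v r = y" if "r \<in> carrier R" "(r \<odot>\<^bsub>B\<^esub> b, y) \<in> G" for r y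
      using fn[OF v that(2)] that unfolding \<aa>_def by auto
    have 0: "(\<zero>\<^bsub>B\<^esub>, \<zero>\<^bsub>I\<^esub>) \<in> G" using G(2)[OF A(2)] g0 by simp
    have add: "((r \<oplus>\<^bsub>R\<^esub> s) \<odot>\<^bsub>B\<^esub> b, v r \<oplus>\<^bsub>I\<^esub> v s) \<in> G" if "r \<in> \<aa>" "s \<in> \<aa>" for r s
      using G(3)[OF v v, OF that] that b by (simp add: \<aa>_def B.smult_l_distr)
    have sm: "((r \<otimes>\<^bsub>R\<^esub> s) \<odot>\<^bsub>B\<^esub> b, r \<odot>\<^bsub>I\<^esub> v s) \<in> G" if "r \<in> carrier R" "s \<in> \<aa>" for r s
      using G(4)[OF that(1) v[OF that(2)]] that b by (simp add: \<aa>_def B.smult_assoc1)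
    have id: "ideal \<aa> R"
      unfolding ideal_iff_submodule[OF B.R.is_cring] submodule_iff[OF self_mod_module[OF B.R.is_cring]]
    proof (intro conjI ballI)
      show "\<aa> \<subseteq> carrier (self_mod R)" by (auto simp: \<aa>_def)
      show "\<zero>\<^bsub>self_mod R\<^esub> \<in> \<aa>" using 0 b by (auto simp: \<aa>_def)
    next
      fix r s assume "r \<in> \<aa>" "s \<in> \<aa>"
      thus "r \<oplus>\<^bsub>self_mod R\<^esub> s \<in> \<aa>" using add[of r s] by (auto simp: \<aa>_def)
    next
      fix r s assume "r \<in> carrier R" "s \<in> \<aa>"
      thus "r \<odot>\<^bsub>self_mod R\<^esub> s \<in> \<aa>" using sm[of r s] by (auto simp: \<aa>_def)
    qed
    have "v \<in> mod_hom R (self_mod R\<lparr>carrier := \<aa>\<rparr>) I"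
    proof (rule mod_homI; simp)
      show "\<And>x. x \<in> \<aa> \<Longrightarrow> v x \<in> carrier I" using Gc(2)[OF v] .
      show "v (x \<oplus>\<^bsub>R\<^esub> y) = v x \<oplus>\<^bsub>I\<^esub> v y" if "x \<in> \<aa>" "y \<in> \<aa>" for x y
        by (rule vI[OF _ add]) (use that in \<open>auto simp: \<aa>_def\<close>)
      show "v (r \<otimes>\<^bsub>R\<^esub> x) = r \<odot>\<^bsub>I\<^esub> v x" if "r \<in> carrier R" "x \<in> \<aa>" for r x
        by (rule vI[OF _ sm]) (use that in \<open>auto simp: \<aa>_def\<close>)
    qed
    then obtain e where e: "e \<in> carrier I" "\<And>r. r \<in> \<aa> \<Longrightarrow> v r = r \<odot>\<^bsub>I\<^esub> e"
      using assms(1) id unfolding baer_def by blast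
    \<comment> \<open>The graph of the extension of \<open>G\<close> that sends \<open>b\<close> to \<open>e\<close>.\<close>
    define H where "H = {(x \<oplus>\<^bsub>B\<^esub> r \<odot>\<^bsub>B\<^esub> b, y \<oplus>\<^bsub>I\<^esub> r \<odot>\<^bsub>I\<^esub> e) | x y r. (x, y) \<in> G \<and> r \<in> carrier R}"
    have GH: "G \<subseteq> H"
    proof clarify
      fix x y assume xy: "(x, y) \<in> G"
      have "(x, y) = (x \<oplus>\<^bsub>B\<^esub> \<zero>\<^bsub>R\<^esub> \<odot>\<^bsub>B\<^esub> b, y \<oplus>\<^bsub>I\<^esub> \<zero>\<^bsub>R\<^esub> \<odot>\<^bsub>I\<^esub> e)"
        using Gc[OF xy] b e(1) by simp
      thus "(x, y) \<in> H" unfolding H_def using xy by blast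
    qed
    have "P H" unfolding P_def
    proof (intro conjI allI impI ballI)
      show "H \<subseteq> carrier B \<times> carrier I" using Gc b e(1) by (auto simp: H_def)
      show "\<And>x. x \<in> A \<Longrightarrow> (x, g x) \<in> H" using GH G(2) by blast
    next
      fix x y x' y' assume "(x, y) \<in> H" "(x', y') \<in> H"
      then obtain p q r p' q' r' where 1: "(p, q) \<in> G" "r \<in> carrier R" "(p', q') \<in> G" "r' \<in> carrier R"
        "x = p \<oplus>\<^bsub>B\<^esub> r \<odot>\<^bsub>B\<^esub> b" "y = q \<oplus>\<^bsub>I\<^esub> r \<odot>\<^bsub>I\<^esub> e" "x' = p' \<oplus>\<^bsub>B\<^esub> r' \<odot>\<^bsub>B\<^esub> b" "y' = q' \<oplus>\<^bsub>I\<^esub> r' \<odot>\<^bsub>I\<^esub> e"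
        unfolding H_def by blast
      have "(x \<oplus>\<^bsub>B\<^esub> x', y \<oplus>\<^bsub>I\<^esub> y') = ((p \<oplus>\<^bsub>B\<^esub> p') \<oplus>\<^bsub>B\<^esub> (r \<oplus>\<^bsub>R\<^esub> r') \<odot>\<^bsub>B\<^esub> b, (q \<oplus>\<^bsub>I\<^esub> q') \<oplus>\<^bsub>I\<^esub> (r \<oplus>\<^bsub>R\<^esub> r') \<odot>\<^bsub>I\<^esub> e)"
        using 1 Gc b e(1) by (simp add: B.smult_l_distr I.smult_l_distr B.M.a_ac I.M.a_ac)
      moreover have "(p \<oplus>\<^bsub>B\<^esub> p', q \<oplus>\<^bsub>I\<^esub> q') \<in> G" "r \<oplus>\<^bsub>R\<^esub> r' \<in> carrier R" using 1 G(3) by auto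
      ultimately show "(x \<oplus>\<^bsub>B\<^esub> x', y \<oplus>\<^bsub>I\<^esub> y') \<in> H" unfolding H_def by blast
    next
      fix s x y assume s: "s \<in> carrier R" and "(x, y) \<in> H"
      then obtain p q r where 1: "(p, q) \<in> G" "r \<in> carrier R"
        "x = p \<oplus>\<^bsub>B\<^esub> r \<odot>\<^bsub>B\<^esub> b" "y = q \<oplus>\<^bsub>I\<^esub> r \<odot>\<^bsub>I\<^esub> e"
        unfolding H_def by blast
      have "(s \<odot>\<^bsub>B\<^esub> x, s \<odot>\<^bsub>I\<^esub> y) = (s \<odot>\<^bsub>B\<^esub> p \<oplus>\<^bsub>B\<^esub> (s \<otimes>\<^bsub>R\<^esub> r) \<odot>\<^bsub>B\<^esub> b, s \<odot>\<^bsub>I\<^esub> q \<oplus>\<^bsub>I\<^esub> (s \<otimes>\<^bsub>R\<^esub> r) \<odot>\<^bsub>I\<^esub> e)"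
        using 1 s Gc b e(1) by (simp add: B.smult_r_distr I.smult_r_distr B.smult_assoc1 I.smult_assoc1)
      moreover have "(s \<odot>\<^bsub>B\<^esub> p, s \<odot>\<^bsub>I\<^esub> q) \<in> G" "s \<otimes>\<^bsub>R\<^esub> r \<in> carrier R" using 1 s G(4) by auto
      ultimately show "(s \<odot>\<^bsub>B\<^esub> x, s \<odot>\<^bsub>I\<^esub> y) \<in> H" unfolding H_def by blast
    next
      fix w assume "(\<zero>\<^bsub>B\<^esub>, w) \<in> H"
      then obtain x y r where 1: "(x, y) \<in> G" "r \<in> carrier R" "\<zero>\<^bsub>B\<^esub> = x \<oplus>\<^bsub>B\<^esub> r \<odot>\<^bsub>B\<^esub> b"
        "w = y \<oplus>\<^bsub>I\<^esub> r \<odot>\<^bsub>I\<^esub> e" unfolding H_def by blast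
      note c = Gc[OF 1(1)]
      have "r \<odot>\<^bsub>B\<^esub> b = \<ominus>\<^bsub>B\<^esub> x" using 1(2,3) c b
        by (metis B.M.minus_equality B.M.add.m_comm B.smult_closed)
      moreover have "(\<ominus>\<^bsub>B\<^esub> x, \<ominus>\<^bsub>I\<^esub> y) \<in> G"
        using G(4)[of "\<ominus>\<^bsub>R\<^esub> \<one>\<^bsub>R\<^esub>", OF _ 1(1)] c by (simp add: B.smult_l_minus I.smult_l_minus)
      ultimately have "(r \<odot>\<^bsub>B\<^esub> b, \<ominus>\<^bsub>I\<^esub> y) \<in> G" by simp
      from vI[OF 1(2) this] have "v r = \<ominus>\<^bsub>I\<^esub> y" .
      moreover have "r \<in> \<aa>" using 1(2) \<open>(r \<odot>\<^bsub>B\<^esub> b, \<ominus>\<^bsub>I\<^esub> y) \<in> G\<close> by (auto simp: \<aa>_def)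
      ultimately have "r \<odot>\<^bsub>I\<^esub> e = \<ominus>\<^bsub>I\<^esub> y" using e(2) by simp
      thus "w = \<zero>\<^bsub>I\<^esub>" using 1(4) c by (simp add: I.M.r_neg)
    qed
    from max[OF this GH] have HG: "H = G" .
    have "(\<zero>\<^bsub>B\<^esub> \<oplus>\<^bsub>B\<^esub> \<one>\<^bsub>R\<^esub> \<odot>\<^bsub>B\<^esub> b, \<zero>\<^bsub>I\<^esub> \<oplus>\<^bsub>I\<^esub> \<one>\<^bsub>R\<^esub> \<odot>\<^bsub>I\<^esub> e) \<in> H"
      unfolding H_def using 0 by blast
    hence "(b, e) \<in> G" using HG b e(1) by simp
    thus False using nb by blast
  qed
  define h where "h = (\<lambda>x. SOME y. (x, y) \<in> G)"
  have h: "(x, h x) \<in> G" if "x \<in> carrier B" for x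
    using dom[OF that] unfolding h_def by (auto intro: someI)
  have "h \<in> mod_hom R B I"
  proof (rule mod_homI)
    show "\<And>x. x \<in> carrier B \<Longrightarrow> h x \<in> carrier I" using Gc(2)[OF h] .
    show "h (x \<oplus>\<^bsub>B\<^esub> y) = h x \<oplus>\<^bsub>I\<^esub> h y" if "x \<in> carrier B" "y \<in> carrier B" for x y
      using fn[OF h G(3)[OF h h]] that by simp
    show "h (r \<odot>\<^bsub>B\<^esub> x) = r \<odot>\<^bsub>I\<^esub> h x" if "r \<in> carrier R" "x \<in> carrier B" for r x
      using fn[OF h G(4)[OF _ h]] that by simp
  qed
  moreover have "h x = g x" if "x \<in> A" for x using fn[OF h G(2)] that A(1) by auto
  ultimately show ?thesis by (intro bexI[of _ h] ballI)
qed

lemma baer_module: "baer R I \<Longrightarrow> module R I"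
  by (simp add: baer_def)

text \<open>On \<open>h ` K\<close> the values of \<open>g\<close> are prescribed, consistently since \<open>f\<close> vanishes where \<open>h\<close> does;
  Baer's criterion extends them to \<open>B\<close>.\<close>

lemma baer_factor:
  assumes "baer R I" "module R A" "module R B" "submodule K R A" "h \<in> mod_hom R A B"
    and "f \<in> mod_hom R (A\<lparr>carrier := K\<rparr>) I"
    and "\<And>x. x \<in> K \<Longrightarrow> h x = \<zero>\<^bsub>B\<^esub> \<Longrightarrow> f x = \<zero>\<^bsub>I\<^esub>"
  shows "\<exists>g\<in>mod_hom R B I. \<forall>x\<in>K. g (h x) = f x"
proof -
  have mI: "module R I" by (rule baer_module[OF assms(1)])
  interpret A: module R A by fact
  interpret B: module R B by fact
  interpret I: module R I by fact
  have K: "K \<subseteq> carrier A" "\<zero>\<^bsub>A\<^esub> \<in> K" "\<And>x y. x \<in> K \<Longrightarrow> y \<in> K \<Longrightarrow> x \<oplus>\<^bsub>A\<^esub> y \<in> K"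
     "\<And>r x. r \<in> carrier R \<Longrightarrow> x \<in> K \<Longrightarrow> r \<odot>\<^bsub>A\<^esub> x \<in> K"
    using assms(4) by (auto simp: submodule_iff[OF assms(2)])
  have f: "\<And>x. x \<in> K \<Longrightarrow> f x \<in> carrier I"
    "\<And>x y. x \<in> K \<Longrightarrow> y \<in> K \<Longrightarrow> f (x \<oplus>\<^bsub>A\<^esub> y) = f x \<oplus>\<^bsub>I\<^esub> f y"
    "\<And>r x. r \<in> carrier R \<Longrightarrow> x \<in> K \<Longrightarrow> f (r \<odot>\<^bsub>A\<^esub> x) = r \<odot>\<^bsub>I\<^esub> f x"
    using mod_hom_closed[OF assms(6)] mod_hom_add[OF assms(6)] mod_hom_smult[OF assms(6)] by auto
  define m where "m = \<ominus>\<^bsub>R\<^esub> \<one>\<^bsub>R\<^esub>"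
  have m: "m \<in> carrier R" by (simp add: m_def)
  have wd: "f x = f y" if "x \<in> K" "y \<in> K" "h x = h y" for x y
  proof -
    have c: "x \<in> carrier A" "y \<in> carrier A" using that K(1) by auto
    have "x \<oplus>\<^bsub>A\<^esub> m \<odot>\<^bsub>A\<^esub> y \<in> K" using that K m by simp
    moreover have "h (x \<oplus>\<^bsub>A\<^esub> m \<odot>\<^bsub>A\<^esub> y) = \<zero>\<^bsub>B\<^esub>"
      using c m that(3) mod_hom_closed[OF assms(5)]
      by (simp add: mod_hom_add[OF assms(5)] mod_hom_smult[OF assms(5)])
        (simp add: m_def B.smult_l_minus B.M.r_neg)
    ultimately have "f (x \<oplus>\<^bsub>A\<^esub> m \<odot>\<^bsub>A\<^esub> y) = \<zero>\<^bsub>I\<^esub>" using assms(7) by blast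
    hence "f x \<ominus>\<^bsub>I\<^esub> f y = \<zero>\<^bsub>I\<^esub>" using that m f K
      by (simp add: module_minus_eq[OF mI] m_def[symmetric])
    thus ?thesis using f(1) that by (simp add: module_diff_zero_iff[OF mI])
  qed
  have KA: "x \<in> K \<Longrightarrow> x \<in> carrier A" for x using K(1) by blast
  define k where "k = (\<lambda>y. f (SOME x. x \<in> K \<and> h x = y))"
  have k: "k (h x) = f x" if "x \<in> K" for x
  proof -
    have "(SOME z. z \<in> K \<and> h z = h x) \<in> K \<and> h (SOME z. z \<in> K \<and> h z = h x) = h x"
      by (rule someI[where x = x]) (use that in simp)
    thus ?thesis unfolding k_def using wd[OF _ that] by blast
  qed
  have hK: "submodule (h ` K) R B" by (rule mod_hom_image_submodule[OF assms(2,3,5,4)])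
  have "k \<in> mod_hom R (B\<lparr>carrier := h ` K\<rparr>) I"
  proof (rule mod_homI; clarsimp)
    show "x \<in> K \<Longrightarrow> k (h x) \<in> carrier I" for x using k f by simp
    show "k (h x \<oplus>\<^bsub>B\<^esub> h y) = k (h x) \<oplus>\<^bsub>I\<^esub> k (h y)" if "x \<in> K" "y \<in> K" for x y
      using k[OF K(3)[OF that]] k[OF that(1)] k[OF that(2)] f(2)[OF that]
        mod_hom_add[OF assms(5) KA KA, OF that] by simp
    show "k (r \<odot>\<^bsub>B\<^esub> h x) = r \<odot>\<^bsub>I\<^esub> k (h x)" if "x \<in> K" "r \<in> carrier R" for r x
      using k[OF K(4)[OF that(2,1)]] k[OF that(1)] f(3)[OF that(2,1)]
        mod_hom_smult[OF assms(5) that(2) KA[OF that(1)]] by simp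
  qed
  from baer_extend[OF assms(1,3) hK this] k show ?thesis by auto
qed

text \<open>If \<open>f\<close> vanishes on the common kernel of finitely many \<open>h\<^sub>l\<close>, it is a sum of maps
  \<open>g\<^sub>l \<circ> h\<^sub>l\<close>: on the common kernel of the first \<open>r\<close> maps, \<open>f\<close> factors through \<open>h\<^sub>r\<close>, and subtracting
  this contribution leaves a map that vanishes on that larger kernel.\<close>

lemma baer_factor_family:
  assumes "baer R I" "module R A" "module R B" "\<And>l. l < r \<Longrightarrow> h l \<in> mod_hom R A B"
    and "f \<in> mod_hom R A I"
    and "\<And>x. x \<in> carrier A \<Longrightarrow> (\<And>l. l < r \<Longrightarrow> h l x = \<zero>\<^bsub>B\<^esub>) \<Longrightarrow> f x = \<zero>\<^bsub>I\<^esub>"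
  shows "\<exists>g. (\<forall>l<r. g l \<in> mod_hom R B I) \<and>
    (\<forall>x\<in>carrier A. f x = lincomb I (\<lambda>l. g l (h l x)) (\<lambda>_. \<one>\<^bsub>R\<^esub>) r)"
  using assms(4-)
proof (induct r arbitrary: f)
  case 0
  thus ?case by auto
next
  case (Suc r)
  have mI: "module R I" by (rule baer_module[OF assms(1)])
  interpret A: module R A by fact
  interpret B: module R B by fact
  interpret I: module R I by fact
  define K where "K = {x \<in> carrier A. \<forall>l<r. h l x = \<zero>\<^bsub>B\<^esub>}"
  have hr: "h r \<in> mod_hom R A B" using Suc.prems by auto
  have hl: "\<And>l. l < r \<Longrightarrow> h l \<in> mod_hom R A B" using Suc.prems(1) by auto
  have K: "submodule K R A"
    unfolding submodule_iff[OF assms(2)] K_def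
    by (auto simp: mod_hom_zero[OF assms(2,3) hl] mod_hom_add[OF hl] mod_hom_smult[OF hl])
  have fK: "f \<in> mod_hom R (A\<lparr>carrier := K\<rparr>) I"
    using Suc.prems(2) by (auto simp: mod_hom_def K_def Pi_def)
  have van: "f x = \<zero>\<^bsub>I\<^esub>" if "x \<in> K" "h r x = \<zero>\<^bsub>B\<^esub>" for x
    by (rule Suc.prems(3)) (use that in \<open>auto simp: K_def less_Suc_eq\<close>)
  obtain k where k: "k \<in> mod_hom R B I" "\<And>x. x \<in> K \<Longrightarrow> k (h r x) = f x"
    using baer_factor[OF assms(1-3) K hr fK van] by blast
  define f' where "f' = (\<lambda>x. f x \<oplus>\<^bsub>I\<^esub> (\<ominus>\<^bsub>R\<^esub> \<one>\<^bsub>R\<^esub>) \<odot>\<^bsub>I\<^esub> k (h r x))"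
  have kh: "(\<lambda>x. k (h r x)) \<in> mod_hom R A I" by (rule mod_hom_comp[OF hr k(1)])
  have f': "f' \<in> mod_hom R A I"
    unfolding f'_def by (rule mod_hom_add_scaled[OF assms(2) mI Suc.prems(2) kh]) simp
  have van': "f' x = \<zero>\<^bsub>I\<^esub>" if "x \<in> carrier A" "\<And>l. l < r \<Longrightarrow> h l x = \<zero>\<^bsub>B\<^esub>" for x
  proof -
    have "x \<in> K" using that by (auto simp: K_def)
    thus ?thesis using k(2)[of x] mod_hom_closed[OF Suc.prems(2) that(1)]
      by (simp add: f'_def I.smult_l_minus I.M.r_neg)
  qed
  obtain g where g: "\<forall>l<r. g l \<in> mod_hom R B I"
    "\<And>x. x \<in> carrier A \<Longrightarrow> f' x = lincomb I (\<lambda>l. g l (h l x)) (\<lambda>_. \<one>\<^bsub>R\<^esub>) r"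
    using Suc.hyps[OF hl f' van'] by blast
  define g' where "g' = g(r := k)"
  have "f x = lincomb I (\<lambda>l. g' l (h l x)) (\<lambda>_. \<one>\<^bsub>R\<^esub>) (Suc r)" if x: "x \<in> carrier A" for x
  proof -
    have c: "f x \<in> carrier I" "k (h r x) \<in> carrier I"
      using mod_hom_closed[OF Suc.prems(2) x] mod_hom_closed[OF kh x] by auto
    have "lincomb I (\<lambda>l. g' l (h l x)) (\<lambda>_. \<one>\<^bsub>R\<^esub>) r = f' x"
      unfolding g(2)[OF x] by (rule lincomb_cong) (auto simp: g'_def)
    thus ?thesis using c by (simp add: g'_def f'_def I.smult_l_minus I.M.a_assoc I.M.l_neg)
  qed
  thus ?case using g(1) k(1) by (intro exI[of _ g']) (auto simp: g'_def less_Suc_eq)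
qed

section \<open>Quotients and quasi-isomorphisms\<close>

lemma submodule_subgroup:
  "module R M \<Longrightarrow> submodule N R M \<Longrightarrow> abelian_subgroup N M"
  by (intro abelian_subgroupI3 additive_subgroup.intro)
    (auto simp: submodule_def module_def)

lemma submodule_diff:
  assumes "module R M" "submodule U R M" "x \<in> U" "y \<in> U"
  shows "x \<ominus>\<^bsub>M\<^esub> y \<in> U"
proof -
  interpret module R M by fact
  have U: "U \<subseteq> carrier M" "\<And>x y. x \<in> U \<Longrightarrow> y \<in> U \<Longrightarrow> x \<oplus>\<^bsub>M\<^esub> y \<in> U"
     "\<And>r x. r \<in> carrier R \<Longrightarrow> x \<in> U \<Longrightarrow> r \<odot>\<^bsub>M\<^esub> x \<in> U"
    using assms(2) by (auto simp: submodule_iff[OF assms(1)])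
  have "x \<in> carrier M" "y \<in> carrier M" using U(1) assms(3,4) by auto
  from module_minus_eq[OF assms(1) this] show ?thesis using U(2,3) assms(3,4) by simp
qed

lemma submodule_zero: "module R M \<Longrightarrow> submodule U R M \<Longrightarrow> \<zero>\<^bsub>M\<^esub> \<in> U"
  by (simp add: submodule_iff)

lemma module_diff_zero:
  assumes "module R M" "x \<in> carrier M" shows "x \<ominus>\<^bsub>M\<^esub> \<zero>\<^bsub>M\<^esub> = x"
proof -
  interpret module R M by fact
  show ?thesis using assms by (simp add: module_minus_eq[OF assms(1)])
qed

lemma coset_self:
  assumes "module R M" "submodule N R M" "x \<in> carrier M"
  shows "x \<in> N +>\<^bsub>M\<^esub> x"
  using abelian_subgroup.a_rcos_self[OF submodule_subgroup[OF assms(1,2)] assms(3)] .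

lemma coset_mem_iff:
  assumes "module R M" "submodule N R M" "x \<in> carrier M" "y \<in> carrier M"
  shows "x \<in> N +>\<^bsub>M\<^esub> y \<longleftrightarrow> x \<ominus>\<^bsub>M\<^esub> y \<in> N"
proof -
  interpret module R M by fact
  interpret N: abelian_subgroup N M by (rule submodule_subgroup[OF assms(1,2)])
  show ?thesis using N.a_rcos_module[OF assms(4,3)] by (simp add: M.minus_eq)
qed

lemma coset_eq_iff:
  assumes "module R M" "submodule N R M" "x \<in> carrier M" "y \<in> carrier M"
  shows "N +>\<^bsub>M\<^esub> x = N +>\<^bsub>M\<^esub> y \<longleftrightarrow> x \<ominus>\<^bsub>M\<^esub> y \<in> N"
proof -
  interpret N: abelian_subgroup N M by (rule submodule_subgroup[OF assms(1,2)])
  show ?thesis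
    using coset_self[OF assms(1-3)] coset_mem_iff[OF assms] N.a_repr_independence'[OF _ assms(4)]
    by metis
qed

lemma coset_closed:
  assumes "module R M" "submodule N R M" "y \<in> carrier M" "x \<in> N +>\<^bsub>M\<^esub> y"
  shows "x \<in> carrier M"
  using abelian_subgroup.a_elemrcos_carrier[OF submodule_subgroup[OF assms(1,2)] assms(3,4)] .

lemma coset_zero:
  assumes "module R M" "submodule N R M"
  shows "N +>\<^bsub>M\<^esub> \<zero>\<^bsub>M\<^esub> = N"
proof -
  interpret N: abelian_subgroup N M by (rule submodule_subgroup[OF assms])
  show ?thesis by (rule N.a_rcos_const[OF submodule_zero[OF assms]])
qed

lemma quot_mod_carrier: "carrier (quot_mod M N) = {N +>\<^bsub>M\<^esub> x | x. x \<in> carrier M}"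
  by (auto simp: quot_mod_def A_RCOSETS_def' a_r_coset_def' )

lemma quot_mod_zero [simp]: "\<zero>\<^bsub>quot_mod M N\<^esub> = N"
  by (simp add: quot_mod_def)

lemma quot_mod_add:
  assumes "module R M" "submodule N R M" "x \<in> carrier M" "y \<in> carrier M"
  shows "(N +>\<^bsub>M\<^esub> x) \<oplus>\<^bsub>quot_mod M N\<^esub> (N +>\<^bsub>M\<^esub> y) = N +>\<^bsub>M\<^esub> (x \<oplus>\<^bsub>M\<^esub> y)"
  using abelian_subgroup.a_rcos_sum[OF submodule_subgroup[OF assms(1,2)] assms(3,4)]
  by (simp add: quot_mod_def)

lemma quot_mod_smult:
  assumes "module R M" "submodule N R M" "x \<in> carrier M" "r \<in> carrier R"
  shows "r \<odot>\<^bsub>quot_mod M N\<^esub> (N +>\<^bsub>M\<^esub> x) = N +>\<^bsub>M\<^esub> (r \<odot>\<^bsub>M\<^esub> x)"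
proof -
  interpret module R M by fact
  have "N +>\<^bsub>M\<^esub> (r \<odot>\<^bsub>M\<^esub> z) = N +>\<^bsub>M\<^esub> (r \<odot>\<^bsub>M\<^esub> x)" if "z \<in> N +>\<^bsub>M\<^esub> x" for z
  proof -
    have z: "z \<in> carrier M" by (rule coset_closed[OF assms(1-3) that])
    have "z \<ominus>\<^bsub>M\<^esub> x \<in> N" using that coset_mem_iff[OF assms(1,2) z assms(3)] by simp
    hence "r \<odot>\<^bsub>M\<^esub> (z \<ominus>\<^bsub>M\<^esub> x) \<in> N" using submoduleE(4)[OF assms(2,4)] by blast
    moreover have "r \<odot>\<^bsub>M\<^esub> (z \<ominus>\<^bsub>M\<^esub> x) = r \<odot>\<^bsub>M\<^esub> z \<ominus>\<^bsub>M\<^esub> r \<odot>\<^bsub>M\<^esub> x"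
      using z assms(3,4) by (simp add: M.minus_eq smult_r_distr smult_r_minus)
    ultimately show ?thesis using coset_eq_iff[OF assms(1,2)] z assms(3,4) by simp
  qed
  hence "(\<Union>z\<in>N +>\<^bsub>M\<^esub> x. N +>\<^bsub>M\<^esub> (r \<odot>\<^bsub>M\<^esub> z)) = N +>\<^bsub>M\<^esub> (r \<odot>\<^bsub>M\<^esub> x)"
    by (intro UN_constant_eq[OF coset_self[OF assms(1-3)]] ballI)
  thus ?thesis by (simp add: quot_mod_def)
qed

lemma quot_mod_module:
  assumes "module R M" "submodule N R M"
  shows "module R (quot_mod M N)"
proof -
  interpret module R M by fact
  note ops = quot_mod_add[OF assms] quot_mod_smult[OF assms]
  have N: "N = N +>\<^bsub>M\<^esub> \<zero>\<^bsub>M\<^esub>" by (rule coset_zero[OF assms, symmetric])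
  have mem: "N +>\<^bsub>M\<^esub> x \<in> carrier (quot_mod M N)" if "x \<in> carrier M" for x
    using that by (auto simp: quot_mod_carrier)
  have ex: "\<exists>x\<in>carrier M. K = N +>\<^bsub>M\<^esub> x" if "K \<in> carrier (quot_mod M N)" for K
    using that by (auto simp: quot_mod_carrier)
  have "abelian_group (quot_mod M N)"
  proof (rule abelian_groupI)
    show "\<zero>\<^bsub>quot_mod M N\<^esub> \<in> carrier (quot_mod M N)" using mem[OF M.zero_closed] N by simp
  next
    fix K L assume "K \<in> carrier (quot_mod M N)" "L \<in> carrier (quot_mod M N)"
    from this[THEN ex] obtain x y where xy: "x \<in> carrier M" "y \<in> carrier M" "K = N +>\<^bsub>M\<^esub> x" "L = N +>\<^bsub>M\<^esub> y"
      by auto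
    show "K \<oplus>\<^bsub>quot_mod M N\<^esub> L \<in> carrier (quot_mod M N)" using xy mem by (simp add: ops)
    show "K \<oplus>\<^bsub>quot_mod M N\<^esub> L = L \<oplus>\<^bsub>quot_mod M N\<^esub> K" using xy by (simp add: ops M.a_comm)
  next
    fix K L H assume "K \<in> carrier (quot_mod M N)" "L \<in> carrier (quot_mod M N)" "H \<in> carrier (quot_mod M N)"
    from this[THEN ex] obtain x y z where xy: "x \<in> carrier M" "y \<in> carrier M" "z \<in> carrier M"
      "K = N +>\<^bsub>M\<^esub> x" "L = N +>\<^bsub>M\<^esub> y" "H = N +>\<^bsub>M\<^esub> z" by auto
    show "K \<oplus>\<^bsub>quot_mod M N\<^esub> L \<oplus>\<^bsub>quot_mod M N\<^esub> H = K \<oplus>\<^bsub>quot_mod M N\<^esub> (L \<oplus>\<^bsub>quot_mod M N\<^esub> H)"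
      using xy by (simp add: ops M.a_assoc)
  next
    fix K assume "K \<in> carrier (quot_mod M N)"
    from ex[OF this] obtain x where xy: "x \<in> carrier M" "K = N +>\<^bsub>M\<^esub> x" by auto
    have "(N +>\<^bsub>M\<^esub> \<zero>\<^bsub>M\<^esub>) \<oplus>\<^bsub>quot_mod M N\<^esub> K = K" using xy by (simp only: ops M.zero_closed M.l_zero)
    thus "\<zero>\<^bsub>quot_mod M N\<^esub> \<oplus>\<^bsub>quot_mod M N\<^esub> K = K" using N by simp
    have "(N +>\<^bsub>M\<^esub> (\<ominus>\<^bsub>M\<^esub> x)) \<oplus>\<^bsub>quot_mod M N\<^esub> K = \<zero>\<^bsub>quot_mod M N\<^esub>"
      using xy N by (simp add: ops M.l_neg)
    thus "\<exists>L\<in>carrier (quot_mod M N). L \<oplus>\<^bsub>quot_mod M N\<^esub> K = \<zero>\<^bsub>quot_mod M N\<^esub>"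
      using mem[of "\<ominus>\<^bsub>M\<^esub> x"] xy by auto
  qed
  thus ?thesis
  proof (rule moduleI[OF R.is_cring])
    fix a K assume a: "a \<in> carrier R" and "K \<in> carrier (quot_mod M N)"
    from ex[OF this(2)] obtain x where xy: "x \<in> carrier M" "K = N +>\<^bsub>M\<^esub> x" by auto
    show "a \<odot>\<^bsub>quot_mod M N\<^esub> K \<in> carrier (quot_mod M N)" using xy a mem by (simp add: ops)
    fix b assume b: "b \<in> carrier R"
    show "(a \<oplus>\<^bsub>R\<^esub> b) \<odot>\<^bsub>quot_mod M N\<^esub> K = a \<odot>\<^bsub>quot_mod M N\<^esub> K \<oplus>\<^bsub>quot_mod M N\<^esub> b \<odot>\<^bsub>quot_mod M N\<^esub> K"
      using xy a b by (simp add: ops smult_l_distr)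
    show "(a \<otimes>\<^bsub>R\<^esub> b) \<odot>\<^bsub>quot_mod M N\<^esub> K = a \<odot>\<^bsub>quot_mod M N\<^esub> (b \<odot>\<^bsub>quot_mod M N\<^esub> K)"
      using xy a b by (simp add: ops smult_assoc1)
  next
    fix a K L assume a: "a \<in> carrier R" and "K \<in> carrier (quot_mod M N)" "L \<in> carrier (quot_mod M N)"
    from this(2,3)[THEN ex] obtain x y where xy: "x \<in> carrier M" "y \<in> carrier M" "K = N +>\<^bsub>M\<^esub> x" "L = N +>\<^bsub>M\<^esub> y"
      by auto
    show "a \<odot>\<^bsub>quot_mod M N\<^esub> (K \<oplus>\<^bsub>quot_mod M N\<^esub> L) = a \<odot>\<^bsub>quot_mod M N\<^esub> K \<oplus>\<^bsub>quot_mod M N\<^esub> a \<odot>\<^bsub>quot_mod M N\<^esub> L"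
      using xy a by (simp add: ops smult_r_distr)
  next
    fix K assume "K \<in> carrier (quot_mod M N)"
    from ex[OF this] obtain x where xy: "x \<in> carrier M" "K = N +>\<^bsub>M\<^esub> x" by auto
    thus "\<one>\<^bsub>R\<^esub> \<odot>\<^bsub>quot_mod M N\<^esub> K = K" by (simp add: ops)
  qed
qed

lemma chain_complexD:
  assumes "chain_complex R X"
  shows "module R (cx_mod X i)" "cx_diff X i \<in> mod_hom R (cx_mod X i) (cx_mod X (i - 1))"
    "x \<in> carrier (cx_mod X i) \<Longrightarrow> cx_diff X (i - 1) (cx_diff X i x) = \<zero>\<^bsub>cx_mod X (i - 1 - 1)\<^esub>"
  using assms by (auto simp: chain_complex_def)

lemma chain_complex_diff_up:
  assumes "chain_complex R X"
  shows "cx_diff X (i + 1) \<in> mod_hom R (cx_mod X (i + 1)) (cx_mod X i)"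
  using chain_complexD(2)[OF assms, of "i + 1"] by simp

lemma cycles_submodule:
  assumes "chain_complex R X"
  shows "submodule (cycles X i) R (cx_mod X i)"
  unfolding cycles_def
  by (rule mod_hom_kernel_submodule[OF chain_complexD(1)[OF assms] chain_complexD(1)[OF assms]
        chain_complexD(2)[OF assms]])

lemma boundaries_submodule:
  assumes "chain_complex R X"
  shows "submodule (boundaries X i) R (cx_mod X i)"
  unfolding boundaries_def
  by (rule mod_hom_image_submodule[OF chain_complexD(1)[OF assms] chain_complexD(1)[OF assms]
        chain_complex_diff_up[OF assms]])
    (rule module.carrier_is_submodule[OF chain_complexD(1)[OF assms]])

lemma boundaries_subset_cycles:
  assumes "chain_complex R X"
  shows "boundaries X i \<subseteq> cycles X i"
proof
  fix y assume "y \<in> boundaries X i"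
  then obtain x where x: "x \<in> carrier (cx_mod X (i + 1))" "y = cx_diff X (i + 1) x"
    by (auto simp: boundaries_def)
  show "y \<in> cycles X i"
    using chain_complexD(3)[OF assms x(1)] mod_hom_closed[OF chain_complex_diff_up[OF assms] x(1)] x(2)
    by (simp add: cycles_def)
qed

lemma submodule_of_submodule:
  assumes "module R M" "submodule Z R M" "submodule B R M" "B \<subseteq> Z"
  shows "submodule B R (M\<lparr>carrier := Z\<rparr>)"
  using assms(3,4) unfolding submodule_iff[OF assms(1)] submodule_iff[OF submodule_module[OF assms(1,2)]]
  by simp

lemma coset_restrict [simp]: "B +>\<^bsub>M\<lparr>carrier := Z\<rparr>\<^esub> x = B +>\<^bsub>M\<^esub> x"
  by (simp add: a_r_coset_def r_coset_def)

lemma homology_carrier: "carrier (homology X i) = {boundaries X i +>\<^bsub>cx_mod X i\<^esub> x | x. x \<in> cycles X i}"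
  by (simp add: homology_def quot_mod_carrier)

lemma cycles_closed: "x \<in> cycles X i \<Longrightarrow> x \<in> carrier (cx_mod X i)"
  by (simp add: cycles_def)

lemma homology_eq_iff:
  assumes "chain_complex R X" "x \<in> cycles X i" "y \<in> cycles X i"
  shows "boundaries X i +>\<^bsub>cx_mod X i\<^esub> x = boundaries X i +>\<^bsub>cx_mod X i\<^esub> y
    \<longleftrightarrow> x \<ominus>\<^bsub>cx_mod X i\<^esub> y \<in> boundaries X i"
  by (rule coset_eq_iff[OF chain_complexD(1)[OF assms(1)] boundaries_submodule[OF assms(1)]
        cycles_closed[OF assms(2)] cycles_closed[OF assms(3)]])

lemma chain_map_cycles:
  assumes "chain_map R X Y \<phi>" "x \<in> cycles X i"
  shows "\<phi> i x \<in> cycles Y i"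
proof -
  have X: "chain_complex R X" and Y: "chain_complex R Y" and h: "\<And>i. \<phi> i \<in> mod_hom R (cx_mod X i) (cx_mod Y i)"
    and c: "\<And>i x. x \<in> carrier (cx_mod X i) \<Longrightarrow> \<phi> (i - 1) (cx_diff X i x) = cx_diff Y i (\<phi> i x)"
    using assms(1) by (auto simp: chain_map_def)
  have "cx_diff Y i (\<phi> i x) = \<phi> (i - 1) \<zero>\<^bsub>cx_mod X (i - 1)\<^esub>"
    using c[OF cycles_closed[OF assms(2)]] assms(2) by (simp add: cycles_def)
  thus ?thesis
    using mod_hom_zero[OF chain_complexD(1)[OF X] chain_complexD(1)[OF Y] h]
      mod_hom_closed[OF h cycles_closed[OF assms(2)]] by (simp add: cycles_def)
qed

text \<open>A chain map sends boundaries to boundaries, so all cosets in the union that defines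
  \<open>homology_map\<close> coincide.\<close>

lemma homology_map_coset:
  assumes "chain_map R X Y \<phi>" "x \<in> cycles X i"
  shows "homology_map Y \<phi> i (boundaries X i +>\<^bsub>cx_mod X i\<^esub> x) = boundaries Y i +>\<^bsub>cx_mod Y i\<^esub> \<phi> i x"
proof -
  have X: "chain_complex R X" and Y: "chain_complex R Y" and h: "\<And>i. \<phi> i \<in> mod_hom R (cx_mod X i) (cx_mod Y i)"
    and c: "\<And>i x. x \<in> carrier (cx_mod X i) \<Longrightarrow> \<phi> (i - 1) (cx_diff X i x) = cx_diff Y i (\<phi> i x)"
    using assms(1) by (auto simp: chain_map_def)
  note mX = chain_complexD(1)[OF X] and mY = chain_complexD(1)[OF Y]
  note bX = boundaries_submodule[OF X] and bY = boundaries_submodule[OF Y]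
  have x: "x \<in> carrier (cx_mod X i)" by (rule cycles_closed[OF assms(2)])
  have "boundaries Y i +>\<^bsub>cx_mod Y i\<^esub> \<phi> i z = boundaries Y i +>\<^bsub>cx_mod Y i\<^esub> \<phi> i x"
    if zm: "z \<in> boundaries X i +>\<^bsub>cx_mod X i\<^esub> x" for z
  proof -
    have z: "z \<in> carrier (cx_mod X i)" by (rule coset_closed[OF mX bX x zm])
    have "z \<ominus>\<^bsub>cx_mod X i\<^esub> x \<in> boundaries X i" using coset_mem_iff[OF mX bX z x] zm by simp
    then obtain w where w: "w \<in> carrier (cx_mod X (i + 1))" "z \<ominus>\<^bsub>cx_mod X i\<^esub> x = cx_diff X (i + 1) w"
      by (auto simp: boundaries_def)
    have "\<phi> i z \<ominus>\<^bsub>cx_mod Y i\<^esub> \<phi> i x = \<phi> i (cx_diff X (i + 1) w)"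
      using mod_hom_minus[OF mX mY h z x] w(2) by simp
    also have "\<dots> = cx_diff Y (i + 1) (\<phi> (i + 1) w)" using c[OF w(1)] by simp
    also have "\<dots> \<in> boundaries Y i" using mod_hom_closed[OF h w(1)] by (auto simp: boundaries_def)
    finally show ?thesis
      using coset_eq_iff[OF mY bY mod_hom_closed[OF h z] mod_hom_closed[OF h x]] by simp
  qed
  thus ?thesis unfolding homology_map_def
    by (intro UN_constant_eq[OF coset_self[OF mX bX x]] ballI)
qed

lemma quasi_isoI:
  assumes "chain_map R X Y \<phi>"
    and "\<And>i z. z \<in> cycles X i \<Longrightarrow> \<phi> i z \<in> boundaries Y i \<Longrightarrow> z \<in> boundaries X i"
    and "\<And>i y. y \<in> cycles Y i \<Longrightarrow> \<exists>z\<in>cycles X i. \<phi> i z \<ominus>\<^bsub>cx_mod Y i\<^esub> y \<in> boundaries Y i"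
  shows "quasi_iso R X Y \<phi>"
proof -
  have X: "chain_complex R X" and Y: "chain_complex R Y" and h: "\<And>i. \<phi> i \<in> mod_hom R (cx_mod X i) (cx_mod Y i)"
    using assms(1) by (auto simp: chain_map_def)
  have "bij_betw (homology_map Y \<phi> i) (carrier (homology X i)) (carrier (homology Y i))" for i
    unfolding bij_betw_def
  proof
    interpret X: module R "cx_mod X i" by (rule chain_complexD(1)[OF X])
    have diff: "x \<ominus>\<^bsub>cx_mod X i\<^esub> y \<in> cycles X i" if "x \<in> cycles X i" "y \<in> cycles X i" for x y
      by (rule submodule_diff[OF chain_complexD(1)[OF X] cycles_submodule[OF X] that])
    show "inj_on (homology_map Y \<phi> i) (carrier (homology X i))"
    proof (rule inj_onI)
      fix K L assume "K \<in> carrier (homology X i)" "L \<in> carrier (homology X i)"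
        and eq: "homology_map Y \<phi> i K = homology_map Y \<phi> i L"
      then obtain x y where xy: "x \<in> cycles X i" "y \<in> cycles X i"
        and K: "K = boundaries X i +>\<^bsub>cx_mod X i\<^esub> x" and L: "L = boundaries X i +>\<^bsub>cx_mod X i\<^esub> y"
        by (auto simp: homology_carrier)
      have "\<phi> i x \<ominus>\<^bsub>cx_mod Y i\<^esub> \<phi> i y \<in> boundaries Y i"
        using eq xy by (simp add: K L homology_map_coset[OF assms(1)] homology_eq_iff[OF Y]
            chain_map_cycles[OF assms(1)])
      hence "\<phi> i (x \<ominus>\<^bsub>cx_mod X i\<^esub> y) \<in> boundaries Y i"
        using xy by (simp add: mod_hom_minus[OF chain_complexD(1)[OF X] chain_complexD(1)[OF Y] h]
            cycles_closed)
      thus "K = L" using assms(2)[OF diff[OF xy]] xy by (simp add: K L homology_eq_iff[OF X])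
    qed
    show "homology_map Y \<phi> i ` carrier (homology X i) = carrier (homology Y i)"
    proof
      show "homology_map Y \<phi> i ` carrier (homology X i) \<subseteq> carrier (homology Y i)"
        using homology_map_coset[OF assms(1)] chain_map_cycles[OF assms(1)]
        by (fastforce simp: homology_carrier)
      show "carrier (homology Y i) \<subseteq> homology_map Y \<phi> i ` carrier (homology X i)"
      proof
        fix K assume "K \<in> carrier (homology Y i)"
        then obtain y where y: "y \<in> cycles Y i" "K = boundaries Y i +>\<^bsub>cx_mod Y i\<^esub> y"
          by (auto simp: homology_carrier)
        from assms(3)[OF y(1)] obtain z where z: "z \<in> cycles X i"
          "\<phi> i z \<ominus>\<^bsub>cx_mod Y i\<^esub> y \<in> boundaries Y i" by blast
        have "homology_map Y \<phi> i (boundaries X i +>\<^bsub>cx_mod X i\<^esub> z) = K"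
          using z y by (simp add: homology_map_coset[OF assms(1)] homology_eq_iff[OF Y]
              chain_map_cycles[OF assms(1)])
        thus "K \<in> homology_map Y \<phi> i ` carrier (homology X i)"
          using z(1) by (auto simp: homology_carrier)
      qed
    qed
  qed
  thus ?thesis using assms(1) by (simp add: quasi_iso_def)
qed

lemma zero_mod_module:
  assumes "cring R" shows "module R zero_mod"
proof -
  have "abelian_group zero_mod" by (rule abelian_groupI) (auto simp: zero_mod_def)
  thus ?thesis by (intro moduleI[OF assms]) (auto simp: zero_mod_def)
qed

lemma zero_mod_simps [simp]:
  "carrier zero_mod = {undefined}" "\<zero>\<^bsub>zero_mod\<^esub> = undefined" "x \<oplus>\<^bsub>zero_mod\<^esub> y = undefined"
  "r \<odot>\<^bsub>zero_mod\<^esub> x = undefined"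
  by (auto simp: zero_mod_def)

lemma zero_cx_simps [simp]: "cx_mod zero_cx i = zero_mod" "cx_diff zero_cx i x = undefined"
  by (auto simp: zero_cx_def)

lemma zero_cx_chain_complex:
  assumes "cring R" shows "chain_complex R zero_cx"
  unfolding chain_complex_def using zero_mod_module[OF assms] by (auto intro: mod_homI)

definition exact_cx :: "('a, 'b) cx \<Rightarrow> bool" where
  "exact_cx X \<longleftrightarrow> (\<forall>i. cycles X i \<subseteq> boundaries X i)"

lemma homology_singleton_iff:
  assumes "chain_complex R X"
  shows "card (carrier (homology X i)) = 1 \<longleftrightarrow> cycles X i \<subseteq> boundaries X i"
proof -
  interpret X: module R "cx_mod X i" by (rule chain_complexD(1)[OF assms])
  have 0: "\<zero>\<^bsub>cx_mod X i\<^esub> \<in> cycles X i"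
    using cycles_submodule[OF assms, of i] by (simp add: submodule_iff[OF chain_complexD(1)[OF assms]])
  have K: "boundaries X i +>\<^bsub>cx_mod X i\<^esub> x = boundaries X i \<longleftrightarrow> x \<in> boundaries X i" if "x \<in> cycles X i" for x
    using homology_eq_iff[OF assms that 0] cycles_closed[OF that]
      coset_zero[OF chain_complexD(1)[OF assms] boundaries_submodule[OF assms]]
    by (simp add: module_diff_zero[OF chain_complexD(1)[OF assms]])
  have mem: "boundaries X i \<in> carrier (homology X i)"
    using 0 coset_zero[OF chain_complexD(1)[OF assms] boundaries_submodule[OF assms]]
    by (force simp: homology_carrier)
  have "card (carrier (homology X i)) = 1 \<longleftrightarrow> carrier (homology X i) \<subseteq> {boundaries X i}"
    using mem by (auto simp: card_1_singleton_iff)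
  also have "\<dots> \<longleftrightarrow> cycles X i \<subseteq> boundaries X i"
    using K by (auto simp: homology_carrier)
  finally show ?thesis .
qed

lemma quasi_iso_exact_iff:
  assumes "quasi_iso R X Y \<phi>"
  shows "chain_complex R X \<and> exact_cx X \<longleftrightarrow> chain_complex R Y \<and> exact_cx Y"
proof -
  have cc: "chain_complex R X" "chain_complex R Y"
    using assms by (auto simp: quasi_iso_def chain_map_def)
  have "card (carrier (homology X i)) = card (carrier (homology Y i))" for i
    by (rule bij_betw_same_card[of "homology_map Y \<phi> i"]) (use assms in \<open>simp add: quasi_iso_def\<close>)
  thus ?thesis
    using cc by (simp add: exact_cx_def homology_singleton_iff[OF cc(1), symmetric]
        homology_singleton_iff[OF cc(2), symmetric])
qed

text \<open>A quasi-isomorphism transports exactness in both directions, hence so does a zigzag.  Conversely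
  an exact complex maps quasi-isomorphically to zero.\<close>

lemma derived_iso_zero_iff:
  fixes X :: "('a, 'b) cx"
  assumes "cring R"
  shows "derived_iso R X zero_cx \<longleftrightarrow> chain_complex R X \<and> exact_cx X"
proof
  assume "derived_iso R X zero_cx"
  hence "equivclp (\<lambda>X Y. \<exists>\<phi>. quasi_iso R X Y \<phi>) zero_cx X"
    unfolding derived_iso_def by (rule equivclp_sym)
  thus "chain_complex R X \<and> exact_cx X"
  proof (induct rule: equivclp_induct)
    case base
    have "cycles zero_cx i \<subseteq> boundaries zero_cx i" for i by (auto simp: boundaries_def cycles_def)
    thus ?case unfolding exact_cx_def by (intro conjI zero_cx_chain_complex[OF assms] allI)
  next
    case (step Y Z)
    then obtain \<phi> where "quasi_iso R Y Z \<phi> \<or> quasi_iso R Z Y \<phi>" by auto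
    thus ?case using step(3) quasi_iso_exact_iff by blast
  qed
next
  assume X: "chain_complex R X \<and> exact_cx X"
  have q: "quasi_iso R X (zero_cx :: ('a, 'b) cx) (\<lambda>_ _. undefined)"
  proof (rule quasi_isoI)
    show "chain_map R X (zero_cx :: ('a, 'b) cx) (\<lambda>_ _. undefined)"
      using X zero_cx_chain_complex[OF assms] by (auto simp: chain_map_def intro: mod_homI)
    show "\<And>i z. z \<in> cycles X i \<Longrightarrow> z \<in> boundaries X i" using X by (auto simp: exact_cx_def)
    fix i y assume "y \<in> cycles (zero_cx :: ('a, 'b) cx) i"
    have "\<zero>\<^bsub>cx_mod X i\<^esub> \<in> cycles X i"
      using cycles_submodule[of R X i] X submodule_iff[OF chain_complexD(1)[of R X i]] by auto
    thus "\<exists>z\<in>cycles X i. undefined \<ominus>\<^bsub>cx_mod (zero_cx :: ('a, 'b) cx) i\<^esub> y \<in>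
        boundaries (zero_cx :: ('a, 'b) cx) i"
      by (intro bexI[of _ "\<zero>\<^bsub>cx_mod X i\<^esub>"]) (simp_all add: boundaries_def a_minus_def)
  qed
  show "derived_iso R X zero_cx"
    unfolding derived_iso_def by (rule r_into_equivclp, rule exI, rule q)
qed

section \<open>Free modules of finite rank\<close>

lemma free_mod_simps [simp]:
  "v \<in> carrier (free_mod R k) \<longleftrightarrow> (\<forall>i<k. v i \<in> carrier R) \<and> (\<forall>i\<ge>k. v i = \<zero>\<^bsub>R\<^esub>)"
  "\<zero>\<^bsub>free_mod R k\<^esub> = (\<lambda>_. \<zero>\<^bsub>R\<^esub>)" "v \<oplus>\<^bsub>free_mod R k\<^esub> w = (\<lambda>i. v i \<oplus>\<^bsub>R\<^esub> w i)"
  "r \<odot>\<^bsub>free_mod R k\<^esub> v = (\<lambda>i. r \<otimes>\<^bsub>R\<^esub> v i)"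
  by (auto simp: free_mod_def)

lemma free_mod_coeff:
  assumes "cring R" "v \<in> carrier (free_mod R k)" shows "v i \<in> carrier R"
proof -
  interpret cring R by fact
  show ?thesis using assms(2) by (cases "i < k") auto
qed

lemma free_mod_module:
  assumes "cring R" shows "module R (free_mod R k)"
proof -
  interpret cring R by fact
  note c = free_mod_coeff[OF assms]
  have "abelian_group (free_mod R k)"
  proof (rule abelian_groupI)
    fix v assume v: "v \<in> carrier (free_mod R k)"
    show "\<exists>w\<in>carrier (free_mod R k). w \<oplus>\<^bsub>free_mod R k\<^esub> v = \<zero>\<^bsub>free_mod R k\<^esub>"
      using v c[OF v] by (intro bexI[of _ "\<lambda>i. \<ominus>\<^bsub>R\<^esub> v i"]) (auto simp: l_neg)
    show "\<zero>\<^bsub>free_mod R k\<^esub> \<oplus>\<^bsub>free_mod R k\<^esub> v = v" using c[OF v] by simp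
  next
    fix u v assume "u \<in> carrier (free_mod R k)" "v \<in> carrier (free_mod R k)"
    from this[THEN c] show "u \<oplus>\<^bsub>free_mod R k\<^esub> v = v \<oplus>\<^bsub>free_mod R k\<^esub> u"
      by (simp add: a_comm)
  next
    fix u v w assume "u \<in> carrier (free_mod R k)" "v \<in> carrier (free_mod R k)" "w \<in> carrier (free_mod R k)"
    from this[THEN c] show "u \<oplus>\<^bsub>free_mod R k\<^esub> v \<oplus>\<^bsub>free_mod R k\<^esub> w = u \<oplus>\<^bsub>free_mod R k\<^esub> (v \<oplus>\<^bsub>free_mod R k\<^esub> w)"
      by (simp add: a_assoc)
  qed auto
  thus ?thesis
  proof (rule moduleI[OF assms])
    fix a b v assume "a \<in> carrier R" "b \<in> carrier R" "v \<in> carrier (free_mod R k)"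
    with c[OF this(3)]
    show "(a \<oplus>\<^bsub>R\<^esub> b) \<odot>\<^bsub>free_mod R k\<^esub> v = a \<odot>\<^bsub>free_mod R k\<^esub> v \<oplus>\<^bsub>free_mod R k\<^esub> b \<odot>\<^bsub>free_mod R k\<^esub> v"
      "(a \<otimes>\<^bsub>R\<^esub> b) \<odot>\<^bsub>free_mod R k\<^esub> v = a \<odot>\<^bsub>free_mod R k\<^esub> (b \<odot>\<^bsub>free_mod R k\<^esub> v)"
      by (auto simp: l_distr m_assoc)
  next
    fix a u v assume "a \<in> carrier R" "u \<in> carrier (free_mod R k)" "v \<in> carrier (free_mod R k)"
    with this(2,3)[THEN c]
    show "a \<odot>\<^bsub>free_mod R k\<^esub> (u \<oplus>\<^bsub>free_mod R k\<^esub> v) = a \<odot>\<^bsub>free_mod R k\<^esub> u \<oplus>\<^bsub>free_mod R k\<^esub> a \<odot>\<^bsub>free_mod R k\<^esub> v"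
      by (auto simp: r_distr)
  next
    fix v assume "v \<in> carrier (free_mod R k)"
    from c[OF this] show "\<one>\<^bsub>R\<^esub> \<odot>\<^bsub>free_mod R k\<^esub> v = v" by simp
  qed auto
qed

definition unit_vec :: "('a, 'r) ring_scheme \<Rightarrow> nat \<Rightarrow> nat \<Rightarrow> 'a" where
  "unit_vec R j = (\<lambda>i. if i = j then \<one>\<^bsub>R\<^esub> else \<zero>\<^bsub>R\<^esub>)"

lemma unit_vec_closed: "cring R \<Longrightarrow> j < k \<Longrightarrow> unit_vec R j \<in> carrier (free_mod R k)"
  by (auto simp: unit_vec_def cring.cring_simprules)

lemma free_mod_expand:
  assumes "cring R" "v \<in> carrier (free_mod R k)"
  shows "lincomb (free_mod R k) (unit_vec R) v k = v"
proof -
  interpret cring R by fact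
  note c = free_mod_coeff[OF assms]
  have "lincomb (free_mod R k) (unit_vec R) v m = (\<lambda>i. if i < m then v i else \<zero>\<^bsub>R\<^esub>)" for m
    by (induct m) (auto simp: unit_vec_def c less_Suc_eq intro!: ext)
  thus ?thesis using assms(2) by auto
qed

lemma lincomb_mod_hom:
  assumes "module R Y" "\<And>i. i < k \<Longrightarrow> y i \<in> carrier Y"
  shows "(\<lambda>v. lincomb Y y v k) \<in> mod_hom R (free_mod R k) Y"
proof (rule mod_homI)
  show "lincomb Y y v k \<in> carrier Y" if "v \<in> carrier (free_mod R k)" for v
    using that by (intro lincomb_closed[OF assms]) auto
  show "lincomb Y y (v \<oplus>\<^bsub>free_mod R k\<^esub> w) k = lincomb Y y v k \<oplus>\<^bsub>Y\<^esub> lincomb Y y w k"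
    if "v \<in> carrier (free_mod R k)" "w \<in> carrier (free_mod R k)" for v w
    using that by (simp add: lincomb_add[OF assms])
  show "lincomb Y y (r \<odot>\<^bsub>free_mod R k\<^esub> v) k = r \<odot>\<^bsub>Y\<^esub> lincomb Y y v k"
    if "r \<in> carrier R" "v \<in> carrier (free_mod R k)" for r v
    using that by (simp add: lincomb_smult[OF assms(1) _ assms(2)])
qed

lemma lincomb_unit_vec:
  assumes "module R Y" "\<And>i. i < k \<Longrightarrow> y i \<in> carrier Y" "j < k"
  shows "lincomb Y y (unit_vec R j) k = y j"
proof -
  interpret module R Y by fact
  have "lincomb Y y (unit_vec R j) m = (if j < m then y j else \<zero>\<^bsub>Y\<^esub>)" if "m \<le> k" for m
    using that by (induct m) (auto simp: unit_vec_def assms(2) less_Suc_eq)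
  from this[of k] show ?thesis using assms(3) by simp
qed

text \<open>The values on the unit vectors can be lifted one by one.\<close>

lemma free_lift:
  assumes "module R X" "module R Y" "d \<in> mod_hom R Y X" "q \<in> mod_hom R (free_mod R k) X"
    and "\<And>v. v \<in> carrier (free_mod R k) \<Longrightarrow> q v \<in> d ` carrier Y"
  shows "\<exists>g\<in>mod_hom R (free_mod R k) Y. \<forall>v\<in>carrier (free_mod R k). d (g v) = q v"
proof -
  have R: "cring R" by (rule module_cring[OF assms(1)])
  have "\<forall>j<k. \<exists>y\<in>carrier Y. d y = q (unit_vec R j)"
  proof (intro allI impI)
    fix j assume "j < k"
    from assms(5)[OF unit_vec_closed[OF R this]]
    show "\<exists>y\<in>carrier Y. d y = q (unit_vec R j)" unfolding image_iff by metis
  qed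
  then obtain y where y: "\<And>j. j < k \<Longrightarrow> y j \<in> carrier Y" "\<And>j. j < k \<Longrightarrow> d (y j) = q (unit_vec R j)"
    by metis
  have "d (lincomb Y y v k) = q v" if v: "v \<in> carrier (free_mod R k)" for v
  proof -
    note c = free_mod_coeff[OF R v]
    have "d (lincomb Y y v k) = lincomb X (\<lambda>j. d (y j)) v k"
      by (rule lincomb_hom[OF assms(2,1,3) y(1) c])
    also have "\<dots> = lincomb X (\<lambda>j. q (unit_vec R j)) v k" by (rule lincomb_cong) (simp_all add: y)
    also have "\<dots> = q (lincomb (free_mod R k) (unit_vec R) v k)"
      by (rule lincomb_hom[OF free_mod_module[OF R] assms(1,4) unit_vec_closed[OF R] c, symmetric])
    finally show ?thesis using free_mod_expand[OF R v] by simp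
  qed
  thus ?thesis using lincomb_mod_hom[OF assms(2) y(1)] by (intro bexI[of _ "\<lambda>v. lincomb Y y v k"]) auto
qed

section \<open>Resolutions over a noetherian ring\<close>

text \<open>Generation is expressed by minimality among submodules, because the finite generating sets of ideals
  of a noetherian ring come in this form, through \<open>genideal\<close>.\<close>

definition fin_gen :: "('a, 'r) ring_scheme \<Rightarrow> ('a, 'b) module \<Rightarrow> 'b set \<Rightarrow> bool" where
  "fin_gen R M U \<longleftrightarrow> (\<exists>S. finite S \<and> S \<subseteq> U \<and> (\<forall>V. submodule V R M \<longrightarrow> S \<subseteq> V \<longrightarrow> U \<subseteq> V))"

lemma ideal_fin_gen:
  assumes "cring R" "noetherian_ring R" "ideal \<aa> R"
  shows "fin_gen R (self_mod R) \<aa>"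
proof -
  interpret cring R by fact
  obtain A where A: "A \<subseteq> carrier R" "finite A" "\<aa> = genideal R A"
    using noetherian_ring.finetely_gen[OF assms(2,3)] by blast
  have "A \<subseteq> \<aa>" using genideal_self[OF A(1)] A(3) by simp
  moreover have "\<aa> \<subseteq> V" if "submodule V R (self_mod R)" "A \<subseteq> V" for V
    using genideal_minimal[of V A] that A(3) by (simp add: ideal_iff_submodule[OF assms(1)])
  ultimately show ?thesis using A(2) unfolding fin_gen_def by blast
qed

text \<open>Submodules of free modules of finite rank are finitely generated, by induction on the rank:
  the last coordinates form an ideal, and the elements whose last coordinate vanishes form a
  submodule of a free module of smaller rank.\<close>

lemma free_submodule_fin_gen:
  assumes "cring R" "noetherian_ring R" "submodule U R (free_mod R k)"
  shows "fin_gen R (free_mod R k) U"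
  using assms(3)
proof (induct k arbitrary: U)
  case 0
  have "U \<subseteq> V" if "submodule V R (free_mod R 0)" for V
  proof
    fix v assume "v \<in> U"
    hence "v \<in> carrier (free_mod R 0)" using 0 by (auto simp: submodule_iff[OF free_mod_module[OF assms(1)]])
    hence "v = \<zero>\<^bsub>free_mod R 0\<^esub>" by auto
    thus "v \<in> V" using submodule_zero[OF free_mod_module[OF assms(1)] that] by simp
  qed
  thus ?case unfolding fin_gen_def by (intro exI[of _ "{}"]) auto
next
  case (Suc k)
  interpret cring R by fact
  let ?F = "free_mod R (Suc k)"
  note mF = free_mod_module[OF assms(1), of "Suc k"] and mF' = free_mod_module[OF assms(1), of k]
  note mS = self_mod_module[OF assms(1)]
  have last: "(\<lambda>v. v k) \<in> mod_hom R ?F (self_mod R)"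
    by (rule mod_homI) (auto simp: free_mod_coeff)
  have idl: "ideal ((\<lambda>v. v k) ` V) R" if "submodule V R ?F" for V
    using mod_hom_image_submodule[OF mF mS last that] by (simp add: ideal_iff_submodule[OF assms(1)])
  obtain A where A: "finite A" "A \<subseteq> (\<lambda>v. v k) ` U"
    "\<And>V. submodule V R (self_mod R) \<Longrightarrow> A \<subseteq> V \<Longrightarrow> (\<lambda>v. v k) ` U \<subseteq> V"
    using ideal_fin_gen[OF assms(1,2) idl[OF Suc.prems]] unfolding fin_gen_def by blast
  from A(2) have "\<forall>a\<in>A. \<exists>w\<in>U. w k = a" by force
  then obtain w where w: "\<And>a. a \<in> A \<Longrightarrow> w a \<in> U" "\<And>a. a \<in> A \<Longrightarrow> w a k = a" by metis
  have low: "submodule (V \<inter> carrier (free_mod R k)) R (free_mod R k)" if "submodule V R ?F" for V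
    using that unfolding submodule_iff[OF mF] submodule_iff[OF mF'] by auto
  obtain S where S: "finite S" "S \<subseteq> U \<inter> carrier (free_mod R k)"
    "\<And>V. submodule V R (free_mod R k) \<Longrightarrow> S \<subseteq> V \<Longrightarrow> U \<inter> carrier (free_mod R k) \<subseteq> V"
    using Suc.hyps[OF low[OF Suc.prems]] unfolding fin_gen_def by blast
  have "U \<subseteq> V" if V: "submodule V R ?F" "S \<union> w ` A \<subseteq> V" for V
  proof
    fix u assume u: "u \<in> U"
    have UV: "submodule (U \<inter> V) R ?F" by (rule submodule_Int[OF mF Suc.prems V(1)])
    have "A \<subseteq> (\<lambda>v. v k) ` (U \<inter> V)" 
    proof
      fix a assume a: "a \<in> A"
      have "w a \<in> U \<inter> V" using w(1)[OF a] V(2) a by blast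
      thus "a \<in> (\<lambda>v. v k) ` (U \<inter> V)" using w(2)[OF a] by (intro image_eqI[of _ _ "w a"]) simp_all
    qed
    hence "u k \<in> (\<lambda>v. v k) ` (U \<inter> V)"
      using A(3)[of "(\<lambda>v. v k) ` (U \<inter> V)"] idl[OF UV] u by (auto simp: ideal_iff_submodule[OF assms(1)])
    then obtain v where v: "v \<in> U" "v \<in> V" "v k = u k" by auto
    have c: "u \<in> carrier ?F" "v \<in> carrier ?F" using u v Suc.prems unfolding submodule_iff[OF mF] by auto
    define m where "m = \<ominus>\<^bsub>R\<^esub> \<one>\<^bsub>R\<^esub>"
    have m: "m \<in> carrier R" by (simp add: m_def)
    define z where "z = u \<oplus>\<^bsub>?F\<^esub> m \<odot>\<^bsub>?F\<^esub> v"
    have zU: "z \<in> U" using u v(1) m Suc.prems unfolding submodule_iff[OF mF] z_def by blast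
    have "z k = \<zero>\<^bsub>R\<^esub>" using v(3) free_mod_coeff[OF assms(1) c(1)] by (simp add: z_def m_def l_minus r_neg)
    moreover have "z \<in> carrier ?F" using zU Suc.prems unfolding submodule_iff[OF mF] by auto
    ultimately have "z \<in> carrier (free_mod R k)"
      by (auto simp: Suc_le_eq) (metis le_neq_implies_less)
    hence zV: "z \<in> V" using S(3)[OF low[OF V(1)]] S(2) V(2) zU by auto
    have "u = z \<oplus>\<^bsub>?F\<^esub> v"
      using free_mod_coeff[OF assms(1) c(1)] free_mod_coeff[OF assms(1) c(2)]
      by (auto simp: z_def m_def l_minus a_assoc l_neg)
    thus "u \<in> V" using zV v(2) V(1) unfolding submodule_iff[OF mF] by blast
  qed
  thus ?case unfolding fin_gen_def using S(1,2) A(1) w(1) by (intro exI[of _ "S \<union> w ` A"]) auto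
qed

lemma fin_gen_enum:
  assumes "fin_gen R M U"
  shows "\<exists>(k :: nat) s. (\<forall>i<k. s i \<in> U) \<and> (\<forall>V. submodule V R M \<longrightarrow> (\<forall>i<k. s i \<in> V) \<longrightarrow> U \<subseteq> V)"
proof -
  obtain S where S: "finite S" "S \<subseteq> U" "\<And>V. submodule V R M \<Longrightarrow> S \<subseteq> V \<Longrightarrow> U \<subseteq> V"
    using assms unfolding fin_gen_def by blast
  obtain k :: nat and s where s: "S = s ` {i. i < k}"
    using S(1) finite_imp_nat_seg_image_inj_on by blast
  show ?thesis using S(2,3) by (intro exI[of _ k] exI[of _ s]) (auto simp: s)
qed

lemma fin_gen_image_of_free:
  assumes "module R M" "submodule U R M" "fin_gen R M U"
  shows "\<exists>k. \<exists>d\<in>mod_hom R (free_mod R k) M. d ` carrier (free_mod R k) = U"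
proof -
  have R: "cring R" by (rule module_cring[OF assms(1)])
  obtain k :: nat and s where s: "\<And>i. i < k \<Longrightarrow> s i \<in> U"
    "\<And>V. submodule V R M \<Longrightarrow> (\<And>i. i < k \<Longrightarrow> s i \<in> V) \<Longrightarrow> U \<subseteq> V"
    using fin_gen_enum[OF assms(3)] by metis
  have U: "U \<subseteq> carrier M" using assms(2) unfolding submodule_iff[OF assms(1)] by blast
  let ?d = "\<lambda>v. lincomb M s v k"
  have sc: "\<And>i. i < k \<Longrightarrow> s i \<in> carrier M" using s(1) U by blast
  have d: "?d \<in> mod_hom R (free_mod R k) M" by (rule lincomb_mod_hom[OF assms(1) sc])
  have "U \<subseteq> ?d ` carrier (free_mod R k)"
  proof (rule s(2))
    show "submodule (?d ` carrier (free_mod R k)) R M"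
      by (rule mod_hom_image_submodule[OF free_mod_module[OF R] assms(1) d
            module.carrier_is_submodule[OF free_mod_module[OF R]]])
    show "s i \<in> ?d ` carrier (free_mod R k)" if "i < k" for i
    proof (rule image_eqI)
      show "s i = lincomb M s (unit_vec R i) k" by (rule lincomb_unit_vec[OF assms(1) sc that, symmetric])
      show "unit_vec R i \<in> carrier (free_mod R k)" by (rule unit_vec_closed[OF R that])
    qed
  qed
  moreover have "?d ` carrier (free_mod R k) \<subseteq> U"
  proof (intro subsetI, elim imageE)
    fix y v assume y: "y = lincomb M s v k" and v: "v \<in> carrier (free_mod R k)"
    show "y \<in> U" unfolding y by (rule lincomb_in_submodule[OF assms(1,2) s(1) free_mod_coeff[OF R v]])
  qed
  ultimately have "?d ` carrier (free_mod R k) = U" by (rule equalityI[rotated])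
  thus ?thesis by (intro exI[of _ k] bexI[OF _ d])
qed

lemma stalk_simps [simp]:
  "cx_mod (stalk N) i = (if i = 0 then N else zero_mod)"
  "cx_diff (stalk N) i x = \<zero>\<^bsub>cx_mod (stalk N) (i - 1)\<^esub>"
  by (auto simp: stalk_def Let_def)

lemma stalk_chain_complex:
  assumes "module R N" shows "chain_complex R (stalk N)"
proof -
  interpret module R N by fact
  have m: "module R (cx_mod (stalk N) i)" for i
    by (simp add: assms zero_mod_module[OF R.is_cring])
  have "cx_diff (stalk N) i \<in> mod_hom R (cx_mod (stalk N) i) (cx_mod (stalk N) (i - 1))" for i
  proof (rule mod_homI; unfold stalk_simps(2))
    interpret S: module R "cx_mod (stalk N) (i - 1)" by (rule m)
    show "\<zero>\<^bsub>cx_mod (stalk N) (i - 1)\<^esub> \<in> carrier (cx_mod (stalk N) (i - 1))" by (rule S.M.zero_closed)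
    show "\<zero>\<^bsub>cx_mod (stalk N) (i - 1)\<^esub> =
        \<zero>\<^bsub>cx_mod (stalk N) (i - 1)\<^esub> \<oplus>\<^bsub>cx_mod (stalk N) (i - 1)\<^esub> \<zero>\<^bsub>cx_mod (stalk N) (i - 1)\<^esub>"
      by (rule S.M.l_zero[OF S.M.zero_closed, symmetric])
    show "\<zero>\<^bsub>cx_mod (stalk N) (i - 1)\<^esub> = r \<odot>\<^bsub>cx_mod (stalk N) (i - 1)\<^esub> \<zero>\<^bsub>cx_mod (stalk N) (i - 1)\<^esub>"
      if "r \<in> carrier R" for r
      by (rule S.smult_r_null[OF that, symmetric])
  qed
  moreover have "cx_diff (stalk N) (i - 1) (cx_diff (stalk N) i x) = \<zero>\<^bsub>cx_mod (stalk N) (i - 1 - 1)\<^esub>" for i x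
    by (rule stalk_simps(2))
  ultimately show ?thesis unfolding chain_complex_def using m by (intro conjI allI ballI)
qed

text \<open>Each differential of the resolution maps a free module of finite rank onto the kernel of the
  preceding one, which is finitely generated as a submodule of a free module.\<close>

lemma free_resolution_exists:
  fixes R :: "('a, 'r) ring_scheme"
  assumes "cring R" "noetherian_ring R" "ideal p R"
  shows "\<exists>P. free_resolution R (quot_mod (self_mod R) p) P"
proof -
  interpret cring R by fact
  note mS = self_mod_module[OF assms(1)] and mF = free_mod_module[OF assms(1)]
  have p: "submodule p R (self_mod R)" using assms(3) by (simp add: ideal_iff_submodule[OF assms(1)])
  note mN = quot_mod_module[OF mS p]
  let ?N = "quot_mod (self_mod R) p"
  define aug where "aug = (\<lambda>v :: nat \<Rightarrow> 'a. p +>\<^bsub>self_mod R\<^esub> (v 0))"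
  have aug: "aug \<in> mod_hom R (free_mod R 1) ?N"
  proof (rule mod_homI)
    fix v assume v: "v \<in> carrier (free_mod R 1)"
    note c = free_mod_coeff[OF assms(1)]
    show "aug v \<in> carrier ?N" using c[OF v] by (auto simp: aug_def quot_mod_carrier)
    show "aug (r \<odot>\<^bsub>free_mod R 1\<^esub> v) = r \<odot>\<^bsub>?N\<^esub> aug v" if "r \<in> carrier R" for r
      using c[OF v] that by (simp add: aug_def quot_mod_smult[OF mS p])
    show "aug (v \<oplus>\<^bsub>free_mod R 1\<^esub> w) = aug v \<oplus>\<^bsub>?N\<^esub> aug w" if "w \<in> carrier (free_mod R 1)" for w
      using c[OF v] c[OF that] by (simp add: aug_def quot_mod_add[OF mS p])
  qed
  have onto: "\<exists>k. \<exists>d\<in>mod_hom R (free_mod R k) (free_mod R l). d ` carrier (free_mod R k) = U"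
    if "submodule U R (free_mod R l)" for l U
    by (rule fin_gen_image_of_free[OF mF that free_submodule_fin_gen[OF assms(1,2) that]])
  define ker where "ker = (\<lambda>l (d :: (nat \<Rightarrow> 'a) \<Rightarrow> nat \<Rightarrow> 'a). {v \<in> carrier (free_mod R l). d v = (\<lambda>_. \<zero>\<^bsub>R\<^esub>)})"
  \<comment> \<open>A triple \<open>(k, l, d)\<close> stands for a differential \<open>d: R\<^sup>l \<rightarrow> R\<^sup>k\<close>.\<close>
  define Q where "Q = (\<lambda>(s :: nat \<times> nat \<times> ((nat \<Rightarrow> 'a) \<Rightarrow> nat \<Rightarrow> 'a)) (t :: nat \<times> nat \<times> ((nat \<Rightarrow> 'a) \<Rightarrow> nat \<Rightarrow> 'a)).
      fst t = fst (snd s) \<and>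
      snd (snd t) ` carrier (free_mod R (fst (snd t))) = ker (fst (snd s)) (snd (snd s)))"
  define H where "H = (\<lambda>s :: nat \<times> nat \<times> ((nat \<Rightarrow> 'a) \<Rightarrow> nat \<Rightarrow> 'a).
      snd (snd s) \<in> mod_hom R (free_mod R (fst (snd s))) (free_mod R (fst s)))"
  define I where "I = (\<lambda>s :: nat \<times> nat \<times> ((nat \<Rightarrow> 'a) \<Rightarrow> nat \<Rightarrow> 'a). fst s = 1 \<and>
      snd (snd s) ` carrier (free_mod R (fst (snd s))) = {v \<in> carrier (free_mod R 1). aug v = \<zero>\<^bsub>?N\<^esub>})"
  have "\<exists>f. \<forall>n. (H (f n) \<and> (n = 0 \<longrightarrow> I (f n))) \<and> Q (f n) (f (Suc n))"
  proof (rule dependent_nat_choice)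
    have "submodule {v \<in> carrier (free_mod R 1). aug v = \<zero>\<^bsub>?N\<^esub>} R (free_mod R 1)"
      by (rule mod_hom_kernel_submodule[OF mF mN aug])
    from onto[OF this] obtain k d where "d \<in> mod_hom R (free_mod R k) (free_mod R 1)"
      "d ` carrier (free_mod R k) = {v \<in> carrier (free_mod R 1). aug v = \<zero>\<^bsub>?N\<^esub>}" by blast
    hence "H (1, k, d) \<and> (0 = (0::nat) \<longrightarrow> I (1, k, d))" by (simp add: H_def I_def)
    thus "\<exists>s. H s \<and> ((0::nat) = 0 \<longrightarrow> I s)" by blast
  next
    fix s n assume "H s \<and> (n = (0::nat) \<longrightarrow> I s)"
    hence "snd (snd s) \<in> mod_hom R (free_mod R (fst (snd s))) (free_mod R (fst s))" by (simp add: H_def)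
    from mod_hom_kernel_submodule[OF mF mF this]
    have "submodule (ker (fst (snd s)) (snd (snd s))) R (free_mod R (fst (snd s)))"
      unfolding ker_def free_mod_simps(2) .
    from onto[OF this] obtain k d where "d \<in> mod_hom R (free_mod R k) (free_mod R (fst (snd s)))"
      "d ` carrier (free_mod R k) = ker (fst (snd s)) (snd (snd s))" by blast
    hence "(H (fst (snd s), k, d) \<and> (Suc n = 0 \<longrightarrow> I (fst (snd s), k, d))) \<and> Q s (fst (snd s), k, d)"
      by (simp add: H_def Q_def)
    thus "\<exists>t. (H t \<and> (Suc n = 0 \<longrightarrow> I t)) \<and> Q s t" by blast
  qed
  then obtain f where f: "\<And>n. H (f n)" "I (f 0)" "\<And>n. Q (f n) (f (Suc n))" by blast
  define K where "K = (\<lambda>n. fst (f n))"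
  define e where "e = (\<lambda>n. snd (snd (f n)))"
  have K1: "fst (snd (f n)) = K (Suc n)" for n using f(3)[of n] by (simp add: Q_def K_def)
  have K0: "K 0 = 1" using f(2) by (simp add: I_def K_def)
  have e: "e n \<in> mod_hom R (free_mod R (K (Suc n))) (free_mod R (K n))" for n
    using f(1)[of n] K1[of n] by (simp add: H_def e_def K_def)
  have im0: "e 0 ` carrier (free_mod R (K 1)) = {v \<in> carrier (free_mod R 1). aug v = \<zero>\<^bsub>?N\<^esub>}"
    using f(2) K1[of 0] by (simp add: I_def e_def)
  have im: "e (Suc n) ` carrier (free_mod R (K (Suc (Suc n)))) =
      {v \<in> carrier (free_mod R (K (Suc n))). e n v = (\<lambda>_. \<zero>\<^bsub>R\<^esub>)}" for n
    using f(3)[of n] K1[of n] K1[of "Suc n"] by (simp add: Q_def e_def ker_def)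
  define k where "k = (\<lambda>i :: int. if i < 0 then 0 else K (nat i))"
  define P where "P = \<lparr>cx_mod = (\<lambda>i. free_mod R (k i)),
     cx_diff = (\<lambda>i. if i \<le> 0 then (\<lambda>_ _. \<zero>\<^bsub>R\<^esub>) else e (nat (i - 1)))\<rparr>"
  have Pm: "cx_mod P i = free_mod R (k i)" for i by (simp add: P_def)
  have Pd: "cx_diff P (int (Suc n)) = e n" for n by (simp add: P_def)
  have kn: "k (int n) = K n" for n by (simp add: k_def)
  have Pd0: "cx_diff P i = (\<lambda>_ _. \<zero>\<^bsub>R\<^esub>)" if "i \<le> 0" for i using that by (simp add: P_def)
  have k0: "k i = 0" if "i < 0" for i using that by (simp add: k_def)
  have pos: "\<exists>n. i = int (Suc n)" if "i > 0" for i :: int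
    using that by (intro exI[of _ "nat (i - 1)"]) simp
  have Pc: "chain_complex R P"
    unfolding chain_complex_def
  proof (intro conjI allI ballI)
    fix i
    show "module R (cx_mod P i)" using mF by (simp add: Pm)
    show "cx_diff P i \<in> mod_hom R (cx_mod P i) (cx_mod P (i - 1))"
    proof (cases "i > 0")
      case True
      then obtain n where n: "i = int (Suc n)" using pos by blast
      hence i: "i - 1 = int n" by simp
      show ?thesis unfolding Pm i unfolding n kn Pd by (rule e)
    next
      case False
      thus ?thesis by (auto simp: Pd0 Pm intro!: mod_homI)
    qed
    fix x assume x: "x \<in> carrier (cx_mod P i)"
    show "cx_diff P (i - 1) (cx_diff P i x) = \<zero>\<^bsub>cx_mod P (i - 1 - 1)\<^esub>"
    proof (cases "i - 1 > 0")
      case True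
      then obtain n where n: "i - 1 = int (Suc n)" using pos by blast
      hence i: "i = int (Suc (Suc n))" by simp
      have "e (Suc n) x \<in> e (Suc n) ` carrier (free_mod R (K (Suc (Suc n))))"
        using x unfolding Pm i kn by (rule imageI)
      hence "e n (e (Suc n) x) = (\<lambda>_. \<zero>\<^bsub>R\<^esub>)" unfolding im by simp
      thus ?thesis unfolding n Pd unfolding i Pd Pm by simp
    next
      case False
      thus ?thesis by (simp add: Pd0 Pm)
    qed
  qed
  define \<phi> where "\<phi> = (\<lambda>i :: int. if i = 0 then aug else (\<lambda>_. undefined))"
  have sc: "chain_complex R (stalk ?N)" by (rule stalk_chain_complex[OF mN])
  have P0: "cx_mod P 0 = free_mod R 1" using Pm[of 0] kn[of 0] K0 by simp
  have "chain_map R P (stalk ?N) \<phi>"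
    unfolding chain_map_def
  proof (intro conjI allI ballI Pc sc)
    fix i
    show "\<phi> i \<in> mod_hom R (cx_mod P i) (cx_mod (stalk ?N) i)"
      using aug P0 by (auto simp: \<phi>_def intro: mod_homI)
    fix x assume x: "x \<in> carrier (cx_mod P i)"
    show "\<phi> (i - 1) (cx_diff P i x) = cx_diff (stalk ?N) i (\<phi> i x)"
    proof (cases "i = 1")
      case True
      have "e 0 x \<in> e 0 ` carrier (free_mod R (K 1))"
        using x Pm[of 1] kn[of 1] True by simp
      hence "aug (e 0 x) = \<zero>\<^bsub>?N\<^esub>" unfolding im0 by simp
      thus ?thesis using True Pd[of 0] by (simp add: \<phi>_def)
    qed (simp add: \<phi>_def)
  qed
  hence "quasi_iso R P (stalk ?N) \<phi>"
  proof (rule quasi_isoI)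
    fix i z assume z: "z \<in> cycles P i" and phz: "\<phi> i z \<in> boundaries (stalk ?N) i"
    consider "i < 0" | "i = 0" | "i > 0" by linarith
    thus "z \<in> boundaries P i"
    proof cases
      case 1
      hence "z = \<zero>\<^bsub>cx_mod P i\<^esub>" using cycles_closed[OF z] k0[OF 1] by (auto simp: Pm)
      thus ?thesis using submodule_zero[OF chain_complexD(1)[OF Pc] boundaries_submodule[OF Pc]] by simp
    next
      case 2
      have "aug z = \<zero>\<^bsub>?N\<^esub>" using phz 2 by (auto simp: boundaries_def \<phi>_def)
      hence "z \<in> e 0 ` carrier (free_mod R (K 1))" unfolding im0 using cycles_closed[OF z] 2 P0 by simp
      thus ?thesis using 2 Pd[of 0] Pm[of 1] kn[of 1] by (simp add: boundaries_def)
    next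
      case 3
      then obtain n where n: "i = int (Suc n)" using pos by blast
      hence i: "i + 1 = int (Suc (Suc n))" by simp
      have "z \<in> {v \<in> carrier (free_mod R (K (Suc n))). e n v = (\<lambda>_. \<zero>\<^bsub>R\<^esub>)}"
        using z unfolding cycles_def n kn Pd Pm by simp
      thus ?thesis unfolding im[symmetric] boundaries_def i Pm Pd kn .
    qed
  next
    fix i y assume y: "y \<in> cycles (stalk ?N) i"
    show "\<exists>z\<in>cycles P i. \<phi> i z \<ominus>\<^bsub>cx_mod (stalk ?N) i\<^esub> y \<in> boundaries (stalk ?N) i"
    proof (cases "i = 0")
      case True
      from cycles_closed[OF y] True obtain a where a: "a \<in> carrier R" "y = p +>\<^bsub>self_mod R\<^esub> a"
        by (auto simp: quot_mod_carrier)
      define v where "v = (\<lambda>i. if i = (0::nat) then a else \<zero>\<^bsub>R\<^esub>)"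
      have v: "v \<in> carrier (free_mod R 1)" using a(1) by (auto simp: v_def)
      have y': "y \<in> carrier ?N" using cycles_closed[OF y] True by simp
      have "v \<in> cycles P i" using v True P0 by (simp add: cycles_def Pd0 Pm)
      moreover have "\<phi> i v = y" using True a by (simp add: \<phi>_def aug_def v_def)
      moreover have "y \<ominus>\<^bsub>cx_mod (stalk ?N) i\<^esub> y = \<zero>\<^bsub>cx_mod (stalk ?N) i\<^esub>"
        using module_diff_zero_iff[OF mN y' y'] True by simp
      ultimately show ?thesis
        using submodule_zero[OF chain_complexD(1)[OF sc] boundaries_submodule[OF sc], of i] by metis
    next
      case False
      have "\<zero>\<^bsub>cx_mod P i\<^esub> \<in> cycles P i"
        by (rule submodule_zero[OF chain_complexD(1)[OF Pc] cycles_submodule[OF Pc]])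
      moreover have "\<phi> i \<zero>\<^bsub>cx_mod P i\<^esub> \<ominus>\<^bsub>cx_mod (stalk ?N) i\<^esub> y = \<zero>\<^bsub>cx_mod (stalk ?N) i\<^esub>"
        using False by (simp add: a_minus_def)
      ultimately show ?thesis
        using submodule_zero[OF chain_complexD(1)[OF sc] boundaries_submodule[OF sc], of i] by metis
    qed
  qed
  moreover have "\<exists>k :: int \<Rightarrow> nat. (\<forall>i<0. k i = 0) \<and> (\<forall>i. cx_mod P i = free_mod R (k i))"
    using k0 Pm by blast
  ultimately show ?thesis unfolding free_resolution_def by blast
qed

section \<open>The Hom complex\<close>

lemma hom_cx_mem_iff:
  "f \<in> carrier (cx_mod (hom_cx R X Y) n) \<longleftrightarrow>
    (\<forall>i. f i \<in> mod_hom R (cx_mod X i) (cx_mod Y (i + n)) \<and> f i \<in> extensional (carrier (cx_mod X i)))"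
  by (auto simp: hom_cx_def)

lemma hom_cx_ops:
  "\<zero>\<^bsub>cx_mod (hom_cx R X Y) n\<^esub> = (\<lambda>i. \<lambda>x\<in>carrier (cx_mod X i). \<zero>\<^bsub>cx_mod Y (i + n)\<^esub>)"
  "f \<oplus>\<^bsub>cx_mod (hom_cx R X Y) n\<^esub> g = (\<lambda>i. \<lambda>x\<in>carrier (cx_mod X i). f i x \<oplus>\<^bsub>cx_mod Y (i + n)\<^esub> g i x)"
  "r \<odot>\<^bsub>cx_mod (hom_cx R X Y) n\<^esub> f = (\<lambda>i. \<lambda>x\<in>carrier (cx_mod X i). r \<odot>\<^bsub>cx_mod Y (i + n)\<^esub> f i x)"
  by (auto simp: hom_cx_def)

lemma hom_cx_eqI:
  assumes "f \<in> carrier (cx_mod (hom_cx R X Y) n)" "g \<in> carrier (cx_mod (hom_cx R X Y) n)"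
    and "\<And>i x. x \<in> carrier (cx_mod X i) \<Longrightarrow> f i x = g i x"
  shows "f = g"
proof
  fix i
  show "f i = g i"
    by (rule extensionalityI[of _ "carrier (cx_mod X i)"])
      (use assms in \<open>auto simp: hom_cx_mem_iff\<close>)
qed

lemma mod_hom_restrict:
  assumes "module R M" "f \<in> mod_hom R M N"
  shows "restrict f (carrier M) \<in> mod_hom R M N"
proof -
  interpret module R M by fact
  show ?thesis using assms(2) by (auto simp: mod_hom_def)
qed

lemma mod_hom_zero_map:
  assumes "module R M" "module R N"
  shows "(\<lambda>_. \<zero>\<^bsub>N\<^esub>) \<in> mod_hom R M N"
proof -
  interpret N: module R N by fact
  show ?thesis by (rule mod_homI) auto
qed

lemma hom_cx_memI:
  assumes "chain_complex R X" "\<And>i. f i \<in> mod_hom R (cx_mod X i) (cx_mod Y (i + n))"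
  shows "(\<lambda>i. restrict (f i) (carrier (cx_mod X i))) \<in> carrier (cx_mod (hom_cx R X Y) n)"
  unfolding hom_cx_mem_iff
  using mod_hom_restrict[OF chain_complexD(1)[OF assms(1)] assms(2)] by auto

lemma hom_cx_module:
  assumes "chain_complex R X" "chain_complex R Y"
  shows "module R (cx_mod (hom_cx R X Y) n)" (is "module R ?H")
proof -
  note mX = chain_complexD(1)[OF assms(1)] and mY = chain_complexD(1)[OF assms(2)]
  have R: "cring R" by (rule module_cring[OF mX])
  interpret R: cring R by fact
  have hom: "f i \<in> mod_hom R (cx_mod X i) (cx_mod Y (i + n))" if "f \<in> carrier ?H" for f i
    using that by (simp add: hom_cx_mem_iff)
  have cl: "f i x \<in> carrier (cx_mod Y (i + n))" if "f \<in> carrier ?H" "x \<in> carrier (cx_mod X i)" for f i x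
    by (rule mod_hom_closed[OF hom[OF that(1)] that(2)])
  have lin: "(\<lambda>x. f i x \<oplus>\<^bsub>cx_mod Y (i + n)\<^esub> g i x) \<in> mod_hom R (cx_mod X i) (cx_mod Y (i + n))"
    if "f \<in> carrier ?H" "g \<in> carrier ?H" for f g i
  proof -
    interpret Y: module R "cx_mod Y (i + n)" by (rule mY)
    interpret X: module R "cx_mod X i" by (rule mX)
    show ?thesis
      by (rule mod_homI) (simp_all add: cl[OF that(1)] cl[OF that(2)] mod_hom_add[OF hom[OF that(1)]]
        mod_hom_add[OF hom[OF that(2)]] mod_hom_smult[OF hom[OF that(1)]] mod_hom_smult[OF hom[OF that(2)]]
        Y.M.a_ac Y.smult_r_distr)
  qed
  have addc: "f \<oplus>\<^bsub>?H\<^esub> g \<in> carrier ?H" if "f \<in> carrier ?H" "g \<in> carrier ?H" for f g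
    unfolding hom_cx_ops by (rule hom_cx_memI[OF assms(1) lin[OF that]])
  have smc: "r \<odot>\<^bsub>?H\<^esub> f \<in> carrier ?H" if "r \<in> carrier R" "f \<in> carrier ?H" for f r
    unfolding hom_cx_ops by (rule hom_cx_memI[OF assms(1) mod_hom_smult_fun[OF mX mY hom[OF that(2)] that(1)]])
  have zc: "\<zero>\<^bsub>?H\<^esub> \<in> carrier ?H"
    unfolding hom_cx_ops by (rule hom_cx_memI[OF assms(1) mod_hom_zero_map[OF mX mY]])
  have ex: "f \<oplus>\<^bsub>?H\<^esub> g \<oplus>\<^bsub>?H\<^esub> h = f \<oplus>\<^bsub>?H\<^esub> (g \<oplus>\<^bsub>?H\<^esub> h)"
    if "f \<in> carrier ?H" "g \<in> carrier ?H" "h \<in> carrier ?H" for f g h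
  proof (rule hom_cx_eqI[where R = R and Y = Y and n = n])
    fix i x assume x: "x \<in> carrier (cx_mod X i)"
    interpret Y: module R "cx_mod Y (i + n)" by (rule mY)
    show "(f \<oplus>\<^bsub>?H\<^esub> g \<oplus>\<^bsub>?H\<^esub> h) i x = (f \<oplus>\<^bsub>?H\<^esub> (g \<oplus>\<^bsub>?H\<^esub> h)) i x"
      using x by (simp add: hom_cx_ops cl[OF that(1) x] cl[OF that(2) x] cl[OF that(3) x] Y.M.a_assoc)
  qed (use that addc in auto)
  have "abelian_group ?H"
  proof (rule abelian_groupI)
    fix f assume f: "f \<in> carrier ?H"
    show "\<zero>\<^bsub>?H\<^esub> \<oplus>\<^bsub>?H\<^esub> f = f"
    proof (rule hom_cx_eqI[where R = R and Y = Y and n = n])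
      fix i x assume x: "x \<in> carrier (cx_mod X i)"
      interpret Y: module R "cx_mod Y (i + n)" by (rule mY)
      show "(\<zero>\<^bsub>?H\<^esub> \<oplus>\<^bsub>?H\<^esub> f) i x = f i x" using x by (simp add: hom_cx_ops cl[OF f x])
    qed (use f addc zc in auto)
    let ?m = "(\<ominus>\<^bsub>R\<^esub> \<one>\<^bsub>R\<^esub>) \<odot>\<^bsub>?H\<^esub> f"
    have m: "?m \<in> carrier ?H" by (rule smc[OF _ f]) simp
    have "?m \<oplus>\<^bsub>?H\<^esub> f = \<zero>\<^bsub>?H\<^esub>"
    proof (rule hom_cx_eqI[where R = R and Y = Y and n = n])
      fix i x assume x: "x \<in> carrier (cx_mod X i)"
      interpret Y: module R "cx_mod Y (i + n)" by (rule mY)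
      show "(?m \<oplus>\<^bsub>?H\<^esub> f) i x = \<zero>\<^bsub>?H\<^esub> i x"
        using x by (simp add: hom_cx_ops cl[OF f x] Y.smult_l_minus Y.M.l_neg)
    qed (use f addc zc m in auto)
    thus "\<exists>g\<in>carrier ?H. g \<oplus>\<^bsub>?H\<^esub> f = \<zero>\<^bsub>?H\<^esub>" using m by blast
  next
    fix f g assume f: "f \<in> carrier ?H" and g: "g \<in> carrier ?H"
    show "f \<oplus>\<^bsub>?H\<^esub> g = g \<oplus>\<^bsub>?H\<^esub> f"
    proof (rule hom_cx_eqI[where R = R and Y = Y and n = n])
      fix i x assume x: "x \<in> carrier (cx_mod X i)"
      interpret Y: module R "cx_mod Y (i + n)" by (rule mY)
      show "(f \<oplus>\<^bsub>?H\<^esub> g) i x = (g \<oplus>\<^bsub>?H\<^esub> f) i x"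
        using x by (simp add: hom_cx_ops cl[OF f x] cl[OF g x] Y.M.a_comm)
    qed (use f g addc in auto)
  qed (use ex addc zc in auto)
  thus ?thesis
  proof (rule moduleI[OF R])
    fix a b f assume a: "a \<in> carrier R" and b: "b \<in> carrier R" and f: "f \<in> carrier ?H"
    show "(a \<oplus>\<^bsub>R\<^esub> b) \<odot>\<^bsub>?H\<^esub> f = a \<odot>\<^bsub>?H\<^esub> f \<oplus>\<^bsub>?H\<^esub> b \<odot>\<^bsub>?H\<^esub> f"
    proof (rule hom_cx_eqI[where R = R and Y = Y and n = n])
      fix i x assume x: "x \<in> carrier (cx_mod X i)"
      interpret Y: module R "cx_mod Y (i + n)" by (rule mY)
      show "((a \<oplus>\<^bsub>R\<^esub> b) \<odot>\<^bsub>?H\<^esub> f) i x = (a \<odot>\<^bsub>?H\<^esub> f \<oplus>\<^bsub>?H\<^esub> b \<odot>\<^bsub>?H\<^esub> f) i x"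
        using x a b by (simp add: hom_cx_ops cl[OF f x] Y.smult_l_distr)
    qed (use f a b addc smc in auto)
    show "(a \<otimes>\<^bsub>R\<^esub> b) \<odot>\<^bsub>?H\<^esub> f = a \<odot>\<^bsub>?H\<^esub> (b \<odot>\<^bsub>?H\<^esub> f)"
    proof (rule hom_cx_eqI[where R = R and Y = Y and n = n])
      fix i x assume x: "x \<in> carrier (cx_mod X i)"
      interpret Y: module R "cx_mod Y (i + n)" by (rule mY)
      show "((a \<otimes>\<^bsub>R\<^esub> b) \<odot>\<^bsub>?H\<^esub> f) i x = (a \<odot>\<^bsub>?H\<^esub> (b \<odot>\<^bsub>?H\<^esub> f)) i x"
        using x a b by (simp add: hom_cx_ops cl[OF f x] Y.smult_assoc1)
    qed (use f a b addc smc in auto)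
  next
    fix a f g assume a: "a \<in> carrier R" and f: "f \<in> carrier ?H" and g: "g \<in> carrier ?H"
    show "a \<odot>\<^bsub>?H\<^esub> (f \<oplus>\<^bsub>?H\<^esub> g) = a \<odot>\<^bsub>?H\<^esub> f \<oplus>\<^bsub>?H\<^esub> a \<odot>\<^bsub>?H\<^esub> g"
    proof (rule hom_cx_eqI[where R = R and Y = Y and n = n])
      fix i x assume x: "x \<in> carrier (cx_mod X i)"
      interpret Y: module R "cx_mod Y (i + n)" by (rule mY)
      show "(a \<odot>\<^bsub>?H\<^esub> (f \<oplus>\<^bsub>?H\<^esub> g)) i x = (a \<odot>\<^bsub>?H\<^esub> f \<oplus>\<^bsub>?H\<^esub> a \<odot>\<^bsub>?H\<^esub> g) i x"
        using x a by (simp add: hom_cx_ops cl[OF f x] cl[OF g x] Y.smult_r_distr)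
    qed (use f g a addc smc in auto)
  next
    fix f assume f: "f \<in> carrier ?H"
    show "\<one>\<^bsub>R\<^esub> \<odot>\<^bsub>?H\<^esub> f = f"
    proof (rule hom_cx_eqI[where R = R and Y = Y and n = n])
      fix i x assume x: "x \<in> carrier (cx_mod X i)"
      interpret Y: module R "cx_mod Y (i + n)" by (rule mY)
      show "(\<one>\<^bsub>R\<^esub> \<odot>\<^bsub>?H\<^esub> f) i x = f i x" using x by (simp add: hom_cx_ops cl[OF f x])
    qed (use f smc in auto)
  qed (use smc in auto)
qed

text \<open>The sign \<open>-(-1)\<^sup>n\<close> in the differential of the Hom complex.  As a scalar it commutes with all
  homomorphisms, which avoids most case distinctions on the parity of \<open>n\<close>.\<close>

definition hom_sign :: "('a, 'r) ring_scheme \<Rightarrow> int \<Rightarrow> 'a" where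
  "hom_sign R n = (if even n then \<ominus>\<^bsub>R\<^esub> \<one>\<^bsub>R\<^esub> else \<one>\<^bsub>R\<^esub>)"

lemma hom_sign_closed: "cring R \<Longrightarrow> hom_sign R n \<in> carrier R"
  by (simp add: hom_sign_def cring.cring_simprules)

lemma hom_sign_alternate:
  assumes "module R Y" "y \<in> carrier Y"
  shows "hom_sign R n \<odot>\<^bsub>Y\<^esub> y \<oplus>\<^bsub>Y\<^esub> hom_sign R (n - 1) \<odot>\<^bsub>Y\<^esub> y = \<zero>\<^bsub>Y\<^esub>"
    "hom_sign R (n + 1) \<odot>\<^bsub>Y\<^esub> y \<oplus>\<^bsub>Y\<^esub> hom_sign R n \<odot>\<^bsub>Y\<^esub> y = \<zero>\<^bsub>Y\<^esub>"
proof -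
  interpret module R Y by fact
  show "hom_sign R n \<odot>\<^bsub>Y\<^esub> y \<oplus>\<^bsub>Y\<^esub> hom_sign R (n - 1) \<odot>\<^bsub>Y\<^esub> y = \<zero>\<^bsub>Y\<^esub>"
    "hom_sign R (n + 1) \<odot>\<^bsub>Y\<^esub> y \<oplus>\<^bsub>Y\<^esub> hom_sign R n \<odot>\<^bsub>Y\<^esub> y = \<zero>\<^bsub>Y\<^esub>"
    using assms(2) by (auto simp: hom_sign_def smult_l_minus M.l_neg M.r_neg)
qed

lemma hom_sign_square:
  assumes "module R Y" "y \<in> carrier Y"
  shows "hom_sign R n \<odot>\<^bsub>Y\<^esub> (hom_sign R n \<odot>\<^bsub>Y\<^esub> y) = y"
proof -
  interpret module R Y by fact
  show ?thesis using assms(2) by (auto simp: hom_sign_def smult_l_minus smult_r_minus)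
qed

lemma hom_cx_component:
  assumes "f \<in> carrier (cx_mod (hom_cx R X Y) n)"
  shows "f i \<in> mod_hom R (cx_mod X i) (cx_mod Y (i + n))"
    "f (i - 1) \<in> mod_hom R (cx_mod X (i - 1)) (cx_mod Y (i + n - 1))"
proof -
  show *: "f i \<in> mod_hom R (cx_mod X i) (cx_mod Y (i + n))" for i
    using assms by (simp add: hom_cx_mem_iff)
  have e: "i - 1 + n = i + n - 1" by simp
  show "f (i - 1) \<in> mod_hom R (cx_mod X (i - 1)) (cx_mod Y (i + n - 1))"
    using *[of "i - 1"] unfolding e .
qed

lemma hom_cx_diff_apply:
  assumes "chain_complex R X" "chain_complex R Y" "f \<in> carrier (cx_mod (hom_cx R X Y) n)"
    "x \<in> carrier (cx_mod X i)"
  shows "cx_diff (hom_cx R X Y) n f i x = cx_diff Y (i + n) (f i x) \<oplus>\<^bsub>cx_mod Y (i + n - 1)\<^esub>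
    hom_sign R n \<odot>\<^bsub>cx_mod Y (i + n - 1)\<^esub> f (i - 1) (cx_diff X i x)"
proof -
  interpret Y: module R "cx_mod Y (i + n - 1)" by (rule chain_complexD(1)[OF assms(2)])
  have 1: "cx_diff Y (i + n) (f i x) \<in> carrier (cx_mod Y (i + n - 1))"
    by (rule mod_hom_closed[OF chain_complexD(2)[OF assms(2)]
        mod_hom_closed[OF hom_cx_component(1)[OF assms(3)] assms(4)]])
  have 2: "f (i - 1) (cx_diff X i x) \<in> carrier (cx_mod Y (i + n - 1))"
    by (rule mod_hom_closed[OF hom_cx_component(2)[OF assms(3)]
        mod_hom_closed[OF chain_complexD(2)[OF assms(1)] assms(4)]])
  show ?thesis using assms(4) 1 2
    by (simp add: hom_cx_def hom_sign_def Y.smult_l_minus Y.M.minus_eq)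
qed

lemma hom_cx_diff_closed:
  assumes "chain_complex R X" "chain_complex R Y" "f \<in> carrier (cx_mod (hom_cx R X Y) n)"
  shows "cx_diff (hom_cx R X Y) n f \<in> carrier (cx_mod (hom_cx R X Y) (n - 1))"
proof -
  have R: "cring R" by (rule module_cring[OF chain_complexD(1)[OF assms(1)]])
  define g where "g = (\<lambda>i x. cx_diff Y (i + n) (f i x) \<oplus>\<^bsub>cx_mod Y (i + n - 1)\<^esub>
    hom_sign R n \<odot>\<^bsub>cx_mod Y (i + n - 1)\<^esub> f (i - 1) (cx_diff X i x))"
  have "g i \<in> mod_hom R (cx_mod X i) (cx_mod Y (i + n - 1))" for i
    unfolding g_def
    by (rule mod_hom_add_scaled[OF chain_complexD(1)[OF assms(1)] chain_complexD(1)[OF assms(2)]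
        mod_hom_comp[OF hom_cx_component(1)[OF assms(3)] chain_complexD(2)[OF assms(2)]]
        mod_hom_comp[OF chain_complexD(2)[OF assms(1)] hom_cx_component(2)[OF assms(3)]]
        hom_sign_closed[OF R]])
  moreover have "i + n - 1 = i + (n - 1)" for i by simp
  ultimately have "g i \<in> mod_hom R (cx_mod X i) (cx_mod Y (i + (n - 1)))" for i by metis
  from hom_cx_memI[OF assms(1) this]
  have "(\<lambda>i. restrict (g i) (carrier (cx_mod X i))) \<in> carrier (cx_mod (hom_cx R X Y) (n - 1))" .
  moreover have "cx_diff (hom_cx R X Y) n f = (\<lambda>i. restrict (g i) (carrier (cx_mod X i)))"
  proof (intro ext)
    fix i x
    show "cx_diff (hom_cx R X Y) n f i x = restrict (g i) (carrier (cx_mod X i)) x"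
    proof (cases "x \<in> carrier (cx_mod X i)")
      case True
      thus ?thesis using hom_cx_diff_apply[OF assms True] by (simp add: g_def)
    next
      case False
      thus ?thesis by (simp add: hom_cx_def)
    qed
  qed
  ultimately show ?thesis by simp
qed

text \<open>In \<open>d (d f)\<close> the terms with \<open>d d\<close> vanish, and the two mixed terms carry opposite signs.\<close>

lemma hom_cx_chain_complex:
  assumes "chain_complex R X" "chain_complex R Y"
  shows "chain_complex R (hom_cx R X Y)"
  unfolding chain_complex_def
proof (intro conjI allI ballI)
  let ?H = "hom_cx R X Y"
  note mX = chain_complexD(1)[OF assms(1)] and mY = chain_complexD(1)[OF assms(2)]
  note dX = chain_complexD(2)[OF assms(1)] and dY = chain_complexD(2)[OF assms(2)]
  note dc = hom_cx_diff_closed[OF assms] and da = hom_cx_diff_apply[OF assms]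
  note mH = hom_cx_module[OF assms]
  note comp = hom_cx_component
  have R: "cring R" by (rule module_cring[OF mX])
  interpret R: cring R by (rule R)
  note s = hom_sign_closed[OF R]
  fix n
  show "module R (cx_mod ?H n)" by (rule mH)
  have e: "i + (n - 1) = i + n - 1" for i :: int by simp
  show "cx_diff ?H n \<in> mod_hom R (cx_mod ?H n) (cx_mod ?H (n - 1))"
  proof (rule mod_homI)
    show "cx_diff ?H n f \<in> carrier (cx_mod ?H (n - 1))" if "f \<in> carrier (cx_mod ?H n)" for f
      by (rule dc[OF that])
  next
    fix f g assume f: "f \<in> carrier (cx_mod ?H n)" and g: "g \<in> carrier (cx_mod ?H n)"
    interpret H: module R "cx_mod ?H n" by (rule mH)
    interpret H': module R "cx_mod ?H (n - 1)" by (rule mH)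
    show "cx_diff ?H n (f \<oplus>\<^bsub>cx_mod ?H n\<^esub> g) = cx_diff ?H n f \<oplus>\<^bsub>cx_mod ?H (n - 1)\<^esub> cx_diff ?H n g"
    proof (rule hom_cx_eqI[where R = R and Y = Y and n = "n - 1"])
      fix i x assume x: "x \<in> carrier (cx_mod X i)"
      interpret Y: module R "cx_mod Y (i + n - 1)" by (rule mY)
      have dx: "cx_diff X i x \<in> carrier (cx_mod X (i - 1))" by (rule mod_hom_closed[OF dX x])
      have c: "f i x \<in> carrier (cx_mod Y (i + n))" "g i x \<in> carrier (cx_mod Y (i + n))"
        using mod_hom_closed[OF comp(1)[OF f] x] mod_hom_closed[OF comp(1)[OF g] x] by auto
      have c': "f (i - 1) (cx_diff X i x) \<in> carrier (cx_mod Y (i + n - 1))"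
         "g (i - 1) (cx_diff X i x) \<in> carrier (cx_mod Y (i + n - 1))"
        using mod_hom_closed[OF comp(2)[OF f] dx] mod_hom_closed[OF comp(2)[OF g] dx] by auto
      note c'' = mod_hom_closed[OF dY c(1)] mod_hom_closed[OF dY c(2)]
      have fg: "f \<oplus>\<^bsub>cx_mod ?H n\<^esub> g \<in> carrier (cx_mod ?H n)" using f g by simp
      have 1: "(f \<oplus>\<^bsub>cx_mod ?H n\<^esub> g) i x = f i x \<oplus>\<^bsub>cx_mod Y (i + n)\<^esub> g i x"
        using x by (simp add: hom_cx_ops)
      have e': "i - 1 + n = i + n - 1" by simp
      have 2: "(f \<oplus>\<^bsub>cx_mod ?H n\<^esub> g) (i - 1) (cx_diff X i x) =
          f (i - 1) (cx_diff X i x) \<oplus>\<^bsub>cx_mod Y (i + n - 1)\<^esub> g (i - 1) (cx_diff X i x)"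
        using dx by (simp add: hom_cx_ops e')
      have 3: "(cx_diff ?H n f \<oplus>\<^bsub>cx_mod ?H (n - 1)\<^esub> cx_diff ?H n g) i x =
          cx_diff ?H n f i x \<oplus>\<^bsub>cx_mod Y (i + n - 1)\<^esub> cx_diff ?H n g i x"
        using x by (simp add: hom_cx_ops e)
      show "cx_diff ?H n (f \<oplus>\<^bsub>cx_mod ?H n\<^esub> g) i x = (cx_diff ?H n f \<oplus>\<^bsub>cx_mod ?H (n - 1)\<^esub> cx_diff ?H n g) i x"
        unfolding da[OF fg x] 3 da[OF f x] da[OF g x] 1 2 mod_hom_add[OF dY c]
        using c' c'' s by (simp add: Y.smult_r_distr Y.M.a_ac)
    qed (use f g dc in auto)
  next
    fix r f assume r: "r \<in> carrier R" and f: "f \<in> carrier (cx_mod ?H n)"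
    interpret H: module R "cx_mod ?H n" by (rule mH)
    interpret H': module R "cx_mod ?H (n - 1)" by (rule mH)
    show "cx_diff ?H n (r \<odot>\<^bsub>cx_mod ?H n\<^esub> f) = r \<odot>\<^bsub>cx_mod ?H (n - 1)\<^esub> cx_diff ?H n f"
    proof (rule hom_cx_eqI[where R = R and Y = Y and n = "n - 1"])
      fix i x assume x: "x \<in> carrier (cx_mod X i)"
      interpret Y: module R "cx_mod Y (i + n - 1)" by (rule mY)
      have dx: "cx_diff X i x \<in> carrier (cx_mod X (i - 1))" by (rule mod_hom_closed[OF dX x])
      have c: "f i x \<in> carrier (cx_mod Y (i + n))" by (rule mod_hom_closed[OF comp(1)[OF f] x])
      have c': "f (i - 1) (cx_diff X i x) \<in> carrier (cx_mod Y (i + n - 1))"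
        by (rule mod_hom_closed[OF comp(2)[OF f] dx])
      note c'' = mod_hom_closed[OF dY c]
      have rf: "r \<odot>\<^bsub>cx_mod ?H n\<^esub> f \<in> carrier (cx_mod ?H n)" using f r by simp
      have 1: "(r \<odot>\<^bsub>cx_mod ?H n\<^esub> f) i x = r \<odot>\<^bsub>cx_mod Y (i + n)\<^esub> f i x"
        using x by (simp add: hom_cx_ops)
      have e': "i - 1 + n = i + n - 1" by simp
      have 2: "(r \<odot>\<^bsub>cx_mod ?H n\<^esub> f) (i - 1) (cx_diff X i x) =
          r \<odot>\<^bsub>cx_mod Y (i + n - 1)\<^esub> f (i - 1) (cx_diff X i x)"
        using dx by (simp add: hom_cx_ops e')
      have 3: "(r \<odot>\<^bsub>cx_mod ?H (n - 1)\<^esub> cx_diff ?H n f) i x = r \<odot>\<^bsub>cx_mod Y (i + n - 1)\<^esub> cx_diff ?H n f i x"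
        using x by (simp add: hom_cx_ops e)
      show "cx_diff ?H n (r \<odot>\<^bsub>cx_mod ?H n\<^esub> f) i x = (r \<odot>\<^bsub>cx_mod ?H (n - 1)\<^esub> cx_diff ?H n f) i x"
        unfolding da[OF rf x] 3 da[OF f x] 1 2 mod_hom_smult[OF dY r c]
        using c' c'' s r by (simp add: Y.smult_r_distr Y.smult_assoc1[symmetric] R.m_comm)
    qed (use f r dc in auto)
  qed
  fix f assume f: "f \<in> carrier (cx_mod ?H n)"
  let ?g = "cx_diff ?H n f"
  have g: "?g \<in> carrier (cx_mod ?H (n - 1))" by (rule dc[OF f])
  interpret H: module R "cx_mod ?H (n - 1 - 1)" by (rule mH)
  show "cx_diff ?H (n - 1) ?g = \<zero>\<^bsub>cx_mod ?H (n - 1 - 1)\<^esub>"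
  proof (rule hom_cx_eqI[where R = R and Y = Y and n = "n - 1 - 1"])
    fix i x assume x: "x \<in> carrier (cx_mod X i)"
    interpret Y: module R "cx_mod Y (i + n - 1 - 1)" by (rule mY)
    have dx: "cx_diff X i x \<in> carrier (cx_mod X (i - 1))" by (rule mod_hom_closed[OF dX x])
    have ddx: "cx_diff X (i - 1) (cx_diff X i x) = \<zero>\<^bsub>cx_mod X (i - 1 - 1)\<^esub>"
      by (rule chain_complexD(3)[OF assms(1) x])
    have c: "f i x \<in> carrier (cx_mod Y (i + n))" by (rule mod_hom_closed[OF comp(1)[OF f] x])
    have c': "f (i - 1) (cx_diff X i x) \<in> carrier (cx_mod Y (i + n - 1))"
      by (rule mod_hom_closed[OF comp(2)[OF f] dx])
    note c'' = mod_hom_closed[OF dY c] and c3 = mod_hom_closed[OF dY c']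
    interpret Y': module R "cx_mod Y (i + n - 1)" by (rule mY)
    have ei: "i + (n - 1) - 1 = i + n - 1 - 1" "i - 1 + n = i + n - 1" "i + (n - 1 - 1) = i + n - 1 - 1"
      "i - 1 + n - 1 = i + n - 1 - 1" by simp_all
    have f0: "f (i - 1 - 1) \<zero>\<^bsub>cx_mod X (i - 1 - 1)\<^esub> = \<zero>\<^bsub>cx_mod Y (i + n - 1 - 1)\<^esub>"
      using mod_hom_zero[OF mX mY comp(2)[OF f, of "i - 1"]] unfolding ei .
    have 1: "?g i x = cx_diff Y (i + n) (f i x) \<oplus>\<^bsub>cx_mod Y (i + n - 1)\<^esub>
      hom_sign R n \<odot>\<^bsub>cx_mod Y (i + n - 1)\<^esub> f (i - 1) (cx_diff X i x)" by (rule da[OF f x])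
    have 2: "?g (i - 1) (cx_diff X i x) = cx_diff Y (i + n - 1) (f (i - 1) (cx_diff X i x))"
      unfolding da[OF f dx] ei ddx f0 by (simp only: Y.smult_r_null[OF s] Y.M.r_zero[OF c3])
    have 3: "cx_diff Y (i + n - 1) (?g i x) =
        hom_sign R n \<odot>\<^bsub>cx_mod Y (i + n - 1 - 1)\<^esub> cx_diff Y (i + n - 1) (f (i - 1) (cx_diff X i x))"
      unfolding 1 mod_hom_add[OF dY c'' Y'.smult_closed[OF s c']] mod_hom_smult[OF dY s c']
        chain_complexD(3)[OF assms(2) c] by (rule Y.M.l_zero[OF Y.smult_closed[OF s c3]])
    have "cx_diff ?H (n - 1) ?g i x = hom_sign R n \<odot>\<^bsub>cx_mod Y (i + n - 1 - 1)\<^esub> cx_diff Y (i + n - 1) (f (i - 1) (cx_diff X i x))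
       \<oplus>\<^bsub>cx_mod Y (i + n - 1 - 1)\<^esub> hom_sign R (n - 1) \<odot>\<^bsub>cx_mod Y (i + n - 1 - 1)\<^esub> cx_diff Y (i + n - 1) (f (i - 1) (cx_diff X i x))"
      unfolding da[OF g x] ei(1) e 2 3 ..
    also have "\<dots> = \<zero>\<^bsub>cx_mod Y (i + n - 1 - 1)\<^esub>" by (rule hom_sign_alternate(1)[OF mY c3])
    finally show "cx_diff ?H (n - 1) ?g i x = \<zero>\<^bsub>cx_mod ?H (n - 1 - 1)\<^esub> i x"
      unfolding hom_cx_ops ei(3) restrict_apply'[OF x] .
  qed (rule dc[OF g] H.M.zero_closed)+
qed

section \<open>Lifting along free complexes\<close>

text \<open>A family \<open>g\<^sub>j: A\<^sub>j \<rightarrow> D\<^sub>j\<^sub>+\<^sub>1\<close> with \<open>\<delta> g\<^sub>j\<^sub>+\<^sub>1 = q\<^sub>j\<^sub>+\<^sub>1 + \<sigma> g\<^sub>j \<alpha>\<close> is built step by step: the compatibility of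
  the \<open>q\<^sub>j\<close> makes the right-hand side a cycle, and it lifts since \<open>D\<close> is exact there and \<open>A\<^sub>j\<^sub>+\<^sub>1\<close>
  is free.  With \<open>q\<close> a cycle of the Hom complex this bounds \<open>q\<close>; with \<open>q = 0\<close> it extends \<open>g\<^sub>0\<close> to a chain
  map.\<close>

lemma ladder_lift:
  fixes D :: "nat \<Rightarrow> ('a, 'c) module"
  assumes R: "cring R" and mD: "\<And>j. module R (D j)"
    and A: "\<And>j. A j = free_mod R (k j)"
    and \<alpha>: "\<And>j. \<alpha> j \<in> mod_hom R (A (Suc j)) (A j)"
    and \<alpha>\<alpha>: "\<And>j x. x \<in> carrier (A (Suc (Suc j))) \<Longrightarrow> \<alpha> j (\<alpha> (Suc j) x) = \<zero>\<^bsub>A j\<^esub>"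
    and \<delta>: "\<And>j. \<delta> j \<in> mod_hom R (D (Suc j)) (D j)"
    and q: "\<And>j. q j \<in> mod_hom R (A j) (D j)"
    and \<sigma>: "\<sigma> \<in> carrier R"
    and cyc: "\<And>j x. x \<in> carrier (A (Suc (Suc j))) \<Longrightarrow>
      \<delta> (Suc j) (q (Suc (Suc j)) x) \<oplus>\<^bsub>D (Suc j)\<^esub> \<sigma> \<odot>\<^bsub>D (Suc j)\<^esub> q (Suc j) (\<alpha> (Suc j) x) = \<zero>\<^bsub>D (Suc j)\<^esub>"
    and exact: "\<And>j x. x \<in> carrier (D (Suc (Suc j))) \<Longrightarrow> \<delta> (Suc j) x = \<zero>\<^bsub>D (Suc j)\<^esub> \<Longrightarrow>
      x \<in> \<delta> (Suc (Suc j)) ` carrier (D (Suc (Suc (Suc j))))"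
    and g0: "g0 \<in> mod_hom R (A 0) (D (Suc 0))"
    and start: "\<And>x. x \<in> carrier (A (Suc 0)) \<Longrightarrow>
      q (Suc 0) x \<oplus>\<^bsub>D (Suc 0)\<^esub> \<sigma> \<odot>\<^bsub>D (Suc 0)\<^esub> g0 (\<alpha> 0 x) \<in> \<delta> (Suc 0) ` carrier (D (Suc (Suc 0)))"
  shows "\<exists>g. g 0 = g0 \<and> (\<forall>j. g j \<in> mod_hom R (A j) (D (Suc j))) \<and>
    (\<forall>j. \<forall>x\<in>carrier (A (Suc j)). \<delta> (Suc j) (g (Suc j) x) =
      q (Suc j) x \<oplus>\<^bsub>D (Suc j)\<^esub> \<sigma> \<odot>\<^bsub>D (Suc j)\<^esub> g j (\<alpha> j x))"
proof -
  have mA: "module R (A j)" for j unfolding A by (rule free_mod_module[OF R])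
  define P where "P = (\<lambda>j g. g \<in> mod_hom R (A j) (D (Suc j)) \<and> (\<forall>x\<in>carrier (A (Suc j)).
      q (Suc j) x \<oplus>\<^bsub>D (Suc j)\<^esub> \<sigma> \<odot>\<^bsub>D (Suc j)\<^esub> g (\<alpha> j x) \<in> \<delta> (Suc j) ` carrier (D (Suc (Suc j)))) \<and>
      (j = 0 \<longrightarrow> g = g0))"
  define Q where "Q = (\<lambda>j g g'. \<forall>x\<in>carrier (A (Suc j)). \<delta> (Suc j) (g' x) =
      q (Suc j) x \<oplus>\<^bsub>D (Suc j)\<^esub> \<sigma> \<odot>\<^bsub>D (Suc j)\<^esub> g (\<alpha> j x))"
  have "\<exists>g. \<forall>j. P j (g j) \<and> Q j (g j) (g (Suc j))"
  proof (rule dependent_nat_choice)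
    show "\<exists>g. P 0 g" using g0 start by (auto simp: P_def)
  next
    fix g j assume Pg: "P j g"
    hence g: "g \<in> mod_hom R (A j) (D (Suc j))" by (simp add: P_def)
    let ?r = "\<lambda>x. q (Suc j) x \<oplus>\<^bsub>D (Suc j)\<^esub> \<sigma> \<odot>\<^bsub>D (Suc j)\<^esub> g (\<alpha> j x)"
    have r: "?r \<in> mod_hom R (A (Suc j)) (D (Suc j))"
      by (rule mod_hom_add_scaled[OF mA mD q mod_hom_comp[OF \<alpha> g] \<sigma>])
    have "?r x \<in> \<delta> (Suc j) ` carrier (D (Suc (Suc j)))" if "x \<in> carrier (A (Suc j))" for x
      using Pg that by (simp add: P_def)
    from free_lift[OF mD mD \<delta> r[unfolded A[of "Suc j"]] this[unfolded A[of "Suc j"]]]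
    obtain g' where g': "g' \<in> mod_hom R (A (Suc j)) (D (Suc (Suc j)))"
      "\<And>x. x \<in> carrier (A (Suc j)) \<Longrightarrow> \<delta> (Suc j) (g' x) = ?r x"
      unfolding A[of "Suc j", symmetric] by blast
    interpret D: module R "D (Suc j)" by (rule mD)
    interpret D': module R "D (Suc (Suc j))" by (rule mD)
    have "q (Suc (Suc j)) x \<oplus>\<^bsub>D (Suc (Suc j))\<^esub> \<sigma> \<odot>\<^bsub>D (Suc (Suc j))\<^esub> g' (\<alpha> (Suc j) x)
        \<in> \<delta> (Suc (Suc j)) ` carrier (D (Suc (Suc (Suc j))))" if x: "x \<in> carrier (A (Suc (Suc j)))" for x
    proof (rule exact)
      have ax: "\<alpha> (Suc j) x \<in> carrier (A (Suc j))" by (rule mod_hom_closed[OF \<alpha> x])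
      have c: "q (Suc (Suc j)) x \<in> carrier (D (Suc (Suc j)))" "g' (\<alpha> (Suc j) x) \<in> carrier (D (Suc (Suc j)))"
        "q (Suc j) (\<alpha> (Suc j) x) \<in> carrier (D (Suc j))" "\<zero>\<^bsub>D (Suc j)\<^esub> \<in> carrier (D (Suc j))"
        using mod_hom_closed[OF q x] mod_hom_closed[OF g'(1) ax] mod_hom_closed[OF q ax] by auto
      show "q (Suc (Suc j)) x \<oplus>\<^bsub>D (Suc (Suc j))\<^esub> \<sigma> \<odot>\<^bsub>D (Suc (Suc j))\<^esub> g' (\<alpha> (Suc j) x) \<in> carrier (D (Suc (Suc j)))"
        using c \<sigma> by simp
      have "g (\<alpha> j (\<alpha> (Suc j) x)) = \<zero>\<^bsub>D (Suc j)\<^esub>" unfolding \<alpha>\<alpha>[OF x] by (rule mod_hom_zero[OF mA mD g])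
      hence dg: "\<delta> (Suc j) (g' (\<alpha> (Suc j) x)) = q (Suc j) (\<alpha> (Suc j) x)"
        using g'(2)[OF ax] c \<sigma> by simp
      have "\<delta> (Suc j) (q (Suc (Suc j)) x \<oplus>\<^bsub>D (Suc (Suc j))\<^esub> \<sigma> \<odot>\<^bsub>D (Suc (Suc j))\<^esub> g' (\<alpha> (Suc j) x)) =
        \<delta> (Suc j) (q (Suc (Suc j)) x) \<oplus>\<^bsub>D (Suc j)\<^esub> \<sigma> \<odot>\<^bsub>D (Suc j)\<^esub> q (Suc j) (\<alpha> (Suc j) x)"
        using mod_hom_add[OF \<delta> c(1) D'.smult_closed[OF \<sigma> c(2)]] mod_hom_smult[OF \<delta> \<sigma> c(2)] dg by simp
      thus "\<delta> (Suc j) (q (Suc (Suc j)) x \<oplus>\<^bsub>D (Suc (Suc j))\<^esub> \<sigma> \<odot>\<^bsub>D (Suc (Suc j))\<^esub> g' (\<alpha> (Suc j) x)) = \<zero>\<^bsub>D (Suc j)\<^esub>"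
        using cyc[OF x] by simp
    qed
    hence "P (Suc j) g' \<and> Q j g g'" using g' by (simp add: P_def Q_def)
    thus "\<exists>g'. P (Suc j) g' \<and> Q j g g'" by blast
  qed
  then obtain g where g: "\<And>j. P j (g j)" "\<And>j. Q j (g j) (g (Suc j))" by blast
  show ?thesis
  proof (intro exI[of _ g] conjI allI ballI)
    show "g 0 = g0" using g(1)[of 0] by (simp add: P_def)
    show "g j \<in> mod_hom R (A j) (D (Suc j))" for j using g(1)[of j] by (simp add: P_def)
    show "\<delta> (Suc j) (g (Suc j) x) = q (Suc j) x \<oplus>\<^bsub>D (Suc j)\<^esub> \<sigma> \<odot>\<^bsub>D (Suc j)\<^esub> g j (\<alpha> j x)"
      if "x \<in> carrier (A (Suc j))" for j x using g(2)[of j] that by (simp add: Q_def)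
  qed
qed

lemma free_resolution_chain_complex:
  "free_resolution R N P \<Longrightarrow> chain_complex R P"
  by (auto simp: free_resolution_def quasi_iso_def chain_map_def)

text \<open>The component of degree \<open>0\<close> of the quasi-isomorphism onto the stalk complex, which is bijective
  on \<open>H\<^sub>0\<close>.\<close>

lemma free_resolution_augmentation:
  assumes "module R N" "free_resolution R N P"
  shows "\<exists>aug\<in>mod_hom R (cx_mod P 0) N. (\<forall>x\<in>carrier (cx_mod P 1). aug (cx_diff P 1 x) = \<zero>\<^bsub>N\<^esub>) \<and>
    (\<forall>y\<in>carrier N. \<exists>v\<in>carrier (cx_mod P 0). aug v = y)"
proof -
  obtain \<phi> where \<phi>: "quasi_iso R P (stalk N) \<phi>" using assms(2) unfolding free_resolution_def by blast
  hence cm: "chain_map R P (stalk N) \<phi>" by (simp add: quasi_iso_def)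
  have sc: "chain_complex R (stalk N)" by (rule stalk_chain_complex[OF assms(1)])
  have hom: "\<phi> i \<in> mod_hom R (cx_mod P i) (cx_mod (stalk N) i)" for i
    using cm unfolding chain_map_def by blast
  have aug: "\<phi> 0 \<in> mod_hom R (cx_mod P 0) N" using hom[of 0] by simp
  have van: "\<phi> 0 (cx_diff P 1 x) = \<zero>\<^bsub>N\<^esub>" if "x \<in> carrier (cx_mod P 1)" for x
  proof -
    have "\<phi> (1 - 1) (cx_diff P 1 x) = cx_diff (stalk N) 1 (\<phi> 1 x)"
      using cm that unfolding chain_map_def by blast
    thus ?thesis by simp
  qed
  have surj: "\<exists>v\<in>carrier (cx_mod P 0). \<phi> 0 v = y" if y: "y \<in> carrier N" for y
  proof -
    have yc: "y \<in> cycles (stalk N) 0" using y by (simp add: cycles_def)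
    have "bij_betw (homology_map (stalk N) \<phi> 0) (carrier (homology P 0)) (carrier (homology (stalk N) 0))"
      using \<phi> by (simp add: quasi_iso_def)
    moreover have "boundaries (stalk N) 0 +>\<^bsub>cx_mod (stalk N) 0\<^esub> y \<in> carrier (homology (stalk N) 0)"
      using yc unfolding homology_carrier by blast
    ultimately have "\<exists>K\<in>carrier (homology P 0). homology_map (stalk N) \<phi> 0 K = boundaries (stalk N) 0 +>\<^bsub>cx_mod (stalk N) 0\<^esub> y"
      unfolding bij_betw_def by (metis imageE)
    then obtain v where v: "v \<in> cycles P 0"
      "homology_map (stalk N) \<phi> 0 (boundaries P 0 +>\<^bsub>cx_mod P 0\<^esub> v) = boundaries (stalk N) 0 +>\<^bsub>cx_mod (stalk N) 0\<^esub> y"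
      unfolding homology_carrier by blast
    hence "\<phi> 0 v \<ominus>\<^bsub>cx_mod (stalk N) 0\<^esub> y \<in> boundaries (stalk N) 0"
      using homology_map_coset[OF cm v(1)] homology_eq_iff[OF sc chain_map_cycles[OF cm v(1)] yc] by simp
    hence "\<phi> 0 v \<ominus>\<^bsub>N\<^esub> y = \<zero>\<^bsub>N\<^esub>" by (auto simp: boundaries_def)
    hence "\<phi> 0 v = y"
      using module_diff_zero_iff[OF assms(1) mod_hom_closed[OF aug cycles_closed[OF v(1)]] y] by simp
    thus ?thesis using cycles_closed[OF v(1)] by blast
  qed
  show ?thesis by (intro bexI[OF _ aug] conjI ballI van surj)
qed

lemma free_mod_zero_rank:
  "x \<in> carrier (free_mod R 0) \<Longrightarrow> x = \<zero>\<^bsub>free_mod R 0\<^esub>"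
  by auto

lemma shifted_diff:
  assumes "chain_complex R X"
  shows "cx_diff X (int (Suc j) + n) \<in> mod_hom R (cx_mod X (int (Suc j) + n)) (cx_mod X (int j + n))"
proof -
  have e: "int (Suc j) + n - 1 = int j + n" by simp
  show ?thesis using chain_complexD(2)[OF assms, of "int (Suc j) + n"] unfolding e .
qed

lemma shifted_exact:
  assumes "cycles X (int (Suc j) + n) \<subseteq> boundaries X (int (Suc j) + n)"
    and "x \<in> carrier (cx_mod X (int (Suc j) + n))" "cx_diff X (int (Suc j) + n) x = \<zero>\<^bsub>cx_mod X (int j + n)\<^esub>"
  shows "x \<in> cx_diff X (int (Suc (Suc j)) + n) ` carrier (cx_mod X (int (Suc (Suc j)) + n))"
proof -
  have e: "int (Suc j) + n - 1 = int j + n" by simp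
  have e': "int (Suc j) + n + 1 = int (Suc (Suc j)) + n" by simp
  have "x \<in> cycles X (int (Suc j) + n)" using assms(2,3) unfolding cycles_def e by simp
  thus ?thesis using assms(1) unfolding boundaries_def e' by blast
qed

definition extend_zero :: "('a, 'b) cx \<Rightarrow> ('a, 'c) cx \<Rightarrow> int \<Rightarrow> (nat \<Rightarrow> 'b \<Rightarrow> 'c) \<Rightarrow> int \<Rightarrow> 'b \<Rightarrow> 'c" where
  "extend_zero P X m g = (\<lambda>i. restrict (if i < 0 then (\<lambda>_. \<zero>\<^bsub>cx_mod X (i + m)\<^esub>) else g (nat i)) (carrier (cx_mod P i)))"

lemma extend_zero_mem:
  assumes "chain_complex R P" "chain_complex R X" "\<And>j. g j \<in> mod_hom R (cx_mod P (int j)) (cx_mod X (int j + m))"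
  shows "extend_zero P X m g \<in> carrier (cx_mod (hom_cx R P X) m)"
  unfolding extend_zero_def
proof (rule hom_cx_memI[OF assms(1)])
  fix i
  show "(if i < 0 then \<lambda>_. \<zero>\<^bsub>cx_mod X (i + m)\<^esub> else g (nat i)) \<in> mod_hom R (cx_mod P i) (cx_mod X (i + m))"
  proof (cases "i < 0")
    case True
    thus ?thesis
      using mod_hom_zero_map[OF chain_complexD(1)[OF assms(1)] chain_complexD(1)[OF assms(2)]] by simp
  next
    case False
    then obtain j where "i = int j" by (metis nonneg_int_cases not_less)
    thus ?thesis using assms(3)[of j] by simp
  qed
qed

lemma extend_zero_nat:
  "x \<in> carrier (cx_mod P (int j)) \<Longrightarrow> extend_zero P X m g (int j) x = g j x"
  by (simp add: extend_zero_def)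

lemma hom_cx_zero_at:
  assumes "chain_complex R P" "chain_complex R X" "f \<in> carrier (cx_mod (hom_cx R P X) n)"
  shows "f i \<zero>\<^bsub>cx_mod P i\<^esub> = \<zero>\<^bsub>cx_mod X (i + n)\<^esub>"
  by (rule mod_hom_zero[OF chain_complexD(1)[OF assms(1)] chain_complexD(1)[OF assms(2)]
        hom_cx_component(1)[OF assms(3)]])

text \<open>In degree \<open>0\<close> the second summand of the differential vanishes, since \<open>P\<close> vanishes in degree \<open>-1\<close>.\<close>

lemma hom_diff_at_zero:
  assumes "chain_complex R P" "chain_complex R X" "cx_mod P (-1) = free_mod R 0"
    "f \<in> carrier (cx_mod (hom_cx R P X) n)" "x \<in> carrier (cx_mod P 0)"
  shows "cx_diff (hom_cx R P X) n f 0 x = cx_diff X n (f 0 x)"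
proof -
  interpret X: module R "cx_mod X (0 + n - 1)" by (rule chain_complexD(1)[OF assms(2)])
  have "cx_diff P 0 x \<in> carrier (cx_mod P (0 - 1))" by (rule mod_hom_closed[OF chain_complexD(2)[OF assms(1)] assms(5)])
  hence "cx_diff P 0 x = \<zero>\<^bsub>cx_mod P (0 - 1)\<^esub>" using free_mod_zero_rank[of "cx_diff P 0 x" R] assms(3) by simp
  hence 0: "f (0 - 1) (cx_diff P 0 x) = \<zero>\<^bsub>cx_mod X (0 + n - 1)\<^esub>"
    using mod_hom_zero[OF chain_complexD(1)[OF assms(1)] chain_complexD(1)[OF assms(2)] hom_cx_component(2)[OF assms(4), of 0]]
    by simp
  have c: "cx_diff X (0 + n) (f 0 x) \<in> carrier (cx_mod X (0 + n - 1))"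
    by (rule mod_hom_closed[OF chain_complexD(2)[OF assms(2)] mod_hom_closed[OF hom_cx_component(1)[OF assms(4)] assms(5)]])
  have "cx_diff (hom_cx R P X) n f 0 x = cx_diff X (0 + n) (f 0 x)"
    unfolding hom_cx_diff_apply[OF assms(1,2,4,5)] 0
    by (simp only: X.smult_r_null[OF hom_sign_closed[OF X.R.is_cring]] X.M.r_zero[OF c])
  thus ?thesis by simp
qed

lemma hom_diff_at_Suc:
  assumes "chain_complex R P" "chain_complex R X" "f \<in> carrier (cx_mod (hom_cx R P X) n)"
    "x \<in> carrier (cx_mod P (int (Suc j)))"
  shows "cx_diff (hom_cx R P X) n f (int (Suc j)) x = cx_diff X (int (Suc j) + n) (f (int (Suc j)) x)
    \<oplus>\<^bsub>cx_mod X (int j + n)\<^esub> hom_sign R n \<odot>\<^bsub>cx_mod X (int j + n)\<^esub> f (int j) (cx_diff P (int (Suc j)) x)"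
proof -
  have e: "int (Suc j) + n - 1 = int j + n" "int (Suc j) - 1 = int j" by simp_all
  show ?thesis using hom_cx_diff_apply[OF assms] unfolding e .
qed

text \<open>In negative degrees both elements consist of maps out of zero modules.\<close>

lemma hom_cx_eqI_nonneg:
  assumes "chain_complex R P" "chain_complex R X" "\<And>i. i < 0 \<Longrightarrow> cx_mod P i = free_mod R 0"
    "f \<in> carrier (cx_mod (hom_cx R P X) n)" "g \<in> carrier (cx_mod (hom_cx R P X) n)"
    "\<And>x. x \<in> carrier (cx_mod P 0) \<Longrightarrow> f 0 x = g 0 x"
    "\<And>j x. x \<in> carrier (cx_mod P (int (Suc j))) \<Longrightarrow> f (int (Suc j)) x = g (int (Suc j)) x"
  shows "f = g"
proof (rule hom_cx_eqI[OF assms(4,5)])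
  fix i x assume x: "x \<in> carrier (cx_mod P i)"
  consider "i < 0" | "i = 0" | j where "i = int (Suc j)"
  proof -
    assume a: "i < 0 \<Longrightarrow> thesis" "i = 0 \<Longrightarrow> thesis" "\<And>j. i = int (Suc j) \<Longrightarrow> thesis"
    show thesis
      by (cases i) (use a in \<open>auto simp: gr0_conv_Suc elim: nat.exhaust\<close>)
  qed
  thus "f i x = g i x"
  proof cases
    case 1
    have "x = \<zero>\<^bsub>cx_mod P i\<^esub>" using free_mod_zero_rank[of x R] x assms(3)[OF 1] by simp
    thus ?thesis using hom_cx_zero_at[OF assms(1,2,4)] hom_cx_zero_at[OF assms(1,2,5)] by simp
  qed (use assms(6,7) x in auto)
qed

text \<open>A cycle \<open>f\<close> of degree \<open>n\<close> is bounded by a homotopy \<open>h\<close>, constructed degree by degree.  It starts with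
  a lift of \<open>f\<^sub>0\<close>, whose values are cycles because \<open>P\<close> vanishes in negative degrees.\<close>

lemma hom_free_exact:
  assumes P: "chain_complex R P" and X: "chain_complex R X" and ex: "exact_cx X"
    and k0: "\<And>i. i < 0 \<Longrightarrow> k i = 0" and kP: "\<And>i. cx_mod P i = free_mod R (k i)"
  shows "exact_cx (hom_cx R P X)"
  unfolding exact_cx_def
proof (intro allI subsetI)
  let ?H = "hom_cx R P X"
  note mP = chain_complexD(1)[OF P] and mX = chain_complexD(1)[OF X]
  note H = hom_cx_chain_complex[OF P X]
  have R: "cring R" by (rule module_cring[OF mP])
  note s = hom_sign_closed[OF R]
  have P': "cx_mod P i = free_mod R 0" if "i < 0" for i using k0[OF that] kP[of i] by simp
  have exi: "cycles X i \<subseteq> boundaries X i" for i using ex by (simp add: exact_cx_def)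
  fix n f assume f: "f \<in> cycles ?H n"
  have fc: "f \<in> carrier (cx_mod ?H n)" by (rule cycles_closed[OF f])
  have f0: "cx_diff ?H n f = \<zero>\<^bsub>cx_mod ?H (n - 1)\<^esub>" using f by (simp add: cycles_def)
  have fz: "cx_diff ?H n f i x = \<zero>\<^bsub>cx_mod X (i + n - 1)\<^esub>" if "x \<in> carrier (cx_mod P i)" for i x
  proof -
    have e: "i + (n - 1) = i + n - 1" by simp
    show ?thesis unfolding f0 hom_cx_ops restrict_apply'[OF that] e ..
  qed
  define D where "D = (\<lambda>j. cx_mod X (int j + n))"
  define \<delta> where "\<delta> = (\<lambda>j. cx_diff X (int (Suc j) + n))"
  define A where "A = (\<lambda>j. cx_mod P (int j))"
  define \<alpha> where "\<alpha> = (\<lambda>j. cx_diff P (int (Suc j)))"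
  define q where "q = (\<lambda>j. f (int j))"
  have mD: "module R (D j)" for j unfolding D_def by (rule mX)
  have A: "A j = free_mod R (k (int j))" for j by (simp add: A_def kP)
  have \<alpha>: "\<alpha> j \<in> mod_hom R (A (Suc j)) (A j)" for j
    using shifted_diff[OF P, of j 0] by (simp add: \<alpha>_def A_def)
  have \<delta>: "\<delta> j \<in> mod_hom R (D (Suc j)) (D j)" for j
    unfolding \<delta>_def D_def by (rule shifted_diff[OF X])
  have q: "q j \<in> mod_hom R (A j) (D j)" for j
    unfolding q_def A_def D_def by (rule hom_cx_component(1)[OF fc])
  have \<alpha>\<alpha>: "\<alpha> j (\<alpha> (Suc j) x) = \<zero>\<^bsub>A j\<^esub>" if "x \<in> carrier (A (Suc (Suc j)))" for j x
  proof -
    have e: "int (Suc (Suc j)) - 1 = int (Suc j)" "int (Suc j) - 1 = int j" by simp_all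
    show ?thesis using chain_complexD(3)[OF P, of x "int (Suc (Suc j))"] that
      unfolding \<alpha>_def A_def e by blast
  qed
  have cyc: "\<delta> j (q (Suc j) x) \<oplus>\<^bsub>D j\<^esub> hom_sign R n \<odot>\<^bsub>D j\<^esub> q j (\<alpha> j x) = \<zero>\<^bsub>D j\<^esub>"
    if x: "x \<in> carrier (A (Suc j))" for j x
  proof -
    have e: "int (Suc j) + n - 1 = int j + n" by simp
    have x': "x \<in> carrier (cx_mod P (int (Suc j)))" using x by (simp add: A_def)
    show ?thesis using fz[OF x'] unfolding hom_diff_at_Suc[OF P X fc x'] e \<delta>_def q_def D_def \<alpha>_def .
  qed
  have exact: "x \<in> \<delta> (Suc j) ` carrier (D (Suc (Suc j)))" if "x \<in> carrier (D (Suc j))" "\<delta> j x = \<zero>\<^bsub>D j\<^esub>" for j x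
    unfolding \<delta>_def D_def
    by (rule shifted_exact[OF exi]) (use that in \<open>simp_all add: \<delta>_def D_def\<close>)
  have lift0: "q 0 v \<in> \<delta> 0 ` carrier (D (Suc 0))" if v: "v \<in> carrier (A 0)" for v
  proof -
    have v': "v \<in> carrier (cx_mod P 0)" using v by (simp add: A_def)
    have "cx_diff X n (f 0 v) = \<zero>\<^bsub>cx_mod X (n - 1)\<^esub>"
      using fz[OF v'] hom_diff_at_zero[OF P X P' fc v'] by simp
    moreover have "f 0 v \<in> carrier (cx_mod X n)" using mod_hom_closed[OF hom_cx_component(1)[OF fc] v'] by simp
    ultimately have "f 0 v \<in> boundaries X n" using exi[of n] by (auto simp: cycles_def)
    thus ?thesis by (simp add: boundaries_def \<delta>_def D_def q_def add.commute)
  qed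
  from free_lift[OF mD mD \<delta> q[of 0, unfolded A] lift0[unfolded A]]
  obtain g0 where g0: "g0 \<in> mod_hom R (A 0) (D (Suc 0))" "\<And>v. v \<in> carrier (A 0) \<Longrightarrow> \<delta> 0 (g0 v) = q 0 v"
    unfolding A[of 0, symmetric] by blast
  have start: "q (Suc 0) x \<oplus>\<^bsub>D (Suc 0)\<^esub> hom_sign R n \<odot>\<^bsub>D (Suc 0)\<^esub> g0 (\<alpha> 0 x) \<in> \<delta> (Suc 0) ` carrier (D (Suc (Suc 0)))"
    if x: "x \<in> carrier (A (Suc 0))" for x
  proof (rule exact)
    interpret D: module R "D (Suc 0)" by (rule mD)
    have c: "q (Suc 0) x \<in> carrier (D (Suc 0))" "g0 (\<alpha> 0 x) \<in> carrier (D (Suc 0))"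
      using mod_hom_closed[OF q x] mod_hom_closed[OF g0(1) mod_hom_closed[OF \<alpha> x]] by auto
    show "q (Suc 0) x \<oplus>\<^bsub>D (Suc 0)\<^esub> hom_sign R n \<odot>\<^bsub>D (Suc 0)\<^esub> g0 (\<alpha> 0 x) \<in> carrier (D (Suc 0))"
      using c s by simp
    show "\<delta> 0 (q (Suc 0) x \<oplus>\<^bsub>D (Suc 0)\<^esub> hom_sign R n \<odot>\<^bsub>D (Suc 0)\<^esub> g0 (\<alpha> 0 x)) = \<zero>\<^bsub>D 0\<^esub>"
      unfolding mod_hom_add[OF \<delta> c(1) D.smult_closed[OF s c(2)]] mod_hom_smult[OF \<delta> s c(2)]
        g0(2)[OF mod_hom_closed[OF \<alpha> x]] by (rule cyc[OF x])
  qed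
  have "\<exists>g. g 0 = g0 \<and> (\<forall>j. g j \<in> mod_hom R (A j) (D (Suc j))) \<and>
    (\<forall>j. \<forall>x\<in>carrier (A (Suc j)). \<delta> (Suc j) (g (Suc j) x) =
      q (Suc j) x \<oplus>\<^bsub>D (Suc j)\<^esub> hom_sign R n \<odot>\<^bsub>D (Suc j)\<^esub> g j (\<alpha> j x))"
    by (rule ladder_lift[OF R mD A \<alpha> \<alpha>\<alpha> \<delta> q s cyc exact g0(1) start])
  then obtain g where g: "g 0 = g0" "\<And>j. g j \<in> mod_hom R (A j) (D (Suc j))"
    "\<And>j x. x \<in> carrier (A (Suc j)) \<Longrightarrow> \<delta> (Suc j) (g (Suc j) x) =
      q (Suc j) x \<oplus>\<^bsub>D (Suc j)\<^esub> hom_sign R n \<odot>\<^bsub>D (Suc j)\<^esub> g j (\<alpha> j x)" by blast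
  let ?h = "extend_zero P X (n + 1) g"
  have eD: "D (Suc j) = cx_mod X (int j + (n + 1))" for j
  proof -
    have "int (Suc j) + n = int j + (n + 1)" by simp
    thus ?thesis by (simp only: D_def)
  qed
  have h: "?h \<in> carrier (cx_mod ?H (n + 1))"
    by (rule extend_zero_mem[OF P X]) (use g(2) in \<open>simp add: eD[symmetric] A_def\<close>)
  have dh: "cx_diff ?H (n + 1) ?h \<in> carrier (cx_mod ?H n)"
    using hom_cx_diff_closed[OF P X h] by simp
  have "cx_diff ?H (n + 1) ?h = f"
  proof (rule hom_cx_eqI_nonneg[OF P X P' dh fc])
    fix x assume x: "x \<in> carrier (cx_mod P 0)"
    have x': "x \<in> carrier (A 0)" using x by (simp add: A_def)
    have "?h 0 x = g0 x" using extend_zero_nat[of x P 0 X "n + 1" g] x g(1) by simp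
    thus "cx_diff ?H (n + 1) ?h 0 x = f 0 x"
      using hom_diff_at_zero[OF P X P' h x] g0(2)[OF x'] by (simp add: \<delta>_def q_def add.commute)
  next
    fix j x assume x: "x \<in> carrier (cx_mod P (int (Suc j)))"
    have x': "x \<in> carrier (A (Suc j))" using x by (simp add: A_def)
    interpret D: module R "D (Suc j)" by (rule mD)
    have ax: "\<alpha> j x \<in> carrier (A j)" by (rule mod_hom_closed[OF \<alpha> x'])
    have e: "int (Suc j) + (n + 1) = int (Suc (Suc j)) + n" by simp
    have 1: "?h (int (Suc j)) x = g (Suc j) x" by (rule extend_zero_nat[OF x])
    have 2: "?h (int j) (\<alpha> j x) = g j (\<alpha> j x)" by (rule extend_zero_nat) (use ax in \<open>simp add: A_def\<close>)
    have c: "q (Suc j) x \<in> carrier (D (Suc j))" "g j (\<alpha> j x) \<in> carrier (D (Suc j))"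
      using mod_hom_closed[OF q x'] mod_hom_closed[OF g(2) ax] by auto
    have "cx_diff ?H (n + 1) ?h (int (Suc j)) x = \<delta> (Suc j) (g (Suc j) x)
      \<oplus>\<^bsub>D (Suc j)\<^esub> hom_sign R (n + 1) \<odot>\<^bsub>D (Suc j)\<^esub> g j (\<alpha> j x)"
      unfolding hom_diff_at_Suc[OF P X h x] 1 e eD[symmetric] 2[unfolded \<alpha>_def] \<delta>_def \<alpha>_def ..
    also have "\<dots> = q (Suc j) x \<oplus>\<^bsub>D (Suc j)\<^esub> (hom_sign R (n + 1) \<odot>\<^bsub>D (Suc j)\<^esub> g j (\<alpha> j x) \<oplus>\<^bsub>D (Suc j)\<^esub>
        hom_sign R n \<odot>\<^bsub>D (Suc j)\<^esub> g j (\<alpha> j x))"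
      unfolding g(3)[OF x'] using c s by (simp add: D.M.a_ac)
    also have "\<dots> = q (Suc j) x" unfolding hom_sign_alternate(2)[OF mD c(2)] using c by simp
    finally show "cx_diff ?H (n + 1) ?h (int (Suc j)) x = f (int (Suc j)) x" by (simp add: q_def)
  qed
  thus "f \<in> boundaries ?H n" using h unfolding boundaries_def by blast
qed

text \<open>The map \<open>a \<mapsto> a \<xi>\<close> induces a nonzero map from \<open>R/p\<close> to \<open>H\<^sub>s(X)\<close>.  Since \<open>X\<close> is exact
  above degree \<open>s\<close>, it lifts to a chain map of degree \<open>s\<close> from the resolution; a null homotopy would make
  \<open>\<xi>\<close> a boundary.\<close>

lemma hom_resolution_top:
  assumes N: "submodule p R (self_mod R)" and res: "free_resolution R (quot_mod (self_mod R) p) P"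
    and X: "chain_complex R X" and \<xi>: "\<xi> \<in> cycles X s" "\<xi> \<notin> boundaries X s"
    and p\<xi>: "\<And>a. a \<in> p \<Longrightarrow> a \<odot>\<^bsub>cx_mod X s\<^esub> \<xi> \<in> boundaries X s"
    and exi: "\<And>i. i > s \<Longrightarrow> cycles X i \<subseteq> boundaries X i"
  shows "\<not> exact_cx (hom_cx R P X)"
proof
  let ?H = "hom_cx R P X" and ?N = "quot_mod (self_mod R) p"
  assume exH: "exact_cx ?H"
  have P: "chain_complex R P" by (rule free_resolution_chain_complex[OF res])
  note mP = chain_complexD(1)[OF P] and mX = chain_complexD(1)[OF X]
  note H = hom_cx_chain_complex[OF P X]
  have R: "cring R" by (rule module_cring[OF mP])
  interpret R: cring R by (rule R)
  note sg = hom_sign_closed[OF R]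
  note mS = self_mod_module[OF R]
  note mN = quot_mod_module[OF mS N]
  obtain k :: "int \<Rightarrow> nat" where k0: "\<And>i. i < 0 \<Longrightarrow> k i = 0" and kP: "\<And>i. cx_mod P i = free_mod R (k i)"
    using res unfolding free_resolution_def by blast
  have P': "cx_mod P i = free_mod R 0" if "i < 0" for i using k0[OF that] kP[of i] by simp
  from free_resolution_augmentation[OF mN res] obtain aug where aug0: "aug \<in> mod_hom R (cx_mod P 0) ?N"
    and aug1: "(\<forall>x\<in>carrier (cx_mod P 1). aug (cx_diff P 1 x) = \<zero>\<^bsub>?N\<^esub>) \<and>
    (\<forall>y\<in>carrier ?N. \<exists>v\<in>carrier (cx_mod P 0). aug v = y)" by (rule bexE)
  note aug = aug0 aug1[THEN conjunct1, rule_format] aug1[THEN conjunct2, rule_format]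
  have quo: "(\<lambda>a. p +>\<^bsub>self_mod R\<^esub> a) \<in> mod_hom R (self_mod R) ?N"
  proof (rule mod_homI)
    show "p +>\<^bsub>self_mod R\<^esub> x \<in> carrier ?N" if "x \<in> carrier (self_mod R)" for x
      using that unfolding quot_mod_carrier by blast
  qed (simp_all only: quot_mod_add[OF mS N] quot_mod_smult[OF mS N])
  have "aug v \<in> (\<lambda>a. p +>\<^bsub>self_mod R\<^esub> a) ` carrier (self_mod R)" if "v \<in> carrier (cx_mod P 0)" for v
    using mod_hom_closed[OF aug(1) that] unfolding quot_mod_carrier by blast
  from free_lift[OF mN mS quo aug(1)[unfolded kP] this[unfolded kP]]
  obtain t where t: "t \<in> mod_hom R (cx_mod P 0) (self_mod R)"
    "\<And>v. v \<in> carrier (cx_mod P 0) \<Longrightarrow> p +>\<^bsub>self_mod R\<^esub> t v = aug v"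
    unfolding kP[symmetric] by blast
  have tc: "t v \<in> carrier R" if "v \<in> carrier (cx_mod P 0)" for v using mod_hom_closed[OF t(1) that] by simp
  have \<xi>c: "\<xi> \<in> carrier (cx_mod X s)" by (rule cycles_closed[OF \<xi>(1)])
  interpret Xs: module R "cx_mod X s" by (rule mX)
  have B: "submodule (boundaries X s) R (cx_mod X s)" by (rule boundaries_submodule[OF X])
  \<comment> \<open>With this shift \<open>D\<^sub>1\<close> is \<open>X\<^sub>s\<close>, the target of \<open>g\<^sub>0\<close>, and exactness is only required in degrees above \<open>s\<close>.\<close>
  define n where "n = s - 1"
  define D where "D = (\<lambda>j. cx_mod X (int j + n))"
  define \<delta> where "\<delta> = (\<lambda>j. cx_diff X (int (Suc j) + n))"
  define A where "A = (\<lambda>j. cx_mod P (int j))"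
  define \<alpha> where "\<alpha> = (\<lambda>j. cx_diff P (int (Suc j)))"
  define q where "q = (\<lambda>j (_ :: nat \<Rightarrow> 'a). \<zero>\<^bsub>D j\<^esub>)"
  define g0 where "g0 = (\<lambda>v. t v \<odot>\<^bsub>cx_mod X s\<^esub> \<xi>)"
  have D1: "D (Suc 0) = cx_mod X s" by (simp add: D_def n_def)
  have mD: "module R (D j)" for j unfolding D_def by (rule mX)
  have A: "A j = free_mod R (k (int j))" for j by (simp add: A_def kP)
  have mA: "module R (A j)" for j unfolding A_def by (rule mP)
  have \<alpha>: "\<alpha> j \<in> mod_hom R (A (Suc j)) (A j)" for j
    using shifted_diff[OF P, of j 0] by (simp add: \<alpha>_def A_def)
  have \<delta>: "\<delta> j \<in> mod_hom R (D (Suc j)) (D j)" for j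
    unfolding \<delta>_def D_def by (rule shifted_diff[OF X])
  have q: "q j \<in> mod_hom R (A j) (D j)" for j
    unfolding q_def by (rule mod_hom_zero_map[OF mA mD])
  have \<alpha>\<alpha>: "\<alpha> j (\<alpha> (Suc j) x) = \<zero>\<^bsub>A j\<^esub>" if "x \<in> carrier (A (Suc (Suc j)))" for j x
  proof -
    have e: "int (Suc (Suc j)) - 1 = int (Suc j)" "int (Suc j) - 1 = int j" by simp_all
    show ?thesis using chain_complexD(3)[OF P, of x "int (Suc (Suc j))"] that
      unfolding \<alpha>_def A_def e by blast
  qed
  have cyc: "\<delta> j (q (Suc j) x) \<oplus>\<^bsub>D j\<^esub> hom_sign R n \<odot>\<^bsub>D j\<^esub> q j y = \<zero>\<^bsub>D j\<^esub>" for j x y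
  proof -
    interpret D: module R "D j" by (rule mD)
    show ?thesis using mod_hom_zero[OF mD mD \<delta>] sg by (simp add: q_def)
  qed
  have exact: "x \<in> \<delta> (Suc (Suc j)) ` carrier (D (Suc (Suc (Suc j))))"
    if "x \<in> carrier (D (Suc (Suc j)))" "\<delta> (Suc j) x = \<zero>\<^bsub>D (Suc j)\<^esub>" for j x
  proof -
    have gt: "int (Suc (Suc j)) + n > s" by (simp add: n_def)
    show ?thesis
      unfolding \<delta>_def D_def by (rule shifted_exact[OF exi[OF gt] that[unfolded \<delta>_def D_def]])
  qed
  have g0: "g0 \<in> mod_hom R (A 0) (D (Suc 0))"
    unfolding D1 g0_def A_def
  proof (rule mod_homI)
    fix x y assume "x \<in> carrier (cx_mod P (int 0))" "y \<in> carrier (cx_mod P (int 0))"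
    thus "t (x \<oplus>\<^bsub>cx_mod P (int 0)\<^esub> y) \<odot>\<^bsub>cx_mod X s\<^esub> \<xi> = t x \<odot>\<^bsub>cx_mod X s\<^esub> \<xi> \<oplus>\<^bsub>cx_mod X s\<^esub> t y \<odot>\<^bsub>cx_mod X s\<^esub> \<xi>"
      using mod_hom_add[OF t(1), of x y] tc[of x] tc[of y] \<xi>c by (simp add: Xs.smult_l_distr)
  next
    fix r x assume "r \<in> carrier R" "x \<in> carrier (cx_mod P (int 0))"
    thus "t (r \<odot>\<^bsub>cx_mod P (int 0)\<^esub> x) \<odot>\<^bsub>cx_mod X s\<^esub> \<xi> = r \<odot>\<^bsub>cx_mod X s\<^esub> (t x \<odot>\<^bsub>cx_mod X s\<^esub> \<xi>)"
      using mod_hom_smult[OF t(1), of r x] tc[of x] \<xi>c by (simp add: Xs.smult_assoc1)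
  qed (use tc \<xi>c in simp)
  have dB: "\<delta> (Suc 0) ` carrier (D (Suc (Suc 0))) = boundaries X s"
    by (simp add: \<delta>_def D_def n_def boundaries_def add.commute)
  have start: "q (Suc 0) x \<oplus>\<^bsub>D (Suc 0)\<^esub> hom_sign R n \<odot>\<^bsub>D (Suc 0)\<^esub> g0 (\<alpha> 0 x) \<in> \<delta> (Suc 0) ` carrier (D (Suc (Suc 0)))"
    if x: "x \<in> carrier (A (Suc 0))" for x
  proof -
    have ax: "\<alpha> 0 x \<in> carrier (cx_mod P 0)" using mod_hom_closed[OF \<alpha> x] by (simp add: A_def)
    have "aug (\<alpha> 0 x) = \<zero>\<^bsub>?N\<^esub>" using aug(2)[of x] x by (simp add: A_def \<alpha>_def)
    hence "p +>\<^bsub>self_mod R\<^esub> t (\<alpha> 0 x) = p" using t(2)[OF ax] by simp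
    hence "t (\<alpha> 0 x) \<in> p" using coset_self[OF mS N, of "t (\<alpha> 0 x)"] tc[OF ax] by simp
    hence "g0 (\<alpha> 0 x) \<in> boundaries X s" unfolding g0_def by (rule p\<xi>)
    hence b: "hom_sign R n \<odot>\<^bsub>cx_mod X s\<^esub> g0 (\<alpha> 0 x) \<in> boundaries X s"
      using B sg unfolding submodule_iff[OF mX] by blast
    hence "hom_sign R n \<odot>\<^bsub>cx_mod X s\<^esub> g0 (\<alpha> 0 x) \<in> carrier (cx_mod X s)"
      using B unfolding submodule_iff[OF mX] by blast
    thus ?thesis using b unfolding dB D1 q_def by simp
  qed
  have "\<exists>g. g 0 = g0 \<and> (\<forall>j. g j \<in> mod_hom R (A j) (D (Suc j))) \<and>
    (\<forall>j. \<forall>x\<in>carrier (A (Suc j)). \<delta> (Suc j) (g (Suc j) x) =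
      q (Suc j) x \<oplus>\<^bsub>D (Suc j)\<^esub> hom_sign R n \<odot>\<^bsub>D (Suc j)\<^esub> g j (\<alpha> j x))"
    by (rule ladder_lift[OF R mD A \<alpha> \<alpha>\<alpha> \<delta> q sg cyc exact g0 start])
  then obtain g where g: "g 0 = g0" "\<And>j. g j \<in> mod_hom R (A j) (D (Suc j))"
    "\<And>j x. x \<in> carrier (A (Suc j)) \<Longrightarrow> \<delta> (Suc j) (g (Suc j) x) =
      q (Suc j) x \<oplus>\<^bsub>D (Suc j)\<^esub> hom_sign R n \<odot>\<^bsub>D (Suc j)\<^esub> g j (\<alpha> j x)" by blast
  let ?h = "extend_zero P X s g"
  have eD: "D (Suc j) = cx_mod X (int j + s)" for j
    by (simp add: D_def n_def add.commute)
  have h: "?h \<in> carrier (cx_mod ?H s)"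
    by (rule extend_zero_mem[OF P X]) (use g(2) in \<open>simp add: eD[symmetric] A_def\<close>)
  have h0: "?h 0 x = g0 x" if "x \<in> carrier (cx_mod P 0)" for x
    using extend_zero_nat[of x P 0 X s g] that g(1) by simp
  have dh: "cx_diff ?H s ?h \<in> carrier (cx_mod ?H (s - 1))" by (rule hom_cx_diff_closed[OF P X h])
  have zH: "\<zero>\<^bsub>cx_mod ?H (s - 1)\<^esub> \<in> carrier (cx_mod ?H (s - 1))"
    by (rule module_zero_closed[OF chain_complexD(1)[OF H]])
  have "cx_diff ?H s ?h = \<zero>\<^bsub>cx_mod ?H (s - 1)\<^esub>"
  proof (rule hom_cx_eqI_nonneg[OF P X P' dh zH])
    fix x assume x: "x \<in> carrier (cx_mod P 0)"
    have "cx_diff X s (g0 x) = t x \<odot>\<^bsub>cx_mod X (s - 1)\<^esub> cx_diff X s \<xi>"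
      unfolding g0_def by (rule mod_hom_smult[OF chain_complexD(2)[OF X] tc[OF x] \<xi>c])
    also have "\<dots> = \<zero>\<^bsub>cx_mod X (s - 1)\<^esub>"
      using \<xi>(1) module.smult_r_null[OF mX tc[OF x]] by (simp add: cycles_def)
    finally show "cx_diff ?H s ?h 0 x = \<zero>\<^bsub>cx_mod ?H (s - 1)\<^esub> 0 x"
      using hom_diff_at_zero[OF P X P' h x] h0[OF x] x by (simp add: hom_cx_ops)
  next
    fix j x assume x: "x \<in> carrier (cx_mod P (int (Suc j)))"
    have x': "x \<in> carrier (A (Suc j))" using x by (simp add: A_def)
    interpret D: module R "D (Suc j)" by (rule mD)
    have ax: "\<alpha> j x \<in> carrier (A j)" by (rule mod_hom_closed[OF \<alpha> x'])
    have e: "int (Suc j) + s = int (Suc (Suc j)) + n" "int (Suc j) + (s - 1) = int j + s" by (simp_all add: n_def)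
    have 1: "?h (int (Suc j)) x = g (Suc j) x" by (rule extend_zero_nat[OF x])
    have 2: "?h (int j) (\<alpha> j x) = g j (\<alpha> j x)" by (rule extend_zero_nat) (use ax in \<open>simp add: A_def\<close>)
    have c: "g j (\<alpha> j x) \<in> carrier (D (Suc j))" by (rule mod_hom_closed[OF g(2) ax])
    have "cx_diff ?H s ?h (int (Suc j)) x = \<delta> (Suc j) (g (Suc j) x)
      \<oplus>\<^bsub>D (Suc j)\<^esub> hom_sign R s \<odot>\<^bsub>D (Suc j)\<^esub> g j (\<alpha> j x)"
      unfolding hom_diff_at_Suc[OF P X h x] 1 e(1) eD[symmetric] 2[unfolded \<alpha>_def] \<delta>_def \<alpha>_def ..
    also have "\<dots> = hom_sign R s \<odot>\<^bsub>D (Suc j)\<^esub> g j (\<alpha> j x) \<oplus>\<^bsub>D (Suc j)\<^esub> hom_sign R (s - 1) \<odot>\<^bsub>D (Suc j)\<^esub> g j (\<alpha> j x)"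
      unfolding g(3)[OF x'] q_def n_def using c sg by (simp add: D.M.a_comm)
    also have "\<dots> = \<zero>\<^bsub>D (Suc j)\<^esub>" by (rule hom_sign_alternate(1)[OF mD c])
    finally show "cx_diff ?H s ?h (int (Suc j)) x = \<zero>\<^bsub>cx_mod ?H (s - 1)\<^esub> (int (Suc j)) x"
      unfolding hom_cx_ops restrict_apply'[OF x] e(2) eD .
  qed
  hence "?h \<in> cycles ?H s" using h by (simp add: cycles_def)
  hence "?h \<in> boundaries ?H s" using exH by (auto simp: exact_cx_def)
  then obtain u where u: "u \<in> carrier (cx_mod ?H (s + 1))" "?h = cx_diff ?H (s + 1) u"
    unfolding boundaries_def by blast
  have one: "p +>\<^bsub>self_mod R\<^esub> \<one>\<^bsub>R\<^esub> \<in> carrier ?N" unfolding quot_mod_carrier by auto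
  obtain v where v: "v \<in> carrier (cx_mod P 0)" "aug v = p +>\<^bsub>self_mod R\<^esub> \<one>\<^bsub>R\<^esub>" using aug(3)[OF one] by blast
  have "g0 v = cx_diff X (s + 1) (u 0 v)"
    using h0[OF v(1)] u(2) hom_diff_at_zero[OF P X P' u(1) v(1)] by simp
  moreover have "u 0 v \<in> carrier (cx_mod X (s + 1))"
    using mod_hom_closed[OF hom_cx_component(1)[OF u(1)] v(1)] by simp
  ultimately have tv: "t v \<odot>\<^bsub>cx_mod X s\<^esub> \<xi> \<in> boundaries X s" unfolding boundaries_def g0_def by blast
  have "\<one>\<^bsub>R\<^esub> \<ominus>\<^bsub>self_mod R\<^esub> t v \<in> p"
    using t(2)[OF v(1)] v(2) coset_eq_iff[OF mS N, of "\<one>\<^bsub>R\<^esub>" "t v"] tc[OF v(1)] by simp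
  moreover have "\<one>\<^bsub>R\<^esub> \<ominus>\<^bsub>self_mod R\<^esub> t v = \<one>\<^bsub>R\<^esub> \<ominus>\<^bsub>R\<^esub> t v"
    using module_minus_eq[OF mS, of "\<one>\<^bsub>R\<^esub>" "t v"] tc[OF v(1)] by (simp add: R.minus_eq R.l_minus)
  ultimately have "(\<one>\<^bsub>R\<^esub> \<ominus>\<^bsub>R\<^esub> t v) \<odot>\<^bsub>cx_mod X s\<^esub> \<xi> \<in> boundaries X s" using p\<xi> by simp
  hence "(\<one>\<^bsub>R\<^esub> \<ominus>\<^bsub>R\<^esub> t v) \<odot>\<^bsub>cx_mod X s\<^esub> \<xi> \<oplus>\<^bsub>cx_mod X s\<^esub> t v \<odot>\<^bsub>cx_mod X s\<^esub> \<xi> \<in> boundaries X s"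
    using tv B unfolding submodule_iff[OF mX] by blast
  moreover have "(\<one>\<^bsub>R\<^esub> \<ominus>\<^bsub>R\<^esub> t v) \<odot>\<^bsub>cx_mod X s\<^esub> \<xi> \<oplus>\<^bsub>cx_mod X s\<^esub> t v \<odot>\<^bsub>cx_mod X s\<^esub> \<xi> = \<xi>"
    using tc[OF v(1)] \<xi>c by (simp add: Xs.smult_l_distr[symmetric] R.minus_eq R.a_assoc R.l_neg)
  ultimately show False using \<xi>(2) by simp
qed

section \<open>Maps into an injective module\<close>

lemma stalk_hom_component:
  assumes "f \<in> carrier (cx_mod (hom_cx S C (stalk I)) (- m))"
  shows "f m \<in> mod_hom S (cx_mod C m) I"
  using hom_cx_component(1)[OF assms, of m] by simp

lemma stalk_hom_eqI:
  assumes "f \<in> carrier (cx_mod (hom_cx S C (stalk I)) (- m))" "g \<in> carrier (cx_mod (hom_cx S C (stalk I)) (- m))"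
    and "\<And>x. x \<in> carrier (cx_mod C m) \<Longrightarrow> f m x = g m x"
  shows "f = g"
proof (rule hom_cx_eqI[OF assms(1,2)])
  fix i x assume x: "x \<in> carrier (cx_mod C i)"
  show "f i x = g i x"
  proof (cases "i = m")
    case False
    hence "i + - m \<noteq> 0" by simp
    thus ?thesis using mod_hom_closed[OF hom_cx_component(1)[OF assms(1)] x]
        mod_hom_closed[OF hom_cx_component(1)[OF assms(2)] x] by simp
  qed (use x assms(3) in simp)
qed

lemma stalk_hom_exists:
  assumes "chain_complex S C" "module S I" "\<phi> \<in> mod_hom S (cx_mod C m) I"
  shows "\<exists>f\<in>carrier (cx_mod (hom_cx S C (stalk I)) (- m)). \<forall>x\<in>carrier (cx_mod C m). f m x = \<phi> x"
proof -
  \<comment> \<open>The only element of the zero module is \<open>undefined\<close>.\<close>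
  have "(if i = m then \<phi> else (\<lambda>_. undefined)) \<in> mod_hom S (cx_mod C i) (cx_mod (stalk I) (i + - m))" for i
    using assms(3) by (auto intro: mod_homI)
  from hom_cx_memI[OF assms(1) this]
  show ?thesis by (rule bexI[rotated]) simp
qed

lemma stalk_hom_diff:
  assumes "chain_complex S C" "module S I" "f \<in> carrier (cx_mod (hom_cx S C (stalk I)) (- m))"
    "x \<in> carrier (cx_mod C (m + 1))"
  shows "cx_diff (hom_cx S C (stalk I)) (- m) f (m + 1) x = hom_sign S (- m) \<odot>\<^bsub>I\<^esub> f m (cx_diff C (m + 1) x)"
proof -
  interpret I: module S I by fact
  have "f m (cx_diff C (m + 1) x) \<in> carrier I"
    by (rule mod_hom_closed[OF stalk_hom_component[OF assms(3)]
        mod_hom_closed[OF chain_complex_diff_up[OF assms(1)] assms(4)]])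
  thus ?thesis
    using hom_cx_diff_apply[OF assms(1) stalk_chain_complex[OF assms(2)] assms(3,4)]
      hom_sign_closed[OF I.R.is_cring] by simp
qed

lemma stalk_hom_cycles_iff:
  assumes "chain_complex S C" "module S I"
  shows "f \<in> cycles (hom_cx S C (stalk I)) (- m) \<longleftrightarrow> f \<in> carrier (cx_mod (hom_cx S C (stalk I)) (- m)) \<and>
    (\<forall>b\<in>boundaries C m. f m b = \<zero>\<^bsub>I\<^esub>)"
proof (cases "f \<in> carrier (cx_mod (hom_cx S C (stalk I)) (- m))")
  case True
  interpret I: module S I by fact
  let ?H = "hom_cx S C (stalk I)"
  note sc = stalk_chain_complex[OF assms(2)]
  note sg = hom_sign_closed[OF I.R.is_cring]
  have e: "- m - 1 = - (m + 1)" by simp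
  have df: "cx_diff ?H (- m) f \<in> carrier (cx_mod ?H (- (m + 1)))"
    using hom_cx_diff_closed[OF assms(1) sc True] unfolding e .
  have z: "\<zero>\<^bsub>cx_mod ?H (- (m + 1))\<^esub> \<in> carrier (cx_mod ?H (- (m + 1)))"
    by (rule module_zero_closed[OF hom_cx_module[OF assms(1) sc]])
  have cl: "f m (cx_diff C (m + 1) x) \<in> carrier I" if "x \<in> carrier (cx_mod C (m + 1))" for x
    by (rule mod_hom_closed[OF stalk_hom_component[OF True]
        mod_hom_closed[OF chain_complex_diff_up[OF assms(1)] that]])
  have zap: "\<zero>\<^bsub>cx_mod ?H (- (m + 1))\<^esub> (m + 1) x = \<zero>\<^bsub>I\<^esub>" if "x \<in> carrier (cx_mod C (m + 1))" for x
    using that by (simp add: hom_cx_ops)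
  have "f \<in> cycles ?H (- m) \<longleftrightarrow> cx_diff ?H (- m) f = \<zero>\<^bsub>cx_mod ?H (- (m + 1))\<^esub>"
    using True unfolding cycles_def e by simp
  also have "\<dots> \<longleftrightarrow> (\<forall>x\<in>carrier (cx_mod C (m + 1)). f m (cx_diff C (m + 1) x) = \<zero>\<^bsub>I\<^esub>)"
  proof
    assume h: "cx_diff ?H (- m) f = \<zero>\<^bsub>cx_mod ?H (- (m + 1))\<^esub>"
    show "\<forall>x\<in>carrier (cx_mod C (m + 1)). f m (cx_diff C (m + 1) x) = \<zero>\<^bsub>I\<^esub>"
    proof
      fix x assume x: "x \<in> carrier (cx_mod C (m + 1))"
      have "hom_sign S (- m) \<odot>\<^bsub>I\<^esub> f m (cx_diff C (m + 1) x) = \<zero>\<^bsub>I\<^esub>"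
        using stalk_hom_diff[OF assms True x] zap[OF x] unfolding h by simp
      thus "f m (cx_diff C (m + 1) x) = \<zero>\<^bsub>I\<^esub>"
        using hom_sign_square[OF assms(2) cl[OF x], of "- m"] sg by simp
    qed
  next
    assume h: "\<forall>x\<in>carrier (cx_mod C (m + 1)). f m (cx_diff C (m + 1) x) = \<zero>\<^bsub>I\<^esub>"
    show "cx_diff ?H (- m) f = \<zero>\<^bsub>cx_mod ?H (- (m + 1))\<^esub>"
    proof (rule stalk_hom_eqI[OF df z])
      fix x assume x: "x \<in> carrier (cx_mod C (m + 1))"
      show "cx_diff ?H (- m) f (m + 1) x = \<zero>\<^bsub>cx_mod ?H (- (m + 1))\<^esub> (m + 1) x"
        unfolding stalk_hom_diff[OF assms True x] zap[OF x] using h x sg by simp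
    qed
  qed
  also have "\<dots> \<longleftrightarrow> (\<forall>b\<in>boundaries C m. f m b = \<zero>\<^bsub>I\<^esub>)" unfolding boundaries_def by simp
  finally show ?thesis using True by simp
qed (simp add: cycles_def)

text \<open>A map that vanishes on the kernel of \<open>d\<close> factors through \<open>d\<close>, by injectivity.\<close>

lemma stalk_hom_boundaries_iff:
  assumes "chain_complex S C" "baer S I"
  shows "f \<in> boundaries (hom_cx S C (stalk I)) (- m) \<longleftrightarrow> f \<in> carrier (cx_mod (hom_cx S C (stalk I)) (- m)) \<and>
    (\<forall>z\<in>cycles C m. f m z = \<zero>\<^bsub>I\<^esub>)"
proof
  let ?H = "hom_cx S C (stalk I)"
  note mI = baer_module[OF assms(2)] and mC = chain_complexD(1)[OF assms(1)]
  note sc = stalk_chain_complex[OF mI]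
  interpret I: module S I by (rule mI)
  note sg = hom_sign_closed[OF I.R.is_cring]
  have e: "- m + 1 = - (m - 1)" by simp
  have d: "cx_diff C m \<in> mod_hom S (cx_mod C m) (cx_mod C (m - 1))" by (rule chain_complexD(2)[OF assms(1)])
  {
    assume "f \<in> boundaries ?H (- m)"
    then obtain h where h: "h \<in> carrier (cx_mod ?H (- (m - 1)))" "f = cx_diff ?H (- (m - 1)) h"
      unfolding boundaries_def e by blast
    have f: "f \<in> carrier (cx_mod ?H (- m))" using hom_cx_diff_closed[OF assms(1) sc h(1)] h(2) by simp
    have "f m z = \<zero>\<^bsub>I\<^esub>" if z: "z \<in> cycles C m" for z
    proof -
      have "f m z = hom_sign S (- (m - 1)) \<odot>\<^bsub>I\<^esub> h (m - 1) (cx_diff C m z)"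
        using stalk_hom_diff[OF assms(1) mI h(1), of z] cycles_closed[OF z] h(2) by simp
      also have "cx_diff C m z = \<zero>\<^bsub>cx_mod C (m - 1)\<^esub>" using z by (simp add: cycles_def)
      finally show ?thesis
        using mod_hom_zero[OF mC mI stalk_hom_component[OF h(1)]] sg by simp
    qed
    thus "f \<in> carrier (cx_mod ?H (- m)) \<and> (\<forall>z\<in>cycles C m. f m z = \<zero>\<^bsub>I\<^esub>)" using f by blast
  next
    assume f: "f \<in> carrier (cx_mod ?H (- m)) \<and> (\<forall>z\<in>cycles C m. f m z = \<zero>\<^bsub>I\<^esub>)"
    hence fc: "f \<in> carrier (cx_mod ?H (- m))" by blast
    have fm: "f m \<in> mod_hom S (cx_mod C m) I" by (rule stalk_hom_component[OF fc])
    have full: "f m \<in> mod_hom S (cx_mod C m\<lparr>carrier := carrier (cx_mod C m)\<rparr>) I" using fm by simp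
    have "\<exists>g\<in>mod_hom S (cx_mod C (m - 1)) I. \<forall>x\<in>carrier (cx_mod C m). g (cx_diff C m x) = f m x"
      by (rule baer_factor[OF assms(2) mC mC module.carrier_is_submodule[OF mC] d full])
        (use f in \<open>simp add: cycles_def\<close>)
    then obtain g where g: "g \<in> mod_hom S (cx_mod C (m - 1)) I"
      "\<And>x. x \<in> carrier (cx_mod C m) \<Longrightarrow> g (cx_diff C m x) = f m x" by blast
    define s where "s = hom_sign S (- (m - 1))"
    have "(\<lambda>x. s \<odot>\<^bsub>I\<^esub> g x) \<in> mod_hom S (cx_mod C (m - 1)) I"
      unfolding s_def by (rule mod_hom_smult_fun[OF mC mI g(1) sg])
    from stalk_hom_exists[OF assms(1) mI this]
    obtain h where h: "h \<in> carrier (cx_mod ?H (- (m - 1)))"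
      "\<And>x. x \<in> carrier (cx_mod C (m - 1)) \<Longrightarrow> h (m - 1) x = s \<odot>\<^bsub>I\<^esub> g x" by blast
    have dh: "cx_diff ?H (- (m - 1)) h \<in> carrier (cx_mod ?H (- m))"
      using hom_cx_diff_closed[OF assms(1) sc h(1)] by simp
    have "cx_diff ?H (- (m - 1)) h = f"
    proof (rule stalk_hom_eqI[OF dh fc])
      fix x assume x: "x \<in> carrier (cx_mod C m)"
      have "cx_diff ?H (- (m - 1)) h m x = s \<odot>\<^bsub>I\<^esub> h (m - 1) (cx_diff C m x)"
        using stalk_hom_diff[OF assms(1) mI h(1), of x] x by (simp add: s_def)
      also have "\<dots> = s \<odot>\<^bsub>I\<^esub> (s \<odot>\<^bsub>I\<^esub> f m x)"
        using h(2)[OF mod_hom_closed[OF d x]] g(2)[OF x] by simp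
      also have "\<dots> = f m x" unfolding s_def by (rule hom_sign_square[OF mI mod_hom_closed[OF fm x]])
      finally show "cx_diff ?H (- (m - 1)) h m x = f m x" .
    qed
    thus "f \<in> boundaries ?H (- m)" unfolding boundaries_def e using h(1) by blast
  }
qed

lemma stalk_hom_exact:
  assumes "chain_complex S C" "baer S I" "cycles C m \<subseteq> boundaries C m"
  shows "cycles (hom_cx S C (stalk I)) (- m) \<subseteq> boundaries (hom_cx S C (stalk I)) (- m)"
  using assms(3) stalk_hom_cycles_iff[OF assms(1) baer_module[OF assms(2)]]
    stalk_hom_boundaries_iff[OF assms(1,2)] by blast

section \<open>A class annihilated by the maximal ideal of a local ring\<close>

definition span_over :: "('a, 'r) ring_scheme \<Rightarrow> ('a, 'b) module \<Rightarrow> 'b set \<Rightarrow> (nat \<Rightarrow> 'b) \<Rightarrow> nat \<Rightarrow> 'b set" where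
  "span_over R M B x k = {b \<oplus>\<^bsub>M\<^esub> lincomb M x c k | b c. b \<in> B \<and> (\<forall>i. c i \<in> carrier R)}"

lemma span_over_submodule:
  assumes "module R M" "submodule B R M" "\<And>i. i < k \<Longrightarrow> x i \<in> carrier M"
  shows "submodule (span_over R M B x k) R M"
proof -
  interpret module R M by fact
  have B: "B \<subseteq> carrier M" "\<zero>\<^bsub>M\<^esub> \<in> B" "\<And>x y. x \<in> B \<Longrightarrow> y \<in> B \<Longrightarrow> x \<oplus>\<^bsub>M\<^esub> y \<in> B"
     "\<And>r x. r \<in> carrier R \<Longrightarrow> x \<in> B \<Longrightarrow> r \<odot>\<^bsub>M\<^esub> x \<in> B"
    using assms(2) by (auto simp: submodule_iff[OF assms(1)])
  have lc: "lincomb M x c k \<in> carrier M" if "\<forall>i. c i \<in> carrier R" for c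
    by (rule lincomb_closed[OF assms(1,3)]) (use that in auto)
  show ?thesis
    unfolding submodule_iff[OF assms(1)]
  proof (intro conjI ballI)
    show "span_over R M B x k \<subseteq> carrier M" unfolding span_over_def using B(1) lc by auto
    have "\<zero>\<^bsub>M\<^esub> = \<zero>\<^bsub>M\<^esub> \<oplus>\<^bsub>M\<^esub> lincomb M x (\<lambda>_. \<zero>\<^bsub>R\<^esub>) k" using lincomb_zero[OF assms(1,3)] by simp
    thus "\<zero>\<^bsub>M\<^esub> \<in> span_over R M B x k" unfolding span_over_def using B(2) R.zero_closed by blast
  next
    fix u v assume "u \<in> span_over R M B x k" "v \<in> span_over R M B x k"
    then obtain b c b' c' where 1: "b \<in> B" "\<forall>i. c i \<in> carrier R" "u = b \<oplus>\<^bsub>M\<^esub> lincomb M x c k"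
      "b' \<in> B" "\<forall>i. c' i \<in> carrier R" "v = b' \<oplus>\<^bsub>M\<^esub> lincomb M x c' k" unfolding span_over_def by blast
    have bc: "b \<in> carrier M" "b' \<in> carrier M" using 1 B(1) by auto
    have "u \<oplus>\<^bsub>M\<^esub> v = (b \<oplus>\<^bsub>M\<^esub> b') \<oplus>\<^bsub>M\<^esub> lincomb M x (\<lambda>i. c i \<oplus>\<^bsub>R\<^esub> c' i) k"
      using 1(2,5) bc lc[OF 1(2)] lc[OF 1(5)] by (simp add: 1(3,6) lincomb_add[OF assms(1,3)] M.a_ac)
    moreover have "b \<oplus>\<^bsub>M\<^esub> b' \<in> B" by (rule B(3)[OF 1(1,4)])
    moreover have "\<forall>i. c i \<oplus>\<^bsub>R\<^esub> c' i \<in> carrier R" using 1(2,5) by simp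
    ultimately show "u \<oplus>\<^bsub>M\<^esub> v \<in> span_over R M B x k" unfolding span_over_def by blast
  next
    fix r u assume r: "r \<in> carrier R" and "u \<in> span_over R M B x k"
    then obtain b c where 1: "b \<in> B" "\<forall>i. c i \<in> carrier R" "u = b \<oplus>\<^bsub>M\<^esub> lincomb M x c k"
      unfolding span_over_def by blast
    have bc: "b \<in> carrier M" using 1 B(1) by auto
    have "r \<odot>\<^bsub>M\<^esub> u = r \<odot>\<^bsub>M\<^esub> b \<oplus>\<^bsub>M\<^esub> lincomb M x (\<lambda>i. r \<otimes>\<^bsub>R\<^esub> c i) k"
      using 1(2) bc lc[OF 1(2)] r by (simp add: 1(3) lincomb_smult[OF assms(1) r assms(3)] smult_r_distr)
    moreover have "r \<odot>\<^bsub>M\<^esub> b \<in> B" by (rule B(4)[OF r 1(1)])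
    moreover have "\<forall>i. r \<otimes>\<^bsub>R\<^esub> c i \<in> carrier R" using 1(2) r by simp
    ultimately show "r \<odot>\<^bsub>M\<^esub> u \<in> span_over R M B x k" unfolding span_over_def by blast
  qed
qed

lemma span_over_base:
  assumes "module R M" "submodule B R M" "\<And>i. i < k \<Longrightarrow> x i \<in> carrier M"
  shows "B \<subseteq> span_over R M B x k"
proof
  interpret module R M by fact
  fix b assume b: "b \<in> B"
  have "b \<in> carrier M" using b assms(2) unfolding submodule_iff[OF assms(1)] by blast
  hence "b = b \<oplus>\<^bsub>M\<^esub> lincomb M x (\<lambda>_. \<zero>\<^bsub>R\<^esub>) k" using lincomb_zero[OF assms(1,3)] by simp
  thus "b \<in> span_over R M B x k" unfolding span_over_def using b R.zero_closed by blast
qed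

lemma span_over_0:
  assumes "module R M" "submodule B R M"
  shows "span_over R M B x 0 = B"
proof -
  interpret module R M by fact
  have B: "B \<subseteq> carrier M" using assms(2) by (simp add: submodule_iff[OF assms(1)])
  show ?thesis
  proof
    show "span_over R M B x 0 \<subseteq> B" unfolding span_over_def using B by auto
    show "B \<subseteq> span_over R M B x 0" by (rule span_over_base[OF assms]) simp
  qed
qed

lemma span_over_Suc:
  assumes "module R M" "submodule B R M" "\<And>i. i < Suc k \<Longrightarrow> x i \<in> carrier M" "u \<in> span_over R M B x (Suc k)"
  shows "\<exists>w\<in>span_over R M B x k. \<exists>c\<in>carrier R. u = w \<oplus>\<^bsub>M\<^esub> c \<odot>\<^bsub>M\<^esub> x k"
proof -
  interpret module R M by fact
  from assms(4) obtain b c where 1: "b \<in> B" "\<forall>i. c i \<in> carrier R" "u = b \<oplus>\<^bsub>M\<^esub> lincomb M x c (Suc k)"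
    unfolding span_over_def by blast
  have bc: "b \<in> carrier M" using 1(1) assms(2) unfolding submodule_iff[OF assms(1)] by blast
  have "lincomb M x c k \<in> carrier M" by (rule lincomb_closed[OF assms(1)]) (use assms(3) 1(2) in auto)
  hence "u = (b \<oplus>\<^bsub>M\<^esub> lincomb M x c k) \<oplus>\<^bsub>M\<^esub> c k \<odot>\<^bsub>M\<^esub> x k"
    using 1 bc assms(3)[of k] by (simp add: M.a_assoc)
  moreover have "b \<oplus>\<^bsub>M\<^esub> lincomb M x c k \<in> span_over R M B x k" unfolding span_over_def using 1(1,2) by blast
  moreover have "c k \<in> carrier R" using 1(2) by blast
  ultimately show ?thesis by blast
qed

text \<open>An argument in the spirit of Nakayama's lemma, made on the side of the maps into \<open>I\<close>.  Among the
  submodules \<open>U\<^sub>j\<close> spanned by the boundaries and the first \<open>j\<close> generators, let \<open>U\<^sub>l\<close> be the last one that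
  does not contain all cycles.  Modulo \<open>U\<^sub>l\<close> the cycles are generated by the single nonzero class of
  \<open>x\<^sub>l\<close>, whose annihilator lies in \<open>\<nn>\<close>; so \<open>x\<^sub>l \<mapsto> e\<close> defines a map from the cyclic module that it
  generates, and this map extends to the whole quotient.\<close>

lemma local_annihilated_class:
  assumes C: "chain_complex S C" and I: "baer S I"
    and unit: "\<And>a. a \<in> carrier S \<Longrightarrow> a \<notin> \<nn> \<Longrightarrow> \<exists>b\<in>carrier S. b \<otimes>\<^bsub>S\<^esub> a = \<one>\<^bsub>S\<^esub>"
    and nS: "\<nn> \<subseteq> carrier S"
    and e: "e \<in> carrier I" "e \<noteq> \<zero>\<^bsub>I\<^esub>" "\<And>a. a \<in> \<nn> \<Longrightarrow> a \<odot>\<^bsub>I\<^esub> e = \<zero>\<^bsub>I\<^esub>"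
    and x: "\<And>i. i < k \<Longrightarrow> x i \<in> cycles C m"
    and gen: "cycles C m \<subseteq> span_over S (cx_mod C m) (boundaries C m) x k"
    and ne: "\<not> cycles C m \<subseteq> boundaries C m"
  shows "\<exists>\<xi>\<in>cycles (hom_cx S C (stalk I)) (- m). \<xi> \<notin> boundaries (hom_cx S C (stalk I)) (- m) \<and>
    (\<forall>a\<in>\<nn>. a \<odot>\<^bsub>cx_mod (hom_cx S C (stalk I)) (- m)\<^esub> \<xi> \<in> boundaries (hom_cx S C (stalk I)) (- m))"
proof -
  let ?H = "hom_cx S C (stalk I)"
  let ?M = "cx_mod C m"
  define U where "U = (\<lambda>j. span_over S ?M (boundaries C m) x j)"
  have mI: "module S I" by (rule baer_module[OF I])
  have mM: "module S ?M" by (rule chain_complexD(1)[OF C])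
  have B: "submodule (boundaries C m) S ?M" by (rule boundaries_submodule[OF C])
  interpret I: module S I by (rule mI)
  interpret M: module S ?M by (rule mM)
  have S: "cring S" by (rule module_cring[OF mM])
  have mS: "module S (self_mod S)" by (rule self_mod_module[OF S])
  have xc: "x i \<in> carrier ?M" if "i < k" for i by (rule cycles_closed[OF x[OF that]])
  have "cycles C m \<subseteq> U k" using gen by (simp add: U_def)
  then obtain l where l: "cycles C m \<subseteq> U (Suc l)" "\<not> cycles C m \<subseteq> U l" "Suc l \<le> k"
  proof -
    assume k: "cycles C m \<subseteq> U k" and *: "\<And>l. cycles C m \<subseteq> U (Suc l) \<Longrightarrow> \<not> cycles C m \<subseteq> U l \<Longrightarrow> Suc l \<le> k \<Longrightarrow> thesis"
    define j where "j = (LEAST j. cycles C m \<subseteq> U j)"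
    have j: "cycles C m \<subseteq> U j" unfolding j_def by (rule LeastI[of "\<lambda>j. cycles C m \<subseteq> U j", OF k])
    have jk: "j \<le> k" unfolding j_def by (rule Least_le[of "\<lambda>j. cycles C m \<subseteq> U j", OF k])
    have "j \<noteq> 0" using j ne span_over_0[OF mM B, of x] by (auto simp: U_def)
    then obtain l where jl: "j = Suc l" by (cases j) auto
    have "\<not> cycles C m \<subseteq> U l"
      using not_less_Least[of l "\<lambda>j. cycles C m \<subseteq> U j"] jl by (simp add: j_def[symmetric])
    thus thesis using *[of l] j jk jl by simp
  qed
  have lk: "l < k" using l(3) by simp
  have xs: "\<And>i. i < Suc l \<Longrightarrow> x i \<in> carrier ?M" by (rule xc) (use l(3) in simp)
  have Ul: "submodule (U l) S ?M" unfolding U_def by (rule span_over_submodule[OF mM B]) (use xs in simp)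
  have dec: "\<exists>w\<in>U l. \<exists>c\<in>carrier S. z = w \<oplus>\<^bsub>?M\<^esub> c \<odot>\<^bsub>?M\<^esub> x l" if "z \<in> cycles C m" for z
  proof -
    have "z \<in> span_over S ?M (boundaries C m) x (Suc l)" using that l(1) unfolding U_def by blast
    from span_over_Suc[OF mM B xs this] show ?thesis unfolding U_def .
  qed
  have xl: "x l \<in> carrier ?M" by (rule xc[OF lk])
  have ann: "a \<in> \<nn>" if a: "a \<in> carrier S" "a \<odot>\<^bsub>?M\<^esub> x l \<in> U l" for a
  proof (rule ccontr)
    assume "a \<notin> \<nn>"
    then obtain b where b: "b \<in> carrier S" "b \<otimes>\<^bsub>S\<^esub> a = \<one>\<^bsub>S\<^esub>" using unit[OF a(1)] by blast
    have "b \<odot>\<^bsub>?M\<^esub> (a \<odot>\<^bsub>?M\<^esub> x l) \<in> U l" using Ul a(2) b(1) unfolding submodule_iff[OF mM] by blast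
    hence xU: "x l \<in> U l" using M.smult_assoc1[OF b(1) a(1) xl] b(2) xl by simp
    have "cycles C m \<subseteq> U l"
    proof
      fix z assume "z \<in> cycles C m"
      from dec[OF this] obtain w c where "w \<in> U l" "c \<in> carrier S" "z = w \<oplus>\<^bsub>?M\<^esub> c \<odot>\<^bsub>?M\<^esub> x l" by blast
      thus "z \<in> U l" using Ul xU unfolding submodule_iff[OF mM] by blast
    qed
    thus False using l(2) by blast
  qed
  define Q where "Q = quot_mod ?M (U l)"
  define \<pi> where "\<pi> = (\<lambda>y. U l +>\<^bsub>?M\<^esub> y)"
  have mQ: "module S Q" unfolding Q_def by (rule quot_mod_module[OF mM Ul])
  have \<pi>: "\<pi> \<in> mod_hom S ?M Q"
  proof (rule mod_homI)
    show "\<pi> y \<in> carrier Q" if "y \<in> carrier ?M" for y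
      unfolding Q_def quot_mod_carrier \<pi>_def using that by blast
  qed (simp_all only: Q_def \<pi>_def quot_mod_add[OF mM Ul] quot_mod_smult[OF mM Ul])
  have \<pi>0: "\<pi> y = \<zero>\<^bsub>Q\<^esub> \<longleftrightarrow> y \<in> U l" if y: "y \<in> carrier ?M" for y
    using coset_eq_iff[OF mM Ul y M.M.zero_closed] coset_zero[OF mM Ul] module_diff_zero[OF mM y]
    by (simp add: \<pi>_def Q_def)
  have h: "(\<lambda>a. \<pi> (a \<odot>\<^bsub>?M\<^esub> x l)) \<in> mod_hom S (self_mod S) Q"
    by (rule mod_hom_comp[OF mod_homI \<pi>]) (use xl in \<open>simp_all add: M.smult_l_distr M.smult_assoc1\<close>)
  have f: "(\<lambda>a. a \<odot>\<^bsub>I\<^esub> e) \<in> mod_hom S (self_mod S\<lparr>carrier := carrier (self_mod S)\<rparr>) I"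
    by (rule mod_homI) (use e(1) in \<open>simp_all add: I.smult_l_distr I.smult_assoc1\<close>)
  have "\<exists>g\<in>mod_hom S Q I. \<forall>a\<in>carrier (self_mod S). g (\<pi> (a \<odot>\<^bsub>?M\<^esub> x l)) = a \<odot>\<^bsub>I\<^esub> e"
  proof (rule baer_factor[OF I mS mQ module.carrier_is_submodule[OF mS] h f])
    fix a assume a: "a \<in> carrier (self_mod S)" "\<pi> (a \<odot>\<^bsub>?M\<^esub> x l) = \<zero>\<^bsub>Q\<^esub>"
    hence "a \<odot>\<^bsub>?M\<^esub> x l \<in> U l" using \<pi>0[of "a \<odot>\<^bsub>?M\<^esub> x l"] xl by simp
    thus "a \<odot>\<^bsub>I\<^esub> e = \<zero>\<^bsub>I\<^esub>" using e(3)[OF ann[of a]] a(1) by simp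
  qed
  then obtain g where g: "g \<in> mod_hom S Q I" "\<And>a. a \<in> carrier S \<Longrightarrow> g (\<pi> (a \<odot>\<^bsub>?M\<^esub> x l)) = a \<odot>\<^bsub>I\<^esub> e"
    by auto
  have gp: "(\<lambda>y. g (\<pi> y)) \<in> mod_hom S ?M I" by (rule mod_hom_comp[OF \<pi> g(1)])
  obtain \<xi> where \<xi>: "\<xi> \<in> carrier (cx_mod ?H (- m))" "\<And>y. y \<in> carrier ?M \<Longrightarrow> \<xi> m y = g (\<pi> y)"
    using stalk_hom_exists[OF C mI gp] by blast
  have van: "\<xi> m w = \<zero>\<^bsub>I\<^esub>" if "w \<in> U l" for w
  proof -
    have w: "w \<in> carrier ?M" using that Ul unfolding submodule_iff[OF mM] by blast
    show ?thesis using \<xi>(2)[OF w] \<pi>0[OF w] that mod_hom_zero[OF mQ mI g(1)] by simp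
  qed
  have val: "\<xi> m (c \<odot>\<^bsub>?M\<^esub> x l) = c \<odot>\<^bsub>I\<^esub> e" if "c \<in> carrier S" for c
    using \<xi>(2)[of "c \<odot>\<^bsub>?M\<^esub> x l"] g(2)[OF that] that xl by simp
  have BU: "boundaries C m \<subseteq> U l" unfolding U_def by (rule span_over_base[OF mM B]) (use xs in simp)
  note sc = stalk_chain_complex[OF mI]
  have "\<xi> \<in> cycles ?H (- m)"
    unfolding stalk_hom_cycles_iff[OF C mI] using \<xi>(1) van BU by blast
  moreover have "\<xi> m (x l) = e" using val[of "\<one>\<^bsub>S\<^esub>"] xl e(1) by simp
  hence "\<xi> \<notin> boundaries ?H (- m)"
    unfolding stalk_hom_boundaries_iff[OF C I] using x[OF lk] e(2) by metis
  moreover have "a \<odot>\<^bsub>cx_mod ?H (- m)\<^esub> \<xi> \<in> boundaries ?H (- m)" if a: "a \<in> \<nn>" for a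
    unfolding stalk_hom_boundaries_iff[OF C I]
  proof (intro conjI ballI)
    have aS: "a \<in> carrier S" using a nS by blast
    show "a \<odot>\<^bsub>cx_mod ?H (- m)\<^esub> \<xi> \<in> carrier (cx_mod ?H (- m))"
      by (rule module.smult_closed[OF hom_cx_module[OF C sc] aS \<xi>(1)])
    fix z assume z: "z \<in> cycles C m"
    from dec[OF z] obtain w c where wc: "w \<in> U l" "c \<in> carrier S" "z = w \<oplus>\<^bsub>?M\<^esub> c \<odot>\<^bsub>?M\<^esub> x l" by blast
    have w: "w \<in> carrier ?M" using wc(1) Ul unfolding submodule_iff[OF mM] by blast
    have "\<xi> m z = c \<odot>\<^bsub>I\<^esub> e"
      using mod_hom_add[OF stalk_hom_component[OF \<xi>(1)] w M.smult_closed[OF wc(2) xl]] van[OF wc(1)] val[OF wc(2)] e(1) wc(2,3)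
      by simp
    hence "a \<odot>\<^bsub>I\<^esub> \<xi> m z = c \<odot>\<^bsub>I\<^esub> (a \<odot>\<^bsub>I\<^esub> e)"
      using aS wc(2) e(1) by (simp add: I.smult_assoc1[symmetric] I.R.m_comm)
    thus "(a \<odot>\<^bsub>cx_mod ?H (- m)\<^esub> \<xi>) m z = \<zero>\<^bsub>I\<^esub>"
      using cycles_closed[OF z] e(3)[OF a] wc(2) by (simp add: hom_cx_ops)
  qed
  ultimately show ?thesis by blast
qed

section \<open>Localization at a prime ideal\<close>

lemma abelian_group_cong:
  assumes "abelian_group G" "carrier H = carrier G" "zero H = zero G" "add H = add G"
  shows "abelian_group H"
proof -
  interpret abelian_group G by fact
  show ?thesis
  proof (rule abelian_groupI; unfold assms)
    fix x assume x: "x \<in> carrier G"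
    show "\<exists>y\<in>carrier G. y \<oplus>\<^bsub>G\<^esub> x = \<zero>\<^bsub>G\<^esub>"
      by (rule bexI[of _ "\<ominus>\<^bsub>G\<^esub> x"]) (simp_all add: x l_neg)
  qed (simp_all add: a_ac)
qed

locale prime_localization = primeideal p R for p and R :: "('a, 'r) ring_scheme" (structure)
begin

lemma one_denom: "\<one> \<in> carrier R - p"
  using I_notcarr one_imp_carrier by auto

lemma mult_denom: "s \<in> carrier R - p \<Longrightarrow> t \<in> carrier R - p \<Longrightarrow> s \<otimes> t \<in> carrier R - p"
  using I_prime by blast

lemma frac_mem_iff:
  "(n, t) \<in> loc_frac R p M m s \<longleftrightarrow> n \<in> carrier M \<and> t \<in> carrier R - p \<and>
     (\<exists>u\<in>carrier R - p. u \<odot>\<^bsub>M\<^esub> (t \<odot>\<^bsub>M\<^esub> m) = u \<odot>\<^bsub>M\<^esub> (s \<odot>\<^bsub>M\<^esub> n))"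
  by (simp add: loc_frac_def)

lemma frac_self:
  assumes "module R M" "m \<in> carrier M" "s \<in> carrier R - p"
  shows "(m, s) \<in> loc_frac R p M m s"
  unfolding frac_mem_iff using assms one_denom by blast

text \<open>Transitivity of equality of fractions: the witnesses \<open>u\<close> and \<open>v\<close> of two equalities combine with the middle
  denominator \<open>t\<close> to the witness \<open>u v t\<close>.\<close>

lemma frac_subset:
  assumes "module R M" "m \<in> carrier M" "s \<in> carrier R - p" "n \<in> carrier M" "t \<in> carrier R - p"
    and u: "u \<in> carrier R - p" "u \<odot>\<^bsub>M\<^esub> (t \<odot>\<^bsub>M\<^esub> m) = u \<odot>\<^bsub>M\<^esub> (s \<odot>\<^bsub>M\<^esub> n)"
  shows "loc_frac R p M n t \<subseteq> loc_frac R p M m s"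
proof clarify
  interpret M: module R M by fact
  fix q r assume "(q, r) \<in> loc_frac R p M n t"
  then obtain v where q: "q \<in> carrier M" "r \<in> carrier R - p" and v: "v \<in> carrier R - p"
    "v \<odot>\<^bsub>M\<^esub> (r \<odot>\<^bsub>M\<^esub> n) = v \<odot>\<^bsub>M\<^esub> (t \<odot>\<^bsub>M\<^esub> q)" unfolding frac_mem_iff by blast
  have c: "s \<in> carrier R" "t \<in> carrier R" "u \<in> carrier R" "v \<in> carrier R" "r \<in> carrier R"
    using assms q v by auto
  have "(u \<otimes> v \<otimes> t) \<odot>\<^bsub>M\<^esub> (r \<odot>\<^bsub>M\<^esub> m) = (v \<otimes> r) \<odot>\<^bsub>M\<^esub> (u \<odot>\<^bsub>M\<^esub> (t \<odot>\<^bsub>M\<^esub> m))"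
    using c assms(2) by (simp add: M.smult_assoc1[symmetric] m_ac)
  also have "\<dots> = (u \<otimes> s) \<odot>\<^bsub>M\<^esub> (v \<odot>\<^bsub>M\<^esub> (r \<odot>\<^bsub>M\<^esub> n))"
    unfolding u(2) using c assms(4) by (simp add: M.smult_assoc1[symmetric] m_ac)
  also have "\<dots> = (u \<otimes> v \<otimes> t) \<odot>\<^bsub>M\<^esub> (s \<odot>\<^bsub>M\<^esub> q)"
    unfolding v(2) using c q(1) by (simp add: M.smult_assoc1[symmetric] m_ac)
  finally have "(u \<otimes> v \<otimes> t) \<odot>\<^bsub>M\<^esub> (r \<odot>\<^bsub>M\<^esub> m) = (u \<otimes> v \<otimes> t) \<odot>\<^bsub>M\<^esub> (s \<odot>\<^bsub>M\<^esub> q)" .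
  moreover have "u \<otimes> v \<otimes> t \<in> carrier R - p" using mult_denom u(1) v(1) assms(5) by blast
  ultimately show "(q, r) \<in> loc_frac R p M m s" unfolding frac_mem_iff using q by blast
qed

lemma frac_eqI:
  assumes "module R M" "m \<in> carrier M" "s \<in> carrier R - p" "n \<in> carrier M" "t \<in> carrier R - p"
    and "u \<in> carrier R - p" "u \<odot>\<^bsub>M\<^esub> (t \<odot>\<^bsub>M\<^esub> m) = u \<odot>\<^bsub>M\<^esub> (s \<odot>\<^bsub>M\<^esub> n)"
  shows "loc_frac R p M m s = loc_frac R p M n t"
  using frac_subset[OF assms] frac_subset[OF assms(1,4,5,2,3,6) assms(7)[symmetric]] by blast

lemma frac_eq_iff:
  assumes "module R M" "m \<in> carrier M" "s \<in> carrier R - p" "n \<in> carrier M" "t \<in> carrier R - p"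
  shows "loc_frac R p M m s = loc_frac R p M n t \<longleftrightarrow>
    (\<exists>u\<in>carrier R - p. u \<odot>\<^bsub>M\<^esub> (t \<odot>\<^bsub>M\<^esub> m) = u \<odot>\<^bsub>M\<^esub> (s \<odot>\<^bsub>M\<^esub> n))"
proof
  assume "loc_frac R p M m s = loc_frac R p M n t"
  hence "(n, t) \<in> loc_frac R p M m s" using frac_self[OF assms(1,4,5)] by simp
  thus "\<exists>u\<in>carrier R - p. u \<odot>\<^bsub>M\<^esub> (t \<odot>\<^bsub>M\<^esub> m) = u \<odot>\<^bsub>M\<^esub> (s \<odot>\<^bsub>M\<^esub> n)" unfolding frac_mem_iff by blast
next
  assume "\<exists>u\<in>carrier R - p. u \<odot>\<^bsub>M\<^esub> (t \<odot>\<^bsub>M\<^esub> m) = u \<odot>\<^bsub>M\<^esub> (s \<odot>\<^bsub>M\<^esub> n)"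
  thus "loc_frac R p M m s = loc_frac R p M n t" using frac_eqI[OF assms] by blast
qed

lemma frac_expand:
  assumes "module R M" "m \<in> carrier M" "s \<in> carrier R - p" "t \<in> carrier R - p"
  shows "loc_frac R p M m s = loc_frac R p M (t \<odot>\<^bsub>M\<^esub> m) (s \<otimes> t)"
proof -
  interpret M: module R M by fact
  show ?thesis
    by (rule frac_eqI[OF assms(1-3) _ mult_denom[OF assms(3,4)] one_denom])
      (use assms in \<open>auto simp: M.smult_assoc1[symmetric]\<close>)
qed

lemma loc_mod_carrier:
  "X \<in> carrier (loc_mod R p M) \<longleftrightarrow> (\<exists>m s. m \<in> carrier M \<and> s \<in> carrier R - p \<and> X = loc_frac R p M m s)"
  unfolding loc_mod_def by auto

lemma frac_closed: "m \<in> carrier M \<Longrightarrow> s \<in> carrier R - p \<Longrightarrow> loc_frac R p M m s \<in> carrier (loc_mod R p M)"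
  unfolding loc_mod_carrier by blast

lemma UN2_const:
  assumes "a \<in> A" "b \<in> B" "\<And>x y. x \<in> A \<Longrightarrow> y \<in> B \<Longrightarrow> f x y = c"
  shows "(\<Union>x\<in>A. \<Union>y\<in>B. f x y) = c"
  using assms by blast

lemma frac_add:
  assumes "module R M" "m \<in> carrier M" "s \<in> carrier R - p" "n \<in> carrier M" "t \<in> carrier R - p"
  shows "loc_frac R p M m s \<oplus>\<^bsub>loc_mod R p M\<^esub> loc_frac R p M n t =
    loc_frac R p M (t \<odot>\<^bsub>M\<^esub> m \<oplus>\<^bsub>M\<^esub> s \<odot>\<^bsub>M\<^esub> n) (s \<otimes> t)"
proof -
  interpret M: module R M by fact
  let ?X = "loc_frac R p M m s" and ?Y = "loc_frac R p M n t"
  have *: "loc_frac R p M (t' \<odot>\<^bsub>M\<^esub> m' \<oplus>\<^bsub>M\<^esub> s' \<odot>\<^bsub>M\<^esub> n') (s' \<otimes> t') =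
      loc_frac R p M (t \<odot>\<^bsub>M\<^esub> m \<oplus>\<^bsub>M\<^esub> s \<odot>\<^bsub>M\<^esub> n) (s \<otimes> t)"
    if "(m', s') \<in> ?X" "(n', t') \<in> ?Y" for m' s' n' t'
  proof -
    from that(1) obtain u where 1: "m' \<in> carrier M" "s' \<in> carrier R - p" and u: "u \<in> carrier R - p"
      "u \<odot>\<^bsub>M\<^esub> (s' \<odot>\<^bsub>M\<^esub> m) = u \<odot>\<^bsub>M\<^esub> (s \<odot>\<^bsub>M\<^esub> m')" unfolding frac_mem_iff by blast
    from that(2) obtain v where 2: "n' \<in> carrier M" "t' \<in> carrier R - p" and v: "v \<in> carrier R - p"
      "v \<odot>\<^bsub>M\<^esub> (t' \<odot>\<^bsub>M\<^esub> n) = v \<odot>\<^bsub>M\<^esub> (t \<odot>\<^bsub>M\<^esub> n')" unfolding frac_mem_iff by blast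
    have c: "s \<in> carrier R" "t \<in> carrier R" "u \<in> carrier R" "v \<in> carrier R" "s' \<in> carrier R" "t' \<in> carrier R"
      using assms 1 2 u v by auto
    have eq: "(u \<otimes> v) \<odot>\<^bsub>M\<^esub> ((s \<otimes> t) \<odot>\<^bsub>M\<^esub> (t' \<odot>\<^bsub>M\<^esub> m' \<oplus>\<^bsub>M\<^esub> s' \<odot>\<^bsub>M\<^esub> n')) =
      (v \<otimes> t \<otimes> t') \<odot>\<^bsub>M\<^esub> (u \<odot>\<^bsub>M\<^esub> (s \<odot>\<^bsub>M\<^esub> m')) \<oplus>\<^bsub>M\<^esub> (u \<otimes> s \<otimes> s') \<odot>\<^bsub>M\<^esub> (v \<odot>\<^bsub>M\<^esub> (t \<odot>\<^bsub>M\<^esub> n'))"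
      using c 1(1) 2(1) by (simp add: M.smult_r_distr M.smult_assoc1[symmetric] m_ac)
    have "\<dots> = (u \<otimes> v) \<odot>\<^bsub>M\<^esub> ((s' \<otimes> t') \<odot>\<^bsub>M\<^esub> (t \<odot>\<^bsub>M\<^esub> m \<oplus>\<^bsub>M\<^esub> s \<odot>\<^bsub>M\<^esub> n))"
      unfolding u(2)[symmetric] v(2)[symmetric]
      using c assms(2,4) by (simp add: M.smult_r_distr M.smult_assoc1[symmetric] m_ac)
    with eq have eq': "(u \<otimes> v) \<odot>\<^bsub>M\<^esub> ((s \<otimes> t) \<odot>\<^bsub>M\<^esub> (t' \<odot>\<^bsub>M\<^esub> m' \<oplus>\<^bsub>M\<^esub> s' \<odot>\<^bsub>M\<^esub> n')) =
      (u \<otimes> v) \<odot>\<^bsub>M\<^esub> ((s' \<otimes> t') \<odot>\<^bsub>M\<^esub> (t \<odot>\<^bsub>M\<^esub> m \<oplus>\<^bsub>M\<^esub> s \<odot>\<^bsub>M\<^esub> n))" by simp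
    show ?thesis
      by (rule frac_eqI[OF assms(1) _ mult_denom[OF 1(2) 2(2)] _ mult_denom[OF assms(3,5)]
            mult_denom[OF u(1) v(1)] eq'])
        (use c 1(1) 2(1) assms(2,4) in auto)
  qed
  have "?X \<oplus>\<^bsub>loc_mod R p M\<^esub> ?Y = (\<Union>x\<in>?X. \<Union>y\<in>?Y. case x of (m', s') \<Rightarrow> case y of (n', t') \<Rightarrow>
    loc_frac R p M (t' \<odot>\<^bsub>M\<^esub> m' \<oplus>\<^bsub>M\<^esub> s' \<odot>\<^bsub>M\<^esub> n') (s' \<otimes> t'))"
    by (auto simp: loc_mod_def split: prod.splits)
  also have "\<dots> = loc_frac R p M (t \<odot>\<^bsub>M\<^esub> m \<oplus>\<^bsub>M\<^esub> s \<odot>\<^bsub>M\<^esub> n) (s \<otimes> t)"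
    by (rule UN2_const[OF frac_self[OF assms(1-3)] frac_self[OF assms(1,4,5)]])
      (use * in \<open>auto split: prod.splits\<close>)
  finally show ?thesis .
qed

lemma frac_smult:
  assumes "module R M" "a \<in> carrier R" "s \<in> carrier R - p" "m \<in> carrier M" "t \<in> carrier R - p"
  shows "loc_frac R p (self_mod R) a s \<odot>\<^bsub>loc_mod R p M\<^esub> loc_frac R p M m t =
    loc_frac R p M (a \<odot>\<^bsub>M\<^esub> m) (s \<otimes> t)"
proof -
  interpret M: module R M by fact
  have S: "module R (self_mod R)" by (rule self_mod_module[OF is_cring])
  have aS: "a \<in> carrier (self_mod R)" using assms(2) by simp
  let ?X = "loc_frac R p (self_mod R) a s" and ?Y = "loc_frac R p M m t"
  have *: "loc_frac R p M (a' \<odot>\<^bsub>M\<^esub> m') (s' \<otimes> t') = loc_frac R p M (a \<odot>\<^bsub>M\<^esub> m) (s \<otimes> t)"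
    if "(a', s') \<in> ?X" "(m', t') \<in> ?Y" for a' s' m' t'
  proof -
    from that(1) obtain u where 1: "a' \<in> carrier R" "s' \<in> carrier R - p" and u: "u \<in> carrier R - p"
      "u \<otimes> (s' \<otimes> a) = u \<otimes> (s \<otimes> a')" unfolding frac_mem_iff by auto
    from that(2) obtain v where 2: "m' \<in> carrier M" "t' \<in> carrier R - p" and v: "v \<in> carrier R - p"
      "v \<odot>\<^bsub>M\<^esub> (t' \<odot>\<^bsub>M\<^esub> m) = v \<odot>\<^bsub>M\<^esub> (t \<odot>\<^bsub>M\<^esub> m')" unfolding frac_mem_iff by blast
    have c: "s \<in> carrier R" "t \<in> carrier R" "u \<in> carrier R" "v \<in> carrier R" "s' \<in> carrier R" "t' \<in> carrier R"
      using assms 1 2 u v by auto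
    have eq: "(u \<otimes> v) \<odot>\<^bsub>M\<^esub> ((s \<otimes> t) \<odot>\<^bsub>M\<^esub> (a' \<odot>\<^bsub>M\<^esub> m')) =
      (u \<otimes> (s \<otimes> a')) \<odot>\<^bsub>M\<^esub> (v \<odot>\<^bsub>M\<^esub> (t \<odot>\<^bsub>M\<^esub> m'))"
      using c 1(1) 2(1) by (simp add: M.smult_assoc1[symmetric] m_ac)
    have "\<dots> = (u \<otimes> v) \<odot>\<^bsub>M\<^esub> ((s' \<otimes> t') \<odot>\<^bsub>M\<^esub> (a \<odot>\<^bsub>M\<^esub> m))"
      unfolding u(2)[symmetric] v(2)[symmetric]
      using c assms(2,4) by (simp add: M.smult_assoc1[symmetric] m_ac)
    with eq have eq': "(u \<otimes> v) \<odot>\<^bsub>M\<^esub> ((s \<otimes> t) \<odot>\<^bsub>M\<^esub> (a' \<odot>\<^bsub>M\<^esub> m')) =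
      (u \<otimes> v) \<odot>\<^bsub>M\<^esub> ((s' \<otimes> t') \<odot>\<^bsub>M\<^esub> (a \<odot>\<^bsub>M\<^esub> m))" by simp
    show ?thesis
      by (rule frac_eqI[OF assms(1) _ mult_denom[OF 1(2) 2(2)] _ mult_denom[OF assms(3,5)]
            mult_denom[OF u(1) v(1)] eq'])
        (use c 1(1) 2(1) assms(2,4) in auto)
  qed
  have "?X \<odot>\<^bsub>loc_mod R p M\<^esub> ?Y = (\<Union>x\<in>?X. \<Union>y\<in>?Y. case x of (a', s') \<Rightarrow> case y of (m', t') \<Rightarrow>
    loc_frac R p M (a' \<odot>\<^bsub>M\<^esub> m') (s' \<otimes> t'))"
    by (auto simp: loc_mod_def split: prod.splits)
  also have "\<dots> = loc_frac R p M (a \<odot>\<^bsub>M\<^esub> m) (s \<otimes> t)"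
    by (rule UN2_const[OF frac_self[OF S aS assms(3)] frac_self[OF assms(1,4,5)]])
      (use * in \<open>auto split: prod.splits\<close>)
  finally show ?thesis .
qed

lemma loc_mod_zero: "\<zero>\<^bsub>loc_mod R p M\<^esub> = loc_frac R p M \<zero>\<^bsub>M\<^esub> \<one>"
  by (simp add: loc_mod_def)

lemma frac_zero:
  assumes "module R M" "s \<in> carrier R - p"
  shows "loc_frac R p M \<zero>\<^bsub>M\<^esub> s = \<zero>\<^bsub>loc_mod R p M\<^esub>"
proof -
  interpret M: module R M by fact
  show ?thesis unfolding loc_mod_zero
    by (rule frac_eqI[OF assms(1) _ assms(2) _ one_denom one_denom]) (use assms(2) in auto)
qed

lemma frac_zero_iff:
  assumes "module R M" "m \<in> carrier M" "s \<in> carrier R - p"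
  shows "loc_frac R p M m s = \<zero>\<^bsub>loc_mod R p M\<^esub> \<longleftrightarrow> (\<exists>u\<in>carrier R - p. u \<odot>\<^bsub>M\<^esub> m = \<zero>\<^bsub>M\<^esub>)"
proof -
  interpret M: module R M by fact
  have s: "s \<in> carrier R" using assms(3) by simp
  have "loc_frac R p M m s = \<zero>\<^bsub>loc_mod R p M\<^esub> \<longleftrightarrow>
    (\<exists>u\<in>carrier R - p. u \<odot>\<^bsub>M\<^esub> (\<one> \<odot>\<^bsub>M\<^esub> m) = u \<odot>\<^bsub>M\<^esub> (s \<odot>\<^bsub>M\<^esub> \<zero>\<^bsub>M\<^esub>))"
    unfolding loc_mod_zero by (rule frac_eq_iff[OF assms M.M.zero_closed one_denom])
  also have "\<dots> \<longleftrightarrow> (\<exists>u\<in>carrier R - p. u \<odot>\<^bsub>M\<^esub> m = \<zero>\<^bsub>M\<^esub>)"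
    by (rule bex_cong[OF refl]) (use s assms(2) in simp)
  finally show ?thesis .
qed

lemma frac_add_same:
  assumes "module R M" "m \<in> carrier M" "n \<in> carrier M" "s \<in> carrier R - p"
  shows "loc_frac R p M m s \<oplus>\<^bsub>loc_mod R p M\<^esub> loc_frac R p M n s = loc_frac R p M (m \<oplus>\<^bsub>M\<^esub> n) s"
proof -
  interpret M: module R M by fact
  have "s \<odot>\<^bsub>M\<^esub> m \<oplus>\<^bsub>M\<^esub> s \<odot>\<^bsub>M\<^esub> n = s \<odot>\<^bsub>M\<^esub> (m \<oplus>\<^bsub>M\<^esub> n)" using assms by (simp add: M.smult_r_distr)
  thus ?thesis
    using frac_add[OF assms(1,2,4,3,4)] frac_expand[OF assms(1) M.M.a_closed[OF assms(2,3)] assms(4,4)] by simp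
qed

text \<open>Over a common denominator, addition of fractions is addition of numerators, and the axioms for the
  localized module reduce to those for \<open>M\<close>.\<close>

lemma common_denom2:
  assumes "module R M" "X \<in> carrier (loc_mod R p M)" "Y \<in> carrier (loc_mod R p M)"
  shows "\<exists>m\<in>carrier M. \<exists>n\<in>carrier M. \<exists>s\<in>carrier R - p. X = loc_frac R p M m s \<and> Y = loc_frac R p M n s"
proof -
  interpret M: module R M by fact
  obtain m s where X: "m \<in> carrier M" "s \<in> carrier R - p" "X = loc_frac R p M m s"
    using assms(2) unfolding loc_mod_carrier by blast
  obtain n t where Y: "n \<in> carrier M" "t \<in> carrier R - p" "Y = loc_frac R p M n t"
    using assms(3) unfolding loc_mod_carrier by blast
  have "X = loc_frac R p M (t \<odot>\<^bsub>M\<^esub> m) (s \<otimes> t)" using frac_expand[OF assms(1) X(1,2) Y(2)] X(3) by simp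
  moreover have "Y = loc_frac R p M (s \<odot>\<^bsub>M\<^esub> n) (s \<otimes> t)"
    using frac_expand[OF assms(1) Y(1,2) X(2)] Y(3) m_comm[of s t] X(2) Y(2) by simp
  moreover have "t \<odot>\<^bsub>M\<^esub> m \<in> carrier M" "s \<odot>\<^bsub>M\<^esub> n \<in> carrier M" using X Y by auto
  ultimately show ?thesis using mult_denom[OF X(2) Y(2)] by blast
qed

lemma common_denom3:
  assumes "module R M" "X \<in> carrier (loc_mod R p M)" "Y \<in> carrier (loc_mod R p M)" "Z \<in> carrier (loc_mod R p M)"
  shows "\<exists>m\<in>carrier M. \<exists>n\<in>carrier M. \<exists>q\<in>carrier M. \<exists>s\<in>carrier R - p.
    X = loc_frac R p M m s \<and> Y = loc_frac R p M n s \<and> Z = loc_frac R p M q s"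
proof -
  interpret M: module R M by fact
  obtain m n s where X: "m \<in> carrier M" "n \<in> carrier M" "s \<in> carrier R - p" "X = loc_frac R p M m s" "Y = loc_frac R p M n s"
    using common_denom2[OF assms(1-3)] by blast
  obtain q t where Z: "q \<in> carrier M" "t \<in> carrier R - p" "Z = loc_frac R p M q t"
    using assms(4) unfolding loc_mod_carrier by blast
  have "X = loc_frac R p M (t \<odot>\<^bsub>M\<^esub> m) (s \<otimes> t)" using frac_expand[OF assms(1) X(1,3) Z(2)] X(4) by simp
  moreover have "Y = loc_frac R p M (t \<odot>\<^bsub>M\<^esub> n) (s \<otimes> t)" using frac_expand[OF assms(1) X(2,3) Z(2)] X(5) by simp
  moreover have "Z = loc_frac R p M (s \<odot>\<^bsub>M\<^esub> q) (s \<otimes> t)"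
    using frac_expand[OF assms(1) Z(1,2) X(3)] Z(3) m_comm[of s t] X(3) Z(2) by simp
  moreover have "t \<odot>\<^bsub>M\<^esub> m \<in> carrier M" "t \<odot>\<^bsub>M\<^esub> n \<in> carrier M" "s \<odot>\<^bsub>M\<^esub> q \<in> carrier M" using X Z by auto
  ultimately show ?thesis using mult_denom[OF X(3) Z(2)] by blast
qed

lemma loc_mod_abelian_group:
  assumes "module R M" shows "abelian_group (loc_mod R p M)"
proof (rule abelian_groupI)
  interpret M: module R M by fact
  note add = frac_add_same[OF assms]
  show "\<zero>\<^bsub>loc_mod R p M\<^esub> \<in> carrier (loc_mod R p M)"
    unfolding loc_mod_zero by (rule frac_closed[OF M.M.zero_closed one_denom])
  {
    fix X Y assume "X \<in> carrier (loc_mod R p M)" "Y \<in> carrier (loc_mod R p M)"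
    from common_denom2[OF assms this] obtain m n s where X: "m \<in> carrier M" "n \<in> carrier M" "s \<in> carrier R - p"
      "X = loc_frac R p M m s" "Y = loc_frac R p M n s" by blast
    show "X \<oplus>\<^bsub>loc_mod R p M\<^esub> Y \<in> carrier (loc_mod R p M)"
      unfolding X(4,5) add[OF X(1,2,3)] by (rule frac_closed[OF M.M.a_closed[OF X(1,2)] X(3)])
    show "X \<oplus>\<^bsub>loc_mod R p M\<^esub> Y = Y \<oplus>\<^bsub>loc_mod R p M\<^esub> X"
      unfolding X(4,5) add[OF X(1,2,3)] add[OF X(2,1,3)] using M.M.a_comm[OF X(1,2)] by simp
  }
  {
    fix X Y Z assume "X \<in> carrier (loc_mod R p M)" "Y \<in> carrier (loc_mod R p M)" "Z \<in> carrier (loc_mod R p M)"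
    from common_denom3[OF assms this] obtain m n q s where X: "m \<in> carrier M" "n \<in> carrier M" "q \<in> carrier M"
      "s \<in> carrier R - p" "X = loc_frac R p M m s" "Y = loc_frac R p M n s" "Z = loc_frac R p M q s" by blast
    have mn: "m \<oplus>\<^bsub>M\<^esub> n \<in> carrier M" "n \<oplus>\<^bsub>M\<^esub> q \<in> carrier M" using X by auto
    show "X \<oplus>\<^bsub>loc_mod R p M\<^esub> Y \<oplus>\<^bsub>loc_mod R p M\<^esub> Z = X \<oplus>\<^bsub>loc_mod R p M\<^esub> (Y \<oplus>\<^bsub>loc_mod R p M\<^esub> Z)"
      unfolding X(5-7) add[OF X(1,2,4)] add[OF X(2,3,4)] add[OF mn(1) X(3,4)] add[OF X(1) mn(2) X(4)]
        M.M.a_assoc[OF X(1-3)] ..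
  }
  fix X assume "X \<in> carrier (loc_mod R p M)"
  then obtain m s where X: "m \<in> carrier M" "s \<in> carrier R - p" "X = loc_frac R p M m s"
    unfolding loc_mod_carrier by blast
  show "\<zero>\<^bsub>loc_mod R p M\<^esub> \<oplus>\<^bsub>loc_mod R p M\<^esub> X = X"
    unfolding X(3) frac_zero[OF assms X(2), symmetric] add[OF M.M.zero_closed X(1,2)] M.M.l_zero[OF X(1)] ..
  have "loc_frac R p M (\<ominus>\<^bsub>M\<^esub> m) s \<oplus>\<^bsub>loc_mod R p M\<^esub> X = \<zero>\<^bsub>loc_mod R p M\<^esub>"
    unfolding X(3) add[OF M.M.a_inv_closed[OF X(1)] X(1,2)] M.M.l_neg[OF X(1)] by (rule frac_zero[OF assms X(2)])
  thus "\<exists>Y\<in>carrier (loc_mod R p M). Y \<oplus>\<^bsub>loc_mod R p M\<^esub> X = \<zero>\<^bsub>loc_mod R p M\<^esub>"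
    using frac_closed[OF M.M.a_inv_closed[OF X(1)] X(2)] by blast
qed

abbreviation "fr \<equiv> loc_frac R p (self_mod R)"

lemma self: "module R (self_mod R)"
  by (rule self_mod_module[OF is_cring])

lemma loc_ring_simps:
  "carrier (loc_ring R p) = carrier (loc_mod R p (self_mod R))" "\<zero>\<^bsub>loc_ring R p\<^esub> = \<zero>\<^bsub>loc_mod R p (self_mod R)\<^esub>"
  "\<one>\<^bsub>loc_ring R p\<^esub> = fr \<one> \<one>" "X \<oplus>\<^bsub>loc_ring R p\<^esub> Y = X \<oplus>\<^bsub>loc_mod R p (self_mod R)\<^esub> Y"
  "X \<otimes>\<^bsub>loc_ring R p\<^esub> Y = X \<odot>\<^bsub>loc_mod R p (self_mod R)\<^esub> Y"
  by (simp_all add: loc_ring_def)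

lemma loc_ring_carrier:
  "X \<in> carrier (loc_ring R p) \<longleftrightarrow> (\<exists>a s. a \<in> carrier R \<and> s \<in> carrier R - p \<and> X = fr a s)"
  unfolding loc_ring_simps loc_mod_carrier by simp

lemma fr_closed: "a \<in> carrier R \<Longrightarrow> s \<in> carrier R - p \<Longrightarrow> fr a s \<in> carrier (loc_ring R p)"
  unfolding loc_ring_carrier by blast

lemma fr_add: "a \<in> carrier R \<Longrightarrow> b \<in> carrier R \<Longrightarrow> s \<in> carrier R - p \<Longrightarrow>
    fr a s \<oplus>\<^bsub>loc_ring R p\<^esub> fr b s = fr (a \<oplus> b) s"
  using frac_add_same[OF self, of a b s] by (simp add: loc_ring_simps)

lemma fr_mult: "a \<in> carrier R \<Longrightarrow> s \<in> carrier R - p \<Longrightarrow> b \<in> carrier R \<Longrightarrow> t \<in> carrier R - p \<Longrightarrow>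
    fr a s \<otimes>\<^bsub>loc_ring R p\<^esub> fr b t = fr (a \<otimes> b) (s \<otimes> t)"
  using frac_smult[OF self, of a s b t] by (simp add: loc_ring_simps)

lemma fr_cancel: "a \<in> carrier R \<Longrightarrow> s \<in> carrier R - p \<Longrightarrow> t \<in> carrier R - p \<Longrightarrow> fr (t \<otimes> a) (s \<otimes> t) = fr a s"
  using frac_expand[OF self, of a s t] by simp

lemma fr_common2:
  "X \<in> carrier (loc_ring R p) \<Longrightarrow> Y \<in> carrier (loc_ring R p) \<Longrightarrow>
    \<exists>a\<in>carrier R. \<exists>b\<in>carrier R. \<exists>s\<in>carrier R - p. X = fr a s \<and> Y = fr b s"
  using common_denom2[OF self, of X Y] unfolding loc_ring_simps by simp

lemma loc_ring_cring: "cring (loc_ring R p)"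
proof (rule cringI)
  let ?S = "loc_ring R p"
  show "abelian_group ?S"
    by (rule abelian_group_cong[OF loc_mod_abelian_group[OF self]]) (simp_all add: loc_ring_def)
  show "comm_monoid ?S"
  proof (rule comm_monoidI)
    show "\<one>\<^bsub>?S\<^esub> \<in> carrier ?S" unfolding loc_ring_simps(3) by (rule fr_closed[OF one_closed one_denom])
  next
    fix X Y assume "X \<in> carrier ?S" "Y \<in> carrier ?S"
    then obtain a s b t where X: "a \<in> carrier R" "s \<in> carrier R - p" "X = fr a s"
      and Y: "b \<in> carrier R" "t \<in> carrier R - p" "Y = fr b t" unfolding loc_ring_carrier by blast
    show "X \<otimes>\<^bsub>?S\<^esub> Y \<in> carrier ?S"
      unfolding X(3) Y(3) fr_mult[OF X(1,2) Y(1,2)] by (rule fr_closed[OF m_closed[OF X(1) Y(1)] mult_denom[OF X(2) Y(2)]])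
    show "X \<otimes>\<^bsub>?S\<^esub> Y = Y \<otimes>\<^bsub>?S\<^esub> X"
      unfolding X(3) Y(3) fr_mult[OF X(1,2) Y(1,2)] fr_mult[OF Y(1,2) X(1,2)]
      using m_comm[of a b] m_comm[of s t] X Y by simp
  next
    fix X Y Z assume "X \<in> carrier ?S" "Y \<in> carrier ?S" "Z \<in> carrier ?S"
    then obtain a s b t c u where X: "a \<in> carrier R" "s \<in> carrier R - p" "X = fr a s"
      and Y: "b \<in> carrier R" "t \<in> carrier R - p" "Y = fr b t"
      and Z: "c \<in> carrier R" "u \<in> carrier R - p" "Z = fr c u" unfolding loc_ring_carrier by blast
    show "X \<otimes>\<^bsub>?S\<^esub> Y \<otimes>\<^bsub>?S\<^esub> Z = X \<otimes>\<^bsub>?S\<^esub> (Y \<otimes>\<^bsub>?S\<^esub> Z)"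
      unfolding X(3) Y(3) Z(3) fr_mult[OF X(1,2) Y(1,2)] fr_mult[OF Y(1,2) Z(1,2)]
        fr_mult[OF m_closed[OF X(1) Y(1)] mult_denom[OF X(2) Y(2)] Z(1,2)]
        fr_mult[OF X(1,2) m_closed[OF Y(1) Z(1)] mult_denom[OF Y(2) Z(2)]]
      using m_assoc[OF X(1) Y(1) Z(1)] m_assoc[of s t u] X Y Z by simp
  next
    fix X assume "X \<in> carrier ?S"
    then obtain a s where X: "a \<in> carrier R" "s \<in> carrier R - p" "X = fr a s" unfolding loc_ring_carrier by blast
    show "\<one>\<^bsub>?S\<^esub> \<otimes>\<^bsub>?S\<^esub> X = X"
      unfolding X(3) loc_ring_simps(3) fr_mult[OF one_closed one_denom X(1,2)] using X by simp
  qed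
next
  let ?S = "loc_ring R p"
  fix X Y Z assume XYZ: "X \<in> carrier ?S" "Y \<in> carrier ?S" "Z \<in> carrier ?S"
  from fr_common2[OF XYZ(1,2)] obtain a b s where X: "a \<in> carrier R" "b \<in> carrier R" "s \<in> carrier R - p"
    "X = fr a s" "Y = fr b s" by blast
  from XYZ(3) obtain c u where Z: "c \<in> carrier R" "u \<in> carrier R - p" "Z = fr c u" unfolding loc_ring_carrier by blast
  show "(X \<oplus>\<^bsub>?S\<^esub> Y) \<otimes>\<^bsub>?S\<^esub> Z = X \<otimes>\<^bsub>?S\<^esub> Z \<oplus>\<^bsub>?S\<^esub> Y \<otimes>\<^bsub>?S\<^esub> Z"
    unfolding X(4,5) Z(3) fr_add[OF X(1,2,3)] fr_mult[OF X(1,3) Z(1,2)] fr_mult[OF X(2,3) Z(1,2)]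
      fr_mult[OF a_closed[OF X(1,2)] X(3) Z(1,2)]
      fr_add[OF m_closed[OF X(1) Z(1)] m_closed[OF X(2) Z(1)] mult_denom[OF X(3) Z(2)]]
      l_distr[OF X(1,2) Z(1)] ..
qed

lemma loc_mod_module:
  assumes "module R M" shows "module (loc_ring R p) (loc_mod R p M)"
proof (rule moduleI[OF loc_ring_cring loc_mod_abelian_group[OF assms]])
  interpret M: module R M by fact
  note sm = frac_smult[OF assms] and add = frac_add_same[OF assms]
  fix A X assume "A \<in> carrier (loc_ring R p)" and "X \<in> carrier (loc_mod R p M)"
  then obtain a s m t where A: "a \<in> carrier R" "s \<in> carrier R - p" "A = fr a s"
    and X: "m \<in> carrier M" "t \<in> carrier R - p" "X = loc_frac R p M m t"
    unfolding loc_ring_carrier loc_mod_carrier by blast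
  show "A \<odot>\<^bsub>loc_mod R p M\<^esub> X \<in> carrier (loc_mod R p M)"
    unfolding A(3) X(3) sm[OF A(1,2) X(1,2)]
    by (rule frac_closed[OF M.smult_closed[OF A(1) X(1)] mult_denom[OF A(2) X(2)]])
next
  interpret M: module R M by fact
  note sm = frac_smult[OF assms] and add = frac_add_same[OF assms]
  fix A B X assume AB: "A \<in> carrier (loc_ring R p)" "B \<in> carrier (loc_ring R p)" and "X \<in> carrier (loc_mod R p M)"
  then obtain m t where X: "m \<in> carrier M" "t \<in> carrier R - p" "X = loc_frac R p M m t"
    unfolding loc_mod_carrier by blast
  from fr_common2[OF AB] obtain a b s where A: "a \<in> carrier R" "b \<in> carrier R" "s \<in> carrier R - p"
    "A = fr a s" "B = fr b s" by blast
  show "(A \<oplus>\<^bsub>loc_ring R p\<^esub> B) \<odot>\<^bsub>loc_mod R p M\<^esub> X = A \<odot>\<^bsub>loc_mod R p M\<^esub> X \<oplus>\<^bsub>loc_mod R p M\<^esub> B \<odot>\<^bsub>loc_mod R p M\<^esub> X"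
    unfolding A(4,5) X(3) fr_add[OF A(1,2,3)] sm[OF a_closed[OF A(1,2)] A(3) X(1,2)] sm[OF A(1,3) X(1,2)] sm[OF A(2,3) X(1,2)]
      add[OF M.smult_closed[OF A(1) X(1)] M.smult_closed[OF A(2) X(1)] mult_denom[OF A(3) X(2)]]
      M.smult_l_distr[OF A(1,2) X(1)] ..
  show "(A \<otimes>\<^bsub>loc_ring R p\<^esub> B) \<odot>\<^bsub>loc_mod R p M\<^esub> X = A \<odot>\<^bsub>loc_mod R p M\<^esub> (B \<odot>\<^bsub>loc_mod R p M\<^esub> X)"
    unfolding A(4,5) X(3) fr_mult[OF A(1,3) A(2,3)] sm[OF m_closed[OF A(1,2)] mult_denom[OF A(3,3)] X(1,2)]
      sm[OF A(2,3) X(1,2)] sm[OF A(1,3) M.smult_closed[OF A(2) X(1)] mult_denom[OF A(3) X(2)]]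
      M.smult_assoc1[OF A(1,2) X(1)]
    using m_assoc[of s s t] A(3) X(2) by simp
next
  interpret M: module R M by fact
  note sm = frac_smult[OF assms] and add = frac_add_same[OF assms]
  fix A X Y assume "A \<in> carrier (loc_ring R p)" and XY: "X \<in> carrier (loc_mod R p M)" "Y \<in> carrier (loc_mod R p M)"
  then obtain a s where A: "a \<in> carrier R" "s \<in> carrier R - p" "A = fr a s" unfolding loc_ring_carrier by blast
  from common_denom2[OF assms XY] obtain m n t where X: "m \<in> carrier M" "n \<in> carrier M" "t \<in> carrier R - p"
    "X = loc_frac R p M m t" "Y = loc_frac R p M n t" by blast
  show "A \<odot>\<^bsub>loc_mod R p M\<^esub> (X \<oplus>\<^bsub>loc_mod R p M\<^esub> Y) = A \<odot>\<^bsub>loc_mod R p M\<^esub> X \<oplus>\<^bsub>loc_mod R p M\<^esub> A \<odot>\<^bsub>loc_mod R p M\<^esub> Y"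
    unfolding A(3) X(4,5) add[OF X(1-3)] sm[OF A(1,2) M.M.a_closed[OF X(1,2)] X(3)] sm[OF A(1,2) X(1,3)] sm[OF A(1,2) X(2,3)]
      add[OF M.smult_closed[OF A(1) X(1)] M.smult_closed[OF A(1) X(2)] mult_denom[OF A(2) X(3)]]
      M.smult_r_distr[OF A(1) X(1,2)] ..
next
  interpret M: module R M by fact
  fix X assume "X \<in> carrier (loc_mod R p M)"
  then obtain m t where X: "m \<in> carrier M" "t \<in> carrier R - p" "X = loc_frac R p M m t"
    unfolding loc_mod_carrier by blast
  show "\<one>\<^bsub>loc_ring R p\<^esub> \<odot>\<^bsub>loc_mod R p M\<^esub> X = X"
    unfolding X(3) loc_ring_simps(3) frac_smult[OF assms one_closed one_denom X(1,2)] using X by simp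
qed

text \<open>The maximal ideal of the local ring.\<close>

definition loc_ideal :: "('a \<times> 'a) set set" where
  "loc_ideal = {fr a s | a s. a \<in> p \<and> s \<in> carrier R - p}"

lemma loc_ideal_subset: "loc_ideal \<subseteq> carrier (loc_ring R p)"
proof
  fix X assume "X \<in> loc_ideal"
  then obtain a s where "a \<in> p" "s \<in> carrier R - p" "X = fr a s" unfolding loc_ideal_def by blast
  thus "X \<in> carrier (loc_ring R p)" using fr_closed[OF Icarr, of a s] by simp
qed

lemma loc_ideal_submodule: "submodule loc_ideal (loc_ring R p) (self_mod (loc_ring R p))"
  unfolding submodule_iff[OF self_mod_module[OF loc_ring_cring]] self_mod_simps
proof (intro conjI ballI)
  show "loc_ideal \<subseteq> carrier (loc_ring R p)" by (rule loc_ideal_subset)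
  have "\<zero>\<^bsub>loc_ring R p\<^esub> = fr \<zero> \<one>" unfolding loc_ring_simps loc_mod_zero by simp
  thus "\<zero>\<^bsub>loc_ring R p\<^esub> \<in> loc_ideal" unfolding loc_ideal_def using zero_closed one_denom additive_subgroup.zero_closed[OF is_additive_subgroup] by blast
next
  fix X Y assume "X \<in> loc_ideal" "Y \<in> loc_ideal"
  then obtain a s b t where X: "a \<in> p" "s \<in> carrier R - p" "X = fr a s"
    and Y: "b \<in> p" "t \<in> carrier R - p" "Y = fr b t" unfolding loc_ideal_def by blast
  have c: "a \<in> carrier R" "b \<in> carrier R" "s \<in> carrier R" "t \<in> carrier R" using X Y Icarr by auto
  have X': "X = fr (t \<otimes> a) (s \<otimes> t)" using fr_cancel[OF c(1) X(2) Y(2)] X(3) by simp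
  have Y': "Y = fr (s \<otimes> b) (s \<otimes> t)" using fr_cancel[OF c(2) Y(2) X(2)] Y(3) m_comm[of s t] c by simp
  have "X \<oplus>\<^bsub>loc_ring R p\<^esub> Y = fr (t \<otimes> a \<oplus> s \<otimes> b) (s \<otimes> t)"
    unfolding X' Y' by (rule fr_add[OF _ _ mult_denom[OF X(2) Y(2)]]) (use c in auto)
  moreover have "t \<otimes> a \<oplus> s \<otimes> b \<in> p"
    using additive_subgroup.a_closed[OF is_additive_subgroup I_l_closed[OF X(1) c(4)] I_l_closed[OF Y(1) c(3)]] .
  ultimately show "X \<oplus>\<^bsub>loc_ring R p\<^esub> Y \<in> loc_ideal"
    unfolding loc_ideal_def using mult_denom[OF X(2) Y(2)] by blast
next
  fix A X assume "A \<in> carrier (loc_ring R p)" "X \<in> loc_ideal"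
  then obtain a s b t where A: "a \<in> carrier R" "s \<in> carrier R - p" "A = fr a s"
    and X: "b \<in> p" "t \<in> carrier R - p" "X = fr b t" unfolding loc_ideal_def loc_ring_carrier by blast
  have b: "b \<in> carrier R" using X(1) Icarr by auto
  have "A \<otimes>\<^bsub>loc_ring R p\<^esub> X = fr (a \<otimes> b) (s \<otimes> t)" unfolding A(3) X(3) by (rule fr_mult[OF A(1,2) b X(2)])
  thus "A \<otimes>\<^bsub>loc_ring R p\<^esub> X \<in> loc_ideal"
    unfolding loc_ideal_def using I_l_closed[OF X(1) A(1)] mult_denom[OF A(2) X(2)] by blast
qed

lemma one_notin_loc_ideal: "\<one>\<^bsub>loc_ring R p\<^esub> \<notin> loc_ideal"
proof
  assume "\<one>\<^bsub>loc_ring R p\<^esub> \<in> loc_ideal"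
  then obtain a s where a: "a \<in> p" "s \<in> carrier R - p" "fr \<one> \<one> = fr a s"
    unfolding loc_ideal_def loc_ring_simps(3) by blast
  have ac: "a \<in> carrier R" "s \<in> carrier R" using a Icarr by auto
  obtain u where u: "u \<in> carrier R - p" "u \<otimes> (s \<otimes> \<one>) = u \<otimes> (\<one> \<otimes> a)"
    using a(3) frac_eq_iff[OF self _ one_denom _ a(2), of \<one> a] ac by auto
  have "u \<otimes> s = u \<otimes> a" using u ac by simp
  moreover have "u \<otimes> a \<in> p" by (rule I_l_closed[OF a(1)]) (use u in simp)
  ultimately show False using mult_denom[OF u(1) a(2)] by simp
qed

lemma loc_ring_local:
  assumes "X \<in> carrier (loc_ring R p)" "X \<notin> loc_ideal"
  shows "\<exists>Y\<in>carrier (loc_ring R p). Y \<otimes>\<^bsub>loc_ring R p\<^esub> X = \<one>\<^bsub>loc_ring R p\<^esub>"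
proof -
  obtain a s where X: "a \<in> carrier R" "s \<in> carrier R - p" "X = fr a s"
    using assms(1) unfolding loc_ring_carrier by blast
  have a: "a \<in> carrier R - p" using X assms(2) unfolding loc_ideal_def by blast
  have s: "s \<in> carrier R" using X(2) by simp
  have "fr s a \<otimes>\<^bsub>loc_ring R p\<^esub> X = fr (s \<otimes> a) (a \<otimes> s)" unfolding X(3) by (rule fr_mult[OF s a X(1,2)])
  also have "\<dots> = fr ((a \<otimes> s) \<otimes> \<one>) (\<one> \<otimes> (a \<otimes> s))" using m_comm[OF s X(1)] s X(1) by simp
  also have "\<dots> = fr \<one> \<one>" by (rule fr_cancel[OF one_closed one_denom mult_denom[OF a X(2)]])
  finally show ?thesis using fr_closed[OF s a] unfolding loc_ring_simps(3) by blast
qed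

subsection \<open>Localization of complexes\<close>

lemma loc_diff_frac:
  assumes "chain_complex R X" "m \<in> carrier (cx_mod X i)" "s \<in> carrier R - p"
  shows "cx_diff (loc_cx R p X) i (loc_frac R p (cx_mod X i) m s) =
    loc_frac R p (cx_mod X (i - 1)) (cx_diff X i m) s"
proof -
  note mX = chain_complexD(1)[OF assms(1)] and d = chain_complexD(2)[OF assms(1)]
  let ?F = "loc_frac R p (cx_mod X i) m s"
  have "loc_frac R p (cx_mod X (i - 1)) (cx_diff X i n) t = loc_frac R p (cx_mod X (i - 1)) (cx_diff X i m) s"
    if "(n, t) \<in> ?F" for n t
  proof -
    from that obtain u where 1: "n \<in> carrier (cx_mod X i)" "t \<in> carrier R - p" and u: "u \<in> carrier R - p"
      "u \<odot>\<^bsub>cx_mod X i\<^esub> (t \<odot>\<^bsub>cx_mod X i\<^esub> m) = u \<odot>\<^bsub>cx_mod X i\<^esub> (s \<odot>\<^bsub>cx_mod X i\<^esub> n)" unfolding frac_mem_iff by blast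
    have c: "u \<in> carrier R" "t \<in> carrier R" "s \<in> carrier R" using u 1 assms by auto
    interpret M: module R "cx_mod X i" by (rule mX)
    have "u \<odot>\<^bsub>cx_mod X (i - 1)\<^esub> (s \<odot>\<^bsub>cx_mod X (i - 1)\<^esub> cx_diff X i n) =
        cx_diff X i (u \<odot>\<^bsub>cx_mod X i\<^esub> (s \<odot>\<^bsub>cx_mod X i\<^esub> n))"
      using mod_hom_smult[OF d c(1) M.smult_closed[OF c(3) 1(1)]] mod_hom_smult[OF d c(3) 1(1)] by simp
    also have "\<dots> = u \<odot>\<^bsub>cx_mod X (i - 1)\<^esub> (t \<odot>\<^bsub>cx_mod X (i - 1)\<^esub> cx_diff X i m)"
      unfolding u(2)[symmetric]
      using mod_hom_smult[OF d c(1) M.smult_closed[OF c(2) assms(2)]] mod_hom_smult[OF d c(2) assms(2)] by simp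
    finally show ?thesis
      by (rule frac_eqI[OF mX mod_hom_closed[OF d 1(1)] 1(2) mod_hom_closed[OF d assms(2)] assms(3) u(1)])
  qed
  hence "(\<Union>x\<in>?F. case x of (n, t) \<Rightarrow> loc_frac R p (cx_mod X (i - 1)) (cx_diff X i n) t) =
      loc_frac R p (cx_mod X (i - 1)) (cx_diff X i m) s"
    by (intro UN_constant_eq[OF frac_self[OF mX assms(2,3)]]) auto
  thus ?thesis by (simp add: loc_cx_def)
qed

lemma loc_cx_mod [simp]: "cx_mod (loc_cx R p X) i = loc_mod R p (cx_mod X i)"
  by (simp add: loc_cx_def)

lemma loc_cx_chain_complex:
  assumes "chain_complex R X" shows "chain_complex (loc_ring R p) (loc_cx R p X)"
  unfolding chain_complex_def loc_cx_mod
proof (intro conjI allI ballI)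
  note mX = chain_complexD(1)[OF assms] and d = chain_complexD(2)[OF assms]
  note df = loc_diff_frac[OF assms]
  fix i
  show "module (loc_ring R p) (loc_mod R p (cx_mod X i))" by (rule loc_mod_module[OF mX])
  interpret M: module R "cx_mod X i" by (rule mX)
  show "cx_diff (loc_cx R p X) i \<in> mod_hom (loc_ring R p) (loc_mod R p (cx_mod X i)) (loc_mod R p (cx_mod X (i - 1)))"
  proof (rule mod_homI)
    fix F assume "F \<in> carrier (loc_mod R p (cx_mod X i))"
    then obtain m s where F: "m \<in> carrier (cx_mod X i)" "s \<in> carrier R - p" "F = loc_frac R p (cx_mod X i) m s"
      unfolding loc_mod_carrier by blast
    show "cx_diff (loc_cx R p X) i F \<in> carrier (loc_mod R p (cx_mod X (i - 1)))"
      unfolding F(3) df[OF F(1,2)] by (rule frac_closed[OF mod_hom_closed[OF d F(1)] F(2)])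
  next
    fix F G assume FG: "F \<in> carrier (loc_mod R p (cx_mod X i))" "G \<in> carrier (loc_mod R p (cx_mod X i))"
    from common_denom2[OF mX FG] obtain m n s where F: "m \<in> carrier (cx_mod X i)" "n \<in> carrier (cx_mod X i)"
      "s \<in> carrier R - p" "F = loc_frac R p (cx_mod X i) m s" "G = loc_frac R p (cx_mod X i) n s" by blast
    show "cx_diff (loc_cx R p X) i (F \<oplus>\<^bsub>loc_mod R p (cx_mod X i)\<^esub> G) =
      cx_diff (loc_cx R p X) i F \<oplus>\<^bsub>loc_mod R p (cx_mod X (i - 1))\<^esub> cx_diff (loc_cx R p X) i G"
      unfolding F(4,5) frac_add_same[OF mX F(1-3)] df[OF F(1,3)] df[OF F(2,3)] df[OF M.M.a_closed[OF F(1,2)] F(3)]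
        frac_add_same[OF mX mod_hom_closed[OF d F(1)] mod_hom_closed[OF d F(2)] F(3)]
        mod_hom_add[OF d F(1,2)] ..
  next
    fix A F assume "A \<in> carrier (loc_ring R p)" "F \<in> carrier (loc_mod R p (cx_mod X i))"
    then obtain a t m s where A: "a \<in> carrier R" "t \<in> carrier R - p" "A = fr a t"
      and F: "m \<in> carrier (cx_mod X i)" "s \<in> carrier R - p" "F = loc_frac R p (cx_mod X i) m s"
      unfolding loc_mod_carrier loc_ring_carrier by blast
    show "cx_diff (loc_cx R p X) i (A \<odot>\<^bsub>loc_mod R p (cx_mod X i)\<^esub> F) =
      A \<odot>\<^bsub>loc_mod R p (cx_mod X (i - 1))\<^esub> cx_diff (loc_cx R p X) i F"
      unfolding A(3) F(3) frac_smult[OF mX A(1,2) F(1,2)] df[OF F(1,2)]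
        df[OF M.smult_closed[OF A(1) F(1)] mult_denom[OF A(2) F(2)]]
        frac_smult[OF mX A(1,2) mod_hom_closed[OF d F(1)] F(2)] mod_hom_smult[OF d A(1) F(1)] ..
  qed
  fix F assume "F \<in> carrier (loc_mod R p (cx_mod X i))"
  then obtain m s where F: "m \<in> carrier (cx_mod X i)" "s \<in> carrier R - p" "F = loc_frac R p (cx_mod X i) m s"
    unfolding loc_mod_carrier by blast
  show "cx_diff (loc_cx R p X) (i - 1) (cx_diff (loc_cx R p X) i F) = \<zero>\<^bsub>loc_mod R p (cx_mod X (i - 1 - 1))\<^esub>"
    unfolding F(3) df[OF F(1,2)] df[OF mod_hom_closed[OF d F(1)] F(2)] chain_complexD(3)[OF assms F(1)]
    by (rule frac_zero[OF mX F(2)])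
qed

text \<open>A numerator becomes a cycle after multiplication by an element outside \<open>p\<close> that annihilates its
  differential.\<close>

lemma loc_cycles:
  assumes "chain_complex R X" "F \<in> cycles (loc_cx R p X) i"
  shows "\<exists>z\<in>cycles X i. \<exists>s\<in>carrier R - p. F = loc_frac R p (cx_mod X i) z s"
proof -
  note mX = chain_complexD(1)[OF assms(1)] and d = chain_complexD(2)[OF assms(1)]
  interpret M: module R "cx_mod X i" by (rule mX)
  obtain m s where F: "m \<in> carrier (cx_mod X i)" "s \<in> carrier R - p" "F = loc_frac R p (cx_mod X i) m s"
    using cycles_closed[OF assms(2)] unfolding loc_cx_mod loc_mod_carrier by blast
  have "loc_frac R p (cx_mod X (i - 1)) (cx_diff X i m) s = \<zero>\<^bsub>loc_mod R p (cx_mod X (i - 1))\<^esub>"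
    using assms(2) unfolding cycles_def F(3) loc_cx_mod by (simp add: loc_diff_frac[OF assms(1) F(1,2)])
  then obtain u where u: "u \<in> carrier R - p" "u \<odot>\<^bsub>cx_mod X (i - 1)\<^esub> cx_diff X i m = \<zero>\<^bsub>cx_mod X (i - 1)\<^esub>"
    using frac_zero_iff[OF mX mod_hom_closed[OF d F(1)] F(2)] by blast
  have uc: "u \<in> carrier R" using u(1) by simp
  have "u \<odot>\<^bsub>cx_mod X i\<^esub> m \<in> cycles X i"
    using u(2) mod_hom_smult[OF d uc F(1)] M.smult_closed[OF uc F(1)] by (simp add: cycles_def)
  moreover have "F = loc_frac R p (cx_mod X i) (u \<odot>\<^bsub>cx_mod X i\<^esub> m) (s \<otimes> u)"
    unfolding F(3) by (rule frac_expand[OF mX F(1,2) u(1)])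
  ultimately show ?thesis using mult_denom[OF F(2) u(1)] by blast
qed

lemma loc_boundaries:
  assumes "chain_complex R X" "b \<in> boundaries X i" "s \<in> carrier R - p"
  shows "loc_frac R p (cx_mod X i) b s \<in> boundaries (loc_cx R p X) i"
proof -
  obtain y where y: "y \<in> carrier (cx_mod X (i + 1))" "b = cx_diff X (i + 1) y"
    using assms(2) unfolding boundaries_def by blast
  have "loc_frac R p (cx_mod X i) b s = cx_diff (loc_cx R p X) (i + 1) (loc_frac R p (cx_mod X (i + 1)) y s)"
    using loc_diff_frac[OF assms(1) y(1) assms(3)] y(2) by simp
  thus ?thesis unfolding boundaries_def loc_cx_mod using frac_closed[OF y(1) assms(3)] by blast
qed

lemma loc_exact:
  assumes "chain_complex R X" "cycles X i \<subseteq> boundaries X i"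
  shows "cycles (loc_cx R p X) i \<subseteq> boundaries (loc_cx R p X) i"
proof
  fix F assume "F \<in> cycles (loc_cx R p X) i"
  from loc_cycles[OF assms(1) this] obtain z s where "z \<in> cycles X i" "s \<in> carrier R - p"
    "F = loc_frac R p (cx_mod X i) z s" by blast
  thus "F \<in> boundaries (loc_cx R p X) i" using loc_boundaries[OF assms(1), of z i s] assms(2) by blast
qed

lemma frac_lincomb:
  assumes "module R M" "s \<in> carrier R - p" "\<And>i. i < k \<Longrightarrow> x i \<in> carrier M" "\<And>i. c i \<in> carrier R"
  shows "loc_frac R p M (lincomb M x c k) s =
    lincomb (loc_mod R p M) (\<lambda>i. loc_frac R p M (x i) \<one>) (\<lambda>i. fr (c i) s) k"
  using assms(3)
proof (induct k)
  case 0
  show ?case using frac_zero[OF assms(1,2)] by simp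
next
  case (Suc k)
  interpret M: module R M by fact
  have x: "x k \<in> carrier M" using Suc.prems by simp
  have l: "lincomb M x c k \<in> carrier M" by (rule lincomb_closed[OF assms(1)]) (use Suc.prems assms(4) in auto)
  have s: "s \<otimes> \<one> = s" using assms(2) by simp
  have 1: "fr (c k) s \<odot>\<^bsub>loc_mod R p M\<^esub> loc_frac R p M (x k) \<one> = loc_frac R p M (c k \<odot>\<^bsub>M\<^esub> x k) s"
    using frac_smult[OF assms(1,4,2) x one_denom] unfolding s .
  have "loc_frac R p M (lincomb M x c k \<oplus>\<^bsub>M\<^esub> c k \<odot>\<^bsub>M\<^esub> x k) s =
     loc_frac R p M (lincomb M x c k) s \<oplus>\<^bsub>loc_mod R p M\<^esub> loc_frac R p M (c k \<odot>\<^bsub>M\<^esub> x k) s"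
    by (rule frac_add_same[OF assms(1) l M.smult_closed[OF assms(4) x] assms(2), symmetric])
  thus ?case using Suc 1 by simp
qed

lemma loc_generators:
  assumes "chain_complex R X" "\<And>i. i < k \<Longrightarrow> x i \<in> cycles X m"
    "cycles X m \<subseteq> span_over R (cx_mod X m) (boundaries X m) x k"
  shows "\<And>i. i < k \<Longrightarrow> loc_frac R p (cx_mod X m) (x i) \<one> \<in> cycles (loc_cx R p X) m"
    "cycles (loc_cx R p X) m \<subseteq> span_over (loc_ring R p) (cx_mod (loc_cx R p X) m) (boundaries (loc_cx R p X) m)
      (\<lambda>i. loc_frac R p (cx_mod X m) (x i) \<one>) k"
proof -
  note mX = chain_complexD(1)[OF assms(1)]
  interpret M: module R "cx_mod X m" by (rule mX)
  have xc: "x i \<in> carrier (cx_mod X m)" if "i < k" for i by (rule cycles_closed[OF assms(2)[OF that]])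
  show "loc_frac R p (cx_mod X m) (x i) \<one> \<in> cycles (loc_cx R p X) m" if i: "i < k" for i
    using loc_diff_frac[OF assms(1) xc[OF i] one_denom] frac_closed[OF xc[OF i] one_denom] assms(2)[OF i]
      frac_zero[OF mX one_denom, of "m - 1"]
    by (simp add: cycles_def)
  show "cycles (loc_cx R p X) m \<subseteq> span_over (loc_ring R p) (cx_mod (loc_cx R p X) m) (boundaries (loc_cx R p X) m)
      (\<lambda>i. loc_frac R p (cx_mod X m) (x i) \<one>) k"
  proof
    fix F assume "F \<in> cycles (loc_cx R p X) m"
    from loc_cycles[OF assms(1) this] obtain z s where z: "z \<in> cycles X m" "s \<in> carrier R - p"
      "F = loc_frac R p (cx_mod X m) z s" by blast
    from z(1) assms(3) have "z \<in> span_over R (cx_mod X m) (boundaries X m) x k" by blast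
    then obtain b c where bc: "b \<in> boundaries X m" "\<forall>i. c i \<in> carrier R" "z = b \<oplus>\<^bsub>cx_mod X m\<^esub> lincomb (cx_mod X m) x c k"
      unfolding span_over_def by blast
    have b: "b \<in> carrier (cx_mod X m)"
      using bc(1) boundaries_submodule[OF assms(1)] unfolding submodule_iff[OF mX] by blast
    have l: "lincomb (cx_mod X m) x c k \<in> carrier (cx_mod X m)"
      by (rule lincomb_closed[OF mX]) (use xc bc(2) in auto)
    have "F = loc_frac R p (cx_mod X m) b s \<oplus>\<^bsub>loc_mod R p (cx_mod X m)\<^esub> loc_frac R p (cx_mod X m) (lincomb (cx_mod X m) x c k) s"
      unfolding z(3) bc(3) by (rule frac_add_same[OF mX b l z(2), symmetric])
    also have "loc_frac R p (cx_mod X m) (lincomb (cx_mod X m) x c k) s =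
      lincomb (loc_mod R p (cx_mod X m)) (\<lambda>i. loc_frac R p (cx_mod X m) (x i) \<one>) (\<lambda>i. fr (c i) s) k"
      by (rule frac_lincomb[OF mX z(2) xc]) (use bc(2) in auto)
    finally have "F = loc_frac R p (cx_mod X m) b s \<oplus>\<^bsub>loc_mod R p (cx_mod X m)\<^esub>
      lincomb (loc_mod R p (cx_mod X m)) (\<lambda>i. loc_frac R p (cx_mod X m) (x i) \<one>) (\<lambda>i. fr (c i) s) k" .
    moreover have "loc_frac R p (cx_mod X m) b s \<in> boundaries (loc_cx R p X) m"
      by (rule loc_boundaries[OF assms(1) bc(1) z(2)])
    moreover have "\<forall>i. fr (c i) s \<in> carrier (loc_ring R p)" using fr_closed bc(2) z(2) by blast
    ultimately show "F \<in> span_over (loc_ring R p) (cx_mod (loc_cx R p X) m) (boundaries (loc_cx R p X) m)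
      (\<lambda>i. loc_frac R p (cx_mod X m) (x i) \<one>) k" unfolding span_over_def loc_cx_mod by blast
  qed
qed

subsection \<open>Restriction of scalars\<close>

definition loc_map :: "'a \<Rightarrow> ('a \<times> 'a) set" where "loc_map = (\<lambda>r. fr r \<one>)"

lemma restrict_module:
  assumes "module (loc_ring R p) N" shows "module R (restrict_scalars loc_map N)"
proof -
  interpret N: module "loc_ring R p" N by fact
  have cl: "fr r \<one> \<in> carrier (loc_ring R p)" if "r \<in> carrier R" for r by (rule fr_closed[OF that one_denom])
  have ab: "abelian_group (restrict_scalars loc_map N)"
    by (rule abelian_group_cong[OF N.M.abelian_group_axioms]) (simp_all add: restrict_scalars_def)
  show ?thesis
  proof (rule moduleI[OF is_cring ab])
    fix a b x assume abx: "a \<in> carrier R" "b \<in> carrier R" "x \<in> carrier (restrict_scalars loc_map N)"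
    hence x: "x \<in> carrier N" by (simp add: restrict_scalars_def)
    show "(a \<oplus> b) \<odot>\<^bsub>restrict_scalars loc_map N\<^esub> x =
      a \<odot>\<^bsub>restrict_scalars loc_map N\<^esub> x \<oplus>\<^bsub>restrict_scalars loc_map N\<^esub> b \<odot>\<^bsub>restrict_scalars loc_map N\<^esub> x"
      using N.smult_l_distr[OF cl[OF abx(1)] cl[OF abx(2)] x] fr_add[OF abx(1,2) one_denom]
      by (simp add: restrict_scalars_def loc_map_def)
    show "(a \<otimes> b) \<odot>\<^bsub>restrict_scalars loc_map N\<^esub> x = a \<odot>\<^bsub>restrict_scalars loc_map N\<^esub> (b \<odot>\<^bsub>restrict_scalars loc_map N\<^esub> x)"
      using N.smult_assoc1[OF cl[OF abx(1)] cl[OF abx(2)] x] fr_mult[OF abx(1) one_denom abx(2) one_denom]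
      by (simp add: restrict_scalars_def loc_map_def)
  next
    fix x assume "x \<in> carrier (restrict_scalars loc_map N)"
    hence x: "x \<in> carrier N" by (simp add: restrict_scalars_def)
    show "\<one> \<odot>\<^bsub>restrict_scalars loc_map N\<^esub> x = x"
      using N.smult_one[OF x] by (simp add: restrict_scalars_def loc_map_def loc_ring_simps(3))
  qed (use cl in \<open>simp_all add: restrict_scalars_def loc_map_def N.smult_r_distr\<close>)
qed

lemma restrict_cx_simps:
  "cycles (restrict_scalars_cx \<psi> Y) i = cycles Y i" "boundaries (restrict_scalars_cx \<psi> Y) i = boundaries Y i"
  "r \<odot>\<^bsub>cx_mod (restrict_scalars_cx \<psi> Y) i\<^esub> y = \<psi> r \<odot>\<^bsub>cx_mod Y i\<^esub> y"
  by (simp_all add: cycles_def boundaries_def restrict_scalars_cx_def restrict_scalars_def)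

lemma restrict_chain_complex:
  assumes "chain_complex (loc_ring R p) Y"
  shows "chain_complex R (restrict_scalars_cx loc_map Y)"
  unfolding chain_complex_def
proof (intro conjI allI ballI)
  fix i
  show "module R (cx_mod (restrict_scalars_cx loc_map Y) i)"
    unfolding restrict_scalars_cx_def by (simp add: restrict_module[OF chain_complexD(1)[OF assms]])
  note d = chain_complexD(2)[OF assms, of i]
  have cl: "loc_map r \<in> carrier (loc_ring R p)" if "r \<in> carrier R" for r
    unfolding loc_map_def by (rule fr_closed[OF that one_denom])
  show "cx_diff (restrict_scalars_cx loc_map Y) i \<in>
      mod_hom R (cx_mod (restrict_scalars_cx loc_map Y) i) (cx_mod (restrict_scalars_cx loc_map Y) (i - 1))"
    by (rule mod_homI) (simp_all add: restrict_scalars_cx_def restrict_scalars_def mod_hom_closed[OF d]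
        mod_hom_add[OF d] mod_hom_smult[OF d] cl)
  fix x assume "x \<in> carrier (cx_mod (restrict_scalars_cx loc_map Y) i)"
  thus "cx_diff (restrict_scalars_cx loc_map Y) (i - 1) (cx_diff (restrict_scalars_cx loc_map Y) i x) =
      \<zero>\<^bsub>cx_mod (restrict_scalars_cx loc_map Y) (i - 1 - 1)\<^esub>"
    using chain_complexD(3)[OF assms, of x i] by (simp add: restrict_scalars_cx_def restrict_scalars_def)
qed

end

section \<open>Artinian modules over a complete ring\<close>

lemma artinian_minimal_submodule:
  assumes "artinian_module R A" "\<U> \<noteq> {}" "\<And>U. U \<in> \<U> \<Longrightarrow> submodule U R A"
  shows "\<exists>U\<in>\<U>. \<forall>V\<in>\<U>. V \<subseteq> U \<longrightarrow> V = U"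
proof (rule ccontr)
  assume "\<not> ?thesis"
  hence step: "\<And>U. U \<in> \<U> \<Longrightarrow> \<exists>V. V \<in> \<U> \<and> V \<subset> U" by blast
  have "\<exists>U :: nat \<Rightarrow> _. \<forall>n. U n \<in> \<U> \<and> U (Suc n) \<subset> U n"
    by (rule dependent_nat_choice) (use assms(2) step in auto)
  then obtain U :: "nat \<Rightarrow> _" where U: "\<And>n. U n \<in> \<U>" "\<And>n. U (Suc n) \<subset> U n" by blast
  have chain: "(\<forall>n. submodule (U n) R A) \<and> (\<forall>n. U (Suc n) \<subseteq> U n)"
    using assms(3)[OF U(1)] U(2) by blast
  have dcc: "\<forall>U :: nat \<Rightarrow> _. (\<forall>n. submodule (U n) R A) \<and> (\<forall>n. U (Suc n) \<subseteq> U n)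
        \<longrightarrow> (\<exists>n. \<forall>m\<ge>n. U m = U n)"
    using assms(1) unfolding artinian_module_def by (rule conjunct2)
  from dcc[THEN spec[of _ U], THEN mp, OF chain]
  obtain n where "\<And>m. m \<ge> n \<Longrightarrow> U m = U n" by blast
  from this[of "Suc n"] U(2)[of n] show False by simp
qed

lemma lincomb_mod_hom_fun:
  assumes "module R A" "module R E" "\<And>i. i < k \<Longrightarrow> x i \<in> mod_hom R A E" "\<And>i. i < k \<Longrightarrow> b i \<in> carrier R"
  shows "(\<lambda>a. lincomb E (\<lambda>i. x i a) b k) \<in> mod_hom R A E"
  using assms(3,4)
proof (induct k)
  case 0
  show ?case using mod_hom_zero_map[OF assms(1,2)] by simp
next
  case (Suc k)
  have "(\<lambda>a. lincomb E (\<lambda>i. x i a) b k \<oplus>\<^bsub>E\<^esub> b k \<odot>\<^bsub>E\<^esub> x k a) \<in> mod_hom R A E"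
    by (rule mod_hom_add_scaled[OF assms(1,2)]) (use Suc in auto)
  thus ?case by simp
qed

lemma lincomb_cong_terms:
  "(\<And>i. i < k \<Longrightarrow> a i \<odot>\<^bsub>M\<^esub> x i = b i \<odot>\<^bsub>M\<^esub> y i) \<Longrightarrow> lincomb M x a k = lincomb M y b k"
  by (induct k) auto

text \<open>These are the properties of the Jacobson radical \<open>\<jj>\<close> and of the sum \<open>E\<close> of the injective envelopes of the
  residue fields on which the duality for artinian modules rests.  The element \<open>\<epsilon>\<close> generates the part of \<open>E\<close>
  annihilated by \<open>\<jj>\<close>.\<close>

locale artinian_duality = cring R for R :: "('a, 'r) ring_scheme" (structure) +
  fixes \<jj> :: "'a set" and E :: "('a, 'e) module" and \<epsilon> :: 'e
  assumes noeth: "noetherian_ring R" and jid: "ideal \<jj> R" and complete: "adically_complete R \<jj>"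
    and junit: "\<And>j. j \<in> \<jj> \<Longrightarrow> \<exists>b\<in>carrier R. b \<otimes> (\<one> \<ominus> j) = \<one>"
    and baerE: "baer R E" and \<epsilon>: "\<epsilon> \<in> carrier E" "\<And>j. j \<in> \<jj> \<Longrightarrow> j \<odot>\<^bsub>E\<^esub> \<epsilon> = \<zero>\<^bsub>E\<^esub>"
    and socle: "\<And>y. y \<in> carrier E \<Longrightarrow> (\<And>j. j \<in> \<jj> \<Longrightarrow> j \<odot>\<^bsub>E\<^esub> y = \<zero>\<^bsub>E\<^esub>) \<Longrightarrow> \<exists>r\<in>carrier R. y = r \<odot>\<^bsub>E\<^esub> \<epsilon>"
begin

lemma mE: "module R E"
  by (rule baer_module[OF baerE])

lemma jc: "j \<in> \<jj> \<Longrightarrow> j \<in> carrier R"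
  by (rule ideal.Icarr[OF jid])

lemma power_ideal: "ideal (ideal_power R \<jj> n) R"
  by (induct n) (auto intro: oneideal ideal_prod_is_ideal jid)

lemma power_closed: "c \<in> ideal_power R \<jj> n \<Longrightarrow> c \<in> carrier R"
  by (rule ideal.Icarr[OF power_ideal])

definition torsion :: "('a, 'b) module \<Rightarrow> nat \<Rightarrow> 'b set" where
  "torsion A n = {a \<in> carrier A. \<forall>c\<in>ideal_power R \<jj> n. c \<odot>\<^bsub>A\<^esub> a = \<zero>\<^bsub>A\<^esub>}"

lemma annihilator_ideal:
  assumes "module R A" "Y \<subseteq> carrier A"
  shows "ideal {r \<in> carrier R. \<forall>y\<in>Y. r \<odot>\<^bsub>A\<^esub> y = \<zero>\<^bsub>A\<^esub>} R"
proof -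
  interpret A: module R A by fact
  have Y: "y \<in> carrier A" if "y \<in> Y" for y using that assms(2) by blast
  show ?thesis
    unfolding ideal_iff_submodule[OF is_cring] submodule_iff[OF self_mod_module[OF is_cring]]
    by (auto simp: Y A.smult_l_distr A.smult_assoc1)
qed

lemma torsion_submodule:
  assumes "module R A" shows "submodule (torsion A n) R A"
proof -
  interpret A: module R A by fact
  have comm: "c \<odot>\<^bsub>A\<^esub> (r \<odot>\<^bsub>A\<^esub> a) = r \<odot>\<^bsub>A\<^esub> (c \<odot>\<^bsub>A\<^esub> a)" if "c \<in> carrier R" "r \<in> carrier R" "a \<in> carrier A" for c r a
    using that by (simp add: A.smult_assoc1[symmetric] m_comm)
  show ?thesis
    unfolding submodule_iff[OF assms] torsion_def
    by (auto simp: power_closed A.smult_r_distr comm)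
qed

lemma torsion_mono: "torsion A n \<subseteq> torsion A (Suc n)"
  unfolding torsion_def using ideal_prod_inter[OF jid power_ideal[of n]] by auto

lemma torsion_mono': "m \<le> n \<Longrightarrow> torsion A m \<subseteq> torsion A n"
  by (rule lift_Suc_mono_le[of "torsion A", OF torsion_mono])

text \<open>Finitely many generators of \<open>\<jj>\<close> decide which power of \<open>\<jj>\<close> annihilates all multiples \<open>j a\<close>.\<close>

lemma torsion_step:
  assumes "module R A" "a \<in> carrier A" "\<And>j. j \<in> \<jj> \<Longrightarrow> \<exists>n. j \<odot>\<^bsub>A\<^esub> a \<in> torsion A n"
  shows "\<exists>n. a \<in> torsion A n"
proof -
  interpret A: module R A by fact
  obtain q :: nat and c where c: "\<And>i. i < q \<Longrightarrow> c i \<in> \<jj>"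
    "\<And>V. submodule V R (self_mod R) \<Longrightarrow> (\<And>i. i < q \<Longrightarrow> c i \<in> V) \<Longrightarrow> \<jj> \<subseteq> V"
    using fin_gen_enum[OF ideal_fin_gen[OF is_cring noeth jid]] by metis
  have "\<exists>N. \<forall>i<l. c i \<odot>\<^bsub>A\<^esub> a \<in> torsion A N" if "l \<le> q" for l
    using that
  proof (induct l)
    case (Suc l)
    then obtain N where N: "\<forall>i<l. c i \<odot>\<^bsub>A\<^esub> a \<in> torsion A N" by auto
    obtain n where n: "c l \<odot>\<^bsub>A\<^esub> a \<in> torsion A n" using assms(3)[OF c(1)[of l]] Suc.prems by auto
    have "\<forall>i<Suc l. c i \<odot>\<^bsub>A\<^esub> a \<in> torsion A (max N n)"
      using N n torsion_mono'[of N "max N n" A] torsion_mono'[of n "max N n" A] by (auto simp: less_Suc_eq)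
    thus ?case by blast
  qed simp
  then obtain N where N: "\<And>i. i < q \<Longrightarrow> c i \<odot>\<^bsub>A\<^esub> a \<in> torsion A N" by blast
  let ?V = "{j \<in> carrier R. j \<odot>\<^bsub>A\<^esub> a \<in> torsion A N}"
  have "submodule ?V R (self_mod R)"
    using torsion_submodule[OF assms(1), of N] assms(2)
    unfolding submodule_iff[OF assms(1)] submodule_iff[OF self_mod_module[OF is_cring]]
    by (auto simp: A.smult_l_distr A.smult_assoc1)
  hence jV: "\<jj> \<subseteq> ?V" by (rule c(2)) (use N c(1) jc in auto)
  have "c' \<odot>\<^bsub>A\<^esub> a = \<zero>\<^bsub>A\<^esub>" if "c' \<in> ideal_prod R \<jj> (ideal_power R \<jj> N)" for c'
    using that
  proof (induct rule: ideal_prod.induct)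
    case (prod j d)
    have "d \<odot>\<^bsub>A\<^esub> (j \<odot>\<^bsub>A\<^esub> a) = \<zero>\<^bsub>A\<^esub>" using jV prod by (auto simp: torsion_def)
    thus ?case using jc[OF prod(1)] power_closed[OF prod(2)] assms(2) m_comm[of j d] A.smult_assoc1[of d j a] by simp
  next
    case (sum s1 s2)
    have "s1 \<in> carrier R" "s2 \<in> carrier R" using sum(1,3) ideal_prod_in_carrier[OF jid power_ideal[of N]] by auto
    thus ?case using sum assms(2) by (simp add: A.smult_l_distr)
  qed
  hence "a \<in> torsion A (Suc N)" using assms(2) by (simp add: torsion_def)
  thus ?thesis by blast
qed

text \<open>A minimal submodule \<open>V\<close> not contained in the torsion part is generated by some \<open>j a\<close> with \<open>a \<in> V\<close>
  and \<open>j \<in> \<jj>\<close>.  Then \<open>a = r j a\<close>, and \<open>1 - r j\<close> is a unit.\<close>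

lemma artinian_torsion:
  assumes "artinian_module R A" "a \<in> carrier A"
  shows "\<exists>n. a \<in> torsion A n"
proof -
  have mA: "module R A" using assms(1) unfolding artinian_module_def by (rule conjunct1)
  interpret A: module R A by (rule mA)
  define T where "T = (\<Union>n. torsion A n)"
  show ?thesis
  proof (rule ccontr)
    assume na: "\<not> ?thesis"
    have "\<exists>U\<in>{V. submodule V R A \<and> \<not> V \<subseteq> T}. \<forall>V\<in>{V. submodule V R A \<and> \<not> V \<subseteq> T}. V \<subseteq> U \<longrightarrow> V = U"
    proof (rule artinian_minimal_submodule[OF assms(1)])
      have "carrier A \<in> {V. submodule V R A \<and> \<not> V \<subseteq> T}"
        using A.carrier_is_submodule na assms(2) by (auto simp: T_def)
      thus "{V. submodule V R A \<and> \<not> V \<subseteq> T} \<noteq> {}" by blast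
    qed blast
    then obtain U where U: "submodule U R A" "\<not> U \<subseteq> T"
      and min: "\<And>V. submodule V R A \<Longrightarrow> \<not> V \<subseteq> T \<Longrightarrow> V \<subseteq> U \<Longrightarrow> V = U" by blast
    obtain u where u: "u \<in> U" "u \<notin> T" using U(2) by blast
    have Uc: "U \<subseteq> carrier A" and Us: "\<And>r x. r \<in> carrier R \<Longrightarrow> x \<in> U \<Longrightarrow> r \<odot>\<^bsub>A\<^esub> x \<in> U"
      using U(1) unfolding submodule_iff[OF mA] by blast+
    have uc: "u \<in> carrier A" using u(1) Uc by blast
    have "\<exists>j\<in>\<jj>. j \<odot>\<^bsub>A\<^esub> u \<notin> T"
    proof (rule ccontr)
      assume "\<not> ?thesis"
      hence "\<And>j. j \<in> \<jj> \<Longrightarrow> \<exists>n. j \<odot>\<^bsub>A\<^esub> u \<in> torsion A n" by (auto simp: T_def)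
      from torsion_step[OF mA uc this] u(2) show False by (auto simp: T_def)
    qed
    then obtain j where j: "j \<in> \<jj>" "j \<odot>\<^bsub>A\<^esub> u \<notin> T" by blast
    have jR: "j \<in> carrier R" by (rule jc[OF j(1)])
    let ?V = "(\<lambda>r. r \<odot>\<^bsub>A\<^esub> (j \<odot>\<^bsub>A\<^esub> u)) ` carrier (self_mod R)"
    have hom: "(\<lambda>r. r \<odot>\<^bsub>A\<^esub> (j \<odot>\<^bsub>A\<^esub> u)) \<in> mod_hom R (self_mod R) A"
      by (rule mod_homI) (use jR uc in \<open>simp_all add: A.smult_l_distr A.smult_assoc1\<close>)
    have "?V = U"
    proof (rule min)
      show "submodule ?V R A"
        by (rule mod_hom_image_submodule[OF self_mod_module[OF is_cring] mA hom
              module.carrier_is_submodule[OF self_mod_module[OF is_cring]]])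
      have "j \<odot>\<^bsub>A\<^esub> u \<in> ?V" by (rule image_eqI[of _ _ \<one>]) (use jR uc in simp_all)
      thus "\<not> ?V \<subseteq> T" using j(2) by blast
      show "?V \<subseteq> U" using Us jR u(1) by auto
    qed
    then obtain r where r: "r \<in> carrier R" "u = r \<odot>\<^bsub>A\<^esub> (j \<odot>\<^bsub>A\<^esub> u)" using u(1) by auto
    have "r \<otimes> j \<in> \<jj>" by (rule ideal.I_l_closed[OF jid j(1) r(1)])
    then obtain b where b: "b \<in> carrier R" "b \<otimes> (\<one> \<ominus> r \<otimes> j) = \<one>" using junit by blast
    have "(\<one> \<ominus> r \<otimes> j) \<odot>\<^bsub>A\<^esub> u = \<one> \<odot>\<^bsub>A\<^esub> u \<ominus>\<^bsub>A\<^esub> r \<odot>\<^bsub>A\<^esub> (j \<odot>\<^bsub>A\<^esub> u)"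
      using r(1) jR uc by (simp add: minus_eq A.M.minus_eq A.smult_l_distr A.smult_l_minus A.smult_assoc1)
    also have "\<dots> = \<zero>\<^bsub>A\<^esub>" using module_diff_zero_iff[OF mA uc uc] r(2) uc by simp
    finally have 0: "(\<one> \<ominus> r \<otimes> j) \<odot>\<^bsub>A\<^esub> u = \<zero>\<^bsub>A\<^esub>" .
    have "u = b \<odot>\<^bsub>A\<^esub> ((\<one> \<ominus> r \<otimes> j) \<odot>\<^bsub>A\<^esub> u)"
      using A.smult_assoc1[OF b(1) _ uc, of "\<one> \<ominus> r \<otimes> j"] b(2) r(1) jR uc by simp
    hence "u = \<zero>\<^bsub>A\<^esub>" using 0 b(1) by simp
    hence "u \<in> torsion A 0" using submodule_zero[OF mA torsion_submodule[OF mA]] by simp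
    thus False using u(2) by (auto simp: T_def)
  qed
qed

text \<open>For the Jacobson radical \<open>\<jj>\<close> of a semilocal ring this is the socle in the usual sense.\<close>

definition socle_of :: "('a, 'b) module \<Rightarrow> 'b set" where
  "socle_of A = {a \<in> carrier A. \<forall>j\<in>\<jj>. j \<odot>\<^bsub>A\<^esub> a = \<zero>\<^bsub>A\<^esub>}"

lemma socle_submodule:
  assumes "module R A" shows "submodule (socle_of A) R A"
proof -
  interpret A: module R A by fact
  have comm: "c \<odot>\<^bsub>A\<^esub> (r \<odot>\<^bsub>A\<^esub> a) = r \<odot>\<^bsub>A\<^esub> (c \<odot>\<^bsub>A\<^esub> a)" if "c \<in> carrier R" "r \<in> carrier R" "a \<in> carrier A" for c r a
    using that by (simp add: A.smult_assoc1[symmetric] m_comm)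
  show ?thesis
    unfolding submodule_iff[OF assms] socle_of_def
    by (auto simp: jc A.smult_r_distr comm)
qed

text \<open>The image of \<open>\<epsilon>\<close> is annihilated by \<open>\<jj>\<close>, hence a multiple of \<open>\<epsilon>\<close>, and \<open>\<epsilon>\<close> generates the socle.\<close>

lemma endo_scalar_on_socle:
  assumes "g \<in> mod_hom R E E"
  shows "\<exists>b\<in>carrier R. \<forall>y\<in>socle_of E. g y = b \<odot>\<^bsub>E\<^esub> y"
proof -
  interpret E: module R E by (rule mE)
  have "\<exists>b\<in>carrier R. g \<epsilon> = b \<odot>\<^bsub>E\<^esub> \<epsilon>"
  proof (rule socle[OF mod_hom_closed[OF assms \<epsilon>(1)]])
    fix j assume "j \<in> \<jj>"
    thus "j \<odot>\<^bsub>E\<^esub> g \<epsilon> = \<zero>\<^bsub>E\<^esub>"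
      using mod_hom_smult[OF assms jc \<epsilon>(1), of j] \<epsilon>(2) mod_hom_zero[OF mE mE assms] by simp
  qed
  then obtain b where b: "b \<in> carrier R" "g \<epsilon> = b \<odot>\<^bsub>E\<^esub> \<epsilon>" by blast
  have "g y = b \<odot>\<^bsub>E\<^esub> y" if "y \<in> socle_of E" for y
  proof -
    have "\<exists>r\<in>carrier R. y = r \<odot>\<^bsub>E\<^esub> \<epsilon>" by (rule socle) (use that in \<open>auto simp: socle_of_def\<close>)
    then obtain r where r: "r \<in> carrier R" "y = r \<odot>\<^bsub>E\<^esub> \<epsilon>" by blast
    have "g y = r \<odot>\<^bsub>E\<^esub> (b \<odot>\<^bsub>E\<^esub> \<epsilon>)" using mod_hom_smult[OF assms r(1) \<epsilon>(1)] r(2) b(2) by simp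
    also have "\<dots> = b \<odot>\<^bsub>E\<^esub> (r \<odot>\<^bsub>E\<^esub> \<epsilon>)"
      using r(1) b(1) \<epsilon>(1) by (simp add: E.smult_assoc1[symmetric] m_comm)
    finally show ?thesis using r(2) by simp
  qed
  thus ?thesis using b(1) by blast
qed

text \<open>Choose \<open>x\<^sub>0, \<dots>, x\<^sub>k\<^sub>-\<^sub>1\<close> with a minimal common kernel in the socle of \<open>A\<close>.  By minimality every further
  map vanishes on this kernel, hence is a sum of maps \<open>g\<^sub>i \<circ> x\<^sub>i\<close>, where \<open>g\<^sub>i\<close> only matters on the
  socle of \<open>E\<close>.\<close>

lemma dual_socle_generators:
  assumes "artinian_module R A"
  shows "\<exists>(k :: nat) x. (\<forall>i<k. x i \<in> mod_hom R A E) \<and>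
    (\<forall>f\<in>mod_hom R A E. \<exists>b. (\<forall>i. b i \<in> carrier R) \<and> (\<forall>a\<in>socle_of A. f a = lincomb E (\<lambda>i. x i a) b k))"
proof -
  have mA: "module R A" using assms unfolding artinian_module_def by (rule conjunct1)
  interpret A: module R A by (rule mA)
  interpret E: module R E by (rule mE)
  define K where "K = (\<lambda>(k :: nat) x. {a \<in> socle_of A. \<forall>i<k. x i a = \<zero>\<^bsub>E\<^esub>})"
  define \<U> where "\<U> = {K k x | k x. \<forall>i<k. x i \<in> mod_hom R A E}"
  have sub: "submodule (K k x) R A" if x: "\<And>i. i < k \<Longrightarrow> x i \<in> mod_hom R A E" for k x
  proof -
    note s = socle_submodule[OF mA, unfolded submodule_iff[OF mA]]
    have sc: "socle_of A \<subseteq> carrier A" using s by blast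
    show ?thesis unfolding submodule_iff[OF mA] K_def
      using s mod_hom_zero[OF mA mE x] mod_hom_add[OF x] mod_hom_smult[OF x] by (auto simp: subset_iff)
  qed
  have "\<exists>U\<in>\<U>. \<forall>V\<in>\<U>. V \<subseteq> U \<longrightarrow> V = U"
  proof (rule artinian_minimal_submodule[OF assms])
    \<comment> \<open>Without any map the common kernel is the whole socle.\<close>
    have "K 0 undefined \<in> \<U>" unfolding \<U>_def by blast
    thus "\<U> \<noteq> {}" by blast
    show "submodule U R A" if "U \<in> \<U>" for U using that sub unfolding \<U>_def by blast
  qed
  then obtain U where U: "U \<in> \<U>" and minU: "\<forall>V\<in>\<U>. V \<subseteq> U \<longrightarrow> V = U" by (rule bexE)
  from U obtain k x where Ux: "U = K k x" and x': "\<forall>i<k. x i \<in> mod_hom R A E" unfolding \<U>_def by blast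
  note x = x'[rule_format] and min = minU[unfolded Ux, rule_format]
  have "\<exists>b. (\<forall>i. b i \<in> carrier R) \<and> (\<forall>a\<in>socle_of A. f a = lincomb E (\<lambda>i. x i a) b k)"
    if f: "f \<in> mod_hom R A E" for f
  proof -
    have "\<forall>i<Suc k. (x(k := f)) i \<in> mod_hom R A E" using x f by (simp add: less_Suc_eq)
    hence "K (Suc k) (x(k := f)) \<in> \<U>" unfolding \<U>_def by blast
    moreover have "K (Suc k) (x(k := f)) \<subseteq> K k x" by (auto simp: K_def less_Suc_eq)
    ultimately have eq: "K (Suc k) (x(k := f)) = K k x" by (rule min)
    hence van: "f a = \<zero>\<^bsub>E\<^esub>" if "a \<in> socle_of A" "\<And>i. i < k \<Longrightarrow> x i a = \<zero>\<^bsub>E\<^esub>" for a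
    proof -
      have "a \<in> K (Suc k) (x(k := f))" unfolding eq using that by (simp add: K_def)
      hence "(x(k := f)) k a = \<zero>\<^bsub>E\<^esub>" unfolding K_def by blast
      thus ?thesis by simp
    qed
    let ?S = "A\<lparr>carrier := socle_of A\<rparr>"
    have mS: "module R ?S" by (rule submodule_module[OF mA socle_submodule[OF mA]])
    have sc: "socle_of A \<subseteq> carrier A" by (auto simp: socle_of_def)
    have res: "h \<in> mod_hom R ?S E" if "h \<in> mod_hom R A E" for h
      using that sc by (auto simp: mod_hom_def Pi_def subset_iff)
    have "\<exists>g. (\<forall>l<k. g l \<in> mod_hom R E E) \<and>
      (\<forall>a\<in>carrier ?S. f a = lincomb E (\<lambda>l. g l (x l a)) (\<lambda>_. \<one>) k)"
      by (rule baer_factor_family[OF baerE mS mE res[OF x] res[OF f]]) (use van in auto)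
    then obtain g where g: "\<And>l. l < k \<Longrightarrow> g l \<in> mod_hom R E E"
      "\<And>a. a \<in> socle_of A \<Longrightarrow> f a = lincomb E (\<lambda>l. g l (x l a)) (\<lambda>_. \<one>) k" by auto
    have "\<forall>l. \<exists>b\<in>carrier R. l < k \<longrightarrow> (\<forall>y\<in>socle_of E. g l y = b \<odot>\<^bsub>E\<^esub> y)"
      using endo_scalar_on_socle[OF g(1)] one_closed by blast
    then obtain b where b: "\<And>l. b l \<in> carrier R" "\<And>l y. l < k \<Longrightarrow> y \<in> socle_of E \<Longrightarrow> g l y = b l \<odot>\<^bsub>E\<^esub> y" by metis
    have "f a = lincomb E (\<lambda>i. x i a) b k" if a: "a \<in> socle_of A" for a
      unfolding g(2)[OF a]
    proof (rule lincomb_cong_terms)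
      fix l assume l: "l < k"
      have ac: "a \<in> carrier A" using a sc by blast
      have xa: "x l a \<in> carrier E" by (rule mod_hom_closed[OF x[OF l] ac])
      have "x l a \<in> socle_of E"
        unfolding socle_of_def
      proof (intro CollectI conjI ballI xa)
        fix j assume j: "j \<in> \<jj>"
        have "j \<odot>\<^bsub>E\<^esub> x l a = x l (j \<odot>\<^bsub>A\<^esub> a)" by (rule mod_hom_smult[OF x[OF l] jc[OF j] ac, symmetric])
        thus "j \<odot>\<^bsub>E\<^esub> x l a = \<zero>\<^bsub>E\<^esub>" using a j mod_hom_zero[OF mA mE x[OF l]] by (simp add: socle_of_def)
      qed
      thus "\<one> \<odot>\<^bsub>E\<^esub> g l (x l a) = b l \<odot>\<^bsub>E\<^esub> x l a" using b(2)[OF l] b(1) xa by simp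
    qed
    thus ?thesis using b(1) by blast
  qed
  thus ?thesis using x by blast
qed

text \<open>The step of the successive approximation.  A map vanishing on the elements annihilated by \<open>\<jj>\<^sup>n\<close> is a
  sum of maps \<open>c g\<close> with \<open>c\<close> among the generators of \<open>\<jj>\<^sup>n\<close>, and \<open>c\<close> moves the elements annihilated by
  \<open>\<jj>\<^sup>n\<^sup>+\<^sup>1\<close> into the socle, where \<open>g\<close> is a combination of the \<open>x\<^sub>i\<close>.\<close>

lemma approximation_step:
  assumes A: "module R A" and x: "\<And>i. i < k \<Longrightarrow> x i \<in> mod_hom R A E"
    and gen: "\<And>f. f \<in> mod_hom R A E \<Longrightarrow> \<exists>b. (\<forall>i. b i \<in> carrier R) \<and>
      (\<forall>a\<in>socle_of A. f a = lincomb E (\<lambda>i. x i a) b k)"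
    and f: "f \<in> mod_hom R A E" and van: "\<And>a. a \<in> torsion A n \<Longrightarrow> f a = \<zero>\<^bsub>E\<^esub>"
  shows "\<exists>b. (\<forall>i. b i \<in> ideal_power R \<jj> n) \<and>
    (\<forall>a\<in>torsion A (Suc n). f a = lincomb E (\<lambda>i. x i a) b k)"
proof -
  interpret A: module R A by (rule A)
  interpret E: module R E by (rule mE)
  let ?I = "ideal_power R \<jj> n"
  obtain r :: nat and c where c: "\<And>i. i < r \<Longrightarrow> c i \<in> ?I"
    "\<And>V. submodule V R (self_mod R) \<Longrightarrow> (\<And>i. i < r \<Longrightarrow> c i \<in> V) \<Longrightarrow> ?I \<subseteq> V"
    using fin_gen_enum[OF ideal_fin_gen[OF is_cring noeth power_ideal]] by metis
  have cR: "c i \<in> carrier R" if "i < r" for i by (rule power_closed[OF c(1)[OF that]])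
  have h: "(\<lambda>a. c l \<odot>\<^bsub>A\<^esub> a) \<in> mod_hom R A A" if "l < r" for l
    by (rule mod_hom_smult_fun[OF A A _ cR[OF that]]) (rule mod_homI; simp)
  have van': "f a = \<zero>\<^bsub>E\<^esub>" if a: "a \<in> carrier A" and ca: "\<And>l. l < r \<Longrightarrow> c l \<odot>\<^bsub>A\<^esub> a = \<zero>\<^bsub>A\<^esub>" for a
  proof -
    have "submodule {s \<in> carrier R. \<forall>y\<in>{a}. s \<odot>\<^bsub>A\<^esub> y = \<zero>\<^bsub>A\<^esub>} R (self_mod R)"
      using annihilator_ideal[OF A, of "{a}"] a by (simp add: ideal_iff_submodule[OF is_cring])
    hence "?I \<subseteq> {s \<in> carrier R. \<forall>y\<in>{a}. s \<odot>\<^bsub>A\<^esub> y = \<zero>\<^bsub>A\<^esub>}" by (rule c(2)) (use ca cR in auto)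
    hence "a \<in> torsion A n" using a by (auto simp: torsion_def)
    thus ?thesis by (rule van)
  qed
  have "\<exists>g. (\<forall>l<r. g l \<in> mod_hom R A E) \<and>
    (\<forall>a\<in>carrier A. f a = lincomb E (\<lambda>l. g l (c l \<odot>\<^bsub>A\<^esub> a)) (\<lambda>_. \<one>) r)"
    by (rule baer_factor_family[OF baerE A A h f van'])
  then obtain g where g: "\<And>l. l < r \<Longrightarrow> g l \<in> mod_hom R A E"
    "\<And>a. a \<in> carrier A \<Longrightarrow> f a = lincomb E (\<lambda>l. g l (c l \<odot>\<^bsub>A\<^esub> a)) (\<lambda>_. \<one>) r" by blast
  have tc: "a \<in> carrier A" if "a \<in> torsion A m" for a m using that by (simp add: torsion_def)
  have soc: "c l \<odot>\<^bsub>A\<^esub> a \<in> socle_of A" if l: "l < r" and a: "a \<in> torsion A (Suc n)" for l a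
    unfolding socle_of_def
  proof (intro CollectI conjI ballI)
    show "c l \<odot>\<^bsub>A\<^esub> a \<in> carrier A" using cR[OF l] tc[OF a] by simp
    fix j assume j: "j \<in> \<jj>"
    have "j \<otimes> c l \<in> ideal_power R \<jj> (Suc n)" using ideal_prod.prod[OF j c(1)[OF l]] by simp
    hence "(j \<otimes> c l) \<odot>\<^bsub>A\<^esub> a = \<zero>\<^bsub>A\<^esub>" using a unfolding torsion_def by blast
    thus "j \<odot>\<^bsub>A\<^esub> (c l \<odot>\<^bsub>A\<^esub> a) = \<zero>\<^bsub>A\<^esub>" using A.smult_assoc1[OF jc[OF j] cR[OF l] tc[OF a]] by simp
  qed
  have I: "submodule ?I R (self_mod R)" using power_ideal by (simp add: ideal_iff_submodule[OF is_cring])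
  have "\<exists>b. (\<forall>i. b i \<in> ?I) \<and> (\<forall>a\<in>torsion A (Suc n).
      lincomb E (\<lambda>l. g l (c l \<odot>\<^bsub>A\<^esub> a)) (\<lambda>_. \<one>) m = lincomb E (\<lambda>i. x i a) b k)" if "m \<le> r" for m
    using that
  proof (induct m)
    case 0
    have "\<zero> \<in> ?I" using submodule_zero[OF self_mod_module[OF is_cring] I] by simp
    moreover have "lincomb E (\<lambda>i. x i a) (\<lambda>_. \<zero>) k = \<zero>\<^bsub>E\<^esub>" if "a \<in> torsion A (Suc n)" for a
      by (rule lincomb_zero[OF mE]) (rule mod_hom_closed[OF x tc[OF that]])
    ultimately show ?case by (intro exI[of _ "\<lambda>_. \<zero>"]) simp
  next
    case (Suc m)
    have mr: "m < r" using Suc.prems by simp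
    obtain b where b: "\<And>i. b i \<in> ?I" "\<And>a. a \<in> torsion A (Suc n) \<Longrightarrow>
      lincomb E (\<lambda>l. g l (c l \<odot>\<^bsub>A\<^esub> a)) (\<lambda>_. \<one>) m = lincomb E (\<lambda>i. x i a) b k"
      using Suc.hyps Suc.prems by auto
    obtain d where d: "\<And>i. d i \<in> carrier R" "\<And>a. a \<in> socle_of A \<Longrightarrow> g m a = lincomb E (\<lambda>i. x i a) d k"
      using gen[OF g(1)[OF mr]] by blast
    define b' where "b' = (\<lambda>i. b i \<oplus> c m \<otimes> d i)"
    have bR: "b i \<in> carrier R" for i by (rule power_closed[OF b(1)])
    have cd: "c m \<otimes> d i \<in> ?I" for i by (rule ideal.I_r_closed[OF power_ideal c(1)[OF mr] d(1)])
    have "b' i \<in> ?I" for i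
      using b(1)[of i] cd[of i] I unfolding b'_def submodule_iff[OF self_mod_module[OF is_cring]] by simp
    moreover have "lincomb E (\<lambda>l. g l (c l \<odot>\<^bsub>A\<^esub> a)) (\<lambda>_. \<one>) (Suc m) = lincomb E (\<lambda>i. x i a) b' k"
      if a: "a \<in> torsion A (Suc n)" for a
    proof -
      have ac: "a \<in> carrier A" by (rule tc[OF a])
      have xa: "x i a \<in> carrier E" if "i < k" for i by (rule mod_hom_closed[OF x[OF that] ac])
      have ga: "g m (c m \<odot>\<^bsub>A\<^esub> a) \<in> carrier E" by (rule mod_hom_closed[OF g(1)[OF mr]]) (use cR[OF mr] ac in simp)
      have "g m (c m \<odot>\<^bsub>A\<^esub> a) = lincomb E (\<lambda>i. x i (c m \<odot>\<^bsub>A\<^esub> a)) d k" by (rule d(2)[OF soc[OF mr a]])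
      also have "\<dots> = lincomb E (\<lambda>i. x i a) (\<lambda>i. c m \<otimes> d i) k"
      proof (rule lincomb_cong_terms)
        fix i assume i: "i < k"
        show "d i \<odot>\<^bsub>E\<^esub> x i (c m \<odot>\<^bsub>A\<^esub> a) = (c m \<otimes> d i) \<odot>\<^bsub>E\<^esub> x i a"
          using mod_hom_smult[OF x[OF i] cR[OF mr] ac] E.smult_assoc1[OF d(1) cR[OF mr] xa[OF i], of i]
            m_comm[OF d(1) cR[OF mr], of i] by simp
      qed
      finally have 1: "g m (c m \<odot>\<^bsub>A\<^esub> a) = lincomb E (\<lambda>i. x i a) (\<lambda>i. c m \<otimes> d i) k" .
      have "lincomb E (\<lambda>l. g l (c l \<odot>\<^bsub>A\<^esub> a)) (\<lambda>_. \<one>) (Suc m) =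
        lincomb E (\<lambda>i. x i a) b k \<oplus>\<^bsub>E\<^esub> lincomb E (\<lambda>i. x i a) (\<lambda>i. c m \<otimes> d i) k"
        using b(2)[OF a] ga 1 by simp
      also have "\<dots> = lincomb E (\<lambda>i. x i a) b' k"
        unfolding b'_def by (rule lincomb_add[OF mE xa bR, symmetric]) (use cR[OF mr] d(1) in auto)
      finally show ?thesis .
    qed
    ultimately show ?case by blast
  qed
  from this[of r] g(2) tc show ?thesis by force
qed

text \<open>By completeness the coefficients of the successive approximations converge.  At each element of \<open>A\<close>
  the limit gives the right value, because the element is annihilated by some power of \<open>\<jj>\<close>.\<close>

lemma artinian_dual_generators:
  assumes "artinian_module R A"
  shows "\<exists>(k :: nat) x. (\<forall>i<k. x i \<in> mod_hom R A E) \<and>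
    (\<forall>f\<in>mod_hom R A E. \<exists>b. (\<forall>i. b i \<in> carrier R) \<and> (\<forall>a\<in>carrier A. f a = lincomb E (\<lambda>i. x i a) b k))"
proof -
  have mA: "module R A" using assms unfolding artinian_module_def by (rule conjunct1)
  interpret A: module R A by (rule mA)
  interpret E: module R E by (rule mE)
  obtain k :: nat and x where x: "\<And>i. i < k \<Longrightarrow> x i \<in> mod_hom R A E"
    and gen: "\<And>f. f \<in> mod_hom R A E \<Longrightarrow> \<exists>b. (\<forall>i. b i \<in> carrier R) \<and>
      (\<forall>a\<in>socle_of A. f a = lincomb E (\<lambda>i. x i a) b k)"
    using dual_socle_generators[OF assms] by blast
  have xa: "x i a \<in> carrier E" if "a \<in> carrier A" "i < k" for i a by (rule mod_hom_closed[OF x[OF that(2)] that(1)])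
  have tc: "a \<in> carrier A" if "a \<in> torsion A m" for a m using that by (simp add: torsion_def)
  have "\<exists>b. (\<forall>i. b i \<in> carrier R) \<and> (\<forall>a\<in>carrier A. f a = lincomb E (\<lambda>i. x i a) b k)"
    if f: "f \<in> mod_hom R A E" for f
  proof -
    define P where "P = (\<lambda>n (b :: nat \<Rightarrow> 'a). (\<forall>i. b i \<in> carrier R) \<and>
      (\<forall>a\<in>torsion A n. f a = lincomb E (\<lambda>i. x i a) b k))"
    \<comment> \<open>Successive coefficients form a Cauchy sequence in the \<open>\<jj>\<close>-adic topology.\<close>
    define Q where "Q = (\<lambda>n (b :: nat \<Rightarrow> 'a) b'. \<forall>i. b' i \<ominus> b i \<in> ideal_power R \<jj> n)"
    have "\<exists>B. \<forall>n. P n (B n) \<and> Q n (B n) (B (Suc n))"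
    proof (rule dependent_nat_choice)
      \<comment> \<open>Only \<open>0\<close> is annihilated by \<open>\<jj>\<^sup>0 = R\<close>.\<close>
      have "f a = lincomb E (\<lambda>i. x i a) (\<lambda>_. \<zero>) k" if a: "a \<in> torsion A 0" for a
      proof -
        have "\<one> \<odot>\<^bsub>A\<^esub> a = \<zero>\<^bsub>A\<^esub>" using a by (simp add: torsion_def)
        hence "a = \<zero>\<^bsub>A\<^esub>" using tc[OF a] by simp
        thus ?thesis using mod_hom_zero[OF mA mE f] lincomb_zero[OF mE xa[OF tc[OF a]]] by simp
      qed
      thus "\<exists>b. P 0 b" unfolding P_def by (intro exI[of _ "\<lambda>_. \<zero>"]) simp
    next
      fix b n assume Pb: "P n b"
      have bR: "b i \<in> carrier R" for i using Pb by (simp add: P_def)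
      let ?L = "\<lambda>a. lincomb E (\<lambda>i. x i a) b k"
      have L: "?L \<in> mod_hom R A E" by (rule lincomb_mod_hom_fun[OF mA mE x bR])
      define f' where "f' = (\<lambda>a. f a \<oplus>\<^bsub>E\<^esub> (\<ominus> \<one>) \<odot>\<^bsub>E\<^esub> ?L a)"
      have f': "f' \<in> mod_hom R A E" unfolding f'_def by (rule mod_hom_add_scaled[OF mA mE f L]) simp
      have "f' a = \<zero>\<^bsub>E\<^esub>" if a: "a \<in> torsion A n" for a
      proof -
        have "f a = ?L a" using Pb a by (simp add: P_def)
        thus ?thesis using mod_hom_closed[OF L tc[OF a]] by (simp add: f'_def E.smult_l_minus E.M.r_neg)
      qed
      from approximation_step[OF mA x gen f' this]
      obtain d where d: "\<And>i. d i \<in> ideal_power R \<jj> n"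
        "\<And>a. a \<in> torsion A (Suc n) \<Longrightarrow> f' a = lincomb E (\<lambda>i. x i a) d k" by blast
      have dR: "d i \<in> carrier R" for i by (rule power_closed[OF d(1)])
      have "f a = lincomb E (\<lambda>i. x i a) (\<lambda>i. b i \<oplus> d i) k" if a: "a \<in> torsion A (Suc n)" for a
      proof -
        note ac = tc[OF a]
        have "lincomb E (\<lambda>i. x i a) (\<lambda>i. b i \<oplus> d i) k = ?L a \<oplus>\<^bsub>E\<^esub> f' a"
          unfolding d(2)[OF a] by (rule lincomb_add[OF mE xa[OF ac] bR dR])
        also have "\<dots> = f a"
          using mod_hom_closed[OF f ac] mod_hom_closed[OF L ac]
          by (simp add: f'_def E.smult_l_minus E.M.a_lcomm E.M.r_neg)
        finally show ?thesis by simp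
      qed
      hence "P (Suc n) (\<lambda>i. b i \<oplus> d i)" using bR dR by (simp add: P_def)
      moreover have "(b i \<oplus> d i) \<ominus> b i = d i" for i
        using bR[of i] dR[of i] by (simp add: minus_eq a_comm[of "b i" "d i"] a_assoc r_neg)
      hence "Q n b (\<lambda>i. b i \<oplus> d i)" using d(1) by (simp add: Q_def)
      ultimately show "\<exists>b'. P (Suc n) b' \<and> Q n b b'" by blast
    qed
    then obtain B where B: "\<And>n. P n (B n)" "\<And>n. Q n (B n) (B (Suc n))" by blast
    have BR: "B n i \<in> carrier R" for n i using B(1)[of n] by (simp add: P_def)
    have "\<exists>!a. a \<in> carrier R \<and> (\<forall>n. a \<ominus> B n i \<in> ideal_power R \<jj> n)" for i
    proof -
      have c: "(\<forall>n. B n i \<in> carrier R) \<and> (\<forall>n. B (Suc n) i \<ominus> B n i \<in> ideal_power R \<jj> n)"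
        using BR B(2) by (simp add: Q_def)
      show ?thesis
        by (rule complete[unfolded adically_complete_def, THEN spec[of _ "\<lambda>n. B n i"], THEN mp, OF c])
    qed
    hence "\<forall>i. \<exists>a. a \<in> carrier R \<and> (\<forall>n. a \<ominus> B n i \<in> ideal_power R \<jj> n)" by blast
    then obtain b where b: "\<And>i. b i \<in> carrier R" "\<And>i n. b i \<ominus> B n i \<in> ideal_power R \<jj> n" by metis
    have "f a = lincomb E (\<lambda>i. x i a) b k" if a: "a \<in> carrier A" for a
    proof -
      obtain n where n: "a \<in> torsion A n" using artinian_torsion[OF assms a] by blast
      have "f a = lincomb E (\<lambda>i. x i a) (B n) k" using B(1)[of n] n by (simp add: P_def)
      also have "\<dots> = lincomb E (\<lambda>i. x i a) b k"
      proof (rule lincomb_cong_terms)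
        fix i assume i: "i < k"
        have "(b i \<ominus> B n i) \<odot>\<^bsub>A\<^esub> a = \<zero>\<^bsub>A\<^esub>" using n b(2)[of i n] by (simp add: torsion_def)
        hence "(b i \<ominus> B n i) \<odot>\<^bsub>E\<^esub> x i a = \<zero>\<^bsub>E\<^esub>"
          using mod_hom_smult[OF x[OF i] power_closed[OF b(2)] a, of i n] mod_hom_zero[OF mA mE x[OF i]] by simp
        hence "b i \<odot>\<^bsub>E\<^esub> x i a \<ominus>\<^bsub>E\<^esub> B n i \<odot>\<^bsub>E\<^esub> x i a = \<zero>\<^bsub>E\<^esub>"
          using b(1)[of i] BR[of n i] xa[OF a i] by (simp add: minus_eq E.M.minus_eq E.smult_l_distr E.smult_l_minus)
        thus "B n i \<odot>\<^bsub>E\<^esub> x i a = b i \<odot>\<^bsub>E\<^esub> x i a"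
          using module_diff_zero_iff[OF mE, of "b i \<odot>\<^bsub>E\<^esub> x i a" "B n i \<odot>\<^bsub>E\<^esub> x i a"] b(1)[of i] BR[of n i] xa[OF a i] by simp
      qed
      finally show ?thesis .
    qed
    thus ?thesis using b(1) by blast
  qed
  thus ?thesis using x by blast
qed

end

section \<open>Injective envelopes over a semilocal ring\<close>

text \<open>The element \<open>e\<close> is the image of the class of \<open>1\<close>.  The last property is essentiality of the extension,
  applied to the submodule generated by \<open>x\<close>.\<close>

lemma injective_hull_generator:
  assumes "cring S" "injective_hull S (quot_mod (self_mod S) \<nn>) I" "submodule \<nn> S (self_mod S)"
  shows "\<exists>e\<in>carrier I. (\<forall>a\<in>carrier S. a \<odot>\<^bsub>I\<^esub> e = \<zero>\<^bsub>I\<^esub> \<longleftrightarrow> a \<in> \<nn>) \<and>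
    (\<forall>x\<in>carrier I. x \<noteq> \<zero>\<^bsub>I\<^esub> \<longrightarrow>
      (\<exists>r\<in>carrier S. \<exists>c\<in>carrier S. r \<odot>\<^bsub>I\<^esub> x = c \<odot>\<^bsub>I\<^esub> e \<and> r \<odot>\<^bsub>I\<^esub> x \<noteq> \<zero>\<^bsub>I\<^esub>))"
proof -
  interpret S: cring S by fact
  let ?k = "quot_mod (self_mod S) \<nn>"
  note mS = self_mod_module[OF assms(1)]
  note mk = quot_mod_module[OF mS assms(3)]
  have mI: "module S I"
    using assms(2) unfolding injective_hull_def by (intro injective_module_module) (rule conjunct1)
  interpret I: module S I by (rule mI)
  from assms(2) obtain j where j: "j \<in> mod_hom S ?k I" "inj_on j (carrier ?k)"
    and ess: "\<And>U. submodule U S I \<Longrightarrow> U \<inter> j ` carrier ?k = {\<zero>\<^bsub>I\<^esub>} \<Longrightarrow> U = {\<zero>\<^bsub>I\<^esub>}"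
    unfolding injective_hull_def by blast
  define cs where "cs = (\<lambda>a. \<nn> +>\<^bsub>self_mod S\<^esub> a)"
  have cs: "cs a \<in> carrier ?k" if "a \<in> carrier S" for a
    unfolding cs_def quot_mod_carrier using that by auto
  have one: "\<one>\<^bsub>S\<^esub> \<in> carrier (self_mod S)" by simp
  define e where "e = j (cs \<one>\<^bsub>S\<^esub>)"
  have e: "e \<in> carrier I" unfolding e_def by (rule mod_hom_closed[OF j(1) cs]) simp
  have je: "j (cs a) = a \<odot>\<^bsub>I\<^esub> e" if a: "a \<in> carrier S" for a
  proof -
    have "cs a = a \<odot>\<^bsub>?k\<^esub> cs \<one>\<^bsub>S\<^esub>"
      using quot_mod_smult[OF mS assms(3) one a] a by (simp add: cs_def)
    thus ?thesis using mod_hom_smult[OF j(1) a cs[OF S.one_closed]] by (simp add: e_def)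
  qed
  have ann: "a \<odot>\<^bsub>I\<^esub> e = \<zero>\<^bsub>I\<^esub> \<longleftrightarrow> a \<in> \<nn>" if a: "a \<in> carrier S" for a
  proof -
    have "a \<odot>\<^bsub>I\<^esub> e = \<zero>\<^bsub>I\<^esub> \<longleftrightarrow> j (cs a) = j \<zero>\<^bsub>?k\<^esub>"
      unfolding je[OF a] mod_hom_zero[OF mk mI j(1)] ..
    also have "\<dots> \<longleftrightarrow> cs a = \<zero>\<^bsub>?k\<^esub>"
      by (rule inj_on_eq_iff[OF j(2) cs[OF a] module_zero_closed[OF mk]])
    also have "\<dots> \<longleftrightarrow> a \<in> \<nn>"
      using coset_eq_iff[OF mS assms(3), of a "\<zero>\<^bsub>S\<^esub>"] coset_zero[OF mS assms(3)] module_diff_zero[OF mS, of a] a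
      by (simp add: cs_def)
    finally show ?thesis .
  qed
  have "\<exists>r\<in>carrier S. \<exists>c\<in>carrier S. r \<odot>\<^bsub>I\<^esub> x = c \<odot>\<^bsub>I\<^esub> e \<and> r \<odot>\<^bsub>I\<^esub> x \<noteq> \<zero>\<^bsub>I\<^esub>"
    if x: "x \<in> carrier I" "x \<noteq> \<zero>\<^bsub>I\<^esub>" for x
  proof -
    let ?U = "(\<lambda>r. r \<odot>\<^bsub>I\<^esub> x) ` carrier (self_mod S)"
    have hom: "(\<lambda>r. r \<odot>\<^bsub>I\<^esub> x) \<in> mod_hom S (self_mod S) I"
      by (rule mod_homI) (use x in \<open>simp_all add: I.smult_l_distr I.smult_assoc1\<close>)
    have U: "submodule ?U S I"
      by (rule mod_hom_image_submodule[OF mS mI hom module.carrier_is_submodule[OF mS]])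
    have "x \<in> ?U" by (rule image_eqI[of _ _ "\<one>\<^bsub>S\<^esub>"]) (use x in simp_all)
    hence "?U \<noteq> {\<zero>\<^bsub>I\<^esub>}" using x(2) by blast
    hence ne: "?U \<inter> j ` carrier ?k \<noteq> {\<zero>\<^bsub>I\<^esub>}" using ess[OF U] by blast
    have "\<zero>\<^bsub>I\<^esub> \<in> j ` carrier ?k"
      using module_zero_closed[OF mk] mod_hom_zero[OF mk mI j(1)] by (metis image_eqI)
    hence "\<zero>\<^bsub>I\<^esub> \<in> ?U \<inter> j ` carrier ?k" using submodule_zero[OF mI U] by blast
    then obtain y where y: "y \<in> ?U" "y \<in> j ` carrier ?k" "y \<noteq> \<zero>\<^bsub>I\<^esub>" using ne by blast
    obtain r where r: "r \<in> carrier S" "y = r \<odot>\<^bsub>I\<^esub> x" using y(1) by auto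
    obtain K where K: "K \<in> carrier ?k" "y = j K" using y(2) by blast
    obtain c where c: "c \<in> carrier S" "K = cs c" using K(1) unfolding quot_mod_carrier cs_def by auto
    have "y = c \<odot>\<^bsub>I\<^esub> e" using je[OF c(1)] K(2) c(2) by simp
    hence "r \<odot>\<^bsub>I\<^esub> x = c \<odot>\<^bsub>I\<^esub> e" "r \<odot>\<^bsub>I\<^esub> x \<noteq> \<zero>\<^bsub>I\<^esub>" using r(2) y(3) by simp_all
    thus ?thesis using r(1) c(1) by blast
  qed
  thus ?thesis using e ann by blast
qed

context cring
begin

lemma maximal_bezout:
  assumes "maximalideal \<mm> R" "r \<in> carrier R" "r \<notin> \<mm>"
  shows "\<exists>b\<in>carrier R. \<one> \<ominus> b \<otimes> r \<in> \<mm>"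
proof -
  interpret \<mm>: maximalideal \<mm> R by fact
  note mS = self_mod_module[OF is_cring]
  have m: "submodule \<mm> R (self_mod R)" using \<mm>.is_ideal by (simp add: ideal_iff_submodule[OF is_cring])
  let ?W = "span_over R (self_mod R) \<mm> (\<lambda>_. r) (Suc 0)"
  have W: "ideal ?W R"
    unfolding ideal_iff_submodule[OF is_cring]
    by (rule span_over_submodule[OF mS m]) (use assms(2) in simp)
  have sub: "\<mm> \<subseteq> ?W" by (rule span_over_base[OF mS m]) (use assms(2) in simp)
  have z: "\<zero> \<in> \<mm>" using submodule_zero[OF mS m] by simp
  have "r = \<zero> \<oplus>\<^bsub>self_mod R\<^esub> lincomb (self_mod R) (\<lambda>_. r) (\<lambda>_. \<one>) (Suc 0)" using assms(2) by simp
  hence "r \<in> ?W" unfolding span_over_def using z one_closed by blast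
  hence "?W \<noteq> \<mm>" using assms(3) by blast
  moreover have "?W \<subseteq> carrier R" by (rule additive_subgroup.a_subset[OF ideal.axioms(1)[OF W]])
  ultimately have "?W = carrier R" using \<mm>.I_maximal[OF W sub] by blast
  hence "\<one> \<in> ?W" by simp
  then obtain x c where xc: "x \<in> \<mm>" "\<forall>i. c i \<in> carrier R"
    "\<one> = x \<oplus>\<^bsub>self_mod R\<^esub> lincomb (self_mod R) (\<lambda>_. r) c (Suc 0)"
    unfolding span_over_def by blast
  define b where "b = c (0 :: nat)"
  have b: "b \<in> carrier R" using xc(2) by (simp add: b_def)
  have x: "x \<in> carrier R" using xc(1) \<mm>.Icarr by simp
  have 1: "\<one> = x \<oplus> b \<otimes> r" using xc(3) b assms(2) by (simp add: b_def)
  have "\<one> \<ominus> b \<otimes> r = x"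
    by (subst 1) (use x b assms(2) in \<open>simp add: minus_eq a_assoc r_neg\<close>)
  thus ?thesis using b xc(1) by auto
qed

text \<open>The element \<open>u\<close> is a product with one factor from each ideal in \<open>F\<close>, each factor being \<open>1\<close> modulo
  \<open>\<mm>\<close>.\<close>

lemma maximal_separate:
  assumes "finite F" "F \<subseteq> Max_ideals R" "\<mm> \<in> Max_ideals R" "\<mm> \<notin> F"
  shows "\<exists>u\<in>carrier R. \<one> \<ominus> u \<in> \<mm> \<and> (\<forall>\<mm>'\<in>F. u \<in> \<mm>')"
  using assms(1,2,4)
proof (induct F rule: finite_induct)
  case empty
  interpret \<mm>: maximalideal \<mm> R using assms(3) by (simp add: Max_ideals_def)
  have 1: "\<one> \<ominus> \<one> = \<zero>" by (simp add: minus_eq r_neg)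
  have "\<one> \<ominus> \<one> \<in> \<mm>"
    unfolding 1 by (rule additive_subgroup.zero_closed[OF \<mm>.is_additive_subgroup])
  thus ?case by (intro bexI[OF _ one_closed] conjI ballI) simp_all
next
  case (insert \<mm>' F)
  then obtain u where u: "u \<in> carrier R" "\<one> \<ominus> u \<in> \<mm>" "\<And>\<mm>'. \<mm>' \<in> F \<Longrightarrow> u \<in> \<mm>'" by blast
  have mm: "maximalideal \<mm> R" and mm': "maximalideal \<mm>' R"
    using assms(3) insert.prems(1) by (auto simp: Max_ideals_def)
  interpret \<mm>: maximalideal \<mm> R by (rule mm)
  interpret \<mm>': maximalideal \<mm>' R by (rule mm')
  have ne: "\<mm> \<noteq> \<mm>'" using insert.prems(2) by blast
  have "\<not> \<mm>' \<subseteq> \<mm>"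
    using \<mm>'.I_maximal[OF \<mm>.is_ideal _ \<mm>.a_subset] ne \<mm>.I_notcarr by blast
  then obtain r where r: "r \<in> \<mm>'" "r \<notin> \<mm>" by blast
  have rc: "r \<in> carrier R" using \<mm>'.Icarr[OF r(1)] .
  obtain b where b: "b \<in> carrier R" "\<one> \<ominus> b \<otimes> r \<in> \<mm>" using maximal_bezout[OF mm rc r(2)] by blast
  define a where "a = b \<otimes> r"
  have a: "a \<in> carrier R" "a \<in> \<mm>'" "\<one> \<ominus> a \<in> \<mm>"
    using b rc \<mm>'.I_l_closed[OF r(1) b(1)] by (simp_all add: a_def)
  have "\<one> \<ominus> u \<otimes> a = (\<one> \<ominus> u) \<oplus> u \<otimes> (\<one> \<ominus> a)"
  proof -
    have "(\<one> \<ominus> u) \<oplus> u \<otimes> (\<one> \<ominus> a) = \<one> \<oplus> (\<ominus> u \<oplus> (u \<oplus> \<ominus> (u \<otimes> a)))"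
      using u(1) a(1) by (simp add: minus_eq r_distr r_minus a_assoc)
    also have "\<dots> = \<one> \<ominus> u \<otimes> a" using u(1) a(1) by (simp add: minus_eq a_assoc[symmetric] l_neg)
    finally show ?thesis by simp
  qed
  moreover have "(\<one> \<ominus> u) \<oplus> u \<otimes> (\<one> \<ominus> a) \<in> \<mm>"
    by (rule additive_subgroup.a_closed[OF \<mm>.is_additive_subgroup u(2) \<mm>.I_l_closed[OF a(3) u(1)]])
  moreover have "u \<otimes> a \<in> \<mm>''" if m: "\<mm>'' \<in> insert \<mm>' F" for \<mm>''
  proof (cases "\<mm>'' = \<mm>'")
    case True
    thus ?thesis using \<mm>'.I_l_closed[OF a(2) u(1)] by simp
  next
    case False
    hence "\<mm>'' \<in> F" using m by blast
    hence "ideal \<mm>'' R" using insert.prems(1) by (auto simp: Max_ideals_def maximalideal_def)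
    thus ?thesis using ideal.I_r_closed[of \<mm>'' R u a] u(3)[OF \<open>\<mm>'' \<in> F\<close>] a(1) by simp
  qed
  ultimately show ?case using u(1) a(1) by (intro bexI[of _ "u \<otimes> a"]) auto
qed

lemma jacobson_radical_ideal: "ideal (jacobson_radical R) R"
proof -
  note mS = self_mod_module[OF is_cring]
  have *: "submodule \<mm> R (self_mod R)" if "\<mm> \<in> Max_ideals R" for \<mm>
    using that by (simp add: Max_ideals_def maximalideal_def ideal_iff_submodule[OF is_cring, symmetric])
  show ?thesis
    unfolding ideal_iff_submodule[OF is_cring] submodule_iff[OF mS] jacobson_radical_def
    using *[unfolded submodule_iff[OF mS]] by auto
qed

text \<open>Otherwise \<open>1 - j\<close> lies in an ideal that is maximal among the proper ones; but such an ideal also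
  contains \<open>j\<close>.\<close>

lemma jacobson_radical_unit:
  assumes "noetherian_ring R" "j \<in> jacobson_radical R"
  shows "\<exists>b\<in>carrier R. b \<otimes> (\<one> \<ominus> j) = \<one>"
proof (rule ccontr)
  assume nb: "\<not> ?thesis"
  have j: "j \<in> carrier R" using assms(2) by (simp add: jacobson_radical_def)
  define x where "x = \<one> \<ominus> j"
  have x: "x \<in> carrier R" using j by (simp add: x_def)
  note mS = self_mod_module[OF is_cring]
  let ?V = "(\<lambda>b. b \<otimes> x) ` carrier (self_mod R)"
  have hom: "(\<lambda>b. b \<otimes> x) \<in> mod_hom R (self_mod R) (self_mod R)"
    by (rule mod_homI) (use x in \<open>simp_all add: l_distr m_assoc\<close>)
  have V: "ideal ?V R"
    unfolding ideal_iff_submodule[OF is_cring]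
    by (rule mod_hom_image_submodule[OF mS mS hom module.carrier_is_submodule[OF mS]])
  have xV: "x \<in> ?V" by (rule image_eqI[of _ _ \<one>]) (use x in simp_all)
  have 1: "\<one> \<notin> ?V"
  proof
    assume "\<one> \<in> ?V"
    then obtain b where b: "b \<in> carrier (self_mod R)" "\<one> = b \<otimes> x" by (elim imageE)
    from b(2)[symmetric, unfolded x_def] b(1)[unfolded self_mod_simps]
    have "\<exists>b\<in>carrier R. b \<otimes> (\<one> \<ominus> j) = \<one>" by (rule bexI)
    with nb show False by (rule notE)
  qed
  let ?P = "{I. ideal I R \<and> x \<in> I \<and> \<one> \<notin> I}"
  have "\<exists>I\<in>?P. \<forall>K\<in>?P. I \<subseteq> K \<longrightarrow> K = I"
  proof (rule subset_Zorn_nonempty)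
    show "?P \<noteq> {}" using V xV 1 by blast
    fix C assume C: "C \<noteq> {}" "subset.chain ?P C"
    have "subset.chain {I. ideal I R} C" using C(2) unfolding subset.chain_def by blast
    hence "\<Union>C \<in> C" by (rule noetherian_ring.ideal_chain_is_trivial[OF assms(1) C(1)])
    thus "\<Union>C \<in> ?P" using C(2) unfolding subset.chain_def by blast
  qed
  then obtain I where I: "ideal I R" "x \<in> I" "\<one> \<notin> I"
    and max: "\<And>K. ideal K R \<Longrightarrow> x \<in> K \<Longrightarrow> \<one> \<notin> K \<Longrightarrow> I \<subseteq> K \<Longrightarrow> K = I" by blast
  have "maximalideal I R"
  proof (rule maximalidealI[OF I(1)])
    show "carrier R \<noteq> I" using I(3) by blast
    fix K assume K: "ideal K R" "I \<subseteq> K" "K \<subseteq> carrier R"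
    show "K = I \<or> K = carrier R"
    proof (cases "\<one> \<in> K")
      case True
      thus ?thesis using ideal.one_imp_carrier[OF K(1)] by simp
    next
      case False
      thus ?thesis using max[OF K(1) _ False K(2)] K(2) I(2) by blast
    qed
  qed
  hence "j \<in> I" using assms(2) by (simp add: jacobson_radical_def Max_ideals_def)
  hence "x \<oplus> j \<in> I" using I(1,2) unfolding ideal_iff_submodule[OF is_cring] submodule_iff[OF mS] by simp
  moreover have "x \<oplus> j = \<one>" using j by (simp add: x_def minus_eq a_assoc l_neg)
  ultimately show False using I(3) by simp
qed

end

lemma direct_sum_simps:
  assumes "finite I"
  shows "f \<in> carrier (direct_sum I N) \<longleftrightarrow> f \<in> (\<Pi>\<^sub>E i\<in>I. carrier (N i))"
    "\<zero>\<^bsub>direct_sum I N\<^esub> = (\<lambda>i\<in>I. \<zero>\<^bsub>N i\<^esub>)"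
    "f \<oplus>\<^bsub>direct_sum I N\<^esub> g = (\<lambda>i\<in>I. f i \<oplus>\<^bsub>N i\<^esub> g i)"
    "r \<odot>\<^bsub>direct_sum I N\<^esub> f = (\<lambda>i\<in>I. r \<odot>\<^bsub>N i\<^esub> f i)"
  using assms by (auto simp: direct_sum_def)

lemma direct_sum_module:
  assumes "cring R" "finite I" "\<And>i. i \<in> I \<Longrightarrow> module R (N i)"
  shows "module R (direct_sum I N)"
proof -
  interpret cring R by fact
  let ?D = "direct_sum I N"
  note ds = direct_sum_simps[OF assms(2), where N = N]
  have z: "\<zero>\<^bsub>N i\<^esub> \<in> carrier (N i)" if "i \<in> I" for i by (rule module_zero_closed[OF assms(3)[OF that]])
  have ac: "x \<oplus>\<^bsub>N i\<^esub> y \<in> carrier (N i)" "x \<oplus>\<^bsub>N i\<^esub> y = y \<oplus>\<^bsub>N i\<^esub> x" "\<zero>\<^bsub>N i\<^esub> \<oplus>\<^bsub>N i\<^esub> x = x"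
    "x \<oplus>\<^bsub>N i\<^esub> y \<oplus>\<^bsub>N i\<^esub> w = x \<oplus>\<^bsub>N i\<^esub> (y \<oplus>\<^bsub>N i\<^esub> w)" "\<ominus>\<^bsub>N i\<^esub> x \<oplus>\<^bsub>N i\<^esub> x = \<zero>\<^bsub>N i\<^esub>" "\<ominus>\<^bsub>N i\<^esub> x \<in> carrier (N i)"
    if "i \<in> I" "x \<in> carrier (N i)" "y \<in> carrier (N i)" "w \<in> carrier (N i)" for i x y w
  proof -
    interpret N: module R "N i" by (rule assms(3)[OF that(1)])
    show "x \<oplus>\<^bsub>N i\<^esub> y \<in> carrier (N i)" "x \<oplus>\<^bsub>N i\<^esub> y = y \<oplus>\<^bsub>N i\<^esub> x" "\<zero>\<^bsub>N i\<^esub> \<oplus>\<^bsub>N i\<^esub> x = x"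
      "x \<oplus>\<^bsub>N i\<^esub> y \<oplus>\<^bsub>N i\<^esub> w = x \<oplus>\<^bsub>N i\<^esub> (y \<oplus>\<^bsub>N i\<^esub> w)" "\<ominus>\<^bsub>N i\<^esub> x \<oplus>\<^bsub>N i\<^esub> x = \<zero>\<^bsub>N i\<^esub>" "\<ominus>\<^bsub>N i\<^esub> x \<in> carrier (N i)"
      using that by (simp_all add: N.M.a_assoc N.M.l_neg) (rule N.M.a_comm[OF that(2,3)])
  qed
  have sm: "a \<odot>\<^bsub>N i\<^esub> x \<in> carrier (N i)" "(a \<oplus>\<^bsub>R\<^esub> b) \<odot>\<^bsub>N i\<^esub> x = a \<odot>\<^bsub>N i\<^esub> x \<oplus>\<^bsub>N i\<^esub> b \<odot>\<^bsub>N i\<^esub> x"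
    "a \<odot>\<^bsub>N i\<^esub> (x \<oplus>\<^bsub>N i\<^esub> y) = a \<odot>\<^bsub>N i\<^esub> x \<oplus>\<^bsub>N i\<^esub> a \<odot>\<^bsub>N i\<^esub> y"
    "(a \<otimes>\<^bsub>R\<^esub> b) \<odot>\<^bsub>N i\<^esub> x = a \<odot>\<^bsub>N i\<^esub> (b \<odot>\<^bsub>N i\<^esub> x)" "\<one>\<^bsub>R\<^esub> \<odot>\<^bsub>N i\<^esub> x = x"
    if "i \<in> I" "a \<in> carrier R" "b \<in> carrier R" "x \<in> carrier (N i)" "y \<in> carrier (N i)" for i a b x y
  proof -
    interpret N: module R "N i" by (rule assms(3)[OF that(1)])
    show "a \<odot>\<^bsub>N i\<^esub> x \<in> carrier (N i)" "(a \<oplus>\<^bsub>R\<^esub> b) \<odot>\<^bsub>N i\<^esub> x = a \<odot>\<^bsub>N i\<^esub> x \<oplus>\<^bsub>N i\<^esub> b \<odot>\<^bsub>N i\<^esub> x"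
      "a \<odot>\<^bsub>N i\<^esub> (x \<oplus>\<^bsub>N i\<^esub> y) = a \<odot>\<^bsub>N i\<^esub> x \<oplus>\<^bsub>N i\<^esub> a \<odot>\<^bsub>N i\<^esub> y"
      "(a \<otimes>\<^bsub>R\<^esub> b) \<odot>\<^bsub>N i\<^esub> x = a \<odot>\<^bsub>N i\<^esub> (b \<odot>\<^bsub>N i\<^esub> x)" "\<one>\<^bsub>R\<^esub> \<odot>\<^bsub>N i\<^esub> x = x"
      using that by (simp_all add: N.smult_l_distr N.smult_r_distr N.smult_assoc1)
  qed
  have cl: "f i \<in> carrier (N i)" if "f \<in> carrier ?D" "i \<in> I" for f i
    using that by (auto simp: ds(1))
  have eqI: "f = g" if "f \<in> extensional I" "g \<in> extensional I" "\<And>i. i \<in> I \<Longrightarrow> f i = g i" for f g :: "'c \<Rightarrow> 'd"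
    by (rule extensionalityI[OF that])
  have ext: "f \<in> extensional I" if "f \<in> carrier ?D" for f using that by (auto simp: ds(1) PiE_def)
  have "abelian_group ?D"
  proof (rule abelian_groupI)
    show "\<zero>\<^bsub>?D\<^esub> \<in> carrier ?D" unfolding ds(1,2) using z by auto
  next
    fix f g assume fg: "f \<in> carrier ?D" "g \<in> carrier ?D"
    show "f \<oplus>\<^bsub>?D\<^esub> g \<in> carrier ?D" unfolding ds(1,3) using ac(1)[OF _ cl[OF fg(1)] cl[OF fg(2)] cl[OF fg(1)]] by auto
    show "f \<oplus>\<^bsub>?D\<^esub> g = g \<oplus>\<^bsub>?D\<^esub> f"
      unfolding ds(3) by (rule restrict_ext) (rule ac(2)[OF _ cl[OF fg(1)] cl[OF fg(2)] cl[OF fg(1)]]; assumption)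
  next
    fix f g h assume fg: "f \<in> carrier ?D" "g \<in> carrier ?D" "h \<in> carrier ?D"
    show "f \<oplus>\<^bsub>?D\<^esub> g \<oplus>\<^bsub>?D\<^esub> h = f \<oplus>\<^bsub>?D\<^esub> (g \<oplus>\<^bsub>?D\<^esub> h)"
      unfolding ds(3)
      by (rule restrict_ext) (simp add: ac(4)[OF _ cl[OF fg(1)] cl[OF fg(2)] cl[OF fg(3)]])
  next
    fix f assume f: "f \<in> carrier ?D"
    show "\<zero>\<^bsub>?D\<^esub> \<oplus>\<^bsub>?D\<^esub> f = f"
      unfolding ds(2,3) by (rule eqI[OF restrict_extensional ext[OF f]])
        (simp add: ac(3)[OF _ cl[OF f] cl[OF f] cl[OF f]])
    let ?g = "\<lambda>i\<in>I. \<ominus>\<^bsub>N i\<^esub> f i"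
    have "?g \<in> carrier ?D" unfolding ds(1) using ac(6)[OF _ cl[OF f] cl[OF f] cl[OF f]] by auto
    moreover have "?g \<oplus>\<^bsub>?D\<^esub> f = \<zero>\<^bsub>?D\<^esub>"
      unfolding ds(2,3) by (rule restrict_ext) (simp add: ac(5)[OF _ cl[OF f] cl[OF f] cl[OF f]])
    ultimately show "\<exists>g\<in>carrier ?D. g \<oplus>\<^bsub>?D\<^esub> f = \<zero>\<^bsub>?D\<^esub>" by blast
  qed
  thus ?thesis
  proof (rule moduleI[OF assms(1)])
    fix a f assume a: "a \<in> carrier R" and f: "f \<in> carrier ?D"
    show "a \<odot>\<^bsub>?D\<^esub> f \<in> carrier ?D" unfolding ds(1,4) using sm(1)[OF _ a a cl[OF f] cl[OF f]] by auto
    fix b assume b: "b \<in> carrier R"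
    show "(a \<oplus>\<^bsub>R\<^esub> b) \<odot>\<^bsub>?D\<^esub> f = a \<odot>\<^bsub>?D\<^esub> f \<oplus>\<^bsub>?D\<^esub> b \<odot>\<^bsub>?D\<^esub> f"
      unfolding ds(3,4) by (rule restrict_ext) (simp add: sm(2)[OF _ a b cl[OF f] cl[OF f]])
    show "(a \<otimes>\<^bsub>R\<^esub> b) \<odot>\<^bsub>?D\<^esub> f = a \<odot>\<^bsub>?D\<^esub> (b \<odot>\<^bsub>?D\<^esub> f)"
      unfolding ds(3,4) by (rule restrict_ext) (simp add: sm(4)[OF _ a b cl[OF f] cl[OF f]])
  next
    fix a f g assume a: "a \<in> carrier R" and f: "f \<in> carrier ?D" and g: "g \<in> carrier ?D"
    show "a \<odot>\<^bsub>?D\<^esub> (f \<oplus>\<^bsub>?D\<^esub> g) = a \<odot>\<^bsub>?D\<^esub> f \<oplus>\<^bsub>?D\<^esub> a \<odot>\<^bsub>?D\<^esub> g"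
      unfolding ds(3,4) by (rule restrict_ext) (simp add: sm(3)[OF _ a a cl[OF f] cl[OF g]])
  next
    fix f assume f: "f \<in> carrier ?D"
    show "\<one>\<^bsub>R\<^esub> \<odot>\<^bsub>?D\<^esub> f = f"
      unfolding ds(4) by (rule eqI[OF restrict_extensional ext[OF f]])
        (simp add: sm(5)[OF _ one_closed one_closed cl[OF f] cl[OF f]])
  qed
qed

text \<open>The elements \<open>e\<^sub>i\<close> that represent the components of a map form an element of the sum since \<open>I\<close> is
  finite.\<close>

lemma direct_sum_baer:
  assumes "cring R" "finite I" "\<And>i. i \<in> I \<Longrightarrow> baer R (N i)"
  shows "baer R (direct_sum I N)"
proof -
  note ds = direct_sum_simps[OF assms(2), where N = N]
  have mD: "module R (direct_sum I N)" by (rule direct_sum_module[OF assms(1,2) baer_module[OF assms(3)]])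
  have "\<exists>e\<in>carrier (direct_sum I N). \<forall>r\<in>\<aa>. g r = r \<odot>\<^bsub>direct_sum I N\<^esub> e"
    if a: "ideal \<aa> R" and g: "g \<in> mod_hom R (self_mod R\<lparr>carrier := \<aa>\<rparr>) (direct_sum I N)" for \<aa> g
  proof -
    have gc: "g r \<in> carrier (direct_sum I N)" if "r \<in> \<aa>" for r using mod_hom_closed[OF g] that by simp
    have ac: "x \<oplus>\<^bsub>R\<^esub> y \<in> \<aa>" if "x \<in> \<aa>" "y \<in> \<aa>" for x y
      by (rule additive_subgroup.a_closed[OF ideal.axioms(1)[OF a] that])
    have "\<exists>e\<in>carrier (N i). \<forall>r\<in>\<aa>. g r i = r \<odot>\<^bsub>N i\<^esub> e" if i: "i \<in> I" for i
    proof -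
      have "(\<lambda>r. g r i) \<in> mod_hom R (self_mod R\<lparr>carrier := \<aa>\<rparr>) (N i)"
      proof (rule mod_homI)
        show "g x i \<in> carrier (N i)" if "x \<in> carrier (self_mod R\<lparr>carrier := \<aa>\<rparr>)" for x
          using gc[of x] that i by (auto simp: ds(1))
      qed (use i in \<open>simp_all only: mod_hom_add[OF g] mod_hom_smult[OF g] ds(3,4) restrict_apply'\<close>)
      thus ?thesis using assms(3)[OF i] a unfolding baer_def by blast
    qed
    then obtain e where e: "\<And>i. i \<in> I \<Longrightarrow> e i \<in> carrier (N i)"
      "\<And>i r. i \<in> I \<Longrightarrow> r \<in> \<aa> \<Longrightarrow> g r i = r \<odot>\<^bsub>N i\<^esub> e i" by metis
    have "restrict e I \<in> carrier (direct_sum I N)" unfolding ds(1) using e(1) by auto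
    moreover have "g r = r \<odot>\<^bsub>direct_sum I N\<^esub> restrict e I" if r: "r \<in> \<aa>" for r
      unfolding ds(4)
      by (rule extensionalityI[OF _ restrict_extensional]) (use gc[OF r] e(2) r in \<open>auto simp: ds(1) PiE_def\<close>)
    ultimately show ?thesis by blast
  qed
  thus ?thesis unfolding baer_def using mD by blast
qed

text \<open>Here \<open>I\<close> is \<open>E(R/\<mm>)\<close> and \<open>e\<close> is the class of \<open>1\<close>.  Elements that are \<open>1\<close> modulo \<open>\<mm>\<close> act injectively
  on \<open>I\<close>, since \<open>R e\<close> is essential.  One of them lies in all other maximal ideals and so multiplies \<open>\<mm>\<close> into the
  radical; hence \<open>\<mm>\<close> annihilates \<open>y\<close>.  As some multiple \<open>r y\<close> is a nonzero element of \<open>R e\<close>, the scalar \<open>r\<close> is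
  invertible modulo \<open>\<mm>\<close>, and \<open>y\<close> itself lies in \<open>R e\<close>.\<close>

lemma hull_socle_component:
  assumes R: "cring R" and fin: "finite (Max_ideals R)" and m: "\<mm> \<in> Max_ideals R" and mI: "module R I"
    and e: "e \<in> carrier I" "\<And>a. a \<in> carrier R \<Longrightarrow> a \<odot>\<^bsub>I\<^esub> e = \<zero>\<^bsub>I\<^esub> \<longleftrightarrow> a \<in> \<mm>"
    and ess: "\<And>x. x \<in> carrier I \<Longrightarrow> x \<noteq> \<zero>\<^bsub>I\<^esub> \<Longrightarrow>
      \<exists>r\<in>carrier R. \<exists>c\<in>carrier R. r \<odot>\<^bsub>I\<^esub> x = c \<odot>\<^bsub>I\<^esub> e \<and> r \<odot>\<^bsub>I\<^esub> x \<noteq> \<zero>\<^bsub>I\<^esub>"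
    and y: "y \<in> carrier I" "\<And>j. j \<in> jacobson_radical R \<Longrightarrow> j \<odot>\<^bsub>I\<^esub> y = \<zero>\<^bsub>I\<^esub>"
  shows "\<exists>a\<in>carrier R. y = a \<odot>\<^bsub>I\<^esub> e"
proof (cases "y = \<zero>\<^bsub>I\<^esub>")
  case True
  interpret I: module R I by (rule mI)
  show ?thesis using True e(1) by (intro bexI[of _ "\<zero>\<^bsub>R\<^esub>"]) auto
next
  case False
  interpret R: cring R by (rule R)
  interpret I: module R I by (rule mI)
  have mm: "maximalideal \<mm> R" using m by (simp add: Max_ideals_def)
  interpret \<mm>: maximalideal \<mm> R by (rule mm)
  obtain u where u: "u \<in> carrier R" "\<one>\<^bsub>R\<^esub> \<ominus>\<^bsub>R\<^esub> u \<in> \<mm>" "\<And>\<mm>'. \<mm>' \<in> Max_ideals R - {\<mm>} \<Longrightarrow> u \<in> \<mm>'"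
    using R.maximal_separate[of "Max_ideals R - {\<mm>}" \<mm>] fin m by auto
  have ann: "t \<odot>\<^bsub>I\<^esub> y = \<zero>\<^bsub>I\<^esub>" if t: "t \<in> \<mm>" for t
  proof (rule ccontr)
    assume nz: "t \<odot>\<^bsub>I\<^esub> y \<noteq> \<zero>\<^bsub>I\<^esub>"
    have tc: "t \<in> carrier R" using \<mm>.Icarr[OF t] .
    have ty: "t \<odot>\<^bsub>I\<^esub> y \<in> carrier I" using tc y(1) by simp
    have "u \<otimes>\<^bsub>R\<^esub> t \<in> \<mm>'" if "\<mm>' \<in> Max_ideals R" for \<mm>'
    proof (cases "\<mm>' = \<mm>")
      case True
      thus ?thesis using \<mm>.I_l_closed[OF t u(1)] by simp
    next
      case False
      have "ideal \<mm>' R" using that by (simp add: Max_ideals_def maximalideal_def)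
      thus ?thesis using ideal.I_r_closed[of \<mm>' R u t] u(3)[of \<mm>'] that False tc by simp
    qed
    hence "u \<otimes>\<^bsub>R\<^esub> t \<in> jacobson_radical R" using u(1) tc by (simp add: jacobson_radical_def)
    hence ut: "u \<odot>\<^bsub>I\<^esub> (t \<odot>\<^bsub>I\<^esub> y) = \<zero>\<^bsub>I\<^esub>" using y(2)[of "u \<otimes>\<^bsub>R\<^esub> t"] I.smult_assoc1[OF u(1) tc y(1)] by simp
    from ess[OF ty nz] obtain r c where rc: "r \<in> carrier R" "c \<in> carrier R"
      "r \<odot>\<^bsub>I\<^esub> (t \<odot>\<^bsub>I\<^esub> y) = c \<odot>\<^bsub>I\<^esub> e" "r \<odot>\<^bsub>I\<^esub> (t \<odot>\<^bsub>I\<^esub> y) \<noteq> \<zero>\<^bsub>I\<^esub>" by blast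
    have "(u \<otimes>\<^bsub>R\<^esub> c) \<odot>\<^bsub>I\<^esub> e = u \<odot>\<^bsub>I\<^esub> (r \<odot>\<^bsub>I\<^esub> (t \<odot>\<^bsub>I\<^esub> y))"
      using I.smult_assoc1[OF u(1) rc(2) e(1)] rc(3) by simp
    also have "\<dots> = r \<odot>\<^bsub>I\<^esub> (u \<odot>\<^bsub>I\<^esub> (t \<odot>\<^bsub>I\<^esub> y))"
      using u(1) rc(1) ty by (simp add: I.smult_assoc1[symmetric] R.m_comm)
    also have "\<dots> = \<zero>\<^bsub>I\<^esub>" unfolding ut using rc(1) by simp
    finally have uc: "u \<otimes>\<^bsub>R\<^esub> c \<in> \<mm>" using e(2)[of "u \<otimes>\<^bsub>R\<^esub> c"] u(1) rc(2) by simp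
    have "(\<one>\<^bsub>R\<^esub> \<ominus>\<^bsub>R\<^esub> u) \<otimes>\<^bsub>R\<^esub> c \<oplus>\<^bsub>R\<^esub> u \<otimes>\<^bsub>R\<^esub> c \<in> \<mm>"
      by (rule additive_subgroup.a_closed[OF \<mm>.is_additive_subgroup \<mm>.I_r_closed[OF u(2) rc(2)] uc])
    moreover have "(\<one>\<^bsub>R\<^esub> \<ominus>\<^bsub>R\<^esub> u) \<otimes>\<^bsub>R\<^esub> c \<oplus>\<^bsub>R\<^esub> u \<otimes>\<^bsub>R\<^esub> c = c"
      using u(1) rc(2) by (simp add: R.minus_eq R.l_distr R.l_minus R.a_assoc R.l_neg)
    ultimately show False using e(2)[OF rc(2)] rc(3,4) by simp
  qed
  from ess[OF y(1) False] obtain r c where rc: "r \<in> carrier R" "c \<in> carrier R"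
    "r \<odot>\<^bsub>I\<^esub> y = c \<odot>\<^bsub>I\<^esub> e" "r \<odot>\<^bsub>I\<^esub> y \<noteq> \<zero>\<^bsub>I\<^esub>" by blast
  have "r \<notin> \<mm>" using ann rc(4) by blast
  from R.maximal_bezout[OF mm rc(1) this] obtain b where b: "b \<in> carrier R" "\<one>\<^bsub>R\<^esub> \<ominus>\<^bsub>R\<^esub> b \<otimes>\<^bsub>R\<^esub> r \<in> \<mm>" by blast
  have "\<one>\<^bsub>R\<^esub> \<odot>\<^bsub>I\<^esub> y \<ominus>\<^bsub>I\<^esub> (b \<otimes>\<^bsub>R\<^esub> r) \<odot>\<^bsub>I\<^esub> y = \<zero>\<^bsub>I\<^esub>"
    using ann[OF b(2)] b(1) rc(1) y(1) by (simp add: R.minus_eq I.M.minus_eq I.smult_l_distr I.smult_l_minus)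
  hence "y = (b \<otimes>\<^bsub>R\<^esub> r) \<odot>\<^bsub>I\<^esub> y"
    using module_diff_zero_iff[OF mI y(1), of "(b \<otimes>\<^bsub>R\<^esub> r) \<odot>\<^bsub>I\<^esub> y"] b(1) rc(1) y(1) by simp
  also have "\<dots> = (b \<otimes>\<^bsub>R\<^esub> c) \<odot>\<^bsub>I\<^esub> e"
    using b(1) rc y(1) e(1) by (simp add: I.smult_assoc1)
  finally show ?thesis using b(1) rc(2) by blast
qed

text \<open>By the Chinese remainder theorem the components can be reached by a single scalar, so the socle of the
  sum is cyclic.\<close>

lemma semilocal_socle_cyclic:
  assumes R: "cring R" and fin: "finite (Max_ideals R)"
    and E: "\<forall>\<mm>\<in>Max_ideals R. injective_hull R (quot_mod (self_mod R) \<mm>) (E \<mm>)"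
  shows "\<exists>\<epsilon>\<in>carrier (direct_sum (Max_ideals R) E).
    (\<forall>j\<in>jacobson_radical R. j \<odot>\<^bsub>direct_sum (Max_ideals R) E\<^esub> \<epsilon> = \<zero>\<^bsub>direct_sum (Max_ideals R) E\<^esub>) \<and>
    (\<forall>y\<in>carrier (direct_sum (Max_ideals R) E).
      (\<forall>j\<in>jacobson_radical R. j \<odot>\<^bsub>direct_sum (Max_ideals R) E\<^esub> y = \<zero>\<^bsub>direct_sum (Max_ideals R) E\<^esub>) \<longrightarrow>
      (\<exists>r\<in>carrier R. y = r \<odot>\<^bsub>direct_sum (Max_ideals R) E\<^esub> \<epsilon>))"
proof -
  interpret R: cring R by (rule R)
  let ?X = "Max_ideals R" and ?D = "direct_sum (Max_ideals R) E"
  note ds = direct_sum_simps[OF fin, where N = E]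
  have mx: "maximalideal \<mm> R" if "\<mm> \<in> ?X" for \<mm> using that by (simp add: Max_ideals_def)
  note hull = E[rule_format]
  have mE: "module R (E \<mm>)" if "\<mm> \<in> ?X" for \<mm>
    using hull[OF that] unfolding injective_hull_def by (intro injective_module_module) (rule conjunct1)
  have idl: "ideal \<mm> R" if "\<mm> \<in> ?X" for \<mm> using mx[OF that] by (simp add: maximalideal_def)
  have sub: "submodule \<mm> R (self_mod R)" if "\<mm> \<in> ?X" for \<mm>
    using idl[OF that] by (simp add: ideal_iff_submodule[OF R])
  define G where "G = (\<lambda>\<mm> e. e \<in> carrier (E \<mm>) \<and>
    (\<forall>a\<in>carrier R. a \<odot>\<^bsub>E \<mm>\<^esub> e = \<zero>\<^bsub>E \<mm>\<^esub> \<longleftrightarrow> a \<in> \<mm>) \<and>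
    (\<forall>x\<in>carrier (E \<mm>). x \<noteq> \<zero>\<^bsub>E \<mm>\<^esub> \<longrightarrow>
      (\<exists>r\<in>carrier R. \<exists>c\<in>carrier R. r \<odot>\<^bsub>E \<mm>\<^esub> x = c \<odot>\<^bsub>E \<mm>\<^esub> e \<and> r \<odot>\<^bsub>E \<mm>\<^esub> x \<noteq> \<zero>\<^bsub>E \<mm>\<^esub>)))"
  have "\<exists>e. G \<mm> e" if "\<mm> \<in> ?X" for \<mm>
    using injective_hull_generator[OF R hull[OF that] sub[OF that]] unfolding G_def Bex_def .
  then obtain e where e0: "\<And>\<mm>. \<mm> \<in> ?X \<Longrightarrow> G \<mm> (e \<mm>)" by metis
  have e: "e \<mm> \<in> carrier (E \<mm>)" "a \<in> carrier R \<Longrightarrow> a \<odot>\<^bsub>E \<mm>\<^esub> e \<mm> = \<zero>\<^bsub>E \<mm>\<^esub> \<longleftrightarrow> a \<in> \<mm>"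
    "x \<in> carrier (E \<mm>) \<Longrightarrow> x \<noteq> \<zero>\<^bsub>E \<mm>\<^esub> \<Longrightarrow>
      \<exists>r\<in>carrier R. \<exists>c\<in>carrier R. r \<odot>\<^bsub>E \<mm>\<^esub> x = c \<odot>\<^bsub>E \<mm>\<^esub> e \<mm> \<and> r \<odot>\<^bsub>E \<mm>\<^esub> x \<noteq> \<zero>\<^bsub>E \<mm>\<^esub>"
    if "\<mm> \<in> ?X" for \<mm> a x using e0[OF that] unfolding G_def by blast+
  define \<epsilon> where "\<epsilon> = restrict e ?X"
  have \<epsilon>: "\<epsilon> \<in> carrier ?D" unfolding ds(1) \<epsilon>_def using e(1) by auto
  have killed: "j \<odot>\<^bsub>?D\<^esub> \<epsilon> = \<zero>\<^bsub>?D\<^esub>" if j: "j \<in> jacobson_radical R" for j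
    unfolding ds(2,4)
  proof (rule restrict_ext)
    fix \<mm> assume m: "\<mm> \<in> ?X"
    have "j \<in> carrier R" "j \<in> \<mm>" using j m by (auto simp: jacobson_radical_def)
    thus "j \<odot>\<^bsub>E \<mm>\<^esub> \<epsilon> \<mm> = \<zero>\<^bsub>E \<mm>\<^esub>" using e(2)[OF m, of j] m by (simp add: \<epsilon>_def)
  qed
  have "\<exists>r\<in>carrier R. y = r \<odot>\<^bsub>?D\<^esub> \<epsilon>"
    if y: "y \<in> carrier ?D" and jy: "\<And>j. j \<in> jacobson_radical R \<Longrightarrow> j \<odot>\<^bsub>?D\<^esub> y = \<zero>\<^bsub>?D\<^esub>" for y
  proof -
    have yc: "y \<mm> \<in> carrier (E \<mm>)" if "\<mm> \<in> ?X" for \<mm> using y that by (auto simp: ds(1))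
    have "\<exists>a\<in>carrier R. y \<mm> = a \<odot>\<^bsub>E \<mm>\<^esub> e \<mm>" if m: "\<mm> \<in> ?X" for \<mm>
    proof (rule hull_socle_component[OF R fin m mE[OF m] e(1)[OF m] e(2)[OF m] e(3)[OF m] yc[OF m]])
      fix j assume "j \<in> jacobson_radical R"
      from fun_cong[OF jy[OF this], of \<mm>] show "j \<odot>\<^bsub>E \<mm>\<^esub> y \<mm> = \<zero>\<^bsub>E \<mm>\<^esub>" using m by (simp add: ds(2,4))
    qed
    then obtain a where a: "\<And>\<mm>. \<mm> \<in> ?X \<Longrightarrow> a \<mm> \<in> carrier R" "\<And>\<mm>. \<mm> \<in> ?X \<Longrightarrow> y \<mm> = a \<mm> \<odot>\<^bsub>E \<mm>\<^esub> e \<mm>" by metis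
    have "\<exists>r\<in>carrier R. \<forall>\<mm>\<in>F. r \<odot>\<^bsub>E \<mm>\<^esub> e \<mm> = y \<mm>" if "finite F" "F \<subseteq> ?X" for F
      using that
    proof (induct F rule: finite_induct)
      case empty
      show ?case by auto
    next
      case (insert \<mm> F)
      then obtain r where r: "r \<in> carrier R" "\<And>\<mm>'. \<mm>' \<in> F \<Longrightarrow> r \<odot>\<^bsub>E \<mm>'\<^esub> e \<mm>' = y \<mm>'" by blast
      have m: "\<mm> \<in> ?X" and F: "F \<subseteq> ?X" using insert.prems by auto
      obtain u where u: "u \<in> carrier R" "\<one>\<^bsub>R\<^esub> \<ominus>\<^bsub>R\<^esub> u \<in> \<mm>" "\<And>\<mm>'. \<mm>' \<in> F \<Longrightarrow> u \<in> \<mm>'"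
        using R.maximal_separate[OF insert.hyps(1) F m insert.hyps(2)] by blast
      define d where "d = a \<mm> \<ominus>\<^bsub>R\<^esub> r"
      have d: "d \<in> carrier R" using a(1)[OF m] r(1) by (simp add: d_def)
      define s where "s = r \<oplus>\<^bsub>R\<^esub> d \<otimes>\<^bsub>R\<^esub> u"
      have "s \<odot>\<^bsub>E \<mm>'\<^esub> e \<mm>' = y \<mm>'" if m': "\<mm>' \<in> insert \<mm> F" for \<mm>'
      proof -
        have X': "\<mm>' \<in> ?X" using m' insert.prems by blast
        interpret E: module R "E \<mm>'" by (rule mE[OF X'])
        note ec = e(1)[OF X']
        have 1: "s \<odot>\<^bsub>E \<mm>'\<^esub> e \<mm>' = r \<odot>\<^bsub>E \<mm>'\<^esub> e \<mm>' \<oplus>\<^bsub>E \<mm>'\<^esub> d \<odot>\<^bsub>E \<mm>'\<^esub> (u \<odot>\<^bsub>E \<mm>'\<^esub> e \<mm>')"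
          using r(1) u(1) d ec by (simp add: s_def E.smult_l_distr E.smult_assoc1)
        show ?thesis
        proof (cases "\<mm>' \<in> F")
          case True
          hence "u \<odot>\<^bsub>E \<mm>'\<^esub> e \<mm>' = \<zero>\<^bsub>E \<mm>'\<^esub>" using e(2)[OF X' u(1)] u(3) by blast
          thus ?thesis using 1 r(2)[OF True] d yc[OF X'] by simp
        next
          case False
          hence mm: "\<mm>' = \<mm>" using m' by blast
          have u2: "\<one>\<^bsub>R\<^esub> \<ominus>\<^bsub>R\<^esub> u \<in> \<mm>'" using u(2) unfolding mm .
          have "\<one>\<^bsub>R\<^esub> \<odot>\<^bsub>E \<mm>'\<^esub> e \<mm>' \<ominus>\<^bsub>E \<mm>'\<^esub> u \<odot>\<^bsub>E \<mm>'\<^esub> e \<mm>' = \<zero>\<^bsub>E \<mm>'\<^esub>"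
            using e(2)[OF X', of "\<one>\<^bsub>R\<^esub> \<ominus>\<^bsub>R\<^esub> u"] u(1) u2 ec
            by (simp add: R.minus_eq E.M.minus_eq E.smult_l_distr E.smult_l_minus)
          hence "u \<odot>\<^bsub>E \<mm>'\<^esub> e \<mm>' = e \<mm>'"
            using module_diff_zero_iff[OF mE[OF X'] ec, of "u \<odot>\<^bsub>E \<mm>'\<^esub> e \<mm>'"] u(1) ec by simp
          hence "s \<odot>\<^bsub>E \<mm>'\<^esub> e \<mm>' = (r \<oplus>\<^bsub>R\<^esub> d) \<odot>\<^bsub>E \<mm>'\<^esub> e \<mm>'"
            using 1 r(1) d ec by (simp add: E.smult_l_distr)
          also have "r \<oplus>\<^bsub>R\<^esub> d = a \<mm>"
            using r(1) a(1)[OF m] by (simp add: d_def R.minus_eq R.a_lcomm[of r] R.r_neg)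
          finally show ?thesis using a(2)[OF m] mm by simp
        qed
      qed
      moreover have "s \<in> carrier R" using r(1) d u(1) by (simp add: s_def)
      ultimately show ?case by blast
    qed
    from this[OF fin subset_refl] obtain r where r: "r \<in> carrier R" "\<And>\<mm>. \<mm> \<in> ?X \<Longrightarrow> r \<odot>\<^bsub>E \<mm>\<^esub> e \<mm> = y \<mm>" by blast
    have "y = r \<odot>\<^bsub>?D\<^esub> \<epsilon>"
      unfolding ds(4)
    proof (rule extensionalityI[OF _ restrict_extensional])
      show "y \<in> extensional ?X" using y by (simp add: ds(1) PiE_def)
      show "y \<mm> = (\<lambda>i\<in>?X. r \<odot>\<^bsub>E i\<^esub> \<epsilon> i) \<mm>" if "\<mm> \<in> ?X" for \<mm>
        using r(2)[OF that] that by (simp add: \<epsilon>_def)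
    qed
    thus ?thesis using r(1) by blast
  qed
  thus ?thesis using \<epsilon> killed by blast
qed

section \<open>Homology of the Matlis dual\<close>

context artinian_duality
begin

text \<open>The cycles of the dual complex in degree \<open>-s\<close> are the maps on \<open>M\<^sub>s\<close> vanishing on boundaries, and modulo
  boundaries only their values on cycles matter: they amount to maps on the homology of \<open>M\<close>.\<close>

lemma dual_homology_generators:
  assumes M: "chain_complex R M" and art: "artinian_module R (homology M s)"
  shows "\<exists>(k :: nat) X. (\<forall>i<k. X i \<in> cycles (hom_cx R M (stalk E)) (- s)) \<and>
    cycles (hom_cx R M (stalk E)) (- s) \<subseteq>
      span_over R (cx_mod (hom_cx R M (stalk E)) (- s)) (boundaries (hom_cx R M (stalk E)) (- s)) X k"
proof -
  let ?D = "hom_cx R M (stalk E)" and ?A = "homology M s" and ?M = "cx_mod M s"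
  let ?Z = "?M\<lparr>carrier := cycles M s\<rparr>"
  note mM = chain_complexD(1)[OF M]
  note sc = stalk_chain_complex[OF mE]
  note D = hom_cx_chain_complex[OF M sc]
  note mD = chain_complexD(1)[OF D]
  interpret E: module R E by (rule mE)
  interpret D: module R "cx_mod ?D (- s)" by (rule mD)
  have Zs: "submodule (cycles M s) R ?M" by (rule cycles_submodule[OF M])
  have mZ: "module R ?Z" by (rule submodule_module[OF mM Zs])
  have BZ: "submodule (boundaries M s) R ?Z"
    by (rule submodule_of_submodule[OF mM Zs boundaries_submodule[OF M] boundaries_subset_cycles[OF M]])
  have mA: "module R ?A" using art unfolding artinian_module_def by (rule conjunct1)
  have A: "?A = quot_mod ?Z (boundaries M s)" by (simp add: homology_def)
  define \<pi> where "\<pi> = (\<lambda>z. boundaries M s +>\<^bsub>?M\<^esub> z)"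
  have \<pi>: "\<pi> \<in> mod_hom R ?Z ?A"
    unfolding A
  proof (rule mod_homI)
    show "\<pi> z \<in> carrier (quot_mod ?Z (boundaries M s))" if "z \<in> carrier ?Z" for z
      using that unfolding quot_mod_carrier \<pi>_def by auto
    show "\<pi> (x \<oplus>\<^bsub>?Z\<^esub> y) = \<pi> x \<oplus>\<^bsub>quot_mod ?Z (boundaries M s)\<^esub> \<pi> y" if "x \<in> carrier ?Z" "y \<in> carrier ?Z" for x y
      using quot_mod_add[OF mZ BZ that] by (simp add: \<pi>_def)
    show "\<pi> (r \<odot>\<^bsub>?Z\<^esub> x) = r \<odot>\<^bsub>quot_mod ?Z (boundaries M s)\<^esub> \<pi> x" if "r \<in> carrier R" "x \<in> carrier ?Z" for r x
      using quot_mod_smult[OF mZ BZ that(2,1)] by (simp add: \<pi>_def)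
  qed
  have \<pi>0: "z \<in> boundaries M s" if z: "z \<in> cycles M s" "\<pi> z = \<zero>\<^bsub>?A\<^esub>" for z
    using coset_self[OF mM boundaries_submodule[OF M] cycles_closed[OF z(1)]] z(2) by (simp add: \<pi>_def A)
  have \<pi>b: "\<pi> b = \<zero>\<^bsub>?A\<^esub>" if b: "b \<in> boundaries M s" for b
    using abelian_subgroup.a_rcos_const[OF submodule_subgroup[OF mM boundaries_submodule[OF M]] b]
    by (simp add: \<pi>_def A)
  obtain k :: nat and x where x: "\<And>i. i < k \<Longrightarrow> x i \<in> mod_hom R ?A E"
    and gen: "\<And>f. f \<in> mod_hom R ?A E \<Longrightarrow> \<exists>b. (\<forall>i. b i \<in> carrier R) \<and>
      (\<forall>a\<in>carrier ?A. f a = lincomb E (\<lambda>i. x i a) b k)"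
    using artinian_dual_generators[OF art] by blast
  have "\<exists>X\<in>cycles ?D (- s). \<forall>z\<in>cycles M s. X s z = x i (\<pi> z)" if i: "i < k" for i
  proof -
    have xp: "(\<lambda>z. x i (\<pi> z)) \<in> mod_hom R ?Z E" by (rule mod_hom_comp[OF \<pi> x[OF i]])
    obtain h where h: "h \<in> mod_hom R ?M E" "\<And>z. z \<in> cycles M s \<Longrightarrow> h z = x i (\<pi> z)"
      using baer_extend[OF baerE mM Zs xp] by blast
    obtain X where X: "X \<in> carrier (cx_mod ?D (- s))" "\<And>z. z \<in> carrier ?M \<Longrightarrow> X s z = h z"
      using stalk_hom_exists[OF M mE h(1)] by blast
    have val: "X s z = x i (\<pi> z)" if "z \<in> cycles M s" for z using X(2)[OF cycles_closed[OF that]] h(2)[OF that] by simp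
    have "X s b = \<zero>\<^bsub>E\<^esub>" if "b \<in> boundaries M s" for b
      using val[of b] boundaries_subset_cycles[OF M] that \<pi>b[OF that] mod_hom_zero[OF mA mE x[OF i]] by auto
    hence "X \<in> cycles ?D (- s)" unfolding stalk_hom_cycles_iff[OF M mE] using X(1) by blast
    thus ?thesis using val by blast
  qed
  then obtain X where X: "\<And>i. i < k \<Longrightarrow> X i \<in> cycles ?D (- s)"
    "\<And>i z. i < k \<Longrightarrow> z \<in> cycles M s \<Longrightarrow> X i s z = x i (\<pi> z)" by metis
  have Xc: "X i \<in> carrier (cx_mod ?D (- s))" if "i < k" for i by (rule cycles_closed[OF X(1)[OF that]])
  have ev: "(\<lambda>f. f s z) \<in> mod_hom R (cx_mod ?D (- s)) E" if z: "z \<in> carrier ?M" for z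
  proof (rule mod_homI)
    show "f s z \<in> carrier E" if "f \<in> carrier (cx_mod ?D (- s))" for f
      by (rule mod_hom_closed[OF stalk_hom_component[OF that] z])
  qed (use z in \<open>simp_all add: hom_cx_ops\<close>)
  have "f \<in> span_over R (cx_mod ?D (- s)) (boundaries ?D (- s)) X k" if f: "f \<in> cycles ?D (- s)" for f
  proof -
    have fc: "f \<in> carrier (cx_mod ?D (- s))" by (rule cycles_closed[OF f])
    have fb: "\<And>b. b \<in> boundaries M s \<Longrightarrow> f s b = \<zero>\<^bsub>E\<^esub>"
      using f unfolding stalk_hom_cycles_iff[OF M mE] by blast
    have "f s \<in> mod_hom R (?Z\<lparr>carrier := carrier ?Z\<rparr>) E"
      using stalk_hom_component[OF fc] cycles_closed[of _ M s] by (auto simp: mod_hom_def Pi_def)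
    from baer_factor[OF baerE mZ mA module.carrier_is_submodule[OF mZ] \<pi> this] \<pi>0 fb
    obtain g where g: "g \<in> mod_hom R ?A E" "\<And>z. z \<in> cycles M s \<Longrightarrow> g (\<pi> z) = f s z" by auto
    obtain b where b: "\<And>i. b i \<in> carrier R" "\<And>a. a \<in> carrier ?A \<Longrightarrow> g a = lincomb E (\<lambda>i. x i a) b k"
      using gen[OF g(1)] by blast
    define L where "L = lincomb (cx_mod ?D (- s)) X b k"
    have L: "L \<in> carrier (cx_mod ?D (- s))" unfolding L_def by (rule lincomb_closed[OF mD Xc b(1)])
    have Lv: "L s z = f s z" if z: "z \<in> cycles M s" for z
    proof -
      have "L s z = lincomb E (\<lambda>i. X i s z) b k"
        unfolding L_def by (rule lincomb_hom[OF mD mE ev[OF cycles_closed[OF z]] Xc b(1)])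
      also have "\<dots> = lincomb E (\<lambda>i. x i (\<pi> z)) b k" by (rule lincomb_cong) (simp_all add: X(2)[OF _ z])
      also have "\<dots> = g (\<pi> z)" by (rule b(2)[symmetric], rule mod_hom_closed[OF \<pi>]) (use z in simp)
      finally show ?thesis using g(2)[OF z] by simp
    qed
    define w where "w = f \<ominus>\<^bsub>cx_mod ?D (- s)\<^esub> L"
    have wc: "w \<in> carrier (cx_mod ?D (- s))" using fc L by (simp add: w_def)
    have "w s z = \<zero>\<^bsub>E\<^esub>" if z: "z \<in> cycles M s" for z
    proof -
      have zc: "z \<in> carrier ?M" by (rule cycles_closed[OF z])
      have "w s z = f s z \<ominus>\<^bsub>E\<^esub> L s z" unfolding w_def by (rule mod_hom_minus[OF mD mE ev[OF zc] fc L])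
      thus ?thesis
        using Lv[OF z] module_diff_zero_iff[OF mE] mod_hom_closed[OF ev[OF zc] fc] by simp
    qed
    hence "w \<in> boundaries ?D (- s)" unfolding stalk_hom_boundaries_iff[OF M baerE] using wc by blast
    moreover have "f = w \<oplus>\<^bsub>cx_mod ?D (- s)\<^esub> L"
      using fc L by (simp add: w_def D.M.minus_eq D.M.a_assoc D.M.l_neg)
    ultimately show ?thesis unfolding span_over_def L_def using b(1) by blast
  qed
  thus ?thesis using X(1) by blast
qed

end

section \<open>Small and big cosupport\<close>

lemma bounded_above_greatest:
  fixes i N :: int
  assumes "Q i" "\<And>n. n > N \<Longrightarrow> \<not> Q n"
  shows "\<exists>s. Q s \<and> (\<forall>n>s. \<not> Q n)"
proof -
  define l where "l = (LEAST l. Q (N - int l))"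
  have "i \<le> N" using assms by (meson not_less)
  hence ex: "Q (N - int (nat (N - i)))" using assms(1) by simp
  have l: "Q (N - int l)" unfolding l_def by (rule LeastI[of "\<lambda>l. Q (N - int l)", OF ex])
  have "\<not> Q n" if n: "n > N - int l" for n
  proof
    assume Qn: "Q n"
    hence "n \<le> N" using assms(2) by (meson not_less)
    hence "Q (N - int (nat (N - n)))" using Qn by simp
    hence "l \<le> nat (N - n)" unfolding l_def by (rule Least_le)
    thus False using n \<open>n \<le> N\<close> by simp
  qed
  thus ?thesis using l by blast
qed

text \<open>\<open>RHom\<close> picks a resolution with the choice operator; since one exists, the choice is a resolution.\<close>

lemma resolution_data:
  assumes "cring R" "noetherian_ring R" "ideal p R"
  shows "free_resolution R (quot_mod (self_mod R) p) (SOME P. free_resolution R (quot_mod (self_mod R) p) P)"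
  using someI_ex[OF free_resolution_exists[OF assms]] .

lemma RHom_exact:
  assumes "cring R" "noetherian_ring R" "ideal p R" "chain_complex R X" "exact_cx X"
  shows "chain_complex R (RHom R (quot_mod (self_mod R) p) X) \<and> exact_cx (RHom R (quot_mod (self_mod R) p) X)"
proof -
  define P where "P = (SOME P. free_resolution R (quot_mod (self_mod R) p) P)"
  have P: "free_resolution R (quot_mod (self_mod R) p) P" unfolding P_def by (rule resolution_data[OF assms(1-3)])
  have cP: "chain_complex R P" by (rule free_resolution_chain_complex[OF P])
  obtain k :: "int \<Rightarrow> nat" where k: "\<And>i. i < 0 \<Longrightarrow> k i = 0" "\<And>i. cx_mod P i = free_mod R (k i)"
    using P unfolding free_resolution_def by blast
  show ?thesis
    unfolding RHom_def P_def[symmetric]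
    using hom_cx_chain_complex[OF cP assms(4)] hom_free_exact[OF cP assms(4,5) k] by blast
qed

text \<open>Since \<open>M\<close> is homologically bounded above, so is \<open>coloc R E J p M\<close>.  Its top nonzero homology, in degree
  \<open>s\<close>, is dual to the localization at \<open>p\<close> of the homology of the Matlis dual in degree \<open>-s\<close>, which is finitely
  generated.  So it contains a nonzero class annihilated by \<open>p\<close>, and this class survives in \<open>RHom\<close>.\<close>

lemma RHom_coloc_not_exact:
  assumes R: "cring R" and noeth: "noetherian_ring R"
    and E: "\<forall>\<mm>\<in>Max_ideals R. injective_hull R (quot_mod (self_mod R) \<mm>) (E \<mm>)"
    and J: "injective_hull (loc_ring R p) (residue_field_mod R p) (J p)"
    and sl: "semilocal_complete R" and Da: "Da_minus R M" and p: "primeideal p R"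
  shows "chain_complex R (coloc R E J p M)"
    and "\<not> exact_cx (coloc R E J p M) \<Longrightarrow> \<not> exact_cx (RHom R (quot_mod (self_mod R) p) (coloc R E J p M))"
proof -
  interpret R: cring R by (rule R)
  interpret L: prime_localization p R by (rule prime_localization.intro[OF p])
  have M: "chain_complex R M" and art: "\<And>i. artinian_module R (homology M i)"
    using Da unfolding Da_minus_def by blast+
  obtain N where N: "\<And>n. n > N \<Longrightarrow> carrier (homology M n) = {\<zero>\<^bsub>homology M n\<^esub>}"
    using Da unfolding Da_minus_def by blast
  have fin: "finite (Max_ideals R)" and comp: "adically_complete R (jacobson_radical R)"
    using sl unfolding semilocal_complete_def by blast+
  let ?E = "direct_sum (Max_ideals R) E" and ?S = "loc_ring R p"
  have baerE: "baer R ?E"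
  proof (rule direct_sum_baer[OF R fin])
    fix \<mm> assume "\<mm> \<in> Max_ideals R"
    from E[rule_format, OF this] show "baer R (E \<mm>)" unfolding injective_hull_def by (intro injective_module_baer[OF R]) (rule conjunct1)
  qed
  obtain \<epsilon> where \<epsilon>: "\<epsilon> \<in> carrier ?E" and soc:
    "(\<forall>j\<in>jacobson_radical R. j \<odot>\<^bsub>?E\<^esub> \<epsilon> = \<zero>\<^bsub>?E\<^esub>) \<and>
    (\<forall>y\<in>carrier ?E. (\<forall>j\<in>jacobson_radical R. j \<odot>\<^bsub>?E\<^esub> y = \<zero>\<^bsub>?E\<^esub>) \<longrightarrow>
      (\<exists>r\<in>carrier R. y = r \<odot>\<^bsub>?E\<^esub> \<epsilon>))"
    using semilocal_socle_cyclic[OF R fin E] by (rule bexE)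
  interpret AD: artinian_duality R "jacobson_radical R" ?E \<epsilon>
    by (intro artinian_duality.intro artinian_duality_axioms.intro R noeth R.jacobson_radical_ideal comp
        R.jacobson_radical_unit[OF noeth] baerE \<epsilon> soc[THEN conjunct1, rule_format] soc[THEN conjunct2, rule_format])
  let ?D = "hom_cx R M (stalk ?E)"
  have D: "chain_complex R ?D" by (rule hom_cx_chain_complex[OF M stalk_chain_complex[OF baer_module[OF baerE]]])
  let ?C = "loc_cx R p ?D"
  have C: "chain_complex ?S ?C" by (rule L.loc_cx_chain_complex[OF D])
  have res: "residue_field_mod R p = quot_mod (self_mod ?S) L.loc_ideal"
    by (simp add: residue_field_mod_def L.loc_ideal_def)
  have hullJ: "injective_hull ?S (quot_mod (self_mod ?S) L.loc_ideal) (J p)" using J unfolding res .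
  have baerJ: "baer ?S (J p)"
    using hullJ unfolding injective_hull_def by (intro injective_module_baer[OF L.loc_ring_cring]) (rule conjunct1)
  obtain e where e: "e \<in> carrier (J p)" "\<And>a. a \<in> carrier ?S \<Longrightarrow> a \<odot>\<^bsub>J p\<^esub> e = \<zero>\<^bsub>J p\<^esub> \<longleftrightarrow> a \<in> L.loc_ideal"
    using injective_hull_generator[OF L.loc_ring_cring hullJ L.loc_ideal_submodule] by blast
  interpret Jm: module ?S "J p" by (rule baer_module[OF baerJ])
  have e0: "e \<noteq> \<zero>\<^bsub>J p\<^esub>"
    using e(2)[of "\<one>\<^bsub>?S\<^esub>"] e(1) L.one_notin_loc_ideal by auto
  let ?Y = "hom_cx ?S ?C (stalk (J p))"
  have Y: "chain_complex ?S ?Y" by (rule hom_cx_chain_complex[OF C stalk_chain_complex[OF baer_module[OF baerJ]]])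
  let ?X = "coloc R E J p M"
  have Xdef: "?X = restrict_scalars_cx L.loc_map ?Y"
    by (simp add: coloc_def matlis_dual_def L.loc_map_def)
  show X: "chain_complex R ?X" unfolding Xdef by (rule L.restrict_chain_complex[OF Y])
  have Xex: "cycles ?X i \<subseteq> boundaries ?X i" if "cycles ?D (- i) \<subseteq> boundaries ?D (- i)" for i
    using stalk_hom_exact[OF C baerJ L.loc_exact[OF D that]] by (simp add: Xdef L.restrict_cx_simps)
  have top: "cycles ?X i \<subseteq> boundaries ?X i" if i: "i > N" for i
  proof (rule Xex, rule stalk_hom_exact[OF M baerE])
    show "cycles M i \<subseteq> boundaries M i"
      unfolding homology_singleton_iff[OF M, symmetric] N[OF i] by simp
  qed
  assume "\<not> exact_cx ?X"
  then obtain i where i: "\<not> cycles ?X i \<subseteq> boundaries ?X i" unfolding exact_cx_def by blast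
  obtain s where s: "\<not> cycles ?X s \<subseteq> boundaries ?X s" and above: "\<And>n. n > s \<Longrightarrow> cycles ?X n \<subseteq> boundaries ?X n"
    using bounded_above_greatest[of "\<lambda>i. \<not> cycles ?X i \<subseteq> boundaries ?X i", OF i] top by blast
  obtain k :: nat and x where x: "\<And>i. i < k \<Longrightarrow> x i \<in> cycles ?D (- s)"
    "cycles ?D (- s) \<subseteq> span_over R (cx_mod ?D (- s)) (boundaries ?D (- s)) x k"
    using AD.dual_homology_generators[OF M art] by blast
  note lg = L.loc_generators[OF D x]
  have ne: "\<not> cycles ?C (- s) \<subseteq> boundaries ?C (- s)"
    using s stalk_hom_exact[OF C baerJ, of "- s"] by (auto simp: Xdef L.restrict_cx_simps)
  have ann: "a \<odot>\<^bsub>J p\<^esub> e = \<zero>\<^bsub>J p\<^esub>" if "a \<in> L.loc_ideal" for a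
    using e(2)[of a] that L.loc_ideal_subset by blast
  obtain \<xi> where \<xi>: "\<xi> \<in> cycles ?Y s" "\<xi> \<notin> boundaries ?Y s"
    "\<And>a. a \<in> L.loc_ideal \<Longrightarrow> a \<odot>\<^bsub>cx_mod ?Y s\<^esub> \<xi> \<in> boundaries ?Y s"
    using local_annihilated_class[OF C baerJ L.loc_ring_local L.loc_ideal_subset e(1) e0 ann lg ne]
    unfolding minus_minus by blast
  define P where "P = (SOME P. free_resolution R (quot_mod (self_mod R) p) P)"
  have P: "free_resolution R (quot_mod (self_mod R) p) P"
    unfolding P_def by (rule resolution_data[OF R noeth L.is_ideal])
  have ps: "submodule p R (self_mod R)" using L.is_ideal by (simp add: ideal_iff_submodule[OF R])
  have "\<not> exact_cx (hom_cx R P ?X)"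
  proof (rule hom_resolution_top[OF ps P X, where s = s and \<xi> = \<xi>])
    show "\<xi> \<in> cycles ?X s" "\<xi> \<notin> boundaries ?X s" using \<xi>(1,2) by (simp_all add: Xdef L.restrict_cx_simps)
    fix a assume a: "a \<in> p"
    have "L.loc_map a \<in> L.loc_ideal" unfolding L.loc_map_def L.loc_ideal_def using a L.one_denom by blast
    from \<xi>(3)[OF this] show "a \<odot>\<^bsub>cx_mod ?X s\<^esub> \<xi> \<in> boundaries ?X s"
      by (simp add: Xdef L.restrict_cx_simps)
  qed (rule above)
  thus "\<not> exact_cx (RHom R (quot_mod (self_mod R) p) ?X)" unfolding RHom_def P_def .
qed

theorem proposition4p2:
  fixes R :: "('a, 'r) ring_scheme"
    and M :: "('a, 'b) cx"
    and E :: "'a set \<Rightarrow> ('a, 'e) module"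
    and J :: "'a set \<Rightarrow> (('a \<times> 'a) set, 'f) module"
  assumes "cring R" and "noetherian_ring R"
    and "\<And>\<mm>. maximalideal \<mm> R \<Longrightarrow> injective_hull R (quot_mod (self_mod R) \<mm>) (E \<mm>)"
    and "\<And>p. primeideal p R \<Longrightarrow> injective_hull (loc_ring R p) (residue_field_mod R p) (J p)"
    and "chain_complex R M"
  shows "small_cosupp R E J M \<subseteq> big_cosupp R E J M \<and>
    (semilocal_complete R \<and> Da_minus R M \<longrightarrow> small_cosupp R E J M = big_cosupp R E J M)"
proof -
  have sub: "small_cosupp R E J M \<subseteq> big_cosupp R E J M"
    unfolding small_cosupp_def big_cosupp_def derived_iso_zero_iff[OF assms(1)]
  proof clarify
    fix p assume p: "primeideal p R" and X: "chain_complex R (coloc R E J p M)" "exact_cx (coloc R E J p M)"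
      and n: "\<not> (chain_complex R (RHom R (quot_mod (self_mod R) p) (coloc R E J p M)) \<and>
        exact_cx (RHom R (quot_mod (self_mod R) p) (coloc R E J p M)))"
    show False using RHom_exact[OF assms(1,2) primeideal.axioms(1)[OF p] X] n by (rule notE[rotated])
  qed
  moreover have "big_cosupp R E J M \<subseteq> small_cosupp R E J M" if sl: "semilocal_complete R" and Da: "Da_minus R M"
    unfolding small_cosupp_def big_cosupp_def derived_iso_zero_iff[OF assms(1)]
  proof clarify
    fix p assume p: "primeideal p R"
      and n: "\<not> (chain_complex R (coloc R E J p M) \<and> exact_cx (coloc R E J p M))"
      and X: "exact_cx (RHom R (quot_mod (self_mod R) p) (coloc R E J p M))"
    have E: "\<forall>\<mm>\<in>Max_ideals R. injective_hull R (quot_mod (self_mod R) \<mm>) (E \<mm>)"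
      using assms(3) by (simp add: Max_ideals_def)
    note * = RHom_coloc_not_exact[where J = J, OF assms(1,2) E assms(4)[OF p] sl Da p]
    have "\<not> exact_cx (coloc R E J p M)" using n *(1) by blast
    thus False using *(2) X by blast
  qed
  ultimately show ?thesis by blast
qed

end
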